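(* Let $\pi$ be a group, $\Bbbk$ a field and $H$ a quasitriangular T-coalgebra over $\pi$ and $\Bbbk$ (not necessarily of finite type). Then $\mathrm{Rib}(H)$ is a ribbon T-category isomorphic to $\mathrm{Rep}_f\bigl(RT(H)\bigr)$. Moreover, $\mathrm{Rib}(H)$ is isomorphic to $\mathcal{N}\bigl((\mathrm{Rep}_f(H))^Z\bigr)$ as a balanced T-category.
   Context: Associativity and unit constraints are suppressed; an object also denotes its identity arrow. **T-categories.** A T-category over $\pi$ is a tensor category $\mathcal{T}$ that is the disjoint union of subcategories $\{\mathcal{T}_\alpha\}_{\alpha\in\pi}$ (no arrows between different components) with $U\otimes V\in\mathcal{T}_{\alpha\beta}$ for $U\in\mathcal{T}_\alpha,V\in\mathcal{T}_\beta$, with a group homomorphism $\varphi:\pi\to\mathrm{aut}(\mathcal{T})$ (invertible strict tensor endofunctors) such that $\varphi_\beta(\mathcal{T}_\alpha)=\mathcal{T}_{\beta\alpha\beta^{-1}}$. For $V\in\mathcal{T}_\beta$ write ${}^V(\cdot)={}^\beta(\cdot)=\varphi_\beta$. T-functors are tensor functors preserving components and commuting with conjugations. **Duals.** A left dual of $U$ is $U^*$ with $b_U:\mathbb{I}\to U\otimes U^*$, $d_U:U^*\otimes U\to\mathbb{I}$ satisfying the duality relations $(U\otimes d_U)(b_U\otimes U)=U$, $(d_U\otimes U^* )(U^*\otimes b_U)=U^*$. It is stable if, for $U\in\mathcal{T}_\alpha$ and $\beta$ commuting with $\alpha$, $\varphi_\beta(U)=U$ implies $\varphi_\beta(b_U)=b_U$,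 $\varphi_\beta(d_U)=d_U$; then each $\varphi_\beta(U)$ gets the left dual $\varphi_\beta(U^* )$ with unit $\varphi_\beta(b_U)$, counit $\varphi_\beta(d_U)$. Left autonomous: a choice of left duals with $U^*\in\mathcal{T}_{\alpha^{-1}}$ for $U\in\mathcal{T}_\alpha$, preserved by conjugation. $f^*:V^*\to U^*$ is the dual of $f:U\to V$. **Braided, balanced, ribbon.** A braiding: isomorphisms $c_{U,V}:U\otimes V\to{}^UV\otimes U$ with $({}^\alpha g\otimes f)c_{U,V}=c_{U',V'}(f\otimes g)$ for $f\in\mathcal{T}_\alpha(U,U')$, $g\in\mathcal{T}(V,V')$; $c_{U\otimes V,W}=(c_{U,{}^VW}\otimes V)(U\otimes c_{V,W})$; $c_{U,V\otimes W}=({}^UV\otimes c_{U,W})(c_{U,V}\otimes W)$; $\varphi_\beta(c_{U,V})=c_{\varphi_\beta(U),\varphi_\beta(V)}$. A twist: isomorphisms $\theta_U:U\to{}^UU$ with $\theta_Vf=({}^\alpha f)\theta_U$ for $f\in\mathcal{T}_\alpha(U,V)$; $\theta_{U\otimes V}=c_{{}^{U\otimes V}V,{}^UU}\,c_{{}^UU,{}^VV}(\theta_U\otimes\theta_V)$; $\varphi_\alpha(\theta_U)=\theta_{\varphi_\alpha(U)}$. Balanced = braided with twist. Ribbon = balanced and left autonomous with $({}^UU\otimes\theta_{{}^UU^*})b_{{}^UU}=(\theta_U\otimes U^* )b_U$, where ${}^UU^*=\varphi_\alpha(U^* )$, $U\in\mathcal{T}_\alpha$. Isomorphisms of balanced (ribbon)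 T-categories are T-functors that are isomorphisms of categories preserving braiding and twist (and the chosen duals). **Twist extension and $\mathcal{N}$.** For a braided $\mathcal{B}$, $\mathcal{B}^Z$: objects $(U,t)$, $t:U\to{}^UU$ an isomorphism; arrows $(U_1,t_1)\to(U_2,t_2)$ in the $\alpha$-th component are $f$ with $({}^\alpha f)t_1=t_2f$; tensor product $(U\otimes U',t\odot t')$, $t\odot t'=c_{{}^{U\otimes U'}U',{}^UU}\,c_{{}^UU,{}^{U'}U'}(t\otimes t')$; unit $(\mathbb{I},\mathrm{Id})$; components by $U\in\mathcal{B}_\alpha$; conjugation $(\varphi_\beta(U),\varphi_\beta(t))$; braiding that of $\mathcal{B}$; twist $\theta_{(U,t)}=t$. For $U\in\mathcal{B}_\alpha$ with stable left dual set $$\omega_U=(d_{{}^{\alpha^2}U}\otimes U)\bigl({}^{\alpha^2}U^*\otimes(c_{{}^{\alpha^2}U,U})^{-1}\bigr)\bigl((c_{{}^\alpha U,{}^\alpha U^*}\circ b_{{}^\alpha U})\otimes{}^{\alpha^2}U\bigr):{}^{\alpha^2}U\to U.$$ In a balanced $\mathcal{B}$ put $\theta_U^2=({}^U\theta_U)\theta_U$; a stable left dual $U^*$ of $U$ is good if $(\theta_U^2)^{-1}=\omega_U$ and $\theta_{U^*}={}^{U^*}(\theta_U^* )$. $\mathcal{N}(\mathcal{B})$ is the full subcategory of objects admitting a good left dual, with structure induced from $\mathcal{B}$ (and a choice of good left duals compatible with conjugation). **T-coalgebras.** A T-coalgebra $H$ consists of associative unital $\Bbbk$-algebras $H_\alpha$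 ($\alpha\in\pi$, unit $1_\alpha$, multiplication $\mu_\alpha$, unit map $\eta_\alpha$), algebra morphisms $\Delta_{\alpha,\beta}:H_{\alpha\beta}\to H_\alpha\otimes H_\beta$ with $(H_\alpha\otimes\Delta_{\beta,\gamma})\Delta_{\alpha,\beta\gamma}=(\Delta_{\alpha,\beta}\otimes H_\gamma)\Delta_{\alpha\beta,\gamma}$, an algebra morphism $\varepsilon:H_1\to\Bbbk$ with $(\varepsilon\otimes H_\alpha)\Delta_{1,\alpha}=\mathrm{Id}=(H_\alpha\otimes\varepsilon)\Delta_{\alpha,1}$, algebra isomorphisms $\varphi_\beta:H_\alpha\to H_{\beta\alpha\beta^{-1}}$ with $\varphi_\beta\varphi_\gamma=\varphi_{\beta\gamma}$, $(\varphi_\gamma\otimes\varphi_\gamma)\Delta_{\alpha,\beta}=\Delta_{\gamma\alpha\gamma^{-1},\gamma\beta\gamma^{-1}}\varphi_\gamma$, $\varepsilon\varphi_\gamma=\varepsilon$, and linear maps $s_\alpha:H_\alpha\to H_{\alpha^{-1}}$ with $\mu_\alpha(H_\alpha\otimes s_{\alpha^{-1}})\Delta_{\alpha,\alpha^{-1}}=\eta_\alpha\varepsilon=\mu_\alpha(s_{\alpha^{-1}}\otimes H_\alpha)\Delta_{\alpha^{-1},\alpha}$. Notation $\Delta_{\alpha,\beta}(h)=h'_{(\alpha)}\otimes h''_{(\beta)}$. Quasitriangular: there are invertible $R_{\alpha,\beta}=\xi_{(\alpha).i}\otimes\zeta_{(\beta).i}\in H_\alpha\otimes H_\beta$ (summation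 over $i$), with inverse $\tilde\xi_{(\alpha).i}\otimes\tilde\zeta_{(\beta).i}$, such that $R_{\alpha,\beta}\Delta_{\alpha,\beta}(h)=\bigl(\sigma(\varphi_{\alpha^{-1}}\otimes H_\alpha)\Delta_{\alpha\beta\alpha^{-1},\alpha}\bigr)(h)R_{\alpha,\beta}$, $(H_\alpha\otimes\Delta_{\beta,\gamma})(R_{\alpha,\beta\gamma})=(R_{\alpha,\gamma})_{1\beta3}(R_{\alpha,\beta})_{12\gamma}$, $(\Delta_{\alpha,\beta}\otimes H_\gamma)(R_{\alpha\beta,\gamma})=\bigl((\varphi_\beta\otimes H_\gamma)(R_{\beta^{-1}\alpha\beta,\gamma})\bigr)_{1\beta3}(R_{\beta,\gamma})_{\alpha23}$, $(\varphi_\alpha\otimes\varphi_\alpha)(R_{\beta,\gamma})=R_{\alpha\beta\alpha^{-1},\alpha\gamma\alpha^{-1}}$ ($\sigma$ the flip; a Greek letter in position $j$ of the subscript means the unit of that component is inserted in tensor position $j$). Drinfeld elements: $u_\alpha=(s_{\alpha^{-1}}\varphi_\alpha)(\zeta_{(\alpha^{-1}).i})\,\xi_{(\alpha).i}\in H_\alpha$. **$\mathrm{Rep}_f(H)$.** The $\alpha$-th component is the category of finite-dimensional left $H_\alpha$-modules; $h(u\otimes v)=h'_{(\alpha)}u\otimes h''_{(\beta)}v$; unit $\Bbbk$ via $\varepsilon$; ${}^\beta U$ has the same space as $U$ (elements ${}^\beta u$), $h\,{}^\beta u={}^\beta(\varphi_{\beta^{-1}}(h)u)$; braiding $c_{U,V}(u\otimes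 v)={}^\alpha(\zeta_{(\beta).i}v)\otimes\xi_{(\alpha).i}u$; left dual $U^*=\mathrm{Hom}_\Bbbk(U,\Bbbk)$ with $\langle hf,u\rangle=\langle f,s_{\alpha^{-1}}(h)u\rangle$ ($h\in H_{\alpha^{-1}}$), $b_U(1)=\sum_ie_i\otimes e^i$ (dual bases), $d_U(f\otimes u)=f(u)$. **$RT(H)$.** $RT_\alpha(H)$ is the space of formal expressions $h+kv_\alpha$ ($h,k\in H_\alpha$) with $(h+kv_\alpha)(h'+k'v_\alpha)=hh'+k\varphi_\alpha(k')u_\alpha s_{\alpha^{-1}}(u_{\alpha^{-1}})+\bigl(hk'+k\varphi_\alpha(h')\bigr)v_\alpha$; for $h,k\in H_{\alpha\beta}$, $$\Delta_{\alpha,\beta}(h+kv_{\alpha\beta})=h'_{(\alpha)}\otimes h''_{(\beta)}+k'_{(\alpha)}\tilde\xi_{(\alpha).i}\tilde\zeta_{(\alpha).j}v_\alpha\otimes k''_{(\beta)}\tilde\zeta_{(\beta).i}\varphi_{\alpha^{-1}}(\tilde\xi_{(\alpha\beta\alpha^{-1}).j})v_\beta;$$ $\varepsilon(h+kv_1)=\varepsilon(h)+\varepsilon(k)$; $s_\alpha(h+kv_\alpha)=s_\alpha(h)+(s_\alpha\varphi_{\alpha^{-1}})(k)v_{\alpha^{-1}}$; $\varphi_\beta(h+kv_\alpha)=\varphi_\beta(h)+\varphi_\beta(k)v_{\beta\alpha\beta^{-1}}$; R-matrix that of $H$ (via $H_\alpha\subset RT_\alpha(H)$). It is a ribbon T-coalgebra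 with $\theta_\alpha=v_\alpha^{-1}$; $\mathrm{Rep}_f(RT(H))$ (whose $\alpha$-th component is the category of finite-dimensional left $RT_\alpha(H)$-modules, with tensor product, unit and conjugation defined by the same formulas as for $\mathrm{Rep}_f(H)$, using the structure maps of $RT(H)$) is a ribbon T-category with twist $\theta_M(m)={}^\alpha(\theta_\alpha m)$ for $M$ in the $\alpha$-th component, braiding $c_{U,V}(u\otimes v)={}^\alpha(\zeta_{(\beta).i}v)\otimes\xi_{(\alpha).i}u$ for $U$ in the $\alpha$-th and $V$ in the $\beta$-th component, and left duals $U^*=\mathrm{Hom}_\Bbbk(U,\Bbbk)$ with $\langle xf,u\rangle=\langle f,s_{\alpha^{-1}}(x)u\rangle$ for $x\in RT_{\alpha^{-1}}(H)$, $f\in U^*$, $u\in U$, with unit $b_U(1)=\sum_ie_i\otimes e^i$ (dual bases) and counit $d_U(f\otimes u)=f(u)$. **$\mathrm{Rib}(H)$.** Objects of $\mathrm{Rib}_\alpha(H)$: pairs $(M,t)$, $M$ a finite-dimensional $H_\alpha$-module, $t:M\to{}^MM$ an $H_\alpha$-linear isomorphism such that, with $t^2=({}^Mt)\circ t$ and $t^{-2}=(t^2)^{-1}$, $t^{-2}({}^{\alpha^2}m)=u_\alpha s_{\alpha^{-1}}(u_{\alpha^{-1}})m$ for all $m\in M$. Morphisms $(M_1,t_1)\to(M_2,t_2)$: $H_\alpha$-linear $f$ with $t_2f=({}^\alpha f)t_1$. Tensor product $(M\otimes M',t\odot t')$, $t\odot t'=\bigl({}^{({}^MM')}t\otimes{}^Mt'\bigr)\circ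 c_{{}^MM',M}\circ c_{M,M'}$; unit $(\Bbbk,\mathrm{Id})$; conjugation ${}^\beta(M,t)=({}^\beta M,{}^\beta t)$; braiding $c_{M,M'}$; twist $\theta_{(M,t)}=t$; dual $(M^*,{}^{M^*}t^* )$ with unit $b_M$ and counit $d_M$. *)

theory Defs
  imports "HOL-Algebra.Module"
begin

section \<open>Crossed tensor categories\<close>

record ('o, 'a) tensor_cat =
  Ob :: "'o set"
  Ar :: "'a set"
  Dom :: "'a \<Rightarrow> 'o"
  Cod :: "'a \<Rightarrow> 'o"
  Id :: "'o \<Rightarrow> 'a"
  Comp :: "'a \<Rightarrow> 'a \<Rightarrow> 'a" (infixr \<open>\<bullet>\<index>\<close> 55)
  tens_ob :: "'o \<Rightarrow> 'o \<Rightarrow> 'o" (infixl \<open>\<otimes>\<^sub>o\<index>\<close> 70)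
  tens_ar :: "'a \<Rightarrow> 'a \<Rightarrow> 'a" (infixl \<open>\<otimes>\<^sub>a\<index>\<close> 70)
  unit_ob :: 'o (\<open>\<I>\<index>\<close>)
  assoc :: "'o \<Rightarrow> 'o \<Rightarrow> 'o \<Rightarrow> 'a"
  lunit :: "'o \<Rightarrow> 'a"
  runit :: "'o \<Rightarrow> 'a"

definition hom_set :: "('o, 'a, 'z) tensor_cat_scheme \<Rightarrow> 'o \<Rightarrow> 'o \<Rightarrow> 'a set" where
  "hom_set C U V = {f \<in> Ar C. Dom C f = U \<and> Cod C f = V}"

definition inverse_arrows :: "('o, 'a, 'z) tensor_cat_scheme \<Rightarrow> 'a \<Rightarrow> 'a \<Rightarrow> bool" where
  "inverse_arrows C f g \<longleftrightarrow> f \<in> Ar C \<and> g \<in> hom_set C (Cod C f) (Dom C f) \<and>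
     g \<bullet>\<^bsub>C\<^esub> f = Id C (Dom C f) \<and> f \<bullet>\<^bsub>C\<^esub> g = Id C (Cod C f)"

definition is_iso :: "('o, 'a, 'z) tensor_cat_scheme \<Rightarrow> 'a \<Rightarrow> bool" where
  "is_iso C f \<longleftrightarrow> (\<exists>g. inverse_arrows C f g)"

definition inv_ar :: "('o, 'a, 'z) tensor_cat_scheme \<Rightarrow> 'a \<Rightarrow> 'a" where
  "inv_ar C f = (THE g. inverse_arrows C f g)"

text \<open>The associativity and unit constraints, which are customarily suppressed, are written out
  everywhere below: \<open>assoc U V W : (U \<otimes> V) \<otimes> W \<rightarrow> U \<otimes> (V \<otimes> W)\<close>, \<open>lunit U : \<I> \<otimes> U \<rightarrow> U\<close>,
  \<open>runit U : U \<otimes> \<I> \<rightarrow> U\<close>.\<close>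

locale tensor_category =
  fixes C :: "('o, 'a, 'z) tensor_cat_scheme" (structure)
  assumes dom_cod: "f \<in> Ar C \<Longrightarrow> Dom C f \<in> Ob C \<and> Cod C f \<in> Ob C"
    and id_hom: "U \<in> Ob C \<Longrightarrow> Id C U \<in> hom_set C U U"
    and comp_hom: "\<lbrakk>f \<in> hom_set C U V; g \<in> hom_set C V W\<rbrakk> \<Longrightarrow> g \<bullet> f \<in> hom_set C U W"
    and comp_id: "f \<in> hom_set C U V \<Longrightarrow> f \<bullet> Id C U = f \<and> Id C V \<bullet> f = f"
    and comp_assoc: "\<lbrakk>f \<in> hom_set C U V; g \<in> hom_set C V W; h \<in> hom_set C W X\<rbrakk>
      \<Longrightarrow> (h \<bullet> g) \<bullet> f = h \<bullet> (g \<bullet> f)"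
    and tens_ob_closed: "\<lbrakk>U \<in> Ob C; V \<in> Ob C\<rbrakk> \<Longrightarrow> U \<otimes>\<^sub>o V \<in> Ob C"
    and unit_closed: "\<I> \<in> Ob C"
    and tens_ar_hom: "\<lbrakk>f \<in> hom_set C U U'; g \<in> hom_set C V V'\<rbrakk>
      \<Longrightarrow> f \<otimes>\<^sub>a g \<in> hom_set C (U \<otimes>\<^sub>o V) (U' \<otimes>\<^sub>o V')"
    and tens_id: "\<lbrakk>U \<in> Ob C; V \<in> Ob C\<rbrakk> \<Longrightarrow> Id C U \<otimes>\<^sub>a Id C V = Id C (U \<otimes>\<^sub>o V)"
    and tens_comp: "\<lbrakk>f \<in> hom_set C U U'; f' \<in> hom_set C U' U''; g \<in> hom_set C V V'; g' \<in> hom_set C V' V''\<rbrakk>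
      \<Longrightarrow> (f' \<bullet> f) \<otimes>\<^sub>a (g' \<bullet> g) = (f' \<otimes>\<^sub>a g') \<bullet> (f \<otimes>\<^sub>a g)"
    and assoc_iso: "\<lbrakk>U \<in> Ob C; V \<in> Ob C; W \<in> Ob C\<rbrakk> \<Longrightarrow>
      assoc C U V W \<in> hom_set C ((U \<otimes>\<^sub>o V) \<otimes>\<^sub>o W) (U \<otimes>\<^sub>o (V \<otimes>\<^sub>o W)) \<and> is_iso C (assoc C U V W)"
    and assoc_natural: "\<lbrakk>f \<in> hom_set C U U'; g \<in> hom_set C V V'; h \<in> hom_set C W W'\<rbrakk> \<Longrightarrow>
      assoc C U' V' W' \<bullet> ((f \<otimes>\<^sub>a g) \<otimes>\<^sub>a h) = (f \<otimes>\<^sub>a (g \<otimes>\<^sub>a h)) \<bullet> assoc C U V W"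
    and lunit_iso: "U \<in> Ob C \<Longrightarrow> lunit C U \<in> hom_set C (\<I> \<otimes>\<^sub>o U) U \<and> is_iso C (lunit C U)"
    and lunit_natural: "f \<in> hom_set C U V \<Longrightarrow> lunit C V \<bullet> (Id C \<I> \<otimes>\<^sub>a f) = f \<bullet> lunit C U"
    and runit_iso: "U \<in> Ob C \<Longrightarrow> runit C U \<in> hom_set C (U \<otimes>\<^sub>o \<I>) U \<and> is_iso C (runit C U)"
    and runit_natural: "f \<in> hom_set C U V \<Longrightarrow> runit C V \<bullet> (f \<otimes>\<^sub>a Id C \<I>) = f \<bullet> runit C U"
    and pentagon: "\<lbrakk>U \<in> Ob C; V \<in> Ob C; W \<in> Ob C; X \<in> Ob C\<rbrakk> \<Longrightarrow>
      assoc C U V (W \<otimes>\<^sub>o X) \<bullet> assoc C (U \<otimes>\<^sub>o V) W X =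
      (Id C U \<otimes>\<^sub>a assoc C V W X) \<bullet> assoc C U (V \<otimes>\<^sub>o W) X \<bullet> (assoc C U V W \<otimes>\<^sub>a Id C X)"
    and triangle: "\<lbrakk>U \<in> Ob C; V \<in> Ob C\<rbrakk> \<Longrightarrow>
      (Id C U \<otimes>\<^sub>a lunit C V) \<bullet> assoc C U \<I> V = runit C U \<otimes>\<^sub>a Id C V"

text \<open>The component of an object is recorded by its degree; \<open>conj_ob \<beta>\<close>, \<open>conj_ar \<beta>\<close> are the two
  parts of the conjugation functor \<open>\<phi>\<^sub>\<beta>\<close>.\<close>

record ('g, 'o, 'a) tcat = "('o, 'a) tensor_cat" +
  Deg :: "'o \<Rightarrow> 'g"
  conj_ob :: "'g \<Rightarrow> 'o \<Rightarrow> 'o"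
  conj_ar :: "'g \<Rightarrow> 'a \<Rightarrow> 'a"

abbreviation lconj_ob :: "('g, 'o, 'a, 'z) tcat_scheme \<Rightarrow> 'o \<Rightarrow> 'o \<Rightarrow> 'o" (infixr \<open>\<rhd>\<^sub>o\<index>\<close> 75)
  where "U \<rhd>\<^sub>o\<^bsub>C\<^esub> V \<equiv> conj_ob C (Deg C U) V"

abbreviation lconj_ar :: "('g, 'o, 'a, 'z) tcat_scheme \<Rightarrow> 'o \<Rightarrow> 'a \<Rightarrow> 'a" (infixr \<open>\<rhd>\<^sub>a\<index>\<close> 75)
  where "U \<rhd>\<^sub>a\<^bsub>C\<^esub> f \<equiv> conj_ar C (Deg C U) f"

definition conj_elt :: "('g, 'm) monoid_scheme \<Rightarrow> 'g \<Rightarrow> 'g \<Rightarrow> 'g" where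
  "conj_elt P b a = b \<otimes>\<^bsub>P\<^esub> a \<otimes>\<^bsub>P\<^esub> inv\<^bsub>P\<^esub> b"

text \<open>That each conjugation is invertible follows from \<open>conj_mult\<close> and \<open>conj_one\<close>; together with
  \<open>deg_conj\<close> this gives \<open>\<phi>\<^sub>\<beta>(\<T>\<^sub>\<alpha>) = \<T>\<^bsub>\<beta>\<alpha>\<beta>\<inverse>\<^esub>\<close>.\<close>

locale T_category = group P + tensor_category C
  for P :: "('g, 'm) monoid_scheme" and C :: "('g, 'o, 'a, 'z) tcat_scheme" (structure) +
  assumes deg_closed: "U \<in> Ob C \<Longrightarrow> Deg C U \<in> carrier P"
    and deg_arrow: "f \<in> Ar C \<Longrightarrow> Deg C (Dom C f) = Deg C (Cod C f)"
    and deg_tens: "\<lbrakk>U \<in> Ob C; V \<in> Ob C\<rbrakk> \<Longrightarrow> Deg C (U \<otimes>\<^sub>o V) = Deg C U \<otimes>\<^bsub>P\<^esub> Deg C V"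
    and conj_ob_closed: "\<lbrakk>b \<in> carrier P; U \<in> Ob C\<rbrakk> \<Longrightarrow> conj_ob C b U \<in> Ob C"
    and deg_conj: "\<lbrakk>b \<in> carrier P; U \<in> Ob C\<rbrakk> \<Longrightarrow> Deg C (conj_ob C b U) = conj_elt P b (Deg C U)"
    and conj_ar_hom: "\<lbrakk>b \<in> carrier P; f \<in> hom_set C U V\<rbrakk>
      \<Longrightarrow> conj_ar C b f \<in> hom_set C (conj_ob C b U) (conj_ob C b V)"
    and conj_id: "\<lbrakk>b \<in> carrier P; U \<in> Ob C\<rbrakk> \<Longrightarrow> conj_ar C b (Id C U) = Id C (conj_ob C b U)"
    and conj_comp: "\<lbrakk>b \<in> carrier P; f \<in> hom_set C U V; g \<in> hom_set C V W\<rbrakk>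
      \<Longrightarrow> conj_ar C b (g \<bullet> f) = conj_ar C b g \<bullet> conj_ar C b f"
    and conj_tens_ob: "\<lbrakk>b \<in> carrier P; U \<in> Ob C; V \<in> Ob C\<rbrakk>
      \<Longrightarrow> conj_ob C b (U \<otimes>\<^sub>o V) = conj_ob C b U \<otimes>\<^sub>o conj_ob C b V"
    and conj_tens_ar: "\<lbrakk>b \<in> carrier P; f \<in> Ar C; g \<in> Ar C\<rbrakk>
      \<Longrightarrow> conj_ar C b (f \<otimes>\<^sub>a g) = conj_ar C b f \<otimes>\<^sub>a conj_ar C b g"
    and conj_unit: "b \<in> carrier P \<Longrightarrow> conj_ob C b \<I> = \<I>"
    and conj_assoc: "\<lbrakk>b \<in> carrier P; U \<in> Ob C; V \<in> Ob C; W \<in> Ob C\<rbrakk>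
      \<Longrightarrow> conj_ar C b (assoc C U V W) = assoc C (conj_ob C b U) (conj_ob C b V) (conj_ob C b W)"
    and conj_lunit: "\<lbrakk>b \<in> carrier P; U \<in> Ob C\<rbrakk> \<Longrightarrow> conj_ar C b (lunit C U) = lunit C (conj_ob C b U)"
    and conj_runit: "\<lbrakk>b \<in> carrier P; U \<in> Ob C\<rbrakk> \<Longrightarrow> conj_ar C b (runit C U) = runit C (conj_ob C b U)"
    and conj_one: "U \<in> Ob C \<Longrightarrow> conj_ob C \<one>\<^bsub>P\<^esub> U = U" "f \<in> Ar C \<Longrightarrow> conj_ar C \<one>\<^bsub>P\<^esub> f = f"
    and conj_mult: "\<lbrakk>b \<in> carrier P; c \<in> carrier P; U \<in> Ob C\<rbrakk>
        \<Longrightarrow> conj_ob C (b \<otimes>\<^bsub>P\<^esub> c) U = conj_ob C b (conj_ob C c U)"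
      "\<lbrakk>b \<in> carrier P; c \<in> carrier P; f \<in> Ar C\<rbrakk>
        \<Longrightarrow> conj_ar C (b \<otimes>\<^bsub>P\<^esub> c) f = conj_ar C b (conj_ar C c f)"


subsection \<open>Left duals\<close>

context
  fixes C :: "('o, 'a, 'z) tensor_cat_scheme" (structure)
begin

definition left_dual :: "'o \<Rightarrow> 'o \<Rightarrow> 'a \<Rightarrow> 'a \<Rightarrow> bool" where
  "left_dual U Us b d \<longleftrightarrow>
     U \<in> Ob C \<and> Us \<in> Ob C \<and> b \<in> hom_set C \<I> (U \<otimes>\<^sub>o Us) \<and> d \<in> hom_set C (Us \<otimes>\<^sub>o U) \<I> \<and>
     runit C U \<bullet> (Id C U \<otimes>\<^sub>a d) \<bullet> assoc C U Us U \<bullet> (b \<otimes>\<^sub>a Id C U) \<bullet> inv_ar C (lunit C U) = Id C U \<and>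
     lunit C Us \<bullet> (d \<otimes>\<^sub>a Id C Us) \<bullet> inv_ar C (assoc C Us U Us) \<bullet> (Id C Us \<otimes>\<^sub>a b)
       \<bullet> inv_ar C (runit C Us) = Id C Us"

text \<open>\<open>dual_arrow Us bU Vs dV f\<close> is \<open>f\<^sup>* : Vs \<rightarrow> Us\<close>, for \<open>f : U \<rightarrow> V\<close> and left duals \<open>Us\<close>, \<open>Vs\<close>
  of \<open>U\<close>, \<open>V\<close>.\<close>

definition dual_arrow :: "'o \<Rightarrow> 'a \<Rightarrow> 'o \<Rightarrow> 'a \<Rightarrow> 'a \<Rightarrow> 'a" where
  "dual_arrow Us bU Vs dV f =
     lunit C Us \<bullet> (dV \<otimes>\<^sub>a Id C Us) \<bullet> inv_ar C (assoc C Vs (Cod C f) Us)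
       \<bullet> (Id C Vs \<otimes>\<^sub>a ((f \<otimes>\<^sub>a Id C Us) \<bullet> bU)) \<bullet> inv_ar C (runit C Vs)"

end

definition stable_left_dual ::
  "('g, 'm) monoid_scheme \<Rightarrow> ('g, 'o, 'a, 'z) tcat_scheme \<Rightarrow> 'o \<Rightarrow> 'o \<Rightarrow> 'a \<Rightarrow> 'a \<Rightarrow> bool" where
  "stable_left_dual P C U Us b d \<longleftrightarrow> left_dual C U Us b d \<and>
     (\<forall>\<beta>\<in>carrier P. \<beta> \<otimes>\<^bsub>P\<^esub> Deg C U = Deg C U \<otimes>\<^bsub>P\<^esub> \<beta> \<and> conj_ob C \<beta> U = U
        \<longrightarrow> conj_ar C \<beta> b = b \<and> conj_ar C \<beta> d = d)"


subsection \<open>Braided, balanced and ribbon T-categories\<close>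

record ('g, 'o, 'a) braided_tcat = "('g, 'o, 'a) tcat" +
  braid :: "'o \<Rightarrow> 'o \<Rightarrow> 'a"

record ('g, 'o, 'a) balanced_tcat = "('g, 'o, 'a) braided_tcat" +
  twist :: "'o \<Rightarrow> 'a"

record ('g, 'o, 'a) ribbon_tcat = "('g, 'o, 'a) balanced_tcat" +
  dual_ob :: "'o \<Rightarrow> 'o"
  coev :: "'o \<Rightarrow> 'a"
  ev :: "'o \<Rightarrow> 'a"

locale braided_T_category = T_category P C
  for P :: "('g, 'm) monoid_scheme" and C :: "('g, 'o, 'a, 'z) braided_tcat_scheme" (structure) +
  assumes braid_iso: "\<lbrakk>U \<in> Ob C; V \<in> Ob C\<rbrakk> \<Longrightarrow>
      braid C U V \<in> hom_set C (U \<otimes>\<^sub>o V) ((U \<rhd>\<^sub>o V) \<otimes>\<^sub>o U) \<and> is_iso C (braid C U V)"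
    and braid_natural: "\<lbrakk>f \<in> hom_set C U U'; g \<in> hom_set C V V'\<rbrakk> \<Longrightarrow>
      ((U \<rhd>\<^sub>a g) \<otimes>\<^sub>a f) \<bullet> braid C U V = braid C U' V' \<bullet> (f \<otimes>\<^sub>a g)"
    and braid_tens_left: "\<lbrakk>U \<in> Ob C; V \<in> Ob C; W \<in> Ob C\<rbrakk> \<Longrightarrow>
      braid C (U \<otimes>\<^sub>o V) W =
        assoc C (U \<rhd>\<^sub>o (V \<rhd>\<^sub>o W)) U V
        \<bullet> (braid C U (V \<rhd>\<^sub>o W) \<otimes>\<^sub>a Id C V)
        \<bullet> inv_ar C (assoc C U (V \<rhd>\<^sub>o W) V)
        \<bullet> (Id C U \<otimes>\<^sub>a braid C V W)
        \<bullet> assoc C U V W"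
    and braid_tens_right: "\<lbrakk>U \<in> Ob C; V \<in> Ob C; W \<in> Ob C\<rbrakk> \<Longrightarrow>
      braid C U (V \<otimes>\<^sub>o W) =
        inv_ar C (assoc C (U \<rhd>\<^sub>o V) (U \<rhd>\<^sub>o W) U)
        \<bullet> (Id C (U \<rhd>\<^sub>o V) \<otimes>\<^sub>a braid C U W)
        \<bullet> assoc C (U \<rhd>\<^sub>o V) U W
        \<bullet> (braid C U V \<otimes>\<^sub>a Id C W)
        \<bullet> inv_ar C (assoc C U V W)"
    and conj_braid: "\<lbrakk>b \<in> carrier P; U \<in> Ob C; V \<in> Ob C\<rbrakk> \<Longrightarrow>
      conj_ar C b (braid C U V) = braid C (conj_ob C b U) (conj_ob C b V)"

locale balanced_T_category = braided_T_category P C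
  for P :: "('g, 'm) monoid_scheme" and C :: "('g, 'o, 'a, 'z) balanced_tcat_scheme" (structure) +
  assumes twist_iso: "U \<in> Ob C \<Longrightarrow> twist C U \<in> hom_set C U (U \<rhd>\<^sub>o U) \<and> is_iso C (twist C U)"
    and twist_natural: "f \<in> hom_set C U V \<Longrightarrow> twist C V \<bullet> f = (U \<rhd>\<^sub>a f) \<bullet> twist C U"
    and twist_tens: "\<lbrakk>U \<in> Ob C; V \<in> Ob C\<rbrakk> \<Longrightarrow>
      twist C (U \<otimes>\<^sub>o V) =
        braid C ((U \<otimes>\<^sub>o V) \<rhd>\<^sub>o V) (U \<rhd>\<^sub>o U) \<bullet> braid C (U \<rhd>\<^sub>o U) (V \<rhd>\<^sub>o V) \<bullet> (twist C U \<otimes>\<^sub>a twist C V)"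
    and conj_twist: "\<lbrakk>b \<in> carrier P; U \<in> Ob C\<rbrakk> \<Longrightarrow> conj_ar C b (twist C U) = twist C (conj_ob C b U)"

locale ribbon_T_category = balanced_T_category P C
  for P :: "('g, 'm) monoid_scheme" and C :: "('g, 'o, 'a, 'z) ribbon_tcat_scheme" (structure) +
  assumes dual: "U \<in> Ob C \<Longrightarrow> left_dual C U (dual_ob C U) (coev C U) (ev C U)"
    and deg_dual: "U \<in> Ob C \<Longrightarrow> Deg C (dual_ob C U) = inv\<^bsub>P\<^esub> (Deg C U)"
    and conj_dual: "\<lbrakk>b \<in> carrier P; U \<in> Ob C\<rbrakk> \<Longrightarrow>
      conj_ob C b (dual_ob C U) = dual_ob C (conj_ob C b U) \<and>
      conj_ar C b (coev C U) = coev C (conj_ob C b U) \<and>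
      conj_ar C b (ev C U) = ev C (conj_ob C b U)"
    and ribbon: "U \<in> Ob C \<Longrightarrow>
      (Id C (U \<rhd>\<^sub>o U) \<otimes>\<^sub>a twist C (U \<rhd>\<^sub>o dual_ob C U)) \<bullet> coev C (U \<rhd>\<^sub>o U) =
      (twist C U \<otimes>\<^sub>a Id C (dual_ob C U)) \<bullet> coev C U"


subsection \<open>Isomorphisms\<close>

text \<open>A tensor functor is given by its object and arrow maps \<open>F\<close>, \<open>f\<close> and by natural isomorphisms
  \<open>F2 U V : F U \<otimes> F V \<rightarrow> F (U \<otimes> V)\<close> and \<open>F0 : \<I> \<rightarrow> F \<I>\<close>.\<close>

locale T_functor =
  C?: T_category P C + D?: T_category P D
  for P :: "('g, 'm) monoid_scheme"
    and C :: "('g, 'o, 'a, 'y) tcat_scheme" and D :: "('g, 'p, 'b, 'z) tcat_scheme"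
    and F :: "'o \<Rightarrow> 'p" and f :: "'a \<Rightarrow> 'b" and F2 :: "'o \<Rightarrow> 'o \<Rightarrow> 'b" and F0 :: 'b +
  assumes functor_hom: "h \<in> hom_set C U V \<Longrightarrow> f h \<in> hom_set D (F U) (F V)"
    and functor_id: "U \<in> Ob C \<Longrightarrow> f (Id C U) = Id D (F U)"
    and functor_comp: "\<lbrakk>h \<in> hom_set C U V; k \<in> hom_set C V W\<rbrakk> \<Longrightarrow> f (k \<bullet>\<^bsub>C\<^esub> h) = f k \<bullet>\<^bsub>D\<^esub> f h"
    and F2_iso: "\<lbrakk>U \<in> Ob C; V \<in> Ob C\<rbrakk> \<Longrightarrow>
      F2 U V \<in> hom_set D (F U \<otimes>\<^sub>o\<^bsub>D\<^esub> F V) (F (U \<otimes>\<^sub>o\<^bsub>C\<^esub> V)) \<and> is_iso D (F2 U V)"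
    and F0_iso: "F0 \<in> hom_set D \<I>\<^bsub>D\<^esub> (F \<I>\<^bsub>C\<^esub>) \<and> is_iso D F0"
    and F2_natural: "\<lbrakk>h \<in> hom_set C U U'; k \<in> hom_set C V V'\<rbrakk> \<Longrightarrow>
      f (h \<otimes>\<^sub>a\<^bsub>C\<^esub> k) \<bullet>\<^bsub>D\<^esub> F2 U V = F2 U' V' \<bullet>\<^bsub>D\<^esub> (f h \<otimes>\<^sub>a\<^bsub>D\<^esub> f k)"
    and F2_assoc: "\<lbrakk>U \<in> Ob C; V \<in> Ob C; W \<in> Ob C\<rbrakk> \<Longrightarrow>
      f (assoc C U V W) \<bullet>\<^bsub>D\<^esub> F2 (U \<otimes>\<^sub>o\<^bsub>C\<^esub> V) W \<bullet>\<^bsub>D\<^esub> (F2 U V \<otimes>\<^sub>a\<^bsub>D\<^esub> Id D (F W)) =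
      F2 U (V \<otimes>\<^sub>o\<^bsub>C\<^esub> W) \<bullet>\<^bsub>D\<^esub> (Id D (F U) \<otimes>\<^sub>a\<^bsub>D\<^esub> F2 V W) \<bullet>\<^bsub>D\<^esub> assoc D (F U) (F V) (F W)"
    and F0_lunit: "U \<in> Ob C \<Longrightarrow>
      f (lunit C U) \<bullet>\<^bsub>D\<^esub> F2 \<I>\<^bsub>C\<^esub> U \<bullet>\<^bsub>D\<^esub> (F0 \<otimes>\<^sub>a\<^bsub>D\<^esub> Id D (F U)) = lunit D (F U)"
    and F0_runit: "U \<in> Ob C \<Longrightarrow>
      f (runit C U) \<bullet>\<^bsub>D\<^esub> F2 U \<I>\<^bsub>C\<^esub> \<bullet>\<^bsub>D\<^esub> (Id D (F U) \<otimes>\<^sub>a\<^bsub>D\<^esub> F0) = runit D (F U)"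
    and functor_deg: "U \<in> Ob C \<Longrightarrow> Deg D (F U) = Deg C U"
    and functor_conj: "\<lbrakk>b \<in> carrier P; U \<in> Ob C\<rbrakk> \<Longrightarrow> F (conj_ob C b U) = conj_ob D b (F U)"
      "\<lbrakk>b \<in> carrier P; h \<in> Ar C\<rbrakk> \<Longrightarrow> f (conj_ar C b h) = conj_ar D b (f h)"
      "\<lbrakk>b \<in> carrier P; U \<in> Ob C; V \<in> Ob C\<rbrakk>
        \<Longrightarrow> F2 (conj_ob C b U) (conj_ob C b V) = conj_ar D b (F2 U V)"
      "b \<in> carrier P \<Longrightarrow> conj_ar D b F0 = F0"

locale balanced_T_isomorphism =
  T_functor P C D F f F2 F0 + C?: balanced_T_category P C + D?: balanced_T_category P D
  for P :: "('g, 'm) monoid_scheme"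
    and C :: "('g, 'o, 'a, 'y) balanced_tcat_scheme" and D :: "('g, 'p, 'b, 'z) balanced_tcat_scheme"
    and F :: "'o \<Rightarrow> 'p" and f :: "'a \<Rightarrow> 'b" and F2 :: "'o \<Rightarrow> 'o \<Rightarrow> 'b" and F0 :: 'b +
  assumes functor_bij: "bij_betw F (Ob C) (Ob D)" "bij_betw f (Ar C) (Ar D)"
    and functor_braid: "\<lbrakk>U \<in> Ob C; V \<in> Ob C\<rbrakk> \<Longrightarrow>
      f (braid C U V) \<bullet>\<^bsub>D\<^esub> F2 U V = F2 (U \<rhd>\<^sub>o\<^bsub>C\<^esub> V) U \<bullet>\<^bsub>D\<^esub> braid D (F U) (F V)"
    and functor_twist: "U \<in> Ob C \<Longrightarrow> f (twist C U) = twist D (F U)"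

locale ribbon_T_isomorphism =
  balanced_T_isomorphism P C D F f F2 F0 + C?: ribbon_T_category P C + D?: ribbon_T_category P D
  for P :: "('g, 'm) monoid_scheme"
    and C :: "('g, 'o, 'a, 'y) ribbon_tcat_scheme" and D :: "('g, 'p, 'b, 'z) ribbon_tcat_scheme"
    and F :: "'o \<Rightarrow> 'p" and f :: "'a \<Rightarrow> 'b" and F2 :: "'o \<Rightarrow> 'o \<Rightarrow> 'b" and F0 :: 'b +
  assumes functor_dual: "U \<in> Ob C \<Longrightarrow>
      F (dual_ob C U) = dual_ob D (F U) \<and>
      f (coev C U) \<bullet>\<^bsub>D\<^esub> F0 = F2 U (dual_ob C U) \<bullet>\<^bsub>D\<^esub> coev D (F U) \<and>
      f (ev C U) \<bullet>\<^bsub>D\<^esub> F2 (dual_ob C U) U = F0 \<bullet>\<^bsub>D\<^esub> ev D (F U)"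

definition isomorphic_balanced_T_categories where
  "isomorphic_balanced_T_categories P C D \<longleftrightarrow> (\<exists>F f F2 F0. balanced_T_isomorphism P C D F f F2 F0)"

definition isomorphic_ribbon_T_categories where
  "isomorphic_ribbon_T_categories P C D \<longleftrightarrow> (\<exists>F f F2 F0. ribbon_T_isomorphism P C D F f F2 F0)"


subsection \<open>The twist extension and the subcategory of objects with a good left dual\<close>

text \<open>Arrows of concrete categories are maps together with a domain and a codomain.\<close>

datatype ('o, 'f) arr = Arr (adom: 'o) (acod: 'o) (amap: 'f)

definition twist_ext ::
  "('g, 'o, 'a, 'z) braided_tcat_scheme \<Rightarrow> ('g, 'o \<times> 'a, ('o \<times> 'a, 'a) arr) balanced_tcat" where
  "twist_ext B =
    (let obs = {(U, t). U \<in> Ob B \<and> t \<in> hom_set B U (U \<rhd>\<^sub>o\<^bsub>B\<^esub> U) \<and> is_iso B t};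
         tens = (\<lambda>(U, t) (U', t').
           (U \<otimes>\<^sub>o\<^bsub>B\<^esub> U',
            braid B ((U \<otimes>\<^sub>o\<^bsub>B\<^esub> U') \<rhd>\<^sub>o\<^bsub>B\<^esub> U') (U \<rhd>\<^sub>o\<^bsub>B\<^esub> U)
              \<bullet>\<^bsub>B\<^esub> braid B (U \<rhd>\<^sub>o\<^bsub>B\<^esub> U) (U' \<rhd>\<^sub>o\<^bsub>B\<^esub> U') \<bullet>\<^bsub>B\<^esub> (t \<otimes>\<^sub>a\<^bsub>B\<^esub> t')));
         un = (\<I>\<^bsub>B\<^esub>, Id B \<I>\<^bsub>B\<^esub>);
         cj = (\<lambda>\<beta> (U, t). (conj_ob B \<beta> U, conj_ar B \<beta> t))
     in \<lparr> Ob = obs,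
          Ar = {Arr X Y f | X Y f. X \<in> obs \<and> Y \<in> obs \<and> f \<in> hom_set B (fst X) (fst Y) \<and>
                  (fst X \<rhd>\<^sub>a\<^bsub>B\<^esub> f) \<bullet>\<^bsub>B\<^esub> snd X = snd Y \<bullet>\<^bsub>B\<^esub> f},
          Dom = adom,
          Cod = acod,
          Id = (\<lambda>X. Arr X X (Id B (fst X))),
          Comp = (\<lambda>g f. Arr (adom f) (acod g) (amap g \<bullet>\<^bsub>B\<^esub> amap f)),
          tens_ob = tens,
          tens_ar = (\<lambda>f g. Arr (tens (adom f) (adom g)) (tens (acod f) (acod g))
                             (amap f \<otimes>\<^sub>a\<^bsub>B\<^esub> amap g)),
          unit_ob = un,
          assoc = (\<lambda>X Y Z. Arr (tens (tens X Y) Z) (tens X (tens Y Z))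
                             (assoc B (fst X) (fst Y) (fst Z))),
          lunit = (\<lambda>X. Arr (tens un X) X (lunit B (fst X))),
          runit = (\<lambda>X. Arr (tens X un) X (runit B (fst X))),
          Deg = (\<lambda>X. Deg B (fst X)),
          conj_ob = cj,
          conj_ar = (\<lambda>\<beta> f. Arr (cj \<beta> (adom f)) (cj \<beta> (acod f)) (conj_ar B \<beta> (amap f))),
          braid = (\<lambda>X Y. Arr (tens X Y) (tens (cj (Deg B (fst X)) Y) X) (braid B (fst X) (fst Y))),
          twist = (\<lambda>X. Arr X (cj (Deg B (fst X)) X) (snd X)) \<rparr>)"

text \<open>\<open>omega B U Us b d : \<^bsup>\<alpha>\<alpha>\<^esup>U \<rightarrow> U\<close> for \<open>U\<close> in the \<open>\<alpha>\<close>-th component with left dual \<open>Us\<close>, unit \<open>b\<close>,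
  counit \<open>d\<close>.\<close>

definition omega :: "('g, 'o, 'a, 'z) braided_tcat_scheme \<Rightarrow> 'o \<Rightarrow> 'o \<Rightarrow> 'a \<Rightarrow> 'a \<Rightarrow> 'a" where
  "omega B U Us b d =
    (let U1 = U \<rhd>\<^sub>o\<^bsub>B\<^esub> U; Us1 = U \<rhd>\<^sub>o\<^bsub>B\<^esub> Us; U2 = U \<rhd>\<^sub>o\<^bsub>B\<^esub> U1; Us2 = U \<rhd>\<^sub>o\<^bsub>B\<^esub> Us1;
         b1 = U \<rhd>\<^sub>a\<^bsub>B\<^esub> b; d2 = U \<rhd>\<^sub>a\<^bsub>B\<^esub> (U \<rhd>\<^sub>a\<^bsub>B\<^esub> d)
     in lunit B U \<bullet>\<^bsub>B\<^esub> (d2 \<otimes>\<^sub>a\<^bsub>B\<^esub> Id B U) \<bullet>\<^bsub>B\<^esub> inv_ar B (assoc B Us2 U2 U)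
        \<bullet>\<^bsub>B\<^esub> (Id B Us2 \<otimes>\<^sub>a\<^bsub>B\<^esub> inv_ar B (braid B U2 U))
        \<bullet>\<^bsub>B\<^esub> assoc B Us2 U1 U2
        \<bullet>\<^bsub>B\<^esub> ((braid B U1 Us1 \<bullet>\<^bsub>B\<^esub> b1) \<otimes>\<^sub>a\<^bsub>B\<^esub> Id B U2)
        \<bullet>\<^bsub>B\<^esub> inv_ar B (lunit B U2))"

definition good_left_dual ::
  "('g, 'm) monoid_scheme \<Rightarrow> ('g, 'o, 'a, 'z) balanced_tcat_scheme \<Rightarrow> 'o \<Rightarrow> 'o \<Rightarrow> 'a \<Rightarrow> 'a \<Rightarrow> bool" where
  "good_left_dual P B U Us b d \<longleftrightarrow> stable_left_dual P B U Us b d \<and>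
     inv_ar B ((U \<rhd>\<^sub>a\<^bsub>B\<^esub> twist B U) \<bullet>\<^bsub>B\<^esub> twist B U) = omega B U Us b d \<and>
     twist B Us =
       Us \<rhd>\<^sub>a\<^bsub>B\<^esub> dual_arrow B Us b (U \<rhd>\<^sub>o\<^bsub>B\<^esub> Us) (U \<rhd>\<^sub>a\<^bsub>B\<^esub> d) (twist B U)"

definition good_subcat ::
  "('g, 'm) monoid_scheme \<Rightarrow> ('g, 'o, 'a, 'z) balanced_tcat_scheme \<Rightarrow> ('g, 'o, 'a, 'z) balanced_tcat_scheme"
  where
  "good_subcat P B =
    (let obs = {U \<in> Ob B. \<exists>Us b d. good_left_dual P B U Us b d}
     in B \<lparr> Ob := obs, Ar := {f \<in> Ar B. Dom B f \<in> obs \<and> Cod B f \<in> obs} \<rparr>)"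


section \<open>Tensor products of vector spaces\<close>

definition linear_on ::
  "('k, 'c) ring_scheme \<Rightarrow> ('k, 'v, 'd) module_scheme \<Rightarrow> ('k, 'w, 'e) module_scheme \<Rightarrow> ('v \<Rightarrow> 'w) \<Rightarrow> bool"
  where
  "linear_on K V W f \<longleftrightarrow> f \<in> carrier V \<rightarrow> carrier W \<and>
     (\<forall>x\<in>carrier V. \<forall>y\<in>carrier V. f (x \<oplus>\<^bsub>V\<^esub> y) = f x \<oplus>\<^bsub>W\<^esub> f y) \<and>
     (\<forall>a\<in>carrier K. \<forall>x\<in>carrier V. f (a \<odot>\<^bsub>V\<^esub> x) = a \<odot>\<^bsub>W\<^esub> f x)"

definition linear_form ::
  "('k, 'c) ring_scheme \<Rightarrow> ('k, 'v, 'd) module_scheme \<Rightarrow> ('v \<Rightarrow> 'k) \<Rightarrow> bool" where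
  "linear_form K V f \<longleftrightarrow> f \<in> carrier V \<rightarrow> carrier K \<and>
     (\<forall>x\<in>carrier V. \<forall>y\<in>carrier V. f (x \<oplus>\<^bsub>V\<^esub> y) = f x \<oplus>\<^bsub>K\<^esub> f y) \<and>
     (\<forall>a\<in>carrier K. \<forall>x\<in>carrier V. f (a \<odot>\<^bsub>V\<^esub> x) = a \<otimes>\<^bsub>K\<^esub> f x)"

definition bilinear_on ::
  "('k, 'c) ring_scheme \<Rightarrow> ('k, 'v, 'd) module_scheme \<Rightarrow> ('k, 'w, 'e) module_scheme \<Rightarrow>
   ('k, 'x, 'f) module_scheme \<Rightarrow> ('v \<Rightarrow> 'w \<Rightarrow> 'x) \<Rightarrow> bool" where
  "bilinear_on K V W X B \<longleftrightarrow>
     (\<forall>v\<in>carrier V. linear_on K W X (B v)) \<and> (\<forall>w\<in>carrier W. linear_on K V X (\<lambda>v. B v w))"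

text \<open>The concrete tensor product \<open>V \<otimes> W\<close>: formal finite sums \<open>\<Sum>\<^sub>i v\<^sub>i \<otimes> w\<^sub>i\<close>, represented by
  the list of the pairs \<open>(v\<^sub>i, w\<^sub>i)\<close>, modulo the usual relations.\<close>

inductive tens_eq ::
  "('k, 'c) ring_scheme \<Rightarrow> ('k, 'v, 'd) module_scheme \<Rightarrow> ('k, 'w, 'e) module_scheme \<Rightarrow>
   ('v \<times> 'w) list \<Rightarrow> ('v \<times> 'w) list \<Rightarrow> bool"
  for K V W where
  refl: "set xs \<subseteq> carrier V \<times> carrier W \<Longrightarrow> tens_eq K V W xs xs"
| sym: "tens_eq K V W xs ys \<Longrightarrow> tens_eq K V W ys xs"
| trans: "\<lbrakk>tens_eq K V W xs ys; tens_eq K V W ys zs\<rbrakk> \<Longrightarrow> tens_eq K V W xs zs"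
| append: "\<lbrakk>tens_eq K V W xs xs'; tens_eq K V W ys ys'\<rbrakk> \<Longrightarrow> tens_eq K V W (xs @ ys) (xs' @ ys')"
| commute: "\<lbrakk>set xs \<subseteq> carrier V \<times> carrier W; set ys \<subseteq> carrier V \<times> carrier W\<rbrakk>
    \<Longrightarrow> tens_eq K V W (xs @ ys) (ys @ xs)"
| zero: "w \<in> carrier W \<Longrightarrow> tens_eq K V W [(\<zero>\<^bsub>V\<^esub>, w)] []"
| add_left: "\<lbrakk>v \<in> carrier V; v' \<in> carrier V; w \<in> carrier W\<rbrakk>
    \<Longrightarrow> tens_eq K V W [(v \<oplus>\<^bsub>V\<^esub> v', w)] [(v, w), (v', w)]"
| add_right: "\<lbrakk>v \<in> carrier V; w \<in> carrier W; w' \<in> carrier W\<rbrakk>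
    \<Longrightarrow> tens_eq K V W [(v, w \<oplus>\<^bsub>W\<^esub> w')] [(v, w), (v, w')]"
| smult: "\<lbrakk>a \<in> carrier K; v \<in> carrier V; w \<in> carrier W\<rbrakk>
    \<Longrightarrow> tens_eq K V W [(a \<odot>\<^bsub>V\<^esub> v, w)] [(v, a \<odot>\<^bsub>W\<^esub> w)]"

definition tens_class ::
  "('k, 'c) ring_scheme \<Rightarrow> ('k, 'v, 'd) module_scheme \<Rightarrow> ('k, 'w, 'e) module_scheme \<Rightarrow>
   ('v \<times> 'w) list \<Rightarrow> ('v \<times> 'w) list set" where
  "tens_class K V W xs = {ys. tens_eq K V W xs ys}"

definition tens_rep :: "('v \<times> 'w) list set \<Rightarrow> ('v \<times> 'w) list" where
  "tens_rep x = (SOME xs. xs \<in> x)"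

abbreviation pure where "pure K V W v w \<equiv> tens_class K V W [(v, w)]"

text \<open>The tensor product of two algebras (of two vector spaces, if \<open>mult\<close> and \<open>one\<close> are ignored).\<close>

definition tensor ::
  "('k, 'c) ring_scheme \<Rightarrow> ('k, 'v, 'd) module_scheme \<Rightarrow> ('k, 'w, 'e) module_scheme \<Rightarrow>
   ('k, ('v \<times> 'w) list set) module" where
  "tensor K V W =
    \<lparr> carrier = {tens_class K V W xs | xs. set xs \<subseteq> carrier V \<times> carrier W},
      mult = (\<lambda>x y. tens_class K V W
        [(a \<otimes>\<^bsub>V\<^esub> c, b \<otimes>\<^bsub>W\<^esub> d). (a, b) \<leftarrow> tens_rep x, (c, d) \<leftarrow> tens_rep y]),
      one = pure K V W \<one>\<^bsub>V\<^esub> \<one>\<^bsub>W\<^esub>,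
      zero = tens_class K V W [],
      add = (\<lambda>x y. tens_class K V W (tens_rep x @ tens_rep y)),
      smult = (\<lambda>a x. tens_class K V W [(a \<odot>\<^bsub>V\<^esub> v, w). (v, w) \<leftarrow> tens_rep x]) \<rparr>"

text \<open>\<open>tsum X B x = \<Sum>\<^sub>i B v\<^sub>i w\<^sub>i\<close> in \<open>X\<close> for \<open>x = \<Sum>\<^sub>i v\<^sub>i \<otimes> w\<^sub>i\<close>; this is
  independent of the representation of \<open>x\<close> if \<open>B\<close> is bilinear, and renders Sweedler-type notation.\<close>

definition tsum :: "('k, 'x, 'f) module_scheme \<Rightarrow> ('v \<Rightarrow> 'w \<Rightarrow> 'x) \<Rightarrow> ('v \<times> 'w) list set \<Rightarrow> 'x" where
  "tsum X B x = foldr (\<lambda>(v, w) s. B v w \<oplus>\<^bsub>X\<^esub> s) (tens_rep x) \<zero>\<^bsub>X\<^esub>"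


section \<open>T-coalgebras\<close>

definition unital_algebra :: "('k, 'c) ring_scheme \<Rightarrow> ('k, 'h, 'd) module_scheme \<Rightarrow> bool" where
  "unital_algebra K A \<longleftrightarrow> module K A \<and> ring A \<and>
     (\<forall>a\<in>carrier K. \<forall>x\<in>carrier A. \<forall>y\<in>carrier A.
        (a \<odot>\<^bsub>A\<^esub> x) \<otimes>\<^bsub>A\<^esub> y = a \<odot>\<^bsub>A\<^esub> (x \<otimes>\<^bsub>A\<^esub> y) \<and> x \<otimes>\<^bsub>A\<^esub> (a \<odot>\<^bsub>A\<^esub> y) = a \<odot>\<^bsub>A\<^esub> (x \<otimes>\<^bsub>A\<^esub> y))"

definition algebra_hom ::
  "('k, 'c) ring_scheme \<Rightarrow> ('k, 'h, 'd) module_scheme \<Rightarrow> ('k, 'l, 'e) module_scheme \<Rightarrow> ('h \<Rightarrow> 'l) set"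
  where
  "algebra_hom K A B = {f \<in> ring_hom A B. linear_on K A B f}"

text \<open>\<open>alg \<alpha>\<close> is the algebra \<open>H\<^sub>\<alpha>\<close>, and \<open>crossing \<beta> \<alpha>\<close> is the restriction
  \<open>H\<^sub>\<alpha> \<rightarrow> H\<^bsub>\<beta>\<alpha>\<beta>\<inverse>\<^esub>\<close> of \<open>\<phi>\<^sub>\<beta>\<close>.\<close>

record ('g, 'k, 'h) tcoalg =
  alg :: "'g \<Rightarrow> ('k, 'h) module"
  comult :: "'g \<Rightarrow> 'g \<Rightarrow> 'h \<Rightarrow> ('h \<times> 'h) list set"
  counit :: "'h \<Rightarrow> 'k"
  crossing :: "'g \<Rightarrow> 'g \<Rightarrow> 'h \<Rightarrow> 'h"
  antipode :: "'g \<Rightarrow> 'h \<Rightarrow> 'h"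

record ('g, 'k, 'h) qt_tcoalg = "('g, 'k, 'h) tcoalg" +
  Rmat :: "'g \<Rightarrow> 'g \<Rightarrow> ('h \<times> 'h) list set"

locale T_coalgebra = group P + field K
  for P :: "('g, 'm) monoid_scheme" and K :: "('k, 'c) ring_scheme"
    and H :: "('g, 'k, 'h, 'z) tcoalg_scheme" +
  assumes alg: "\<alpha> \<in> carrier P \<Longrightarrow> unital_algebra K (alg H \<alpha>)"
    and comult_hom: "\<lbrakk>\<alpha> \<in> carrier P; \<beta> \<in> carrier P\<rbrakk> \<Longrightarrow>
      comult H \<alpha> \<beta> \<in> algebra_hom K (alg H (\<alpha> \<otimes>\<^bsub>P\<^esub> \<beta>)) (tensor K (alg H \<alpha>) (alg H \<beta>))"
    and coassoc: "\<lbrakk>\<alpha> \<in> carrier P; \<beta> \<in> carrier P; \<gamma> \<in> carrier P; h \<in> carrier (alg H (\<alpha> \<otimes>\<^bsub>P\<^esub> \<beta> \<otimes>\<^bsub>P\<^esub> \<gamma>))\<rbrakk> \<Longrightarrow>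
      (let A = alg H \<alpha>; B = alg H \<beta>; D = alg H \<gamma>; BD = tensor K B D; T = tensor K A BD
       in tsum T (\<lambda>x y. pure K A BD x (comult H \<beta> \<gamma> y)) (comult H \<alpha> (\<beta> \<otimes>\<^bsub>P\<^esub> \<gamma>) h) =
          tsum T (\<lambda>x y. tsum T (\<lambda>x' x''. pure K A BD x' (pure K B D x'' y)) (comult H \<alpha> \<beta> x))
            (comult H (\<alpha> \<otimes>\<^bsub>P\<^esub> \<beta>) \<gamma> h))"
    and counit_hom: "counit H \<in> ring_hom (alg H \<one>\<^bsub>P\<^esub>) K \<and> linear_form K (alg H \<one>\<^bsub>P\<^esub>) (counit H)"
    and counit_left: "\<lbrakk>\<alpha> \<in> carrier P; h \<in> carrier (alg H \<alpha>)\<rbrakk> \<Longrightarrow>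
      tsum (alg H \<alpha>) (\<lambda>x y. counit H x \<odot>\<^bsub>alg H \<alpha>\<^esub> y) (comult H \<one>\<^bsub>P\<^esub> \<alpha> h) = h"
    and counit_right: "\<lbrakk>\<alpha> \<in> carrier P; h \<in> carrier (alg H \<alpha>)\<rbrakk> \<Longrightarrow>
      tsum (alg H \<alpha>) (\<lambda>x y. counit H y \<odot>\<^bsub>alg H \<alpha>\<^esub> x) (comult H \<alpha> \<one>\<^bsub>P\<^esub> h) = h"
    and crossing_iso: "\<lbrakk>\<beta> \<in> carrier P; \<alpha> \<in> carrier P\<rbrakk> \<Longrightarrow>
      crossing H \<beta> \<alpha> \<in> algebra_hom K (alg H \<alpha>) (alg H (conj_elt P \<beta> \<alpha>)) \<and>
      bij_betw (crossing H \<beta> \<alpha>) (carrier (alg H \<alpha>)) (carrier (alg H (conj_elt P \<beta> \<alpha>)))"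
    and crossing_mult: "\<lbrakk>\<beta> \<in> carrier P; \<gamma> \<in> carrier P; \<alpha> \<in> carrier P; h \<in> carrier (alg H \<alpha>)\<rbrakk> \<Longrightarrow>
      crossing H \<beta> (conj_elt P \<gamma> \<alpha>) (crossing H \<gamma> \<alpha> h) = crossing H (\<beta> \<otimes>\<^bsub>P\<^esub> \<gamma>) \<alpha> h"
    and crossing_comult: "\<lbrakk>\<alpha> \<in> carrier P; \<beta> \<in> carrier P; \<gamma> \<in> carrier P; h \<in> carrier (alg H (\<alpha> \<otimes>\<^bsub>P\<^esub> \<beta>))\<rbrakk> \<Longrightarrow>
      (let A = alg H (conj_elt P \<gamma> \<alpha>); B = alg H (conj_elt P \<gamma> \<beta>)
       in tsum (tensor K A B) (\<lambda>x y. pure K A B (crossing H \<gamma> \<alpha> x) (crossing H \<gamma> \<beta> y)) (comult H \<alpha> \<beta> h)) =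
      comult H (conj_elt P \<gamma> \<alpha>) (conj_elt P \<gamma> \<beta>) (crossing H \<gamma> (\<alpha> \<otimes>\<^bsub>P\<^esub> \<beta>) h)"
    and crossing_counit: "\<lbrakk>\<gamma> \<in> carrier P; h \<in> carrier (alg H \<one>\<^bsub>P\<^esub>)\<rbrakk> \<Longrightarrow>
      counit H (crossing H \<gamma> \<one>\<^bsub>P\<^esub> h) = counit H h"
    and antipode_linear: "\<alpha> \<in> carrier P \<Longrightarrow> linear_on K (alg H \<alpha>) (alg H (inv\<^bsub>P\<^esub> \<alpha>)) (antipode H \<alpha>)"
    and antipode_right: "\<lbrakk>\<alpha> \<in> carrier P; h \<in> carrier (alg H \<one>\<^bsub>P\<^esub>)\<rbrakk> \<Longrightarrow>
      tsum (alg H \<alpha>) (\<lambda>x y. x \<otimes>\<^bsub>alg H \<alpha>\<^esub> antipode H (inv\<^bsub>P\<^esub> \<alpha>) y) (comult H \<alpha> (inv\<^bsub>P\<^esub> \<alpha>) h) =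
      counit H h \<odot>\<^bsub>alg H \<alpha>\<^esub> \<one>\<^bsub>alg H \<alpha>\<^esub>"
    and antipode_left: "\<lbrakk>\<alpha> \<in> carrier P; h \<in> carrier (alg H \<one>\<^bsub>P\<^esub>)\<rbrakk> \<Longrightarrow>
      tsum (alg H \<alpha>) (\<lambda>x y. antipode H (inv\<^bsub>P\<^esub> \<alpha>) x \<otimes>\<^bsub>alg H \<alpha>\<^esub> y) (comult H (inv\<^bsub>P\<^esub> \<alpha>) \<alpha> h) =
      counit H h \<odot>\<^bsub>alg H \<alpha>\<^esub> \<one>\<^bsub>alg H \<alpha>\<^esub>"

text \<open>Triple tensor products are bracketed to the right in the following axioms.\<close>

locale quasitriangular_T_coalgebra = T_coalgebra P K H
  for P :: "('g, 'm) monoid_scheme" and K :: "('k, 'c) ring_scheme"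
    and H :: "('g, 'k, 'h, 'z) qt_tcoalg_scheme" +
  assumes Rmat_unit: "\<lbrakk>\<alpha> \<in> carrier P; \<beta> \<in> carrier P\<rbrakk> \<Longrightarrow>
      Rmat H \<alpha> \<beta> \<in> Units (tensor K (alg H \<alpha>) (alg H \<beta>))"
    and Rmat_comult: "\<lbrakk>\<alpha> \<in> carrier P; \<beta> \<in> carrier P; h \<in> carrier (alg H (\<alpha> \<otimes>\<^bsub>P\<^esub> \<beta>))\<rbrakk> \<Longrightarrow>
      (let A = alg H \<alpha>; B = alg H \<beta>; T = tensor K A B
       in Rmat H \<alpha> \<beta> \<otimes>\<^bsub>T\<^esub> comult H \<alpha> \<beta> h =
          tsum T (\<lambda>x y. pure K A B y (crossing H (inv\<^bsub>P\<^esub> \<alpha>) (conj_elt P \<alpha> \<beta>) x))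
            (comult H (conj_elt P \<alpha> \<beta>) \<alpha> h) \<otimes>\<^bsub>T\<^esub> Rmat H \<alpha> \<beta>)"
    and Rmat_comult_right: "\<lbrakk>\<alpha> \<in> carrier P; \<beta> \<in> carrier P; \<gamma> \<in> carrier P\<rbrakk> \<Longrightarrow>
      (let A = alg H \<alpha>; B = alg H \<beta>; D = alg H \<gamma>; BD = tensor K B D; T = tensor K A BD
       in tsum T (\<lambda>x y. pure K A BD x (comult H \<beta> \<gamma> y)) (Rmat H \<alpha> (\<beta> \<otimes>\<^bsub>P\<^esub> \<gamma>)) =
          tsum T (\<lambda>x z. pure K A BD x (pure K B D \<one>\<^bsub>B\<^esub> z)) (Rmat H \<alpha> \<gamma>) \<otimes>\<^bsub>T\<^esub>
          tsum T (\<lambda>x y. pure K A BD x (pure K B D y \<one>\<^bsub>D\<^esub>)) (Rmat H \<alpha> \<beta>))"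
    and Rmat_comult_left: "\<lbrakk>\<alpha> \<in> carrier P; \<beta> \<in> carrier P; \<gamma> \<in> carrier P\<rbrakk> \<Longrightarrow>
      (let A = alg H \<alpha>; B = alg H \<beta>; D = alg H \<gamma>; BD = tensor K B D; T = tensor K A BD;
           \<alpha>' = conj_elt P (inv\<^bsub>P\<^esub> \<beta>) \<alpha>
       in tsum T (\<lambda>x z. tsum T (\<lambda>x' x''. pure K A BD x' (pure K B D x'' z)) (comult H \<alpha> \<beta> x))
            (Rmat H (\<alpha> \<otimes>\<^bsub>P\<^esub> \<beta>) \<gamma>) =
          tsum T (\<lambda>x z. pure K A BD (crossing H \<beta> \<alpha>' x) (pure K B D \<one>\<^bsub>B\<^esub> z)) (Rmat H \<alpha>' \<gamma>) \<otimes>\<^bsub>T\<^esub>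
          tsum T (\<lambda>y z. pure K A BD \<one>\<^bsub>A\<^esub> (pure K B D y z)) (Rmat H \<beta> \<gamma>))"
    and Rmat_crossing: "\<lbrakk>\<alpha> \<in> carrier P; \<beta> \<in> carrier P; \<gamma> \<in> carrier P\<rbrakk> \<Longrightarrow>
      (let B = alg H (conj_elt P \<alpha> \<beta>); D = alg H (conj_elt P \<alpha> \<gamma>)
       in tsum (tensor K B D) (\<lambda>y z. pure K B D (crossing H \<alpha> \<beta> y) (crossing H \<alpha> \<gamma> z)) (Rmat H \<beta> \<gamma>)) =
      Rmat H (conj_elt P \<alpha> \<beta>) (conj_elt P \<alpha> \<gamma>)"

definition Rmat_inv ::
  "('k, 'c) ring_scheme \<Rightarrow> ('g, 'k, 'h, 'z) qt_tcoalg_scheme \<Rightarrow> 'g \<Rightarrow> 'g \<Rightarrow> ('h \<times> 'h) list set" where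
  "Rmat_inv K H \<alpha> \<beta> = inv\<^bsub>tensor K (alg H \<alpha>) (alg H \<beta>)\<^esub> Rmat H \<alpha> \<beta>"

definition drinfeld ::
  "('g, 'm) monoid_scheme \<Rightarrow> ('g, 'k, 'h, 'z) qt_tcoalg_scheme \<Rightarrow> 'g \<Rightarrow> 'h" where
  "drinfeld P H \<alpha> =
     tsum (alg H \<alpha>)
       (\<lambda>\<xi> \<zeta>. antipode H (inv\<^bsub>P\<^esub> \<alpha>) (crossing H \<alpha> (inv\<^bsub>P\<^esub> \<alpha>) \<zeta>) \<otimes>\<^bsub>alg H \<alpha>\<^esub> \<xi>)
       (Rmat H \<alpha> (inv\<^bsub>P\<^esub> \<alpha>))"

definition drinfeld_sq ::
  "('g, 'm) monoid_scheme \<Rightarrow> ('g, 'k, 'h, 'z) qt_tcoalg_scheme \<Rightarrow> 'g \<Rightarrow> 'h" where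
  "drinfeld_sq P H \<alpha> =
     drinfeld P H \<alpha> \<otimes>\<^bsub>alg H \<alpha>\<^esub> antipode H (inv\<^bsub>P\<^esub> \<alpha>) (drinfeld P H (inv\<^bsub>P\<^esub> \<alpha>))"


subsection \<open>The ribbon extension\<close>

record ('g, 'k, 'h) ribbon_tcoalg = "('g, 'k, 'h) qt_tcoalg" +
  theta :: "'g \<Rightarrow> 'h"

text \<open>The expression \<open>h + k v\<^sub>\<alpha>\<close> is the pair \<open>(h, k)\<close>.\<close>

definition RT_alg ::
  "('g, 'm) monoid_scheme \<Rightarrow> ('g, 'k, 'h, 'z) qt_tcoalg_scheme \<Rightarrow> 'g \<Rightarrow> ('k, 'h \<times> 'h) module" where
  "RT_alg P H \<alpha> =
    (let A = alg H \<alpha>; \<phi> = crossing H \<alpha> \<alpha>; w = drinfeld_sq P H \<alpha>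
     in \<lparr> carrier = carrier A \<times> carrier A,
          mult = (\<lambda>(h, k) (h', k'). (h \<otimes>\<^bsub>A\<^esub> h' \<oplus>\<^bsub>A\<^esub> k \<otimes>\<^bsub>A\<^esub> \<phi> k' \<otimes>\<^bsub>A\<^esub> w,
                                     h \<otimes>\<^bsub>A\<^esub> k' \<oplus>\<^bsub>A\<^esub> k \<otimes>\<^bsub>A\<^esub> \<phi> h')),
          one = (\<one>\<^bsub>A\<^esub>, \<zero>\<^bsub>A\<^esub>),
          zero = (\<zero>\<^bsub>A\<^esub>, \<zero>\<^bsub>A\<^esub>),
          add = (\<lambda>(h, k) (h', k'). (h \<oplus>\<^bsub>A\<^esub> h', k \<oplus>\<^bsub>A\<^esub> k')),
          smult = (\<lambda>a (h, k). (a \<odot>\<^bsub>A\<^esub> h, a \<odot>\<^bsub>A\<^esub> k)) \<rparr>)"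

definition RT ::
  "('g, 'm) monoid_scheme \<Rightarrow> ('k, 'c) ring_scheme \<Rightarrow> ('g, 'k, 'h, 'z) qt_tcoalg_scheme \<Rightarrow>
   ('g, 'k, 'h \<times> 'h) ribbon_tcoalg" where
  "RT P K H =
    \<lparr> alg = RT_alg P H,
      comult = (\<lambda>\<alpha> \<beta> (h, k).
        let A = alg H \<alpha>; B = alg H \<beta>; A' = RT_alg P H \<alpha>; B' = RT_alg P H \<beta>; T = tensor K A' B';
            \<alpha>' = conj_elt P \<alpha> \<beta>
        in tsum T (\<lambda>h' h''. pure K A' B' (h', \<zero>\<^bsub>A\<^esub>) (h'', \<zero>\<^bsub>B\<^esub>)) (comult H \<alpha> \<beta> h) \<oplus>\<^bsub>T\<^esub>
           tsum T (\<lambda>k' k''.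
             tsum T (\<lambda>\<xi>\<^sub>i \<zeta>\<^sub>i.
               tsum T (\<lambda>\<xi>\<^sub>j \<zeta>\<^sub>j.
                 pure K A' B' (\<zero>\<^bsub>A\<^esub>, k' \<otimes>\<^bsub>A\<^esub> \<xi>\<^sub>i \<otimes>\<^bsub>A\<^esub> \<zeta>\<^sub>j)
                   (\<zero>\<^bsub>B\<^esub>, k'' \<otimes>\<^bsub>B\<^esub> \<zeta>\<^sub>i \<otimes>\<^bsub>B\<^esub> crossing H (inv\<^bsub>P\<^esub> \<alpha>) \<alpha>' \<xi>\<^sub>j))
               (Rmat_inv K H \<alpha>' \<alpha>))
             (Rmat_inv K H \<alpha> \<beta>))
           (comult H \<alpha> \<beta> k)),
      counit = (\<lambda>(h, k). counit H h \<oplus>\<^bsub>K\<^esub> counit H k),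
      crossing = (\<lambda>\<beta> \<alpha> (h, k). (crossing H \<beta> \<alpha> h, crossing H \<beta> \<alpha> k)),
      antipode = (\<lambda>\<alpha> (h, k). (antipode H \<alpha> h, antipode H \<alpha> (crossing H (inv\<^bsub>P\<^esub> \<alpha>) \<alpha> k))),
      Rmat = (\<lambda>\<alpha> \<beta>.
        let A' = RT_alg P H \<alpha>; B' = RT_alg P H \<beta>
        in tsum (tensor K A' B')
             (\<lambda>\<xi> \<zeta>. pure K A' B' (\<xi>, \<zero>\<^bsub>alg H \<alpha>\<^esub>) (\<zeta>, \<zero>\<^bsub>alg H \<beta>\<^esub>)) (Rmat H \<alpha> \<beta>)),
      theta = (\<lambda>\<alpha>. inv\<^bsub>RT_alg P H \<alpha>\<^esub> (\<zero>\<^bsub>alg H \<alpha>\<^esub>, \<one>\<^bsub>alg H \<alpha>\<^esub>)) \<rparr>"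


section \<open>Finite-dimensional vector spaces\<close>

text \<open>A finite-dimensional vector space is a \<open>module\<close> record over a field; to make equality of
  records coincide with equality of vector spaces, the operations are undefined outside the carrier
  and the unused ring operations of the record are undefined.\<close>

definition fd_space :: "('k, 'c) ring_scheme \<Rightarrow> ('k, 'u) module \<Rightarrow> bool" where
  "fd_space K V \<longleftrightarrow> module K V \<and>
     (\<exists>E. finite E \<and> E \<subseteq> carrier V \<and>
       (\<forall>x\<in>carrier V. \<exists>a \<in> E \<rightarrow> carrier K. x = (\<Oplus>\<^bsub>V\<^esub>e\<in>E. a e \<odot>\<^bsub>V\<^esub> e))) \<and>
     mult V = (\<lambda>_ _. undefined) \<and> one V = undefined \<and>
     (\<forall>x y. x \<notin> carrier V \<or> y \<notin> carrier V \<longrightarrow> x \<oplus>\<^bsub>V\<^esub> y = undefined) \<and>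
     (\<forall>a x. a \<notin> carrier K \<or> x \<notin> carrier V \<longrightarrow> a \<odot>\<^bsub>V\<^esub> x = undefined)"

definition is_tensor_product ::
  "('k, 'c) ring_scheme \<Rightarrow> ('k, 'u) module \<Rightarrow> ('k, 'u) module \<Rightarrow> ('k, 'u) module \<Rightarrow> ('u \<Rightarrow> 'u \<Rightarrow> 'u) \<Rightarrow> bool"
  where
  "is_tensor_product K V W T p \<longleftrightarrow> bilinear_on K V W T p \<and>
     (\<forall>(X :: ('k, 'u) module) B. module K X \<and> bilinear_on K V W X B \<longrightarrow>
        (\<exists>!f. f \<in> extensional (carrier T) \<and> linear_on K T X f \<and>
           (\<forall>v\<in>carrier V. \<forall>w\<in>carrier W. f (p v w) = B v w)))"

text \<open>The tensor product, the ground field and the dual space are, as usual, only determined up to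
  canonical isomorphism among the vector spaces with elements in a given universe \<open>'u\<close>. The following
  record is a choice of these: \<open>V \<otimes> W\<close> with the pure tensors \<open>v \<otimes> w\<close>; the ground field as a
  one-dimensional space with distinguished element \<open>1\<close>; and \<open>Hom(V, K)\<close> with its evaluation on \<open>V\<close>.
  Such a choice exists as soon as lists of scalars embed into \<open>'u\<close> (take coordinate spaces).\<close>

record ('k, 'u) vect_choice =
  tsp :: "('k, 'u) module \<Rightarrow> ('k, 'u) module \<Rightarrow> ('k, 'u) module"
  tpure :: "('k, 'u) module \<Rightarrow> ('k, 'u) module \<Rightarrow> 'u \<Rightarrow> 'u \<Rightarrow> 'u"
  usp :: "('k, 'u) module"
  ugen :: 'u
  dsp :: "('k, 'u) module \<Rightarrow> ('k, 'u) module"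
  pairing :: "('k, 'u) module \<Rightarrow> 'u \<Rightarrow> 'u \<Rightarrow> 'k"

locale vect_universe = field K
  for K :: "('k, 'c) ring_scheme" and VV :: "('k, 'u) vect_choice" +
  assumes tsp: "\<lbrakk>fd_space K V; fd_space K W\<rbrakk> \<Longrightarrow>
      fd_space K (tsp VV V W) \<and> is_tensor_product K V W (tsp VV V W) (tpure VV V W)"
    and usp: "fd_space K (usp VV) \<and> ugen VV \<in> carrier (usp VV) \<and>
      (\<forall>x\<in>carrier (usp VV). \<exists>!a. a \<in> carrier K \<and> x = a \<odot>\<^bsub>usp VV\<^esub> ugen VV)"
    and dsp: "fd_space K V \<Longrightarrow> fd_space K (dsp VV V)"
    and pairing_linear: "\<lbrakk>fd_space K V; x \<in> carrier V\<rbrakk> \<Longrightarrow>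
      linear_form K (dsp VV V) (\<lambda>f. pairing VV V f x)"
    and pairing_form: "\<lbrakk>fd_space K V; f \<in> carrier (dsp VV V)\<rbrakk> \<Longrightarrow> linear_form K V (pairing VV V f)"
    and pairing_bij: "\<lbrakk>fd_space K V; linear_form K V l\<rbrakk> \<Longrightarrow>
      \<exists>!f. f \<in> carrier (dsp VV V) \<and> (\<forall>x\<in>carrier V. pairing VV V f x = l x)"

text \<open>The linear map \<open>V \<otimes> W \<rightarrow> X\<close> with \<open>v \<otimes> w \<mapsto> B v w\<close>.\<close>

definition tlift ::
  "('k, 'c) ring_scheme \<Rightarrow> ('k, 'u) vect_choice \<Rightarrow> ('k, 'u) module \<Rightarrow> ('k, 'u) module \<Rightarrow> ('k, 'u) module \<Rightarrow>
   ('u \<Rightarrow> 'u \<Rightarrow> 'u) \<Rightarrow> 'u \<Rightarrow> 'u" where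
  "tlift K VV V W X B =
     (THE f. f \<in> extensional (carrier (tsp VV V W)) \<and> linear_on K (tsp VV V W) X f \<and>
        (\<forall>v\<in>carrier V. \<forall>w\<in>carrier W. f (tpure VV V W v w) = B v w))"

text \<open>The scalar corresponding to an element of the ground field as a vector space.\<close>

definition ucoeff :: "('k, 'c) ring_scheme \<Rightarrow> ('k, 'u) vect_choice \<Rightarrow> 'u \<Rightarrow> 'k" where
  "ucoeff K VV x = (THE a. a \<in> carrier K \<and> x = a \<odot>\<^bsub>usp VV\<^esub> ugen VV)"

text \<open>The element \<open>\<Sum>\<^sub>i e\<^sub>i \<otimes> e\<^sup>i\<close> of \<open>V \<otimes> V\<^sup>*\<close>, for any pair of dual bases.\<close>

definition dual_bases ::
  "('k, 'c) ring_scheme \<Rightarrow> ('k, 'u) vect_choice \<Rightarrow> ('k, 'u) module \<Rightarrow> 'u set \<Rightarrow> ('u \<Rightarrow> 'u) \<Rightarrow> bool" where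
  "dual_bases K VV V E e \<longleftrightarrow> finite E \<and> E \<subseteq> carrier V \<and> e \<in> E \<rightarrow> carrier (dsp VV V) \<and>
     (\<forall>x\<in>carrier V. x = (\<Oplus>\<^bsub>V\<^esub>y\<in>E. pairing VV V (e y) x \<odot>\<^bsub>V\<^esub> y)) \<and>
     (\<forall>x\<in>E. \<forall>y\<in>E. pairing VV V (e x) y = (if x = y then \<one>\<^bsub>K\<^esub> else \<zero>\<^bsub>K\<^esub>))"

definition canonical_elt :: "('k, 'c) ring_scheme \<Rightarrow> ('k, 'u) vect_choice \<Rightarrow> ('k, 'u) module \<Rightarrow> 'u" where
  "canonical_elt K VV V =
     (THE t. \<exists>E e. dual_bases K VV V E e \<and>
        t = (\<Oplus>\<^bsub>tsp VV V (dsp VV V)\<^esub>x\<in>E. tpure VV V (dsp VV V) x (e x)))"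


section \<open>Finite-dimensional representations\<close>

record ('g, 'k, 'h, 'u) hmod =
  grade :: 'g
  space :: "('k, 'u) module"
  act :: "'h \<Rightarrow> 'u \<Rightarrow> 'u"

abbreviation elts where "elts M \<equiv> carrier (space M)"

type_synonym ('g, 'k, 'h, 'u) harr = "(('g, 'k, 'h, 'u) hmod, 'u \<Rightarrow> 'u) arr"

definition is_hmod ::
  "('g, 'm) monoid_scheme \<Rightarrow> ('k, 'c) ring_scheme \<Rightarrow> ('g, 'k, 'h, 'z) tcoalg_scheme \<Rightarrow> ('g, 'k, 'h, 'u) hmod \<Rightarrow> bool"
  where
  "is_hmod P K H M \<longleftrightarrow> grade M \<in> carrier P \<and> fd_space K (space M) \<and>
     (let A = alg H (grade M)
      in bilinear_on K A (space M) (space M) (act M) \<and>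
         (\<forall>a\<in>carrier A. \<forall>b\<in>carrier A. \<forall>x\<in>elts M. act M (a \<otimes>\<^bsub>A\<^esub> b) x = act M a (act M b x)) \<and>
         (\<forall>x\<in>elts M. act M \<one>\<^bsub>A\<^esub> x = x) \<and>
         act M \<in> extensional (carrier A) \<and> (\<forall>a\<in>carrier A. act M a \<in> extensional (elts M)))"

text \<open>The space \<open>\<^bsup>\<beta>\<^esup>U\<close> is literally the space \<open>U\<close>, so that the element \<open>\<^bsup>\<beta>\<^esup>u\<close> is \<open>u\<close>.\<close>

context
  fixes P :: "('g, 'm) monoid_scheme" and K :: "('k, 'c) ring_scheme"
    and VV :: "('k, 'u) vect_choice" and H :: "('g, 'k, 'h, 'z) qt_tcoalg_scheme"
begin

definition hmod_linear :: "('g, 'k, 'h, 'u) hmod \<Rightarrow> ('g, 'k, 'h, 'u) hmod \<Rightarrow> ('u \<Rightarrow> 'u) \<Rightarrow> bool" where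
  "hmod_linear M N f \<longleftrightarrow> grade M = grade N \<and> f \<in> extensional (elts M) \<and>
     linear_on K (space M) (space N) f \<and>
     (\<forall>h\<in>carrier (alg H (grade M)). \<forall>x\<in>elts M. f (act M h x) = act N h (f x))"

definition rep_tens :: "('g, 'k, 'h, 'u) hmod \<Rightarrow> ('g, 'k, 'h, 'u) hmod \<Rightarrow> ('g, 'k, 'h, 'u) hmod" where
  "rep_tens M N =
    (let T = tsp VV (space M) (space N); \<gamma> = grade M \<otimes>\<^bsub>P\<^esub> grade N
     in \<lparr> grade = \<gamma>, space = T,
          act = (\<lambda>h\<in>carrier (alg H \<gamma>).
            tlift K VV (space M) (space N) T
              (\<lambda>x y. tsum T (\<lambda>h' h''. tpure VV (space M) (space N) (act M h' x) (act N h'' y))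
                 (comult H (grade M) (grade N) h))) \<rparr>)"

definition rep_tens_ar :: "('g, 'k, 'h, 'u) harr \<Rightarrow> ('g, 'k, 'h, 'u) harr \<Rightarrow> ('g, 'k, 'h, 'u) harr" where
  "rep_tens_ar f g =
    (let X = rep_tens (adom f) (adom g); Y = rep_tens (acod f) (acod g)
     in Arr X Y (tlift K VV (space (adom f)) (space (adom g)) (space Y)
          (\<lambda>x y. tpure VV (space (acod f)) (space (acod g)) (amap f x) (amap g y))))"

definition rep_unit :: "('g, 'k, 'h, 'u) hmod" where
  "rep_unit = \<lparr> grade = \<one>\<^bsub>P\<^esub>, space = usp VV,
     act = (\<lambda>h\<in>carrier (alg H \<one>\<^bsub>P\<^esub>). \<lambda>x\<in>carrier (usp VV). counit H h \<odot>\<^bsub>usp VV\<^esub> x) \<rparr>"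

definition rep_assoc ::
  "('g, 'k, 'h, 'u) hmod \<Rightarrow> ('g, 'k, 'h, 'u) hmod \<Rightarrow> ('g, 'k, 'h, 'u) hmod \<Rightarrow> ('g, 'k, 'h, 'u) harr" where
  "rep_assoc L M N =
    (let X = rep_tens (rep_tens L M) N; Y = rep_tens L (rep_tens M N);
         U = space L; V = space M; W = space N; UV = tsp VV U V; VW = tsp VV V W
     in Arr X Y (tlift K VV UV W (space Y)
          (\<lambda>x w. tlift K VV U V (space Y) (\<lambda>u v. tpure VV U VW u (tpure VV V W v w)) x)))"

definition rep_lunit :: "('g, 'k, 'h, 'u) hmod \<Rightarrow> ('g, 'k, 'h, 'u) harr" where
  "rep_lunit M = Arr (rep_tens rep_unit M) M
     (tlift K VV (usp VV) (space M) (space M) (\<lambda>x m. ucoeff K VV x \<odot>\<^bsub>space M\<^esub> m))"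

definition rep_runit :: "('g, 'k, 'h, 'u) hmod \<Rightarrow> ('g, 'k, 'h, 'u) harr" where
  "rep_runit M = Arr (rep_tens M rep_unit) M
     (tlift K VV (space M) (usp VV) (space M) (\<lambda>m x. ucoeff K VV x \<odot>\<^bsub>space M\<^esub> m))"

definition rep_conj :: "'g \<Rightarrow> ('g, 'k, 'h, 'u) hmod \<Rightarrow> ('g, 'k, 'h, 'u) hmod" where
  "rep_conj \<beta> M =
    (let \<gamma> = conj_elt P \<beta> (grade M)
     in \<lparr> grade = \<gamma>, space = space M,
          act = (\<lambda>h\<in>carrier (alg H \<gamma>). \<lambda>x\<in>elts M. act M (crossing H (inv\<^bsub>P\<^esub> \<beta>) \<gamma> h) x) \<rparr>)"

definition rep_braid :: "('g, 'k, 'h, 'u) hmod \<Rightarrow> ('g, 'k, 'h, 'u) hmod \<Rightarrow> ('g, 'k, 'h, 'u) harr" where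
  "rep_braid M N =
    (let X = rep_tens M N; Y = rep_tens (rep_conj (grade M) N) M
     in Arr X Y (tlift K VV (space M) (space N) (space Y)
          (\<lambda>x y. tsum (space Y) (\<lambda>\<xi> \<zeta>. tpure VV (space N) (space M) (act N \<zeta> y) (act M \<xi> x))
             (Rmat H (grade M) (grade N)))))"

definition Rep :: "('g, ('g, 'k, 'h, 'u) hmod, ('g, 'k, 'h, 'u) harr) braided_tcat" where
  "Rep =
    \<lparr> Ob = {M. is_hmod P K H M},
      Ar = {Arr M N f | M N f. is_hmod P K H M \<and> is_hmod P K H N \<and> hmod_linear M N f},
      Dom = adom,
      Cod = acod,
      Id = (\<lambda>M. Arr M M (\<lambda>x\<in>elts M. x)),
      Comp = (\<lambda>g f. Arr (adom f) (acod g) (compose (elts (adom f)) (amap g) (amap f))),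
      tens_ob = rep_tens,
      tens_ar = rep_tens_ar,
      unit_ob = rep_unit,
      assoc = rep_assoc,
      lunit = rep_lunit,
      runit = rep_runit,
      Deg = grade,
      conj_ob = rep_conj,
      conj_ar = (\<lambda>\<beta> f. Arr (rep_conj \<beta> (adom f)) (rep_conj \<beta> (acod f)) (amap f)),
      braid = rep_braid \<rparr>"

definition rep_dual :: "('g, 'k, 'h, 'u) hmod \<Rightarrow> ('g, 'k, 'h, 'u) hmod" where
  "rep_dual M =
    (let D = dsp VV (space M); \<gamma> = inv\<^bsub>P\<^esub> (grade M)
     in \<lparr> grade = \<gamma>, space = D,
          act = (\<lambda>h\<in>carrier (alg H \<gamma>). \<lambda>f\<in>carrier D.
            THE g. g \<in> carrier D \<and>
              (\<forall>x\<in>elts M. pairing VV (space M) g x = pairing VV (space M) f (act M (antipode H \<gamma> h) x))) \<rparr>)"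

definition rep_coev :: "('g, 'k, 'h, 'u) hmod \<Rightarrow> ('g, 'k, 'h, 'u) harr" where
  "rep_coev M =
    (let Y = rep_tens M (rep_dual M)
     in Arr rep_unit Y
          (\<lambda>x\<in>carrier (usp VV). ucoeff K VV x \<odot>\<^bsub>space Y\<^esub> canonical_elt K VV (space M)))"

definition rep_ev :: "('g, 'k, 'h, 'u) hmod \<Rightarrow> ('g, 'k, 'h, 'u) harr" where
  "rep_ev M = Arr (rep_tens (rep_dual M) M) rep_unit
     (tlift K VV (dsp VV (space M)) (space M) (usp VV)
        (\<lambda>f x. pairing VV (space M) f x \<odot>\<^bsub>usp VV\<^esub> ugen VV))"

end

definition ribbon_Rep ::
  "('g, 'm) monoid_scheme \<Rightarrow> ('k, 'c) ring_scheme \<Rightarrow> ('k, 'u) vect_choice \<Rightarrow>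
   ('g, 'k, 'h, 'z) ribbon_tcoalg_scheme \<Rightarrow>
   ('g, ('g, 'k, 'h, 'u) hmod, ('g, 'k, 'h, 'u) harr) ribbon_tcat" where
  "ribbon_Rep P K VV H =
     balanced_tcat.extend
       (braided_tcat.extend (Rep P K VV H)
         (balanced_tcat.fields
           (\<lambda>M. Arr M (rep_conj P H (grade M) M) (\<lambda>x\<in>elts M. act M (theta H (grade M)) x))))
       (ribbon_tcat.fields (rep_dual P VV H) (rep_coev P K VV H) (rep_ev P K VV H))"


section \<open>The category \<open>Rib(H)\<close>\<close>

context
  fixes P :: "('g, 'm) monoid_scheme" and K :: "('k, 'c) ring_scheme"
    and VV :: "('k, 'u) vect_choice" and H :: "('g, 'k, 'h, 'z) qt_tcoalg_scheme"
begin

text \<open>The condition on \<open>t\<^sup>-\<^sup>2\<close> is an equation for the map underlying the inverse of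
  \<open>t\<^sup>2 : M \<rightarrow> \<^bsup>\<alpha>\<alpha>\<^esup>M\<close>.\<close>

definition is_rib :: "('g, 'k, 'h, 'u) hmod \<times> ('g, 'k, 'h, 'u) harr \<Rightarrow> bool" where
  "is_rib X \<longleftrightarrow>
    (let B = Rep P K VV H; M = fst X; t = snd X
     in M \<in> Ob B \<and> t \<in> hom_set B M (M \<rhd>\<^sub>o\<^bsub>B\<^esub> M) \<and> is_iso B t \<and>
        (\<forall>x\<in>elts M. amap (inv_ar B ((M \<rhd>\<^sub>a\<^bsub>B\<^esub> t) \<bullet>\<^bsub>B\<^esub> t)) x = act M (drinfeld_sq P H (grade M)) x))"

definition rib_tens ::
  "('g, 'k, 'h, 'u) hmod \<times> ('g, 'k, 'h, 'u) harr \<Rightarrow> ('g, 'k, 'h, 'u) hmod \<times> ('g, 'k, 'h, 'u) harr \<Rightarrow>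
   ('g, 'k, 'h, 'u) hmod \<times> ('g, 'k, 'h, 'u) harr" where
  "rib_tens = (\<lambda>(M, t) (M', t').
    let B = Rep P K VV H
    in (M \<otimes>\<^sub>o\<^bsub>B\<^esub> M',
        (((M \<rhd>\<^sub>o\<^bsub>B\<^esub> M') \<rhd>\<^sub>a\<^bsub>B\<^esub> t) \<otimes>\<^sub>a\<^bsub>B\<^esub> (M \<rhd>\<^sub>a\<^bsub>B\<^esub> t'))
          \<bullet>\<^bsub>B\<^esub> braid B (M \<rhd>\<^sub>o\<^bsub>B\<^esub> M') M \<bullet>\<^bsub>B\<^esub> braid B M M'))"

definition rib_dual ::
  "('g, 'k, 'h, 'u) hmod \<times> ('g, 'k, 'h, 'u) harr \<Rightarrow> ('g, 'k, 'h, 'u) hmod \<times> ('g, 'k, 'h, 'u) harr" where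
  "rib_dual = (\<lambda>(M, t).
    let B = Rep P K VV H; Ms = rep_dual P VV H M; N = M \<rhd>\<^sub>o\<^bsub>B\<^esub> M
    in (Ms, Ms \<rhd>\<^sub>a\<^bsub>B\<^esub>
              dual_arrow B Ms (rep_coev P K VV H M) (rep_dual P VV H N) (rep_ev P K VV H N) t))"

definition Rib ::
  "('g, ('g, 'k, 'h, 'u) hmod \<times> ('g, 'k, 'h, 'u) harr,
    (('g, 'k, 'h, 'u) hmod \<times> ('g, 'k, 'h, 'u) harr, ('g, 'k, 'h, 'u) harr) arr) ribbon_tcat" where
  "Rib =
    (let B = Rep P K VV H;
         un = (\<I>\<^bsub>B\<^esub>, Id B \<I>\<^bsub>B\<^esub>);
         cj = (\<lambda>\<beta> (M, t). (conj_ob B \<beta> M, conj_ar B \<beta> t))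
     in \<lparr> Ob = {X. is_rib X},
          Ar = {Arr X Y f | X Y f. is_rib X \<and> is_rib Y \<and> f \<in> hom_set B (fst X) (fst Y) \<and>
                  snd Y \<bullet>\<^bsub>B\<^esub> f = (fst X \<rhd>\<^sub>a\<^bsub>B\<^esub> f) \<bullet>\<^bsub>B\<^esub> snd X},
          Dom = adom,
          Cod = acod,
          Id = (\<lambda>X. Arr X X (Id B (fst X))),
          Comp = (\<lambda>g f. Arr (adom f) (acod g) (amap g \<bullet>\<^bsub>B\<^esub> amap f)),
          tens_ob = rib_tens,
          tens_ar = (\<lambda>f g. Arr (rib_tens (adom f) (adom g)) (rib_tens (acod f) (acod g))
                             (amap f \<otimes>\<^sub>a\<^bsub>B\<^esub> amap g)),
          unit_ob = un,
          assoc = (\<lambda>X Y Z. Arr (rib_tens (rib_tens X Y) Z) (rib_tens X (rib_tens Y Z))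
                             (assoc B (fst X) (fst Y) (fst Z))),
          lunit = (\<lambda>X. Arr (rib_tens un X) X (lunit B (fst X))),
          runit = (\<lambda>X. Arr (rib_tens X un) X (runit B (fst X))),
          Deg = (\<lambda>X. grade (fst X)),
          conj_ob = cj,
          conj_ar = (\<lambda>\<beta> f. Arr (cj \<beta> (adom f)) (cj \<beta> (acod f)) (conj_ar B \<beta> (amap f))),
          braid = (\<lambda>X Y. Arr (rib_tens X Y) (rib_tens (cj (grade (fst X)) Y) X)
                           (braid B (fst X) (fst Y))),
          twist = (\<lambda>X. Arr X (cj (grade (fst X)) X) (snd X)),
          dual_ob = rib_dual,
          coev = (\<lambda>X. Arr un (rib_tens X (rib_dual X)) (rep_coev P K VV H (fst X))),
          ev = (\<lambda>X. Arr (rib_tens (rib_dual X) X) un (rep_ev P K VV H (fst X))) \<rparr>)"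

end

end

theory Submission
  imports Defs
begin

text \<open>
Let \<open>w\<close> be the element \<open>u s(u)\<close> by which \<open>t\<^sup>-\<^sup>2\<close> has to act on an object \<open>(M, t)\<close> of \<open>Rib(H)\<close>. Two computations
with the R-matrix drive everything. First, the double braiding moves an invariant element
of \<open>V \<otimes> W\<close> (an invariant form on it) by the action of \<open>w\<close> on one factor, for \<open>V\<close>, \<open>W\<close> of opposite degree; so the
unit and the counit of the dual commute with the twists exactly when \<open>t\<^sup>-\<^sup>2 = w\<close>, and \<open>\<omega>\<^sub>U\<close> acts as \<open>w\<close>, whence the
objects with a good left dual are those of \<open>Rib(H)\<close>. Second, \<open>(s \<otimes> s)(R) = R\<close> up to crossing makes the pairing of
\<open>M \<otimes> N\<close> with \<open>N\<^sup>* \<otimes> M\<^sup>*\<close> exchange the twists, and as this pairing is nondegenerate \<open>Rib(H)\<close> is closed under tensor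
products. The axioms of a balanced T-category are inherited from the twist extension, of which \<open>Rib(H)\<close> is a full
subcategory. Finally, an \<open>RT(H)\<close>-module is an \<open>H\<close>-module together with the action of \<open>v\<close>, which is \<open>t\<^sup>-\<^sup>1\<close> for a unique \<open>t\<close>, and
all the structure of \<open>Rib(H)\<close> is transported along this bijection.
\<close>

text \<open>The formal generator of RT(H) is meant to act as the inverse of the twist, and this
  dictates its structure: its square must act as \<open>w\<close>, and its comultiplication is read
  off from the inverse of the twist of a tensor product, where two inverse R-matrices undo the
  double braiding. Goodness admits any stable left dual; hence \<omega> is computed for an arbitrary
  unit and counit, so that goodness of any dual forces the condition defining Rib(H). A direct proof
  that the condition passes to tensor products would need the comultiplication of \<open>w\<close>;
  the pairing with the dual modules replaces it by the action of \<open>w\<close> on the product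
  module as a whole. Two kinds of tensor products occur: over H they are classes of lists, evaluated
  by \<open>tsum\<close>; for modules they are spaces with a universal property, evaluated by
  \<open>tlift\<close>. Identities are turned into identities of multilinear maps and tested on pure
  tensors. Both representation categories use the same chosen spaces, so the isomorphisms are
  strict.\<close>

abbreviation (input) "cr \<equiv> carrier"
abbreviation (input) "gr \<equiv> grade"
abbreviation (input) "sp \<equiv> space"
abbreviation (input) "lo \<equiv> linear_on"
abbreviation (input) "bo \<equiv> bilinear_on"

abbreviation (input) bmult :: "'a \<Rightarrow> ('a, 'm) monoid_scheme \<Rightarrow> 'a \<Rightarrow> 'a" ("_ *[_] _" [70, 0, 71] 70)
  where "x *[G] y \<equiv> x \<otimes>\<^bsub>G\<^esub> y"
abbreviation (input) badd :: "'a \<Rightarrow> ('a, 'm) ring_scheme \<Rightarrow> 'a \<Rightarrow> 'a" ("_ +[_] _" [65, 0, 66] 65)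
  where "x +[G] y \<equiv> x \<oplus>\<^bsub>G\<^esub> y"
abbreviation (input) bsmult :: "'a \<Rightarrow> ('a, 'v, 'm) module_scheme \<Rightarrow> 'v \<Rightarrow> 'v" ("_ .*[_] _" [70, 0, 71] 70)
  where "x .*[G] y \<equiv> x \<odot>\<^bsub>G\<^esub> y"
abbreviation (input) bone :: "('a, 'm) monoid_scheme \<Rightarrow> 'a" ("\<one>[_]") where "\<one>[G] \<equiv> \<one>\<^bsub>G\<^esub>"
abbreviation (input) bzero :: "('a, 'm) ring_scheme \<Rightarrow> 'a" ("\<zero>[_]") where "\<zero>[G] \<equiv> \<zero>\<^bsub>G\<^esub>"
abbreviation (input) bcomp :: "'a \<Rightarrow> ('o, 'a, 'z) tensor_cat_scheme \<Rightarrow> 'a \<Rightarrow> 'a" ("_ \<bullet>[_] _" [56, 0, 55] 55)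
  where "g \<bullet>[C] f \<equiv> g \<bullet>\<^bsub>C\<^esub> f"
abbreviation (input) btob :: "'o \<Rightarrow> ('o, 'a, 'z) tensor_cat_scheme \<Rightarrow> 'o \<Rightarrow> 'o" ("_ **[_] _" [70, 0, 71] 70)
  where "U **[C] V \<equiv> U \<otimes>\<^sub>o\<^bsub>C\<^esub> V"
abbreviation (input) btar :: "'a \<Rightarrow> ('o, 'a, 'z) tensor_cat_scheme \<Rightarrow> 'a \<Rightarrow> 'a" ("_ ***[_] _" [70, 0, 71] 70)
  where "f ***[C] g \<equiv> f \<otimes>\<^sub>a\<^bsub>C\<^esub> g"
abbreviation (input) stob :: "('o, 'a, 'z) tensor_cat_scheme \<Rightarrow> 'o \<Rightarrow> 'o \<Rightarrow> 'o" (infixl "**\<index>" 70)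
  where "stob C U V \<equiv> U \<otimes>\<^sub>o\<^bsub>C\<^esub> V"
abbreviation (input) star :: "('o, 'a, 'z) tensor_cat_scheme \<Rightarrow> 'a \<Rightarrow> 'a \<Rightarrow> 'a" (infixl "***\<index>" 70)
  where "star C f g \<equiv> f \<otimes>\<^sub>a\<^bsub>C\<^esub> g"
abbreviation (input) bunit :: "('o, 'a, 'z) tensor_cat_scheme \<Rightarrow> 'o" ("\<I>[_]") where "\<I>[C] \<equiv> \<I>\<^bsub>C\<^esub>"

section \<open>Sums over tensors\<close>

text \<open>Maps given by Sweedler-type sums are evaluated in stages, and each stage needs linearity
  in some slot. The rules collected here build such facts from the shape of the map.\<close>

named_theorems lin

section \<open>Linear and bilinear maps\<close>

lemma loI:
 assumes "!!x. x:cr V ==> f x:cr W"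
  and "!!x y. x:cr V ==> y:cr V ==> f (x+[V]y) = f x+[W]f y"
  and "!!a x. a:cr K ==> x:cr V ==> f (a.*[V]x) = a.*[W]f x"
 shows "lo K V W f"
 using assms unfolding linear_on_def by blast

lemma loD:
 assumes "lo K V W f"
 shows lo_closed: "x:cr V ==> f x:cr W"
  and lo_add: "x:cr V ==> y:cr V ==> f (x+[V]y) = f x+[W]f y"
  and lo_smult: "a:cr K ==> x:cr V ==> f (a.*[V]x) = a.*[W]f x"
 using assms unfolding linear_on_def by blast+

lemma boI [lin]:
 assumes "!!v. v:cr V ==> lo K W X (%w. B v w)"
  and "!!w. w:cr W ==> lo K V X (%v. B v w)"
 shows "bo K V W X B"
 using assms unfolding bilinear_on_def by blast

lemma boD:
 assumes "bo K V W X B"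
 shows "v:cr V ==> lo K W X (B v)"
  and "w:cr W ==> lo K V X (%v. B v w)"
 using assms unfolding bilinear_on_def by blast+

lemma bo_closed:
 "bo K V W X B ==> v:cr V ==> w:cr W ==> B v w:cr X"
 by (meson boD(1) lo_closed)

lemma lo_cong:
 assumes "!!x. x:cr V ==> f x = g x" "module K V"
 shows "lo K V W f \<longleftrightarrow> lo K V W g"
proof -
 interpret module K V by fact
 show ?thesis using assms(1) unfolding linear_on_def by (auto simp: Pi_iff)
qed

lemma lo_compose:
 "lo K V W f ==> lo K W X g ==> lo K V X (%x. g (f x))"
 unfolding linear_on_def by (auto simp: Pi_iff)

lemma lo_id [lin]: "lo K V V (%x. x)"
 unfolding linear_on_def by auto

lemma lo_zero:
 assumes "module K V" "module K W" "lo K V W f"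
 shows "f \<zero>[V] = \<zero>[W]"
proof -
 interpret V: module K V by fact
 interpret W: module K W by fact
 have "f (\<zero>[V]+[V]\<zero>[V]) = f \<zero>[V]+[W]f \<zero>[V]"
  using lo_add[OF assms(3)] by blast
 moreover have "f \<zero>[V]:cr W" using lo_closed[OF assms(3)] by blast
 ultimately show ?thesis using W.M.add.r_cancel_one' by auto
qed

lemma lo_plus [lin]:
 assumes "module K W" "lo K V W f" "lo K V W g"
 shows "lo K V W (%x. f x+[W]g x)"
proof -
 interpret W: module K W by fact
 show ?thesis
  by (intro loI)
   (auto simp: loD[OF assms(2)] loD[OF assms(3)] W.smult_r_distr W.M.a_ac)
qed

lemma lo_smult_left [lin]:
 assumes "module K W" "a:cr K" "lo K V W f"
 shows "lo K V W (%x. a.*[W]f x)"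
proof -
 interpret W: module K W by fact
 have "a*[K]b = b*[K]a" if "b:cr K" for b
  using assms(2) that W.R.m_comm by blast
 then show ?thesis
  using assms(2) by (intro loI)
   (auto simp: loD[OF assms(3)] W.smult_r_distr W.smult_assoc1[symmetric])
qed

text \<open>A linear form has its values in K, which is a ring record without scalar multiplication.
  To fit into \<open>linear_on\<close>, its values are attached to a fixed vector w.\<close>

lemma lo_form_smult:
 assumes "module K W" "w:cr W" "linear_form K V f"
 shows "lo K V W (%x. f x.*[W]w)"
proof -
 interpret W: module K W by fact
 have *: "f:cr V \<rightarrow> cr K"
   "!!x y. x\<in>cr V ==> y\<in>cr V ==> f (x+[V]y) = f x+[K]f y"
   "!!a x. a\<in>cr K ==> x\<in>cr V ==> f (a.*[V]x) = a*[K]f x"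
  using assms(3) unfolding linear_form_def by blast+
 show ?thesis using *(1) assms(2)
  by (intro loI) (auto simp: *(2,3) W.smult_l_distr W.smult_assoc1 Pi_iff)
qed

lemma lo_finsum [lin]:
 assumes "module K W" "module K V" "!!i. i:I ==> lo K V W (f i)"
 shows "lo K V W (%x. \<Oplus>\<^bsub>W\<^esub>i\<in>I. f i x)"
proof -
 interpret W: module K W by fact
 interpret V: module K V by fact
 show ?thesis
 proof (cases "finite I")
  case True
  then show ?thesis using assms(3)
  proof (induction I rule: finite_induct)
   case empty
   then show ?case by (auto intro!: loI)
  next
   case (insert i F)
   have "lo K V W (%x. f i x+[W](\<Oplus>\<^bsub>W\<^esub>i\<in>F. f i x))"
    using insert assms(1) by (intro lo_plus) auto
   moreover have "(\<Oplus>\<^bsub>W\<^esub>i\<in>insert i F. f i x) = f i x+[W](\<Oplus>\<^bsub>W\<^esub>i\<in>F. f i x)"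
    if "x:cr V" for x
    using insert.hyps insert.prems that by (intro W.M.finsum_insert) (auto dest: lo_closed)
   ultimately show ?case using lo_cong[OF _ assms(2)] by (smt (verit, ccfv_SIG))
  qed
 next
  case False
  then show ?thesis by (auto intro!: loI simp: W.M.finsum_infinite)
 qed
qed

lemma lo_finsum_out:
 assumes "module K V" "module K W" "lo K V W f" "!!i. i:I ==> g i:cr V"
 shows "f (\<Oplus>\<^bsub>V\<^esub>i\<in>I. g i) = (\<Oplus>\<^bsub>W\<^esub>i\<in>I. f (g i))"
proof -
 interpret W: module K W by fact
 interpret V: module K V by fact
 show ?thesis
 proof (cases "finite I")
  case True
  then show ?thesis using assms(4)
  proof (induction I rule: finite_induct)
   case empty
   then show ?case using lo_zero[OF assms(1-3)] by simp
  next
   case (insert i F)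
   have "f (\<Oplus>\<^bsub>V\<^esub>i\<in>insert i F. g i) = f (g i+[V](\<Oplus>\<^bsub>V\<^esub>i\<in>F. g i))"
    using insert by (subst V.M.finsum_insert) auto
   also have "... = f (g i)+[W](\<Oplus>\<^bsub>W\<^esub>i\<in>F. f (g i))"
    using insert lo_add[OF assms(3), of "g i" "\<Oplus>\<^bsub>V\<^esub>i\<in>F. g i"]
    by (auto intro!: V.M.finsum_closed)
   also have "... = (\<Oplus>\<^bsub>W\<^esub>i\<in>insert i F. f (g i))"
    using insert lo_closed[OF assms(3)] by (subst W.M.finsum_insert) auto
   finally show ?case .
  qed
 next
  case False
  then show ?thesis
   using lo_zero[OF assms(1-3)] by (simp add: W.M.finsum_infinite V.M.finsum_infinite)
 qed
qed

text \<open>\<open>tsum\<close> sums over a representative picked by choice. With an explicit list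
  the same sum is open to induction and can be compared for two lists of one class.\<close>

definition lsum :: "('k, 'x, 'f) module_scheme => ('v => 'w => 'x) => ('v \<times> 'w) list => 'x" where
 "lsum X B xs = foldr (%(v, w) s. B v w+[X]s) xs \<zero>[X]"

lemma tsum_lsum: "tsum X B x = lsum X B (tens_rep x)"
 by (simp add: tsum_def lsum_def)

lemma lsum_Nil [simp]: "lsum X B [] = \<zero>[X]"
 and lsum_Cons [simp]: "lsum X B (p # xs) = B (fst p) (snd p)+[X]lsum X B xs"
 by (simp_all add: lsum_def split_def)

lemma lsum_closed:
 assumes "module K X" "set xs <= cr V \<times> cr W"
  "!!v w. v:cr V ==> w:cr W ==> B v w:cr X"
 shows "lsum X B xs:cr X"
proof -
 interpret module K X by fact
 show ?thesis using assms(2,3) by (induction xs) (auto simp: mem_Times_iff)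
qed

lemma lsum_cong:
 assumes "set xs <= cr V \<times> cr W"
  "!!v w. v:cr V ==> w:cr W ==> B v w = C v w"
 shows "lsum X B xs = lsum X C xs"
 using assms by (induction xs) (auto simp: mem_Times_iff)

lemma lsum_append:
 assumes "module K X" "set xs <= cr V \<times> cr W" "set ys <= cr V \<times> cr W"
  "!!v w. v:cr V ==> w:cr W ==> B v w:cr X"
 shows "lsum X B (xs @ ys) = lsum X B xs+[X]lsum X B ys"
proof -
 interpret module K X by fact
 have ys: "lsum X B ys:cr X" using assms(1,3,4) by (rule lsum_closed)
 show ?thesis using assms(2)
 proof (induction xs)
  case Nil
  then show ?case using ys by simp
 next
  case (Cons p xs)
  moreover have "lsum X B xs:cr X" using assms(1,4) Cons by (intro lsum_closed) auto
  ultimately show ?case using ys assms(4) by (auto simp: mem_Times_iff M.a_assoc)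
 qed
qed

lemma lsum_add:
 assumes "module K X" "set xs <= cr V \<times> cr W"
  "!!v w. v:cr V ==> w:cr W ==> B v w:cr X"
  "!!v w. v:cr V ==> w:cr W ==> C v w:cr X"
 shows "lsum X (%v w. B v w+[X]C v w) xs = lsum X B xs+[X]lsum X C xs"
proof -
 interpret module K X by fact
 show ?thesis using assms(2)
 proof (induction xs)
  case (Cons p xs)
  moreover have "lsum X B xs:cr X" "lsum X C xs:cr X"
   using assms(1,3,4) Cons by (auto intro!: lsum_closed)
  ultimately show ?case using assms(3,4) by (auto simp: mem_Times_iff M.a_ac)
 qed simp
qed

lemma lsum_linear_out:
 assumes "module K X" "module K Y" "lo K X Y f" "set xs <= cr V \<times> cr W"
  "!!v w. v:cr V ==> w:cr W ==> B v w:cr X"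
 shows "f (lsum X B xs) = lsum Y (%v w. f (B v w)) xs"
 using assms(4)
proof (induction xs)
 case Nil
 then show ?case using lo_zero[OF assms(1-3)] by simp
next
 case (Cons p xs)
 moreover have "lsum X B xs:cr X" using assms(1,5) Cons by (intro lsum_closed) auto
 ultimately show ?case using assms(5) lo_add[OF assms(3)] by (auto simp: mem_Times_iff)
qed

section \<open>Evaluation of bilinear maps on classes of lists\<close>

lemma tens_eq_carrier:
 assumes "module K V" "module K W" "tens_eq K V W xs ys"
 shows "set xs <= cr V \<times> cr W & set ys <= cr V \<times> cr W"
proof -
 interpret V: module K V by fact
 interpret W: module K W by fact
 show ?thesis using assms(3) by (induction rule: tens_eq.induct) auto
qed

text \<open>Every generating relation of \<open>tens_eq\<close> becomes an equation between sums as
  soon as B is bilinear. This is the existence half of the universal property of the concrete tensor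
  product.\<close>

lemma tens_eq_lsum:
 assumes "module K V" "module K W" "module K X" "bo K V W X B" "tens_eq K V W xs ys"
 shows "lsum X B xs = lsum X B ys"
proof -
 interpret X: module K X by fact
 have cl: "!!v w. v:cr V ==> w:cr W ==> B v w:cr X"
  using bo_closed[OF assms(4)] .
 note L = boD[OF assms(4)]
 show ?thesis using assms(5)
 proof (induction rule: tens_eq.induct)
  case (append xs xs' ys ys')
  then show ?case
   using tens_eq_carrier[OF assms(1,2) append.hyps(1)] tens_eq_carrier[OF assms(1,2) append.hyps(2)]
    lsum_append[OF assms(3),of _ V W _ B] cl by auto
 next
  case (commute xs ys)
  have "lsum X B xs:cr X" "lsum X B ys:cr X"
   using commute lsum_closed[OF assms(3),of _ V W B] cl by auto
  then show ?case using commute lsum_append[OF assms(3),of _ V W _ B] cl by (auto simp: X.M.a_comm)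
 next
  case (zero w)
  then show ?case using lo_zero[OF assms(1,3) L(2)] by simp
 next
  case (add_left v v' w)
  then show ?case using lo_add[OF L(2)] cl by (simp add: X.M.a_assoc)
 next
  case (add_right v w w')
  then show ?case using lo_add[OF L(1)] cl by (simp add: X.M.a_assoc)
 next
  case (smult a v w)
  then show ?case using lo_smult[OF L(1)] lo_smult[OF L(2)] cl by simp
 qed auto
qed

section \<open>The vector space structure on classes of lists\<close>

lemma tens_class_eq:
 assumes "tens_eq K V W xs ys"
 shows "tens_class K V W xs = tens_class K V W ys"
 unfolding tens_class_def using assms tens_eq.sym tens_eq.trans by blast

lemma tens_rep_eq:
 assumes "set xs <= cr V \<times> cr W"
 shows "tens_eq K V W xs (tens_rep (tens_class K V W xs))"
 unfolding tens_rep_def tens_class_def mem_Collect_eq by (rule someI) (rule tens_eq.refl[OF assms])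

lemma tens_rep_c:
 assumes "module K V" "module K W" "x:cr (tensor K V W)"
 shows "set (tens_rep x) <= cr V \<times> cr W"
proof -
 obtain xs where "x = tens_class K V W xs" "set xs <= cr V \<times> cr W"
  using assms(3) by (auto simp: tensor_def)
 then show ?thesis using tens_rep_eq[of xs V W K] tens_eq_carrier[OF assms(1,2)] by blast
qed

lemma tens_class_rep:
 assumes "x:cr (tensor K V W)"
 shows "tens_class K V W (tens_rep x) = x"
proof -
 obtain xs where "x = tens_class K V W xs" "set xs <= cr V \<times> cr W"
  using assms by (auto simp: tensor_def)
 then show ?thesis using tens_class_eq[OF tens_rep_eq[of xs V W K]] by simp
qed

lemma tens_class_closed:
 "set xs <= cr V \<times> cr W ==> tens_class K V W xs:cr (tensor K V W)"
 by (auto simp: tensor_def)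

lemma tensor_add_class:
 assumes "set xs <= cr V \<times> cr W" "set ys <= cr V \<times> cr W"
 shows "tens_class K V W xs+[tensor K V W]tens_class K V W ys = tens_class K V W (xs @ ys)"
 using tens_class_eq[OF tens_eq.append[OF tens_rep_eq[OF assms(1),of K] tens_rep_eq[OF assms(2),of K]]]
 by (simp add: tensor_def)

text \<open>Scalar multiplication is defined on a chosen representative. Scaling the left entries
  has to respect all generating relations; for the balancing relation this uses commutativity of
  K.\<close>

lemma tensor_smult_class:
 assumes "module K V" "module K W" "set xs <= cr V \<times> cr W" "a:cr K"
 shows "a.*[tensor K V W]tens_class K V W xs = tens_class K V W (map (%(v, w). (a.*[V]v, w)) xs)"
proof -
 interpret V: module K V by fact
 interpret W: module K W by fact
 have cl: "set (map (%(v, w). (a.*[V]v, w)) xs) <= cr V \<times> cr W"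
  if "set xs <= cr V \<times> cr W" for xs using that assms(4) by auto
 have "tens_eq K V W (map (%(v, w). (a.*[V]v, w)) xs) (map (%(v, w). (a.*[V]v, w)) ys)"
  if "tens_eq K V W xs ys" for xs ys
  using that
 proof (induction rule: tens_eq.induct)
  case (refl xs)
  then show ?case using cl by (intro tens_eq.refl)
 next
  case (commute xs ys)
  then show ?case using tens_eq.commute[OF cl[of xs] cl[of ys]] by simp
 next
  case (zero w)
  then show ?case using assms(4) by (auto intro: tens_eq.zero)
 next
  case (add_left v v' w)
  then show ?case using assms(4) by (auto simp: V.smult_r_distr intro: tens_eq.add_left)
 next
  case (add_right v w w')
  then show ?case using assms(4) by (auto intro: tens_eq.add_right)
 next
  case (smult b v w)
  have "a.*[V](b.*[V]v) = b.*[V](a.*[V]v)"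
   using smult assms(4) by (simp add: V.smult_assoc1[symmetric] V.R.m_comm)
  then show ?case using smult assms(4) by (auto intro: tens_eq.smult)
 qed (auto intro: tens_eq.sym tens_eq.trans tens_eq.append)
 then show ?thesis
  using tens_class_eq[of K V W] tens_rep_eq[OF assms(3)] by (fastforce simp: tensor_def)
qed

lemma tensor_zero: "\<zero>[tensor K V W] = tens_class K V W []"
 by (simp add: tensor_def)

lemma mod_tensor [lin]:
 assumes "module K V" "module K W"
 shows "module K (tensor K V W)"
proof -
 interpret V: module K V by fact
 interpret W: module K W by fact
 let ?T = "tensor K V W"
 have ex: "\<exists>xs. set xs <= cr V \<times> cr W & x = tens_class K V W xs" if "x:cr ?T" for x
  using that by (auto simp: tensor_def)
 \<comment> \<open>The opposite of a class is represented by the same list with negated left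
   entries; in the inductive step the head is moved past the negated tail so that it meets its own
   negative.\<close>
 have neg: "tens_eq K V W (map (%(v, w). (\<ominus>\<^bsub>V\<^esub> v, w)) xs @ xs) []"
  if "set xs <= cr V \<times> cr W" for xs
  using that
 proof (induction xs)
  case Nil
  then show ?case by (auto intro: tens_eq.refl)
 next
  case (Cons p xs)
  obtain v w where p: "p = (v, w)" "v:cr V" "w:cr W" using Cons by auto
  let ?m = "map (%(v, w). (\<ominus>\<^bsub>V\<^esub> v, w)) xs"
  have m: "set ?m <= cr V \<times> cr W" using Cons by auto
  have "tens_eq K V W ([(\<ominus>\<^bsub>V\<^esub> v, w)] @ (?m @ [(v, w)]) @ xs) ([(\<ominus>\<^bsub>V\<^esub> v, w)] @ ([(v, w)] @ ?m) @ xs)"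
   using Cons p m by (intro tens_eq.append tens_eq.commute tens_eq.refl) auto
  moreover have "tens_eq K V W ([(\<ominus>\<^bsub>V\<^esub> v, w)] @ [(v, w)]) []"
   using tens_eq.add_left[of "\<ominus>\<^bsub>V\<^esub> v" V v w W K] p tens_eq.zero[of w W K V]
   by (simp add: V.M.l_neg) (metis tens_eq.sym tens_eq.trans)
  then have "tens_eq K V W (([(\<ominus>\<^bsub>V\<^esub> v, w)] @ [(v, w)]) @ (?m @ xs)) ([] @ [])"
   using Cons p by (intro tens_eq.append) auto
  ultimately show ?case using p by (auto intro: tens_eq.trans)
 qed
 note cls = tens_class_closed tensor_add_class tensor_zero
 have ag: "abelian_group ?T"
 proof (rule abelian_groupI)
  fix x assume x: "x:cr ?T"
  from ex[OF x] obtain xs where xs: "set xs <= cr V \<times> cr W" "x = tens_class K V W xs" by blast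
  have m: "set (map (%(v, w). (\<ominus>\<^bsub>V\<^esub> v, w)) xs) <= cr V \<times> cr W" using xs by auto
  show "\<exists>y\<in>cr ?T. y+[?T]x = \<zero>[?T]"
   using tens_class_closed[OF m] neg[OF xs(1)] xs(2) tensor_add_class[OF m xs(1)]
    tens_class_eq by (metis tensor_zero)
  show "\<zero>[?T]+[?T]x = x" using xs by (simp add: tensor_zero tensor_add_class)
 next
  fix x y assume x: "x:cr ?T" and y: "y:cr ?T"
  from ex[OF x] obtain xs where xs: "set xs <= cr V \<times> cr W" "x = tens_class K V W xs" by blast
  from ex[OF y] obtain ys where ys: "set ys <= cr V \<times> cr W" "y = tens_class K V W ys" by blast
  show "x+[?T]y:cr ?T" using xs ys by (simp add: cls)
  show "x+[?T]y = y+[?T]x"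
   using xs ys tens_class_eq[OF tens_eq.commute[OF xs(1) ys(1),of K]] by (simp add: cls)
  fix z assume z: "z:cr ?T"
  from ex[OF z] obtain zs where zs: "set zs <= cr V \<times> cr W" "z = tens_class K V W zs" by blast
  show "x+[?T]y+[?T]z = x+[?T](y+[?T]z)" using xs ys zs by (simp add: cls)
 qed (auto simp: tensor_zero tens_class_closed)
 have map_cl: "set (map (%(v, w). (a.*[V]v, w)) xs) <= cr V \<times> cr W"
  if "set xs <= cr V \<times> cr W" "a:cr K" for xs a using that by auto
 note sm = tensor_smult_class[OF assms]
 show ?thesis
 proof (rule moduleI[OF module.axioms(1)[OF assms(1)] ag])
  fix a x assume a: "a:cr K" and x: "x:cr ?T"
  from ex[OF x] obtain xs where xs: "set xs <= cr V \<times> cr W" "x = tens_class K V W xs" by blast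
  show "a.*[?T]x:cr ?T" using xs a map_cl by (simp add: sm tens_class_closed)
  {
   fix y assume y: "y:cr ?T"
   from ex[OF y] obtain ys where ys: "set ys <= cr V \<times> cr W" "y = tens_class K V W ys" by blast
   show "a.*[?T](x+[?T]y) = a.*[?T]x+[?T]a.*[?T]y"
    using xs ys a map_cl by (simp add: sm cls)
  }
  fix b assume b: "b:cr K"
  have "map (%(v, w). ((a*[K]b).*[V]v, w)) xs
    = map (%(v, w). (a.*[V]v, w)) (map (%(v, w). (b.*[V]v, w)) xs)"
   using xs(1) a b by (auto simp: V.smult_assoc1)
  then show "(a*[K]b).*[?T]x = a.*[?T](b.*[?T]x)"
   using xs a b map_cl[OF xs(1) b] by (simp add: sm del: map_map)
  \<comment> \<open>Splitting each pair yields the two kinds of scaled pairs interleaved, whereas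
    the sum of classes is a concatenation; the induction sorts them.\<close>
  have "tens_eq K V W (map (%(v, w). ((a+[K]b).*[V]v, w)) xs)
    (map (%(v, w). (a.*[V]v, w)) xs @ map (%(v, w). (b.*[V]v, w)) xs)"
   using xs(1)
  proof (induction xs)
   case (Cons p xs)
   obtain v w where p: "p = (v, w)" "v:cr V" "w:cr W" using Cons by auto
   let ?A = "map (%(v, w). (a.*[V]v, w)) xs" and ?B = "map (%(v, w). (b.*[V]v, w)) xs"
   have AB: "set ?A <= cr V \<times> cr W" "set ?B <= cr V \<times> cr W"
    using Cons a b by auto
   have "tens_eq K V W ([((a+[K]b).*[V]v, w)] @ map (%(v, w). ((a+[K]b).*[V]v, w)) xs)
     ([(a.*[V]v, w), (b.*[V]v, w)] @ (?A @ ?B))"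
    using Cons p a b tens_eq.add_left[of "a.*[V]v" V "b.*[V]v" w W K]
    by (intro tens_eq.append) (auto simp: V.smult_l_distr)
   moreover have "tens_eq K V W ([(a.*[V]v, w)] @ ([(b.*[V]v, w)] @ ?A) @ ?B)
     ([(a.*[V]v, w)] @ (?A @ [(b.*[V]v, w)]) @ ?B)"
    using Cons p a b AB by (intro tens_eq.append tens_eq.commute tens_eq.refl) auto
   ultimately show ?case using p by (auto intro: tens_eq.trans)
  qed (auto intro: tens_eq.refl)
  then show "(a+[K]b).*[?T]x = a.*[?T]x+[?T]b.*[?T]x"
   using xs a b map_cl[OF xs(1)] tens_class_eq by (simp add: sm cls)
 next
  fix x assume x: "x:cr ?T"
  from ex[OF x] obtain xs where xs: "set xs <= cr V \<times> cr W" "x = tens_class K V W xs" by blast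
  have "map (%(v, w). (\<one>[K].*[V]v, w)) xs = xs"
   using xs(1) by (induction xs) auto
  then show "\<one>[K].*[?T]x = x" using xs by (simp add: sm)
 qed
qed

lemma pure_closed [simp, intro]:
 "v:cr V ==> w:cr W ==> pure K V W v w:cr (tensor K V W)"
 by (auto intro: tens_class_closed)

context
 fixes K :: "('k, 'c) ring_scheme" and V :: "('k, 'v, 'd) module_scheme"
  and W :: "('k, 'w, 'e) module_scheme"
 assumes V: "module K V" and W: "module K W"
begin

interpretation V: module K V by (rule V)
interpretation W: module K W by (rule W)

lemma tsum_cong:
 assumes "t:cr (tensor K V W)"
  "!!v w. v:cr V ==> w:cr W ==> B v w = C v w"
 shows "tsum X B t = tsum X C t"
 unfolding tsum_lsum using tens_rep_c[OF V W assms(1)] assms(2) by (rule lsum_cong)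

lemma tsum_closed:
 assumes "module K X" "t:cr (tensor K V W)"
  "!!v w. v:cr V ==> w:cr W ==> B v w:cr X"
 shows "tsum X B t:cr X"
 unfolding tsum_lsum using assms(1) tens_rep_c[OF V W assms(2)] assms(3) by (rule lsum_closed)

lemma tsum_class:
 assumes "module K X" "bo K V W X B" "set xs <= cr V \<times> cr W"
 shows "tsum X B (tens_class K V W xs) = lsum X B xs"
 unfolding tsum_lsum using tens_eq_lsum[OF V W assms(1,2) tens_rep_eq[OF assms(3)]] by simp

lemma tsum_pure:
 assumes "module K X" "bo K V W X B" "v:cr V" "w:cr W"
 shows "tsum X B (pure K V W v w) = B v w"
proof -
 interpret X: module K X by fact
 show ?thesis using assms bo_closed[OF assms(2)] by (subst tsum_class) auto
qed

text \<open>Both sums run over the same chosen list for t, so linearity of f and closure of B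
  suffice.\<close>

lemma tsum_out:
 assumes "module K X" "module K Y" "lo K X Y f" "t:cr (tensor K V W)"
  "!!v w. v:cr V ==> w:cr W ==> B v w:cr X"
 shows "f (tsum X B t) = tsum Y (%v w. f (B v w)) t"
 unfolding tsum_lsum using assms tens_rep_c[OF V W assms(4)] by (intro lsum_linear_out) auto

lemma tsum_plus:
 assumes "module K X" "t:cr (tensor K V W)"
  "!!v w. v:cr V ==> w:cr W ==> B v w:cr X"
  "!!v w. v:cr V ==> w:cr W ==> C v w:cr X"
 shows "tsum X (%v w. B v w+[X]C v w) t = tsum X B t+[X]tsum X C t"
 unfolding tsum_lsum using assms(1) tens_rep_c[OF V W assms(2)] assms(3,4) by (rule lsum_add)

lemma lo_tsum:
 assumes "module K X" "t:cr (tensor K V W)"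
  "!!v w. v:cr V ==> w:cr W ==> lo K U X (%u. B u v w)"
 shows "lo K U X (%u. tsum X (B u) t)"
proof (rule loI)
 interpret X: module K X by fact
 note L = loD[OF assms(3)]
 fix x y assume x: "x:cr U" and y: "y:cr U"
 show "tsum X (B x) t:cr X" using assms x by (intro tsum_closed) (auto intro: L)
 have "tsum X (B (x+[U]y)) t = tsum X (%v w. B x v w+[X]B y v w) t"
  using x y assms(2) by (intro tsum_cong) (auto simp: L)
 also have "... = tsum X (B x) t+[X]tsum X (B y) t"
  using x y assms by (intro tsum_plus) (auto intro: L)
 finally show "tsum X (B (x+[U]y)) t = tsum X (B x) t+[X]tsum X (B y) t" .
next
 interpret X: module K X by fact
 note L = loD[OF assms(3)]
 fix a x assume a: "a:cr K" and x: "x:cr U"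
 have "tsum X (B (a.*[U]x)) t = tsum X (%v w. a.*[X]B x v w) t"
  using a x assms(2) by (intro tsum_cong) (auto simp: L)
 also have "... = a.*[X]tsum X (B x) t"
  using a x assms lo_smult_left[OF assms(1) a lo_id]
  by (intro tsum_out[symmetric]) (auto intro: L)
 finally show "tsum X (B (a.*[U]x)) t = a.*[X]tsum X (B x) t" .
qed

text \<open>Here bilinearity of B enters: the representative chosen for a sum or a multiple may
  differ from the list formed out of the given representatives, and \<open>tsum_class\<close>
  identifies the values.\<close>

lemma lo_tsum_tensor:
 assumes X: "module K X" and B: "bo K V W X B"
 shows "lo K (tensor K V W) X (tsum X B)"
proof (rule loI)
 interpret X: module K X by fact
 note cl = bo_closed[OF B]
 fix x y assume x: "x:cr (tensor K V W)" and y: "y:cr (tensor K V W)"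
 show "tsum X B x:cr X" using X x cl by (rule tsum_closed)
 note xr = tens_rep_c[OF V W x] and yr = tens_rep_c[OF V W y]
 have "tsum X B (x+[tensor K V W]y) = tsum X B (tens_class K V W (tens_rep x @ tens_rep y))"
  by (simp add: tensor_def)
 also have "... = lsum X B (tens_rep x)+[X]lsum X B (tens_rep y)"
  using xr yr cl by (subst tsum_class[OF X B]) (auto intro: lsum_append[OF X])
 finally show "tsum X B (x+[tensor K V W]y) = tsum X B x+[X]tsum X B y" by (simp add: tsum_lsum)
next
 interpret X: module K X by fact
 note cl = bo_closed[OF B]
 fix a x assume a: "a:cr K" and x: "x:cr (tensor K V W)"
 note xr = tens_rep_c[OF V W x]
 have "tsum X B (a.*[tensor K V W]x) = tsum X B (tens_class K V W (map (%(v, w). (a.*[V]v, w)) (tens_rep x)))"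
  by (simp add: tensor_def)
 also have "... = lsum X B (map (%(v, w). (a.*[V]v, w)) (tens_rep x))"
  using xr a by (subst tsum_class[OF X B]) auto
 also have "... = lsum X (%v w. a.*[X]B v w) (tens_rep x)"
  using xr
 proof (induction "tens_rep x" arbitrary: x)
  case Nil then show ?case by simp
 next
  case (Cons p ps)
  have "lsum X B (map (%(v, w). (a.*[V]v, w)) ps) = lsum X (%v w. a.*[X]B v w) ps"
   if "set ps <= cr V \<times> cr W" for ps using that
   by (induction ps) (use a lo_smult[OF boD(2)[OF B]] in auto)
  then show ?case using Cons.prems by metis
 qed
 also have "... = a.*[X]lsum X B (tens_rep x)"
  using xr cl a lo_smult_left[OF X a lo_id]
  by (intro lsum_linear_out[OF X X,symmetric]) auto
 finally show "tsum X B (a.*[tensor K V W]x) = a.*[X]tsum X B x" by (simp add: tsum_lsum)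
qed

lemma lo_tsum_arg:
 assumes "module K X" "bo K V W X B" "lo K U (tensor K V W) f"
 shows "lo K U X (%u. tsum X B (f u))"
 by (rule lo_compose[OF assms(3) lo_tsum_tensor[OF assms(1,2)]])

lemma bilinear_pure [lin]: "bo K V W (tensor K V W) (pure K V W)"
proof -
 let ?t = "tensor K V W"
 have 1: "pure K V W (v+[V]v') w = pure K V W v w+[?t]pure K V W v' w"
  if "v:cr V" "v':cr V" "w:cr W" for v v' w
  using that tens_class_eq[OF tens_eq.add_left[OF that,of K]] by (subst tensor_add_class) auto
 have 2: "pure K V W v (w+[W]w') = pure K V W v w+[?t]pure K V W v w'"
  if "v:cr V" "w:cr W" "w':cr W" for v w w'
  using that tens_class_eq[OF tens_eq.add_right[OF that,of K]] by (subst tensor_add_class) auto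
 have 3: "pure K V W (a.*[V]v) w = a.*[?t]pure K V W v w"
  if "v:cr V" "a:cr K" "w:cr W" for a v w
  using that by (subst tensor_smult_class[OF V W]) auto
 have 4: "pure K V W v (a.*[W]w) = a.*[?t]pure K V W v w"
  if "v:cr V" "a:cr K" "w:cr W" for a v w
  using that tens_class_eq[OF tens_eq.smult[of a K v V w W]] 3 by simp
 show ?thesis using 1 2 3 4 by (auto intro!: boI loI)
qed

lemma tsum_pure_id:
 assumes "t:cr (tensor K V W)"
 shows "tsum (tensor K V W) (pure K V W) t = t"
proof -
 have "lsum (tensor K V W) (pure K V W) xs = tens_class K V W xs"
  if "set xs <= cr V \<times> cr W" for xs
  using that
 proof (induction xs)
  case Nil
  then show ?case by (simp add: tensor_zero)
 next
  case (Cons p xs)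
  then show ?case using tensor_add_class[of "[p]" V W xs K] by auto
 qed
 then show ?thesis
  unfolding tsum_lsum using tens_rep_c[OF V W assms] tens_class_rep[OF assms] by simp
qed

end

text \<open>Turns a sum over a tensor that is itself a sum of tensors into an iterated sum. By this
  rule axioms stated in tensor products become identities of iterated sums.\<close>

lemma tsum_tsum:
 assumes "module K V" "module K W" "module K V'" "module K W'" "module K X"
  "bo K V W X B" "t:cr (tensor K V' W')"
  "!!v w. v:cr V' ==> w:cr W' ==> C v w:cr (tensor K V W)"
 shows "tsum X B (tsum (tensor K V W) C t) = tsum X (%v w. tsum X B (C v w)) t"
 using assms(7,8) by (intro tsum_out[OF assms(3,4) mod_tensor[OF assms(1,2)] assms(5)]
   lo_tsum_tensor[OF assms(1,2,5,6)]) auto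

text \<open>Both are finite sums over fixed lists, hence interchangeable for every B with values in
  X.\<close>

lemma tsum_swap:
 assumes "module K V" "module K W" "module K V'" "module K W'" "module K X"
  "t:cr (tensor K V W)" "s:cr (tensor K V' W')"
  "!!v w v' w'. v:cr V ==> w:cr W ==> v':cr V' ==> w':cr W'
   ==> B v w v' w':cr X"
 shows "tsum X (%v w. tsum X (B v w) s) t = tsum X (%v' w'. tsum X (%v w. B v w v' w') t) s"
proof -
 interpret X: module K X by fact
 have "lsum X (%v w. lsum X (B v w) ys) xs = lsum X (%v' w'. lsum X (%v w. B v w v' w') xs) ys"
  if "set xs <= cr V \<times> cr W" and ys: "set ys <= cr V' \<times> cr W'" for xs ys
  using that(1)
 proof (induction xs)
  case Nil
  have "lsum X (%v' w'. \<zero>[X]) ys = \<zero>[X]" by (induction ys) auto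
  then show ?case by simp
 next
  case (Cons p xs)
  have "lsum X (%v' w'. B (fst p) (snd p) v' w'+[X]lsum X (%v w. B v w v' w') xs) ys
   = lsum X (B (fst p) (snd p)) ys+[X]lsum X (%v' w'. lsum X (%v w. B v w v' w') xs) ys"
   using Cons assms(8) by (intro lsum_add[OF assms(5) ys]) (auto simp: mem_Times_iff intro!: lsum_closed[OF assms(5)])
  then show ?case using Cons by auto
 qed
 then show ?thesis
  unfolding tsum_lsum
  using tens_rep_c[OF assms(1,2,6)] tens_rep_c[OF assms(3,4,7)] by blast
qed

lemma tensor_one: "\<one>[tensor K V W] = pure K V W \<one>[V] \<one>[W]"
 by (simp add: tensor_def)

lemma linear_tensor_eqI:
 assumes "module K V" "module K W" "module K X"
  "lo K (tensor K V W) X f" "lo K (tensor K V W) X g"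
  "!!v w. v:cr V ==> w:cr W ==> f (pure K V W v w) = g (pure K V W v w)"
  "t:cr (tensor K V W)"
 shows "f t = g t"
proof -
 let ?T = "tensor K V W"
 note T = mod_tensor[OF assms(1,2)]
 have *: "h t = tsum X (%v w. h (pure K V W v w)) t" if "lo K ?T X h" for h
 proof -
  have "h t = h (tsum ?T (pure K V W) t)" using assms by (simp add: tsum_pure_id)
  also have "... = tsum X (%v w. h (pure K V W v w)) t"
   by (intro tsum_out[OF assms(1,2) T assms(3) that assms(7)]) auto
  finally show ?thesis .
 qed
 show ?thesis
  unfolding*[OF assms(4)]*[OF assms(5)]
  by (intro tsum_cong[OF assms(1,2,7)] assms(6))
qed

lemma bilinear_left:
 "bo K V W X B ==> lo K U V f ==> w:cr W ==> lo K U X (%u. B (f u) w)"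
 by (rule lo_compose[where g = "%v. B v w"]) (auto dest: boD(2))

lemma bilinear_right:
 "bo K V W X B ==> lo K U W f ==> v:cr V ==> lo K U X (%u. B v (f u))"
 by (rule lo_compose[where g = "B v"]) (auto dest: boD(1))

lemma linear_pure_left [lin]:
 "module K V ==> module K W ==> lo K U V f ==> w:cr W
  ==> lo K U (tensor K V W) (%u. pure K V W (f u) w)"
 by (rule bilinear_left[OF bilinear_pure])

lemma linear_pure_right [lin]:
 "module K V ==> module K W ==> lo K U W f ==> v:cr V
  ==> lo K U (tensor K V W) (%u. pure K V W v (f u))"
 by (rule bilinear_right[OF bilinear_pure])

lemma uaD:
 assumes "unital_algebra K A"
 shows "module K A" "ring A"
 using assms by (auto simp: unital_algebra_def)

lemma bilinear_mult:
 assumes "unital_algebra K A"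
 shows "bo K A A A (%x y. x*[A]y)"
proof -
 interpret ring A using uaD[OF assms] by blast
 show ?thesis
  using assms unfolding unital_algebra_def
  by (intro boI loI) (auto simp: l_distr r_distr)
qed

lemma linear_mult_left [lin]:
 "unital_algebra K A ==> lo K U A f ==> y:cr A ==> lo K U A (%u. f u*[A]y)"
 by (rule bilinear_left[OF bilinear_mult])

lemma linear_mult_right [lin]:
 "unital_algebra K A ==> lo K U A f ==> y:cr A ==> lo K U A (%u. y*[A]f u)"
 by (rule bilinear_right[OF bilinear_mult])

lemma linear_tsum_ring:
 "module K V ==> module K W ==> module K X ==> t:cr (tensor K V W) ==>
  (!!v w. v:cr V ==> w:cr W ==> lo K U X (%u. B u v w)) ==>
  lo K U X (%u. tsum X (B u) t)"
 by (rule lo_tsum)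

subsection \<open>The tensor product of two algebras\<close>

context
 fixes K :: "('k, 'c) ring_scheme" and A :: "('k, 'v, 'd) module_scheme"
  and B :: "('k, 'w, 'e) module_scheme"
 assumes A: "unital_algebra K A" and B: "unital_algebra K B"
begin

interpretation A: module K A using uaD[OF A] by blast
interpretation B: module K B using uaD[OF B] by blast
interpretation AR: ring A using uaD[OF A] by blast
interpretation BR: ring B using uaD[OF B] by blast

text \<open>The product in \<open>tensor\<close> is formed from pairwise products of two chosen
  lists. Rewritten as an iterated \<open>tsum\<close> it is visibly independent of the choices, and
  its bilinearity follows from the rules above.\<close>

lemma tensor_mult:
 assumes "x:cr (tensor K A B)" "y:cr (tensor K A B)"
 shows "x*[tensor K A B]y
  = tsum (tensor K A B) (%a b. tsum (tensor K A B) (%c d. pure K A B (a*[A]c) (b*[B]d)) y) x"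
proof -
 let ?T = "tensor K A B"
 note T = mod_tensor[OF A.module_axioms B.module_axioms]
 interpret T: module K ?T by (rule T)
 let ?p = "%xs ys. [(a*[A]c, b*[B]d). (a, b) \<leftarrow> xs, (c, d) \<leftarrow> ys]"
 have 1: "lsum ?T (pure K A B) zs = tens_class K A B zs" if "set zs <= cr A \<times> cr B" for zs
  using that
 proof (induction zs)
  case Nil
  then show ?case by (simp add: tensor_zero)
 next
  case (Cons p xs)
  then show ?case using tensor_add_class[of "[p]" A B xs K] by auto
 qed
 have 2: "lsum ?T (pure K A B) (?p xs ys)
  = lsum ?T (%a b. lsum ?T (%c d. pure K A B (a*[A]c) (b*[B]d)) ys) xs
  & set (?p xs ys) <= cr A \<times> cr B"
  if "set xs <= cr A \<times> cr B" and ys: "set ys <= cr A \<times> cr B" for xs ys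
  using that(1)
 proof (induction xs)
  case (Cons p xs)
  obtain a b where p: "p = (a, b)" "a:cr A" "b:cr B" using Cons by auto
  let ?q = "[(a*[A]c, b*[B]d). (c, d) \<leftarrow> ys]"
  have q: "set ?q <= cr A \<times> cr B" using ys p by auto
  have "lsum ?T (pure K A B) ?q = lsum ?T (%c d. pure K A B (a*[A]c) (b*[B]d)) ys"
   using ys by (induction ys) auto
  moreover have "lsum ?T (pure K A B) (?q @ ?p xs ys)
    = lsum ?T (pure K A B) ?q+[?T]lsum ?T (pure K A B) (?p xs ys)"
  proof (rule lsum_append[OF T q])
   show "set (?p xs ys) <= cr A \<times> cr B" using Cons by (simp only: list.set insert_subset)
  qed auto
  moreover have "?p (p # xs) ys = ?q @ ?p xs ys" using p by simp
  ultimately show ?case using Cons p q by (simp del: concat.simps)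
 qed simp
 note xr = tens_rep_c[OF A.module_axioms B.module_axioms assms(1)]
  and yr = tens_rep_c[OF A.module_axioms B.module_axioms assms(2)]
 have "x*[?T]y = tens_class K A B (?p (tens_rep x) (tens_rep y))" by (simp add: tensor_def)
 also have "... = lsum ?T (pure K A B) (?p (tens_rep x) (tens_rep y))"
  using 1 2[OF xr yr] by metis
 finally show ?thesis using 2[OF xr yr] unfolding tsum_lsum by simp
qed

lemma tensor_mult_c:
 assumes "x:cr (tensor K A B)" "y:cr (tensor K A B)"
 shows "x*[tensor K A B]y:cr (tensor K A B)"
 unfolding tensor_mult[OF assms]
 by (intro tsum_closed[OF A.module_axioms B.module_axioms] mod_tensor assms A.module_axioms B.module_axioms) auto

lemma tsum_mult:
 assumes "module K X" "bo K A B X C" "x:cr (tensor K A B)" "y:cr (tensor K A B)"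
 shows "tsum X C (x*[tensor K A B]y) = tsum X (%a b. tsum X (%c d. C (a*[A]c) (b*[B]d)) y) x"
proof -
 note M = A.module_axioms B.module_axioms
 let ?T = "tensor K A B"
 have "tsum X C (x*[?T]y)
  = tsum X (%a b. tsum X C (tsum ?T (%c d. pure K A B (a*[A]c) (b*[B]d)) y)) x"
  unfolding tensor_mult[OF assms(3,4)]
  using assms M by (intro tsum_tsum tsum_closed[OF M] mod_tensor) auto
 also have "... = tsum X (%a b. tsum X (%c d. tsum X C (pure K A B (a*[A]c) (b*[B]d))) y) x"
  using assms M by (intro tsum_cong[OF M] tsum_tsum) auto
 also have "... = tsum X (%a b. tsum X (%c d. C (a*[A]c) (b*[B]d)) y) x"
  using assms by (intro tsum_cong[OF M] tsum_pure[OF M]) auto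
 finally show ?thesis .
qed

lemma pure_mult:
 assumes "a:cr A" "b:cr B" "c:cr A" "d:cr B"
 shows "pure K A B a b*[tensor K A B]pure K A B c d = pure K A B (a*[A]c) (b*[B]d)"
proof -
 note M = A.module_axioms B.module_axioms
 let ?T = "tensor K A B"
 note T = mod_tensor[OF M]
 note lins = boI linear_pure_left linear_pure_right linear_mult_left linear_mult_right lo_id
  linear_tsum_ring
 have "pure K A B a b*[?T]pure K A B c d
  = tsum ?T (%a b. tsum ?T (%c d. pure K A B (a*[A]c) (b*[B]d)) (pure K A B c d)) (pure K A B a b)"
  using assms by (intro tensor_mult) auto
 also have "... = tsum ?T (%a b. pure K A B (a*[A]c) (b*[B]d)) (pure K A B a b)"
  using assms by (intro tsum_cong[OF M] tsum_pure[OF M] T lins A B M) auto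
 also have "... = pure K A B (a*[A]c) (b*[B]d)"
  using assms by (intro tsum_pure[OF M] T lins A B M) auto
 finally show ?thesis .
qed

lemma bilinear_tensor_mult:
 "bo K (tensor K A B) (tensor K A B) (tensor K A B) (%x y. x*[tensor K A B]y)"
proof -
 note M = A.module_axioms B.module_axioms
 let ?T = "tensor K A B"
 note T = mod_tensor[OF M]
 let ?M = "%x y. tsum ?T (%a b. tsum ?T (%c d. pure K A B (a*[A]c) (b*[B]d)) y) x"
 note lins = linear_pure_left linear_pure_right linear_mult_left linear_mult_right lo_id
 have "lo K ?T ?T (%y. ?M x y)" if "x:cr ?T" for x
  using that
  by (intro lo_tsum[OF M T] lo_tsum_arg[OF M T] boI lins A B M) auto
 moreover have "lo K ?T ?T (%x. ?M x y)" if "y:cr ?T" for y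
  using that
  by (intro lo_tsum_arg[OF M T] lo_tsum[OF M T] boI lins A B M) auto
 ultimately show ?thesis
  by (intro boI) (simp_all add: lo_cong[OF tensor_mult T])
qed

text \<open>Associativity is trilinear, so it is checked on pure tensors, one argument at a
  time.\<close>

lemma unital_algebra_tensor: "unital_algebra K (tensor K A B)"
proof -
 note M = A.module_axioms B.module_axioms
 let ?T = "tensor K A B"
 note T = mod_tensor[OF M]
 interpret T: module K ?T by (rule T)
 note BM = bilinear_tensor_mult
 note BL = bilinear_left[OF BM] and BR = bilinear_right[OF BM]
 note ext = linear_tensor_eqI[OF M T]
 have one: "\<one>[?T]:cr ?T" by (auto simp: tensor_one)
 have assoc: "(x*[?T]y)*[?T]z = x*[?T](y*[?T]z)"
  if x: "x:cr ?T" and y: "y:cr ?T" and z: "z:cr ?T" for x y z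
 proof (rule ext[where f = "%x. (x*[?T]y)*[?T]z" and t = x])
  fix a b assume ab: "a:cr A" "b:cr B"
  show "(pure K A B a b*[?T]y)*[?T]z = pure K A B a b*[?T](y*[?T]z)"
  proof (rule ext[where f = "%y. (pure K A B a b*[?T]y)*[?T]z" and t = y])
   fix c d assume cd: "c:cr A" "d:cr B"
   show "(pure K A B a b*[?T]pure K A B c d)*[?T]z = pure K A B a b*[?T](pure K A B c d*[?T]z)"
   proof (rule ext[where f = "%z. (pure K A B a b*[?T]pure K A B c d)*[?T]z" and t = z])
    fix e f assume ef: "e:cr A" "f:cr B"
    show "(pure K A B a b*[?T]pure K A B c d)*[?T]pure K A B e f
      = pure K A B a b*[?T](pure K A B c d*[?T]pure K A B e f)"
     using ab cd ef by (simp add: pure_mult AR.m_assoc BR.m_assoc)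
   qed (use ab cd z in \<open>auto intro!: BL BR lo_id tensor_mult_c\<close>)
  qed (use ab y z in \<open>auto intro!: BL BR lo_id tensor_mult_c\<close>)
 qed (use x y z in \<open>auto intro!: BL BR lo_id tensor_mult_c\<close>)
 have lone: "\<one>[?T]*[?T]x = x" if x: "x:cr ?T" for x
  by (rule ext[where f = "%x. \<one>[?T]*[?T]x" and t = x])
   (use x one in \<open>auto intro!: BL BR lo_id tensor_mult_c simp: tensor_one pure_mult\<close>)
 have rone: "x*[?T]\<one>[?T] = x" if x: "x:cr ?T" for x
  by (rule ext[where f = "%x. x*[?T]\<one>[?T]" and t = x])
   (use x one in \<open>auto intro!: BL BR lo_id tensor_mult_c simp: tensor_one pure_mult\<close>)
 have "monoid ?T"
  by (rule monoidI) (auto simp: tensor_mult_c one assoc lone rone)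
 then have "ring ?T"
  using lo_add[OF boD(1)[OF BM]] lo_add[OF boD(2)[OF BM]]
  by (intro ringI module.axioms(2)[OF T]) simp_all
 then show ?thesis
  using T lo_smult[OF boD(1)[OF BM]] lo_smult[OF boD(2)[OF BM]]
  by (simp add: unital_algebra_def)
qed

end

section \<open>Calculus in a quasitriangular T-coalgebra\<close>

context group
begin

lemma conj_elt_closed [simp]: "b:cr G ==> a:cr G ==> conj_elt G b a:cr G"
 by (simp add: conj_elt_def)

lemma inv_mult_cancel [simp]:
 "a:cr G ==> b:cr G ==> inv a \<otimes> (a \<otimes> b) = b"
 "a:cr G ==> b:cr G ==> a \<otimes> (inv a \<otimes> b) = b"
 by (simp_all add: m_assoc[symmetric])

lemma mult_inv_cancel [simp]:
 "a:cr G ==> b:cr G ==> b \<otimes> inv a \<otimes> a = b"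
 "a:cr G ==> b:cr G ==> b \<otimes> a \<otimes> inv a = b"
 by (simp_all add: m_assoc)

lemma conj_elt_simps [simp]:
 "a:cr G ==> conj_elt G a a = a"
 "a:cr G ==> conj_elt G (inv a) a = a"
 "a:cr G ==> conj_elt G a (inv a) = inv a"
 "a:cr G ==> conj_elt G \<one> a = a"
 "a:cr G ==> conj_elt G a \<one> = \<one>"
 by (simp_all add: conj_elt_def m_assoc)

lemma conj_elt_mult:
 "b:cr G ==> a:cr G ==> c:cr G ==>
  conj_elt G b (a \<otimes> c) = conj_elt G b a \<otimes> conj_elt G b c"
 by (simp add: conj_elt_def m_assoc)

lemma conj_elt_conj [simp]:
 "b:cr G ==> a:cr G ==> c:cr G ==>
  conj_elt G b (conj_elt G c a) = conj_elt G (b \<otimes> c) a"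
 by (simp add: conj_elt_def m_assoc inv_mult_group)

lemma inv_conj_elt [simp]:
 "b:cr G ==> a:cr G ==> inv (conj_elt G b a) = conj_elt G b (inv a)"
 by (simp add: conj_elt_def m_assoc inv_mult_group)

lemma conj_elt_mult_self [simp]:
 "a:cr G ==> b:cr G ==> conj_elt G (b \<otimes> a) a = conj_elt G b a"
 "a:cr G ==> b:cr G ==> conj_elt G (b \<otimes> a) (inv a) = conj_elt G b (inv a)"
 "a:cr G ==> b:cr G ==> conj_elt G (b \<otimes> inv a) a = conj_elt G b a"
 "a:cr G ==> b:cr G ==> conj_elt G (b \<otimes> inv a) (inv a) = conj_elt G b (inv a)"
 by (simp_all add: conj_elt_def m_assoc inv_mult_group)

lemma conj_elt_mult_left [simp]:
 "a:cr G ==> b:cr G ==> conj_elt G a b \<otimes> a = a \<otimes> b"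
 by (simp add: conj_elt_def m_assoc)

end

section \<open>Components, crossing and Sweedler sums of a T-coalgebra\<close>

context T_coalgebra
begin

lemma P_assoc:
 "a:cr P ==> b:cr P ==> c:cr P
  ==> (a*[P]b)*[P]c = a*[P](b*[P]c)"
 using group.is_monoid[OF group_axioms] monoid.m_assoc by fast

abbreviation "A == alg H"
abbreviation "cA a == cr (A a)"
abbreviation "eP == \<one>[P]"
abbreviation "S == antipode H"
abbreviation "ep == counit H"
abbreviation "De == comult H"
abbreviation "cj == conj_elt P"
abbreviation "ph == crossing H"
abbreviation "iv a == inv\<^bsub>P\<^esub> a"

lemma A_algebra [simp, lin]: "a:cr P ==> unital_algebra K (A a)"
 by (rule alg)

lemma A_module [simp, lin]: "a:cr P ==> module K (A a)"
 using uaD(1)[OF alg] .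

lemma A_ring: "a:cr P ==> ring (A a)"
 using uaD(2)[OF alg] .

lemma A_ops [simp]:
 assumes "a:cr P"
 shows "x:cA a ==> y:cA a ==> x*[A a]y:cA a"
  and "x:cA a ==> y:cA a ==> x+[A a]y:cA a"
  and "\<one>[A a]:cA a"
  and "\<zero>[A a]:cA a"
  and "x:cA a ==> \<one>[A a]*[A a]x = x"
  and "x:cA a ==> x*[A a]\<one>[A a] = x"
  and "r:cr K ==> x:cA a ==> r.*[A a]x:cA a"
  and "x:cA a ==> \<one>[K].*[A a]x = x"
  and "r:cr K ==> x:cA a ==> y:cA a
   ==> (r.*[A a]x)*[A a]y = r.*[A a](x*[A a]y)"
  and "r:cr K ==> x:cA a ==> y:cA a
   ==> x*[A a](r.*[A a]y) = r.*[A a](x*[A a]y)"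
proof -
 interpret R: ring "A a" using A_ring[OF assms] .
 interpret M: module K "A a" using A_module[OF assms] .
 show "x:cA a ==> y:cA a ==> x*[A a]y:cA a"
  "x:cA a ==> y:cA a ==> x+[A a]y:cA a"
  "\<one>[A a]:cA a"
  "\<zero>[A a]:cA a"
  "x:cA a ==> \<one>[A a]*[A a]x = x"
  "x:cA a ==> x*[A a]\<one>[A a] = x"
  "r:cr K ==> x:cA a ==> r.*[A a]x:cA a"
  "x:cA a ==> \<one>[K].*[A a]x = x"
  by auto
 show "r:cr K ==> x:cA a ==> y:cA a
   ==> (r.*[A a]x)*[A a]y = r.*[A a](x*[A a]y)"
  "r:cr K ==> x:cA a ==> y:cA a
   ==> x*[A a](r.*[A a]y) = r.*[A a](x*[A a]y)"
  using alg[OF assms] by (auto simp: unital_algebra_def)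
qed

lemma A_assoc:
 "a:cr P ==> x:cA a ==> y:cA a ==> z:cA a
  ==> (x*[A a]y)*[A a]z = x*[A a](y*[A a]z)"
 using A_ring ring.is_monoid monoid.m_assoc by fastforce

lemma linear_antipode [lin]:
 "a:cr P ==> b = iv a ==> lo K V (A a) f ==> lo K V (A b) (%x. S a (f x))"
 using lo_compose[OF _ antipode_linear] by blast

lemma antipode_closed [simp]:
 "a:cr P ==> b = iv a ==> x:cA a ==> S a x:cA b"
 using lo_closed[OF antipode_linear] by blast

lemma ph_hom:
 assumes "b:cr P" "a:cr P"
 shows "lo K (A a) (A (cj b a)) (ph b a)"
  and "x:cA a ==> ph b a x:cA (cj b a)"
  and "x:cA a ==> y:cA a
   ==> ph b a (x*[A a]y) = ph b a x*[A (cj b a)]ph b a y"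
  and "ph b a \<one>[A a] = \<one>[A (cj b a)]"
  and "inj_on (ph b a) (cA a)"
 using crossing_iso[OF assms] unfolding algebra_hom_def ring_hom_def bij_betw_def by auto

lemma linear_crossing [lin]:
 "b:cr P ==> a:cr P ==> c = cj b a ==> lo K V (A a) f
  ==> lo K V (A c) (%x. ph b a (f x))"
 using lo_compose[OF _ ph_hom(1)] by blast

lemma crossing_closed [simp]:
 "b:cr P ==> a:cr P ==> c = cj b a ==> x:cA a ==> ph b a x:cA c"
 using ph_hom(2) by blast

lemma ph_mult:
 "b:cr P ==> a:cr P ==> c = cj b a ==> x:cA a ==> y:cA a
  ==> ph b a (x*[A a]y) = ph b a x*[A c]ph b a y"
 using ph_hom(3) by blast

lemma crossing_crossing [simp]:
 "b:cr P ==> c:cr P ==> a:cr P ==> d = cj c a ==> h:cA a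
  ==> ph b d (ph c a h) = ph (b*[P]c) a h"
 using crossing_mult by blast

lemma crossing_one [simp]:
 assumes "a:cr P" "h:cA a"
 shows "ph eP a h = h"
proof -
 have "ph eP a (ph eP a h) = ph eP a h" using assms by simp
 then show ?thesis
  using inj_onD[OF ph_hom(5)[of "eP" a], of "ph eP a h" h] assms by simp
qed

lemma De_closed:
 assumes "a:cr P" "b:cr P" "h:cA (a*[P]b)"
 shows "De a b h:cr (tensor K (A a) (A b))"
 using comult_hom[OF assms(1,2)] assms(3) by (auto simp: algebra_hom_def dest: lo_closed)

lemma comult_mult:
 assumes "a:cr P" "b:cr P" "h:cA (a*[P]b)" "k:cA (a*[P]b)"
 shows "De a b (h*[A (a*[P]b)]k) = De a b h*[tensor K (A a) (A b)]De a b k"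
 using comult_hom[OF assms(1,2)] assms(3,4) unfolding algebra_hom_def ring_hom_def by blast

lemma comult_one:
 assumes "a:cr P" "b:cr P"
 shows "De a b \<one>[A (a*[P]b)] = pure K (A a) (A b) \<one>[A a] \<one>[A b]"
 using comult_hom[OF assms(1,2)] unfolding algebra_hom_def ring_hom_def by (simp add: tensor_one)

lemma linear_comult [lin]:
 "a:cr P ==> b:cr P ==> c = a*[P]b ==> lo K V (A c) f
  ==> lo K V (tensor K (A a) (A b)) (%x. De a b (f x))"
 using comult_hom lo_compose unfolding algebra_hom_def by blast

lemma Dsum_closed [simp]:
 "a:cr P ==> b:cr P ==> h:cA (a*[P]b) ==> module K X ==>
  (!!x y. x:cA a ==> y:cA b ==> B x y:cr X)
  ==> tsum X B (De a b h):cr X"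
 by (rule tsum_closed[of K "A a" "A b"]) (auto intro: De_closed)

lemma Ds_cong:
 "a:cr P ==> b:cr P ==> h:cA (a*[P]b) ==>
  (!!x y. x:cA a ==> y:cA b ==> B x y = C x y)
  ==> tsum X B (De a b h) = tsum X C (De a b h)"
 by (rule tsum_cong[of K "A a" "A b"]) (auto intro: De_closed)

lemma linear_Dsum [lin]:
 "a:cr P ==> b:cr P ==> h:cA (a*[P]b) ==> module K X ==>
  (!!x y. x:cA a ==> y:cA b ==> lo K U X (%u. B u x y))
  ==> lo K U X (%u. tsum X (B u) (De a b h))"
 by (rule lo_tsum[of K "A a" "A b"]) (auto intro: De_closed)

lemma linear_Dsum_arg [lin]:
 "a:cr P ==> b:cr P ==> c = a*[P]b ==> lo K U (A c) f ==> module K X ==>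
  bo K (A a) (A b) X B ==> lo K U X (%u. tsum X B (De a b (f u)))"
 by (rule lo_tsum_arg) (auto intro: linear_comult)

lemma Ds_out:
 "a:cr P ==> b:cr P ==> h:cA (a*[P]b) ==> module K X ==> module K Y ==>
  lo K X Y f ==>
  (!!x y. x:cA a ==> y:cA b ==> B x y:cr X)
  ==> f (tsum X B (De a b h)) = tsum Y (%x y. f (B x y)) (De a b h)"
 by (rule tsum_out[of K "A a" "A b" X Y f "De a b h" B]) (auto intro: De_closed)

lemma counit_facts [simp]:
 "h:cr (A eP) ==> ep h:cr K"
 "ep \<one>[A eP] = \<one>[K]"
 "h:cr (A eP) ==> k:cr (A eP) ==> ep (h*[A eP]k) = ep h*[K]ep k"
 using counit_hom by (auto simp: ring_hom_def)

lemma linear_counit [lin]: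
 assumes "module K W" "w:cr W" "lo K V (A eP) f"
 shows "lo K V W (%x. ep (f x).*[W]w)"
 using lo_compose[OF assms(3) lo_form_smult[OF assms(1,2)]] counit_hom by blast

text \<open>The trilinear B extends to a linear map on the right-bracketed triple tensor product.
  Applied to both sides of coassociativity it turns the axiom into an identity in X.\<close>

lemma coassoc_sum:
 assumes abc: "a:cr P" "b:cr P" "c:cr P"
  and h: "h:cA (a*[P]b*[P]c)" and X: "module K X"
  and B1: "!!y z. y:cA b ==> z:cA c ==> lo K (A a) X (%x. B x y z)"
  and B2: "!!x z. x:cA a ==> z:cA c ==> lo K (A b) X (%y. B x y z)"
  and B3: "!!x y. x:cA a ==> y:cA b ==> lo K (A c) X (%z. B x y z)"
 shows "tsum X (%x y. tsum X (%y' y''. B x y' y'') (De b c y)) (De a (b*[P]c) h)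
  = tsum X (%x y. tsum X (%x' x''. B x' x'' y) (De a b x)) (De (a*[P]b) c h)"
proof -
 let ?BD = "tensor K (A b) (A c)" let ?T = "tensor K (A a) ?BD"
 let ?C = "%x s. tsum X (B x) s"
 note M = A_module[OF abc(1)] A_module[OF abc(2)] A_module[OF abc(3)]
 note BD = mod_tensor[OF M(2,3)] note T = mod_tensor[OF M(1) BD]
 let ?D = "De (a*[P]b) c h" and ?a = "De a (b*[P]c) h"
 have h': "h:cA (a*[P](b*[P]c))" using h abc by (simp add: P_assoc)
 have C: "bo K (A a) ?BD X ?C"
  using B1 B2 B3 by (intro boI lo_tsum[OF M(2,3)] lo_tsum_tensor[OF M(2,3)] X) auto
 have C3: "bo K (A b) (A c) X (B x)" if "x:cA a" for x
  using B2 B3 that by (intro boI) auto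
 let ?l = "tsum ?T (%x y. pure K (A a) ?BD x (De b c y)) ?a"
 let ?r = "tsum ?T (%x y. tsum ?T (%x' x''. pure K (A a) ?BD x' (pure K (A b) (A c) x'' y)) (De a b x))
      ?D"
 have "tsum X ?C ?l = tsum X (%x y. tsum X ?C (pure K (A a) ?BD x (De b c y))) ?a"
  using abc h' De_closed[of b c] by (intro tsum_tsum M BD C X) (auto intro!: De_closed)
 also have "... = tsum X (%x y. tsum X (%y' y''. B x y' y'') (De b c y)) ?a"
  using abc h' De_closed[of b c] by (intro Ds_cong tsum_pure[OF M(1) BD X C]) auto
 finally have 1: "tsum X ?C ?l = ..." .
 have "tsum X ?C ?r = tsum X (%x y. tsum X ?C (tsum ?T (%x' x''. pure K (A a) ?BD x' (pure K (A b) (A c) x'' y)) (De a b x)))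
      ?D"
  using abc h T by (intro tsum_tsum M BD C X A_module m_closed) (auto intro!: De_closed)
 also have "... = tsum X (%x y. tsum X (%x' x''. tsum X ?C (pure K (A a) ?BD x' (pure K (A b) (A c) x'' y))) (De a b x))
      ?D"
  using abc h T by (intro Ds_cong tsum_tsum M BD C X) (auto intro!: De_closed)
 also have "... = tsum X (%x y. tsum X (%x' x''. tsum X (B x') (pure K (A b) (A c) x'' y)) (De a b x))
      ?D"
  using abc h by (intro Ds_cong tsum_pure[OF M(1) BD X C]) auto
 also have "... = tsum X (%x y. tsum X (%x' x''. B x' x'' y) (De a b x)) ?D"
  using abc h by (intro Ds_cong tsum_pure[OF M(2,3) X C3]) auto
 finally have 2: "tsum X ?C ?r = ..." .
 have "?l = ?r" using coassoc[OF abc h] by (simp add: Let_def)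
 then show ?thesis using 1 2 by simp
qed

text \<open>The degrees of the two intermediate products are separate variables, so that the rule
  still matches after a product such as a a^-1 has been simplified to the neutral element.\<close>

lemma coassoc_sum':
 assumes "a:cr P" "b:cr P" "c:cr P" "ab = a*[P]b" "bc = b*[P]c"
  "h:cA (ab*[P]c)" "module K X"
  "!!y z. y:cA b ==> z:cA c ==> lo K (A a) X (%x. B x y z)"
  "!!x z. x:cA a ==> z:cA c ==> lo K (A b) X (%y. B x y z)"
  "!!x y. x:cA a ==> y:cA b ==> lo K (A c) X (%z. B x y z)"
 shows "tsum X (%x y. tsum X (%x' x''. B x' x'' y) (De a b x)) (De ab c h)
  = tsum X (%x y. tsum X (%y' y''. B x y' y'') (De b c y)) (De a bc h)"
 unfolding assms(4,5) using assms by (intro coassoc_sum[symmetric]) auto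

lemma ep_left:
 assumes "a:cr P" "h:cA a" "module K X" "lo K (A a) X f"
 shows "tsum X (%x y. ep x.*[X]f y) (De eP a h) = f h"
proof -
 have "tsum X (%x y. ep x.*[X]f y) (De eP a h)
  = tsum X (%x y. f (ep x.*[A a]y)) (De eP a h)"
  using assms by (intro Ds_cong) (auto simp: lo_smult)
 also have "... = f (tsum (A a) (%x y. ep x.*[A a]y) (De eP a h))"
  using assms by (intro Ds_out[symmetric]) auto
 finally show ?thesis using assms counit_left by simp
qed

lemma ep_right:
 assumes "a:cr P" "h:cA a" "module K X" "lo K (A a) X f"
 shows "tsum X (%x y. ep y.*[X]f x) (De a eP h) = f h"
proof -
 have "tsum X (%x y. ep y.*[X]f x) (De a eP h)
  = tsum X (%x y. f (ep y.*[A a]x)) (De a eP h)"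
  using assms by (intro Ds_cong) (auto simp: lo_smult)
 also have "... = f (tsum (A a) (%x y. ep y.*[A a]x) (De a eP h))"
  using assms by (intro Ds_out[symmetric]) auto
 finally show ?thesis using assms counit_right by simp
qed

lemma antipode_left': "a:cr P ==> h:cr (A eP) ==>
  tsum (A (iv a)) (%x y. S a x*[A (iv a)]y) (De a (iv a) h) = ep h.*[A (iv a)]\<one>[A (iv a)]"
 using antipode_left[of "iv a" h] by simp

lemma antipode_right': "a:cr P ==> h:cr (A eP) ==>
  tsum (A (iv a)) (%x y. x*[A (iv a)]S a y) (De (iv a) a h) = ep h.*[A (iv a)]\<one>[A (iv a)]"
 using antipode_right[of "iv a" h] by simp

lemma comult_mult_sum:
 assumes "a:cr P" "b:cr P" "h:cA (a*[P]b)" "k:cA (a*[P]b)"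
  "module K X" "bo K (A a) (A b) X B"
 shows "tsum X B (De a b (h*[A (a*[P]b)]k))
  = tsum X (%x y. tsum X (%x' y'. B (x*[A a]x') (y*[A b]y')) (De a b k)) (De a b h)"
 using assms De_closed by (simp add: comult_mult tsum_mult)

lemma comult_one_sum:
 assumes "a:cr P" "b:cr P" "module K X" "bo K (A a) (A b) X B"
 shows "tsum X B (De a b \<one>[A (a*[P]b)]) = B \<one>[A a] \<one>[A b]"
 using assms by (simp add: comult_one tsum_pure)

lemma crossing_comult_sum:
 assumes "a:cr P" "b:cr P" "c:cr P" "h:cA (a*[P]b)" "module K X"
  "bo K (A (cj c a)) (A (cj c b)) X B"
 shows "tsum X B (De (cj c a) (cj c b) (ph c (a*[P]b) h))
  = tsum X (%x y. B (ph c a x) (ph c b y)) (De a b h)"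
proof -
 let ?A = "A (cj c a)" and ?B = "A (cj c b)"
 have M: "module K ?A" "module K ?B" "module K (A a)" "module K (A b)" using assms by auto
 have "tsum X B (tsum (tensor K ?A ?B) (%x y. pure K ?A ?B (ph c a x) (ph c b y)) (De a b h))
  = tsum X (%x y. tsum X B (pure K ?A ?B (ph c a x) (ph c b y))) (De a b h)"
  using assms by (intro tsum_tsum M) (auto intro: De_closed)
 also have "... = tsum X (%x y. B (ph c a x) (ph c b y)) (De a b h)"
  using assms by (intro Ds_cong tsum_pure M) auto
 finally show ?thesis using crossing_comult[OF assms(1-4)] by (simp add: Let_def)
qed

subsection \<open>The antipode\<close>

lemma Ds_swap:
 assumes "a:cr P" "b:cr P" "h:cA (a*[P]b)"
  "c:cr P" "d:cr P" "k:cA (c*[P]d)" "module K X"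
  "!!v w v' w'. v:cA a ==> w:cA b ==> v':cA c ==> w':cA d
   ==> B v w v' w':cr X"
 shows "tsum X (%v w. tsum X (B v w) (De c d k)) (De a b h)
  = tsum X (%v' w'. tsum X (%v w. B v w v' w') (De a b h)) (De c d k)"
 using assms De_closed by (intro tsum_swap[where K = K and V = "A a" and W = "A b" and V' = "A c" and W' = "A d"]) auto

lemma Ds_multL:
 "a:cr P ==> b:cr P ==> h:cA (a*[P]b) ==> c:cr P ==> z:cA c ==>
  (!!x y. x:cA a ==> y:cA b ==> B x y:cA c)
  ==> z*[A c]tsum (A c) B (De a b h) = tsum (A c) (%x y. z*[A c]B x y) (De a b h)"
 by (rule Ds_out[where f = "%x. z*[A c]x"]) (auto intro: lin)

lemma Ds_multR:
 "a:cr P ==> b:cr P ==> h:cA (a*[P]b) ==> c:cr P ==> z:cA c ==>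
  (!!x y. x:cA a ==> y:cA b ==> B x y:cA c)
  ==> tsum (A c) B (De a b h)*[A c]z = tsum (A c) (%x y. B x y*[A c]z) (De a b h)"
 by (rule Ds_out[where f = "%x. x*[A c]z"]) (auto intro: lin)

text \<open>In the convolution product F is a left inverse of M and G a right inverse, hence F = F M
  G = G. The degrees force M to live on the component of the inverse.\<close>

lemma convolution_unique:
 assumes a: "a:cr P" and b: "b:cr P"
  and F: "lo K (A a) (A b) F" and G: "lo K (A a) (A b) G" and M: "lo K (A (iv a)) (A b) M"
  and FM: "!!h. h:cr (A eP) ==> tsum (A b) (%x y. F x*[A b]M y) (De a (iv a) h) = ep h.*[A b]\<one>[A b]"
  and MG: "!!h. h:cr (A eP) ==> tsum (A b) (%x y. M x*[A b]G y) (De (iv a) a h) = ep h.*[A b]\<one>[A b]"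
  and h: "h:cA a"
 shows "F h = G h"
proof -
 have Ya: "unital_algebra K (A b)" and Ym: "module K (A b)" using b by auto
 have cl [simp]: "x:cA a ==> F x:cA b" "x:cA a ==> G x:cA b"
  "x:cA (iv a) ==> M x:cA b" for x
  using F G M by (auto dest: lo_closed)
 have [simp]: "x:cA b ==> y:cA b ==> x*[A b]y:cA b" for x y
  using b by simp
 have "G h = tsum (A b) (%x y. ep x.*[A b]G y) (De eP a h)"
  using a b h G by (simp add: ep_left)
 also have "... = tsum (A b) (%x y. tsum (A b) (%x' x''. F x'*[A b]M x'') (De a (iv a) x)*[A b]G y) (De eP a h)"
  using a b h by (intro Ds_cong) (auto simp: FM)
 also have "... = tsum (A b) (%x y. tsum (A b) (%x' x''. F x'*[A b]M x''*[A b]G y) (De a (iv a) x)) (De eP a h)"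
  using a b h by (intro Ds_cong Ds_out[where f = "%x. x*[A b]G _"]) (auto intro!: lin)
 also have "... = tsum (A b) (%x y. tsum (A b) (%y' y''. F x*[A b]M y'*[A b]G y'') (De (iv a) a y)) (De a eP h)"
  using a b h F G M by (intro coassoc_sum') (auto intro!: lin)
 also have "... = tsum (A b) (%x y. F x*[A b]tsum (A b) (%y' y''. M y'*[A b]G y'') (De (iv a) a y)) (De a eP h)"
  using a b h by (intro Ds_cong) (auto intro!: Ds_cong simp: A_assoc Ds_multL)
 also have "... = tsum (A b) (%x y. ep y.*[A b]F x) (De a eP h)"
  using a b h by (intro Ds_cong) (auto simp: MG)
 also have "... = F h" using a b h F by (simp add: ep_right)
 finally show ?thesis by simp
qed

lemma antipode_one [simp]:
 assumes a: "a:cr P"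
 shows "S a \<one>[A a] = \<one>[A (iv a)]"
proof -
 have "tsum (A (iv a)) (%x y. S a x*[A (iv a)]y) (De a (iv a) \<one>[A (a*[P]iv a)])
   = S a \<one>[A a]*[A (iv a)]\<one>[A (iv a)]"
  using a by (intro comult_one_sum) (auto intro!: lin)
 then show ?thesis using a by (simp add: antipode_left')
qed

text \<open>Both sides are convolution inverses of \<open>ph b (iv a)\<close>: the left one because
  the crossing is multiplicative, the right one because it preserves the comultiplication.\<close>

lemma S_crossing:
 assumes a: "a:cr P" and b: "b:cr P" and h: "h:cA a" and c: "c = iv a"
 shows "ph b c (S a h) = S (cj b a) (ph b a h)"
proof -
 let ?Y = "A (cj b (iv a))"
 let ?c = "cj b a"
 have "ph b (iv a) (S a h) = S ?c (ph b a h)"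
 proof (rule convolution_unique[where F = "%h. ph b (iv a) (S a h)" and G = "%h. S ?c (ph b a h)"
    and b = "cj b (iv a)" and M = "ph b (iv a)", OF a])
  fix g assume g: "g:cr (A eP)"
  have "tsum ?Y (%x y. ph b (iv a) (S a x)*[?Y]ph b (iv a) y) (De a (iv a) g)
   = tsum ?Y (%x y. ph b (iv a) (S a x*[A (iv a)]y)) (De a (iv a) g)"
   using a b g by (intro Ds_cong) (auto simp: ph_mult)
  also have "... = ph b (iv a) (tsum (A (iv a)) (%x y. S a x*[A (iv a)]y) (De a (iv a) g))"
   using a b g by (intro Ds_out[symmetric]) (auto intro: ph_hom)
  also have "... = ep g.*[?Y]\<one>[?Y]"
   using a b g by (simp add: antipode_left' lo_smult[OF ph_hom(1)] ph_hom(4))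
  finally show "tsum ?Y (%x y. ph b (iv a) (S a x)*[?Y]ph b (iv a) y) (De a (iv a) g) = ..." .
  have "tsum ?Y (%x y. x*[?Y]S ?c y) (De (cj b (iv a)) ?c (ph b (iv a*[P]a) g))
   = tsum ?Y (%x y. ph b (iv a) x*[?Y]S ?c (ph b a y)) (De (iv a) a g)"
   using a b g by (intro crossing_comult_sum) (auto intro!: lin)
  then show "tsum ?Y (%x y. ph b (iv a) x*[?Y]S ?c (ph b a y)) (De (iv a) a g) = ep g.*[?Y]\<one>[?Y]"
   using a b g antipode_right'[of "cj b a" "ph b eP g"] by (simp add: crossing_counit)
 qed (use a b h in \<open>auto intro!: lin ph_hom(1)\<close>)
 then show ?thesis using c by simp
qed

text \<open>Uniqueness of convolution inverses for maps of two arguments: S(h k) and S(k) S(h), as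
  functions of h and k, are both inverse to the multiplication. The argument of
  \<open>convolution_unique\<close> is written out with a separate sum for each argument.\<close>

lemma S_mult:
 assumes a: "a:cr P" and h: "h:cA a" and k: "k:cA a" and c: "c = iv a"
 shows "S a (h*[A a]k) = S a k*[A c]S a h"
proof -
 let ?Y = "A (iv a)" let ?D = "De"
 let ?a = "?D eP a h" and ?b = "?D eP a k" and ?c = "?D a eP k" and ?d = "?D a eP h"
 have ia [simp]: "iv a:cr P" "unital_algebra K ?Y" "module K ?Y" using a by auto
 let ?F = "%x y. S a (x*[A a]y)" and ?G = "%x y. S a y*[?Y]S a x" and ?M = "%x y. x*[?Y]y"
 let ?E = "%x1 x2 x3 y1 y2 y3. ?F x1 y1*[?Y]?M x2 y2*[?Y]?G x3 y3"
 note r = a h k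
 have FM: "tsum ?Y (%x1 x2. tsum ?Y (%y1 y2. ?F x1 y1*[?Y]?M x2 y2) (?D a (iv a) y)) (?D a (iv a) x)
   = ep x.*[?Y](ep y.*[?Y]\<one>[?Y])"
  if "x:cr (A eP)" "y:cr (A eP)" for x y
 proof -
  have "tsum ?Y (%x y. S a x*[?Y]y) (De a (iv a) (x*[A (a*[P]iv a)]y))
   = tsum ?Y (%x1 x2. tsum ?Y (%y1 y2. ?F x1 y1*[?Y]?M x2 y2) (?D a (iv a) y)) (?D a (iv a) x)"
   using a that by (intro comult_mult_sum) (auto intro!: lin)
  then show ?thesis
   using a that by (simp add: antipode_left' module.smult_assoc1[OF A_module])
 qed
 have MG: "tsum ?Y (%x1 x2. tsum ?Y (%y1 y2. ?M x1 y1*[?Y]?G x2 y2) (?D (iv a) a y)) (?D (iv a) a x)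
   = ep x.*[?Y](ep y.*[?Y]\<one>[?Y])"
  if "x:cr (A eP)" "y:cr (A eP)" for x y
 proof -
  have "tsum ?Y (%x1 x2. tsum ?Y (%y1 y2. ?M x1 y1*[?Y]?G x2 y2) (?D (iv a) a y)) (?D (iv a) a x)
   = tsum ?Y (%x1 x2. x1*[?Y](tsum ?Y (%y1 y2. y1*[?Y]S a y2) (?D (iv a) a y)*[?Y]S a x2)) (?D (iv a) a x)"
   using a that by (intro Ds_cong) (auto simp: Ds_multL Ds_multR A_assoc intro!: Ds_cong)
  also have "... = tsum ?Y (%x1 x2. ep y.*[?Y](x1*[?Y]S a x2)) (?D (iv a) a x)"
   using a that by (intro Ds_cong) (auto simp: antipode_right')
  also have "... = ep y.*[?Y]tsum ?Y (%x1 x2. x1*[?Y]S a x2) (?D (iv a) a x)"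
   using a that by (intro Ds_out[symmetric]) (auto intro!: lin)
  also have "... = ep x.*[?Y](ep y.*[?Y]\<one>[?Y])"
   using a that by (simp add: antipode_right' module.smult_assoc1[OF A_module,symmetric] m_comm)
  finally show ?thesis .
 qed
 \<comment> \<open>Counits are inserted in both arguments and expanded as F M; coassociativity in
   each argument regroups the product so that M G is formed and collapses to counits again.\<close>
 have "?G h k = tsum ?Y (%x y. ep x.*[?Y]?G y k) ?a"
  using r by (intro ep_left[symmetric]) (auto intro!: lin)
 also have "... = tsum ?Y (%x y. ep x.*[?Y]tsum ?Y (%x' y'. ep x'.*[?Y]?G y y') ?b) ?a"
  using r by (intro Ds_cong arg_cong2[where f = "smult ?Y"] ep_left[symmetric]) (auto intro!: lin)
 also have "... = tsum ?Y (%x y. tsum ?Y (%x' y'. ep x.*[?Y](ep x'.*[?Y]?G y y')) ?b) ?a"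
  using r by (intro Ds_cong Ds_out) (auto intro!: lin)
 also have "... = tsum ?Y (%x y. tsum ?Y (%x' y'. tsum ?Y (%x1 x2. tsum ?Y (%y1 y2. ?F x1 y1*[?Y]?M x2 y2) (?D a (iv a) x')) (?D a (iv a) x)*[?Y]?G y y') ?b) ?a"
  using r by (intro Ds_cong) (auto simp: FM)
 also have "... = tsum ?Y (%x y. tsum ?Y (%x' y'. tsum ?Y (%x1 x2. tsum ?Y (%y1 y2. ?E x1 x2 y y1 y2 y') (?D a (iv a) x')) (?D a (iv a) x)) ?b) ?a"
  using r by (intro Ds_cong) (auto simp: Ds_multR intro!: Ds_cong)
 also have "... = tsum ?Y (%x y. tsum ?Y (%x1 x2. tsum ?Y (%x' y'. tsum ?Y (%y1 y2. ?E x1 x2 y y1 y2 y') (?D a (iv a) x')) ?b) (?D a (iv a) x)) ?a"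
  using r by (intro Ds_cong Ds_swap) auto
 also have "... = tsum ?Y (%x y. tsum ?Y (%x1 x2. tsum ?Y (%y1 y'. tsum ?Y (%y2 y3. ?E x1 x2 y y1 y2 y3) (?D (iv a) a y')) ?c) (?D a (iv a) x)) ?a"
  using r by (intro Ds_cong coassoc_sum') (auto intro!: lin)
 also have "... = tsum ?Y (%x1 x'. tsum ?Y (%x2 x3. tsum ?Y (%y1 y'. tsum ?Y (%y2 y3. ?E x1 x2 x3 y1 y2 y3) (?D (iv a) a y')) ?c) (?D (iv a) a x')) ?d"
  using r by (intro coassoc_sum') (auto intro!: lin)
 also have "... = tsum ?Y (%x1 x'. tsum ?Y (%y1 y'. tsum ?Y (%x2 x3. tsum ?Y (%y2 y3. ?E x1 x2 x3 y1 y2 y3) (?D (iv a) a y')) (?D (iv a) a x')) ?c) ?d"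
  using r by (intro Ds_cong Ds_swap) auto
 also have "... = tsum ?Y (%x1 x'. tsum ?Y (%y1 y'. ?F x1 y1*[?Y]tsum ?Y (%x2 x3. tsum ?Y (%y2 y3. ?M x2 y2*[?Y]?G x3 y3) (?D (iv a) a y')) (?D (iv a) a x')) ?c) ?d"
  using r by (intro Ds_cong) (auto simp: Ds_multL A_assoc intro!: Ds_cong)
 also have "... = tsum ?Y (%x1 x'. tsum ?Y (%y1 y'. ep y'.*[?Y](ep x'.*[?Y]?F x1 y1)) ?c) ?d"
  using r by (intro Ds_cong) (auto simp: MG module.smult_assoc1[OF A_module,symmetric] m_comm)
 also have "... = tsum ?Y (%x1 x'. ep x'.*[?Y]?F x1 k) ?d"
  using r by (intro Ds_cong ep_right) (auto intro!: lin)
 also have "... = ?F h k"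
  using r by (intro ep_right) (auto intro!: lin)
 finally show ?thesis using c by simp
qed

lemma counit_antipode:
 assumes h: "h:cr (A eP)"
 shows "ep (S eP h) = ep h"
proof -
 let ?A = "A eP"
 have m: "eP*[P]eP = eP" "iv eP = eP" "eP:cr P" by auto
 \<comment> \<open>Sums have their values in a module, so \<epsilon> is replaced by its multiple of
   the unit and recovered at the end by applying \<epsilon> once more.\<close>
 let ?f = "%x. ep x.*[?A]\<one>[?A]"
 have f: "lo K ?A ?A ?f" by (auto intro!: lin)
 have "?f (S eP h) = tsum ?A (%x y. ep y.*[?A]?f (S eP x)) (De eP eP h)"
  using h m by (intro ep_right[symmetric]) (auto intro!: lin)
 also have "... = tsum ?A (%x y. ?f (S eP x*[?A]y)) (De eP eP h)"
  using h m by (intro Ds_cong) (auto simp: module.smult_assoc1[OF A_module,symmetric] m_comm)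
 also have "... = ?f (tsum ?A (%x y. S eP x*[?A]y) (De eP eP h))"
  using h m f by (intro Ds_out[symmetric]) auto
 also have "... = ?f (ep h.*[?A]\<one>[?A])"
  using antipode_left'[OF m(3) h] m by simp
 also have "... = ?f h" using h lo_smult[OF f, of "ep h" "\<one>[?A]"] by simp
 finally have "?f (S eP h) = ?f h" .
 moreover have "ep (?f x) = ep x" if "x:cr ?A" for x
  using that counit_hom unfolding linear_form_def by simp
 ultimately show ?thesis using h by (metis antipode_closed m(2,3))
qed

end

section \<open>The axioms of the R-matrix as identities of multilinear sums\<close>

context quasitriangular_T_coalgebra
begin

abbreviation "Ri == Rmat_inv K H"
abbreviation "R == Rmat H"

lemma R_closed:
 assumes "a:cr P" "b:cr P"
 shows "R a b:cr (tensor K (A a) (A b))"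
 using Rmat_unit[OF assms] by (auto simp: Units_def)

lemma Rsum_closed [simp]:
 "a:cr P ==> b:cr P ==> module K X ==>
  (!!x y. x:cA a ==> y:cA b ==> B x y:cr X)
  ==> tsum X B (R a b):cr X"
 by (rule tsum_closed[of K "A a" "A b"]) (auto intro: R_closed)

lemma Rs_cong:
 "a:cr P ==> b:cr P ==>
  (!!x y. x:cA a ==> y:cA b ==> B x y = C x y)
  ==> tsum X B (R a b) = tsum X C (R a b)"
 by (rule tsum_cong[of K "A a" "A b"]) (auto intro: R_closed)

lemma linear_Rsum [lin]:
 "a:cr P ==> b:cr P ==> module K X ==>
  (!!x y. x:cA a ==> y:cA b ==> lo K U X (%u. B u x y))
  ==> lo K U X (%u. tsum X (B u) (R a b))"
 by (rule lo_tsum[of K "A a" "A b"]) (auto intro: R_closed)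

lemma Rs_out:
 "a:cr P ==> b:cr P ==> module K X ==> module K Y ==>
  lo K X Y f ==>
  (!!x y. x:cA a ==> y:cA b ==> B x y:cr X)
  ==> f (tsum X B (R a b)) = tsum Y (%x y. f (B x y)) (R a b)"
 by (rule tsum_out[of K "A a" "A b" X Y f "R a b" B]) (auto intro: R_closed)

lemma Rs_multL:
 "a:cr P ==> b:cr P ==> c:cr P ==> z:cA c ==>
  (!!x y. x:cA a ==> y:cA b ==> B x y:cA c)
  ==> z*[A c]tsum (A c) B (R a b) = tsum (A c) (%x y. z*[A c]B x y) (R a b)"
 by (rule Rs_out[where f = "%x. z*[A c]x"]) (auto intro: lin)

lemma Rs_multR:
 "a:cr P ==> b:cr P ==> c:cr P ==> z:cA c ==>
  (!!x y. x:cA a ==> y:cA b ==> B x y:cA c)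
  ==> tsum (A c) B (R a b)*[A c]z = tsum (A c) (%x y. B x y*[A c]z) (R a b)"
 by (rule Rs_out[where f = "%x. x*[A c]z"]) (auto intro: lin)

lemma Rsum_antipode:
 "a:cr P ==> b:cr P ==> c:cr P ==>
  (!!x y. x:cA a ==> y:cA b ==> B x y:cA c)
  ==> S c (tsum (A c) B (R a b)) = tsum (A (iv c)) (%x y. S c (B x y)) (R a b)"
 by (rule Rs_out[where f = "S c"]) (auto intro: antipode_linear)

lemma Rsum_crossing:
 "a:cr P ==> b:cr P ==> c:cr P ==> d:cr P ==>
  (!!x y. x:cA a ==> y:cA b ==> B x y:cA c)
  ==> ph d c (tsum (A c) B (R a b)) = tsum (A (cj d c)) (%x y. ph d c (B x y)) (R a b)"
 by (rule Rs_out[where f = "ph d c"]) (auto intro: ph_hom)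

lemma Rs_swap:
 assumes "a:cr P" "b:cr P" "c:cr P" "d:cr P" "module K X"
  "!!v w v' w'. v:cA a ==> w:cA b ==> v':cA c ==> w':cA d
   ==> B v w v' w':cr X"
 shows "tsum X (%v w. tsum X (B v w) (R c d)) (R a b)
  = tsum X (%v' w'. tsum X (%v w. B v w v' w') (R a b)) (R c d)"
 using assms R_closed by (intro tsum_swap[where K = K and V = "A a" and W = "A b" and V' = "A c" and W' = "A d"]) auto

lemma DR_swap:
 assumes "a:cr P" "b:cr P" "c:cr P" "d:cr P" "module K X"
  "h:cA (a*[P]b)"
  "!!v w v' w'. v:cA a ==> w:cA b ==> v':cA c ==> w':cA d
   ==> B v w v' w':cr X"
 shows "tsum X (%v w. tsum X (B v w) (R c d)) (De a b h)
  = tsum X (%v' w'. tsum X (%v w. B v w v' w') (De a b h)) (R c d)"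
 using assms R_closed De_closed by (intro tsum_swap[where K = K and V = "A a" and W = "A b" and V' = "A c" and W' = "A d"]) auto

text \<open>The flip and the crossing in the exchange rule show on the right-hand side: the second
  part of h stands in the first slot and the crossed first part in the second. B may be any bilinear
  map, for instance an action on a pure tensor of modules.\<close>

lemma R_comult_sum:
 assumes ab: "a:cr P" "b:cr P" and h: "h:cA (a*[P]b)" and X: "module K X"
  and B: "bo K (A a) (A b) X B" and c: "c = cj a b"
 shows "tsum X (%x y. tsum X (%h1 h2. B (x*[A a]h1) (y*[A b]h2)) (De a b h)) (R a b)
  = tsum X (%h1 h2. tsum X (%x y. B (h2*[A a]x) (ph (iv a) c h1*[A b]y)) (R a b)) (De c a h)"
proof -
 let ?T = "tensor K (A a) (A b)"
 note lB = lin bilinear_left[OF B] bilinear_right[OF B]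
 have h': "h:cA (c*[P]a)" and c': "c:cr P" using h ab c by (simp_all add: conj_elt_mult_left)
 let ?s = "tsum ?T (%x y. pure K (A a) (A b) y (ph (iv a) c x)) (De c a h)"
 have s: "?s:cr ?T"
  using ab c c' h' by (intro Dsum_closed mod_tensor A_module pure_closed) auto
 have "tsum X (%x y. tsum X (%h1 h2. B (x*[A a]h1) (y*[A b]h2)) (De a b h)) (R a b)
  = tsum X B (R a b*[?T]De a b h)"
  using ab h B X by (intro tsum_mult[symmetric]) (auto intro: R_closed De_closed)
 also have "... = tsum X B (?s*[?T]R a b)"
  using Rmat_comult[OF ab h] c by (simp add: Let_def)
 also have "... = tsum X (%p q. tsum X (%x y. B (p*[A a]x) (q*[A b]y)) (R a b)) ?s"
  using ab B X s by (intro tsum_mult) (auto intro: R_closed)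
 also have "... = tsum X (%h1 h2. tsum X (%p q. tsum X (%x y. B (p*[A a]x) (q*[A b]y)) (R a b))
   (pure K (A a) (A b) h2 (ph (iv a) c h1))) (De c a h)"
  using ab c c' h' X by (intro tsum_tsum[OF A_module[OF ab(1)] A_module[OF ab(2)] A_module[OF c'] A_module[OF ab(1)]])
   (auto intro!: De_closed lB)
 also have "... = tsum X (%h1 h2. tsum X (%x y. B (h2*[A a]x) (ph (iv a) c h1*[A b]y)) (R a b)) (De c a h)"
  using ab c c' h' X by (intro Ds_cong tsum_pure A_module) (auto intro!: De_closed lB)
 finally show ?thesis .
qed

text \<open>As for coassociativity, an axiom in a triple tensor product is pushed through the linear
  map induced by a trilinear B. The product of the two embedded R-matrices multiplies only in the
  slot that both occupy.\<close>

lemma R_tri_left: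
 assumes abc: "a:cr P" "b:cr P" "c:cr P" "d = cj (iv b) a" "ab = a*[P]b" and X: "module K X"
  and B1: "!!y z. y:cA b ==> z:cA c ==> lo K (A a) X (%x. B x y z)"
  and B2: "!!x z. x:cA a ==> z:cA c ==> lo K (A b) X (%y. B x y z)"
  and B3: "!!x y. x:cA a ==> y:cA b ==> lo K (A c) X (%z. B x y z)"
 shows "tsum X (%x z. tsum X (%x' x''. B x' x'' z) (De a b x)) (R ab c)
  = tsum X (%x z. tsum X (%y z'. B (ph b d x) y (z*[A c]z')) (R b c)) (R d c)"
proof -
 let ?BD = "tensor K (A b) (A c)" let ?T = "tensor K (A a) ?BD"
 let ?C = "%x s. tsum X (B x) s"
 note M = A_module[OF abc(1)] A_module[OF abc(2)] A_module[OF abc(3)]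
 note AL = A_algebra[OF abc(1)] A_algebra[OF abc(2)] A_algebra[OF abc(3)]
 note BD = mod_tensor[OF M(2,3)] note T = mod_tensor[OF M(1) BD]
 note BDA = unital_algebra_tensor[OF AL(2,3)]
 have d: "d:cr P" "cj b d = a" using abc by auto
 have C: "bo K (A a) ?BD X ?C"
  using B1 B2 B3 by (intro boI lo_tsum[OF M(2,3)] lo_tsum_tensor[OF M(2,3)] X) auto
 have C3: "bo K (A b) (A c) X (B x)" if "x:cA a" for x
  using B2 B3 that by (intro boI) auto
 note lC = bilinear_left[OF C] bilinear_right[OF C]
 let ?l = "tsum ?T (%x z. tsum ?T (%x' x''. pure K (A a) ?BD x' (pure K (A b) (A c) x'' z)) (De a b x)) (R ab c)"
 let ?p = "tsum ?T (%x z. pure K (A a) ?BD (ph b d x) (pure K (A b) (A c) \<one>[A b] z)) (R d c)"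
 let ?q = "tsum ?T (%y z. pure K (A a) ?BD \<one>[A a] (pure K (A b) (A c) y z)) (R b c)"
 have pq: "?p:cr ?T" "?q:cr ?T"
  using abc(1-3) d T by (auto intro!: Rsum_closed pure_closed)
 have "tsum X ?C ?l = tsum X (%x z. tsum X ?C (tsum ?T (%x' x''. pure K (A a) ?BD x' (pure K (A b) (A c) x'' z)) (De a b x))) (R ab c)"
  using abc(1-3,5) T by (intro tsum_tsum M BD C X A_module) (auto intro!: R_closed)
 also have "... = tsum X (%x z. tsum X (%x' x''. tsum X ?C (pure K (A a) ?BD x' (pure K (A b) (A c) x'' z))) (De a b x)) (R ab c)"
  using abc(1-3,5) T by (intro Rs_cong tsum_tsum M BD C X) (auto intro!: De_closed)
 also have "... = tsum X (%x z. tsum X (%x' x''. tsum X (B x') (pure K (A b) (A c) x'' z)) (De a b x)) (R ab c)"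
  using abc(1-3,5) by (intro Rs_cong Ds_cong tsum_pure[OF M(1) BD X C]) auto
 also have "... = tsum X (%x z. tsum X (%x' x''. B x' x'' z) (De a b x)) (R ab c)"
  using abc(1-3,5) by (intro Rs_cong Ds_cong tsum_pure[OF M(2,3) X C3]) auto
 finally have 1: "tsum X ?C ?l = ..." .
 \<comment> \<open>\<open>?F\<close> is right multiplication by the second embedded R-matrix
   followed by the map induced by B; the first R-matrix can then be inserted as a sum of pure
   tensors.\<close>
 let ?F = "%x s. tsum X (%x' s'. ?C (x*[A a]x') (s*[?BD]s')) ?q"
 have F: "bo K (A a) ?BD X ?F"
  using pq abc(1-3) M AL BD BDA X
  by (intro boI lo_tsum[OF M(1) BD X]) (auto intro!: lC linear_mult_left lo_id tensor_mult_c AL)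
 have "tsum X ?C (?p*[?T]?q) = tsum X ?F ?p"
  using pq by (intro tsum_mult AL BDA X C) auto
 also have "... = tsum X (%x z. tsum X ?F (pure K (A a) ?BD (ph b d x) (pure K (A b) (A c) \<one>[A b] z))) (R d c)"
  using abc(1-3) d F by (intro tsum_tsum M BD X A_module) (auto intro!: R_closed)
 also have "... = tsum X (%x z. ?F (ph b d x) (pure K (A b) (A c) \<one>[A b] z)) (R d c)"
  using abc(1-3) d F by (intro Rs_cong tsum_pure M BD X) auto
 also have "... = tsum X (%x z. tsum X (%y z'. B (ph b d x) y (z*[A c]z')) (R b c)) (R d c)"
 proof (intro Rs_cong)
  fix x z assume x: "x:cA d" and z: "z:cA c"
  have x': "ph b d x:cA a" using x abc(1-3) d by auto
  let ?G = "%x' s'. ?C (ph b d x*[A a]x') (pure K (A b) (A c) \<one>[A b] z*[?BD]s')"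
  have G: "bo K (A a) ?BD X ?G"
   using abc(1-3) z x' AL BDA by (intro boI) (auto intro!: lC linear_mult_right lo_id tensor_mult_c AL)
  have "?F (ph b d x) (pure K (A b) (A c) \<one>[A b] z)
   = tsum X (%y z'. tsum X ?G (pure K (A a) ?BD \<one>[A a] (pure K (A b) (A c) y z'))) (R b c)"
   using abc(1-3) z x' G by (intro tsum_tsum M BD X) (auto intro!: R_closed)
  also have "... = tsum X (%y z'. ?G \<one>[A a] (pure K (A b) (A c) y z')) (R b c)"
   using abc(1-3) z x' G by (intro Rs_cong tsum_pure M BD X) auto
  also have "... = tsum X (%y z'. ?C (ph b d x) (pure K (A b) (A c) y (z*[A c]z'))) (R b c)"
   using abc(1-3) z x' by (intro Rs_cong) (auto simp: pure_mult[OF AL(2,3)])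
  also have "... = tsum X (%y z'. B (ph b d x) y (z*[A c]z')) (R b c)"
   using abc(1-3) z x' by (intro Rs_cong tsum_pure[OF M(2,3) X C3]) auto
  finally show "?F (ph b d x) (pure K (A b) (A c) \<one>[A b] z) = ..." .
 qed (use abc d in auto)
 finally have 2: "tsum X ?C (?p*[?T]?q) = ..." .
 have "?l = ?p*[?T]?q" using Rmat_comult_left[OF abc(1-3)] abc(4,5) by (simp add: Let_def)
 then show ?thesis using 1 2 by simp
qed

lemma R_tri_right:
 assumes abc: "a:cr P" "b:cr P" "c:cr P" "bc = b*[P]c" and X: "module K X"
  and B1: "!!y z. y:cA b ==> z:cA c ==> lo K (A a) X (%x. B x y z)"
  and B2: "!!x z. x:cA a ==> z:cA c ==> lo K (A b) X (%y. B x y z)"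
  and B3: "!!x y. x:cA a ==> y:cA b ==> lo K (A c) X (%z. B x y z)"
 shows "tsum X (%x y. tsum X (%y' y''. B x y' y'') (De b c y)) (R a bc)
  = tsum X (%x z. tsum X (%x' y. B (x*[A a]x') y z) (R a b)) (R a c)"
proof -
 let ?BD = "tensor K (A b) (A c)" let ?T = "tensor K (A a) ?BD"
 let ?C = "%x s. tsum X (B x) s"
 note M = A_module[OF abc(1)] A_module[OF abc(2)] A_module[OF abc(3)]
 note AL = A_algebra[OF abc(1)] A_algebra[OF abc(2)] A_algebra[OF abc(3)]
 note BD = mod_tensor[OF M(2,3)] note T = mod_tensor[OF M(1) BD]
 note BDA = unital_algebra_tensor[OF AL(2,3)]
 have C: "bo K (A a) ?BD X ?C"
  using B1 B2 B3 by (intro boI lo_tsum[OF M(2,3)] lo_tsum_tensor[OF M(2,3)] X) auto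
 have C3: "bo K (A b) (A c) X (B x)" if "x:cA a" for x
  using B2 B3 that by (intro boI) auto
 note lC = bilinear_left[OF C] bilinear_right[OF C]
 let ?l = "tsum ?T (%x y. pure K (A a) ?BD x (De b c y)) (R a bc)"
 let ?p = "tsum ?T (%x z. pure K (A a) ?BD x (pure K (A b) (A c) \<one>[A b] z)) (R a c)"
 let ?q = "tsum ?T (%x y. pure K (A a) ?BD x (pure K (A b) (A c) y \<one>[A c])) (R a b)"
 have pq: "?p:cr ?T" "?q:cr ?T"
  using abc(1-3) T by (auto intro!: Rsum_closed pure_closed)
 have "tsum X ?C ?l = tsum X (%x y. tsum X ?C (pure K (A a) ?BD x (De b c y))) (R a bc)"
  using abc T by (intro tsum_tsum M BD C X A_module) (auto intro!: R_closed De_closed)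
 also have "... = tsum X (%x y. tsum X (%y' y''. B x y' y'') (De b c y)) (R a bc)"
  using abc by (intro Rs_cong tsum_pure[OF M(1) BD X C]) (auto intro!: De_closed)
 finally have 1: "tsum X ?C ?l = ..." .
 let ?F = "%x s. tsum X (%x' s'. ?C (x*[A a]x') (s*[?BD]s')) ?q"
 have F: "bo K (A a) ?BD X ?F"
  using pq abc(1-3) M AL BD BDA X
  by (intro boI lo_tsum[OF M(1) BD X]) (auto intro!: lC linear_mult_left lo_id tensor_mult_c AL)
 have "tsum X ?C (?p*[?T]?q) = tsum X ?F ?p"
  using pq by (intro tsum_mult AL BDA X C) auto
 also have "... = tsum X (%x z. tsum X ?F (pure K (A a) ?BD x (pure K (A b) (A c) \<one>[A b] z))) (R a c)"
  using abc(1-3) F by (intro tsum_tsum M BD X A_module) (auto intro!: R_closed)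
 also have "... = tsum X (%x z. ?F x (pure K (A b) (A c) \<one>[A b] z)) (R a c)"
  using abc(1-3) F by (intro Rs_cong tsum_pure M BD X) auto
 also have "... = tsum X (%x z. tsum X (%x' y. B (x*[A a]x') y z) (R a b)) (R a c)"
 proof (intro Rs_cong)
  fix x z assume x': "x:cA a" and z: "z:cA c"
  let ?G = "%x' s'. ?C (x*[A a]x') (pure K (A b) (A c) \<one>[A b] z*[?BD]s')"
  have G: "bo K (A a) ?BD X ?G"
   using abc(1-3) z x' AL BDA by (intro boI) (auto intro!: lC linear_mult_right lo_id tensor_mult_c AL)
  have "?F x (pure K (A b) (A c) \<one>[A b] z)
   = tsum X (%x' y. tsum X ?G (pure K (A a) ?BD x' (pure K (A b) (A c) y \<one>[A c]))) (R a b)"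
   using abc(1-3) z x' G by (intro tsum_tsum M BD X) (auto intro!: R_closed)
  also have "... = tsum X (%x' y. ?G x' (pure K (A b) (A c) y \<one>[A c])) (R a b)"
   using abc(1-3) z x' G by (intro Rs_cong tsum_pure M BD X) auto
  also have "... = tsum X (%x' y. ?C (x*[A a]x') (pure K (A b) (A c) y z)) (R a b)"
   using abc(1-3) z x' by (intro Rs_cong) (auto simp: pure_mult[OF AL(2,3)])
  also have "... = tsum X (%x' y. B (x*[A a]x') y z) (R a b)"
   using abc(1-3) z x' by (intro Rs_cong tsum_pure[OF M(2,3) X C3]) auto
  finally show "?F x (pure K (A b) (A c) \<one>[A b] z) = ..." .
 qed (use abc in auto)
 finally have 2: "tsum X ?C (?p*[?T]?q) = ..." .
 have "?l = ?p*[?T]?q" using Rmat_comult_right[OF abc(1-3)] abc(4) by (simp add: Let_def)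
 then show ?thesis using 1 2 by simp
qed

lemma R_crossing_sum:
 assumes "a:cr P" "b:cr P" "c:cr P" "module K X" "d = cj c a" "e = cj c b"
  "bo K (A d) (A e) X B"
 shows "tsum X B (R d e) = tsum X (%x y. B (ph c a x) (ph c b y)) (R a b)"
proof -
 have M: "module K (A d)" "module K (A e)" "module K (A a)" "module K (A b)" using assms by auto
 have "tsum X B (tsum (tensor K (A d) (A e)) (%x y. pure K (A d) (A e) (ph c a x) (ph c b y)) (R a b))
  = tsum X (%x y. tsum X B (pure K (A d) (A e) (ph c a x) (ph c b y))) (R a b)"
  using assms by (intro tsum_tsum M) (auto intro: R_closed)
 also have "... = tsum X (%x y. B (ph c a x) (ph c b y)) (R a b)"
  using assms by (intro Rs_cong tsum_pure M) auto
 finally show ?thesis using Rmat_crossing[OF assms(3,1,2)] assms(5,6) by (simp add: Let_def)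
qed

abbreviation "u == drinfeld P H"
abbreviation "w == drinfeld_sq P H"

section \<open>Normalisation of the R-matrix under the counit\<close>

lemma R_unit_sum:
 assumes "a:cr P" "b:cr P" "module K X" "bo K (A a) (A b) X B"
 obtains r where "r:cr (tensor K (A a) (A b))"
  "tsum X (%x y. tsum X (%x' y'. B (x*[A a]x') (y*[A b]y')) r) (R a b) = B \<one>[A a] \<one>[A b]"
proof -
 let ?T = "tensor K (A a) (A b)"
 obtain r where r: "r:cr ?T" "R a b*[?T]r = \<one>[?T]"
  using Rmat_unit[OF assms(1,2)] by (auto simp: Units_def)
 have "tsum X (%x y. tsum X (%x' y'. B (x*[A a]x') (y*[A b]y')) r) (R a b) = tsum X B (R a b*[?T]r)"
  using assms r by (intro tsum_mult[symmetric]) (auto intro: R_closed)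
 also have "... = B \<one>[A a] \<one>[A b]" using assms r by (simp add: tensor_one tsum_pure)
 finally show ?thesis using r that by blast
qed

text \<open>The element e = (\<epsilon> \<otimes> id)(R) is idempotent, by the axiom for (\<Delta>
  \<otimes> id)(R) with neutral left degrees and the counit axiom. It has a right inverse, because R
  has one and \<epsilon> \<otimes> id is multiplicative. An idempotent with a right inverse is the
  unit.\<close>

lemma R_counit_left:
 assumes c: "c:cr P"
 shows "tsum (A c) (%x z. ep x.*[A c]z) (R eP c) = \<one>[A c]"
proof -
 let ?e = "tsum (A c) (%x z. ep x.*[A c]z) (R eP c)"
 interpret Ac: ring "A c" using A_ring[OF c] .
 let ?R = "R eP c"
 have 1: "eP:cr P" by simp
 let ?B = "%x z. ep x.*[A c]z"
 have B: "bo K (A eP) (A c) (A c) ?B" using c by (auto intro!: lin)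
 have e: "?e:cA c" using c by simp
 have mult: "?B (x*[A eP]x') (z*[A c]z') = ?B x z*[A c]?B x' z'"
  if "x:cr (A eP)" "x':cr (A eP)" "z:cA c" "z':cA c" for x x' z z'
  using that c by (simp add: module.smult_assoc1[OF A_module,symmetric] m_comm)
 have "tsum (A c) (%x z. tsum (A c) (%x' x''. ep x'.*[A c](ep x''.*[A c]z)) (De eP eP x)) ?R
  = tsum (A c) (%x z. tsum (A c) (%y z'. ep (ph eP eP x).*[A c](ep y.*[A c](z*[A c]z'))) ?R) ?R"
  using c by (intro R_tri_left) (auto intro!: lin)
 also have "... = tsum (A c) (%x z. ?B x z*[A c]?e) ?R"
  using c by (intro Rs_cong)
   (auto simp: Rs_multL module.smult_assoc1[OF A_module,symmetric] m_comm intro!: Rs_cong)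
 also have "... = ?e*[A c]?e" using c e by (simp add: Rs_multR)
 also have "tsum (A c) (%x z. tsum (A c) (%x' x''. ep x'.*[A c](ep x''.*[A c]z)) (De eP eP x)) ?R = ?e"
  using c by (intro Rs_cong ep_left) (auto intro!: lin)
 finally have ee: "?e*[A c]?e = ?e" by simp
 obtain r where r: "r:cr (tensor K (A eP) (A c))"
  "tsum (A c) (%x y. tsum (A c) (%x' y'. ?B (x*[A eP]x') (y*[A c]y')) r) ?R = ?B \<one>[A eP] \<one>[A c]"
  using R_unit_sum[OF 1 c _ B] c by auto
 let ?r = "tsum (A c) ?B r"
 have rc: "?r:cA c" using r(1) c by (auto intro!: tsum_closed[of K "A eP" "A c"])
 have "?B \<one>[A eP] \<one>[A c] = tsum (A c) (%x y. tsum (A c) (%x' y'. ?B x y*[A c]?B x' y') r) ?R"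
  unfolding r(2)[symmetric]
  using r(1) c mult by (intro Rs_cong tsum_cong[of K "A eP" "A c"]) auto
 also have "... = tsum (A c) (%x y. ?B x y*[A c]?r) ?R"
  using r(1) c by (intro Rs_cong tsum_out[of K "A eP" "A c" _ _ "%x. _*[A c]x", symmetric]) (auto intro!: lin)
 also have "... = ?e*[A c]?r" using c rc by (simp add: Rs_multR)
 finally have er: "?e*[A c]?r = \<one>[A c]" using c by simp
 then have "\<one>[A c] = (?e*[A c]?e)*[A c]?r" using ee by simp
 also have "... = ?e" using e rc er Ac.m_assoc by simp
 finally show ?thesis by simp
qed

lemma R_counit_right:
 assumes c: "c:cr P"
 shows "tsum (A c) (%z x. ep x.*[A c]z) (R c eP) = \<one>[A c]"
proof -
 let ?e = "tsum (A c) (%z x. ep x.*[A c]z) (R c eP)"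
 interpret Ac: ring "A c" using A_ring[OF c] .
 let ?R = "R c eP"
 have 1: "eP:cr P" by simp
 let ?B = "%z x. ep x.*[A c]z"
 have B: "bo K (A c) (A eP) (A c) ?B" using c by (auto intro!: lin)
 have e: "?e:cA c" using c by simp
 have mult: "?B (z*[A c]z') (x*[A eP]x') = ?B z x*[A c]?B z' x'"
  if "x:cr (A eP)" "x':cr (A eP)" "z:cA c" "z':cA c" for x x' z z'
  using that c by (simp add: module.smult_assoc1[OF A_module,symmetric] m_comm)
 have "tsum (A c) (%z x. tsum (A c) (%x' x''. ep x'.*[A c](ep x''.*[A c]z)) (De eP eP x)) ?R
  = tsum (A c) (%z x. tsum (A c) (%z' y. ep y.*[A c](ep x.*[A c](z*[A c]z'))) ?R) ?R"
  using c by (intro R_tri_right) (auto intro!: lin)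
 also have "... = tsum (A c) (%z x. ?B z x*[A c]?e) ?R"
  using c by (intro Rs_cong)
   (auto simp: Rs_multL module.smult_assoc1[OF A_module,symmetric] m_comm intro!: Rs_cong)
 also have "... = ?e*[A c]?e" using c e by (simp add: Rs_multR)
 also have "tsum (A c) (%z x. tsum (A c) (%x' x''. ep x'.*[A c](ep x''.*[A c]z)) (De eP eP x)) ?R = ?e"
  using c by (intro Rs_cong ep_left) (auto intro!: lin)
 finally have ee: "?e*[A c]?e = ?e" by simp
 obtain r where r: "r:cr (tensor K (A c) (A eP))"
  "tsum (A c) (%x y. tsum (A c) (%x' y'. ?B (x*[A c]x') (y*[A eP]y')) r) ?R = ?B \<one>[A c] \<one>[A eP]"
  using R_unit_sum[OF c 1 _ B] c by auto
 let ?r = "tsum (A c) ?B r"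
 have rc: "?r:cA c" using r(1) c by (auto intro!: tsum_closed[of K "A c" "A eP"])
 have "?B \<one>[A c] \<one>[A eP] = tsum (A c) (%x y. tsum (A c) (%x' y'. ?B x y*[A c]?B x' y') r) ?R"
  unfolding r(2)[symmetric]
  using r(1) c mult by (intro Rs_cong tsum_cong[of K "A c" "A eP"]) auto
 also have "... = tsum (A c) (%x y. ?B x y*[A c]?r) ?R"
  using r(1) c by (intro Rs_cong tsum_out[of K "A c" "A eP" _ _ "%x. _*[A c]x", symmetric]) (auto intro!: lin)
 also have "... = ?e*[A c]?r" using c rc by (simp add: Rs_multR)
 finally have er: "?e*[A c]?r = \<one>[A c]" using c by simp
 then have "\<one>[A c] = (?e*[A c]?e)*[A c]?r" using ee by simp
 also have "... = ?e" using e rc er Ac.m_assoc by simp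
 finally show ?thesis by simp
qed

lemma R_counit_left_sum:
 assumes "c:cr P" "module K X" "lo K (A c) X f"
 shows "tsum X (%x z. ep x.*[X]f z) (R eP c) = f \<one>[A c]"
proof -
 have "tsum X (%x z. ep x.*[X]f z) (R eP c) = tsum X (%x z. f (ep x.*[A c]z)) (R eP c)"
  using assms by (intro Rs_cong) (auto simp: lo_smult)
 also have "... = f (tsum (A c) (%x z. ep x.*[A c]z) (R eP c))"
  using assms by (intro Rs_out[symmetric]) auto
 finally show ?thesis using assms R_counit_left by simp
qed

lemma R_counit_right_sum:
 assumes "c:cr P" "module K X" "lo K (A c) X f"
 shows "tsum X (%z x. ep x.*[X]f z) (R c eP) = f \<one>[A c]"
proof -
 have "tsum X (%z x. ep x.*[X]f z) (R c eP) = tsum X (%z x. f (ep x.*[A c]z)) (R c eP)"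
  using assms by (intro Rs_cong) (auto simp: lo_smult)
 also have "... = f (tsum (A c) (%z x. ep x.*[A c]z) (R c eP))"
  using assms by (intro Rs_out[symmetric]) auto
 finally show ?thesis using assms R_counit_right by simp
qed

subsection \<open>The inverse of the R-matrix\<close>

text \<open>In (\<Delta> \<otimes> id)(R), with \<Delta> on the neutral component, S is applied to
  the first leg and the first two legs are multiplied. The antipode axiom reduces this to
  (\<epsilon> \<otimes> id)(R) = 1, while the axiom of R gives the product of (S \<phi> \<otimes>
  id)(R) with R.\<close>

lemma Rinv_left_sum:
 assumes bc: "b:cr P" "c:cr P" and X: "module K X" and B: "bo K (A b) (A c) X B"
 shows "tsum X (%x z. tsum X (%y z'. B (S (iv b) (ph b (iv b) x)*[A b]y) (z*[A c]z')) (R b c)) (R (iv b) c)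
  = B \<one>[A b] \<one>[A c]"
proof -
 note lB = lin bilinear_left[OF B] bilinear_right[OF B]
 have "tsum X (%x z. tsum X (%x' x''. B (S (iv b) x'*[A b]x'') z) (De (iv b) b x)) (R eP c)
  = tsum X (%x z. tsum X (%y z'. B (S (iv b) (ph b (iv b) x)*[A b]y) (z*[A c]z')) (R b c)) (R (iv b) c)"
  using bc X by (intro R_tri_left) (auto intro!: lB)
 moreover have "tsum X (%x z. tsum X (%x' x''. B (S (iv b) x'*[A b]x'') z) (De (iv b) b x)) (R eP c)
  = tsum X (%x z. B (tsum (A b) (%x' x''. S (iv b) x'*[A b]x'') (De (iv b) b x)) z) (R eP c)"
  using bc X by (intro Rs_cong Ds_out[where f = "%x. B x _", symmetric]) (auto intro!: lB)
 moreover have "... = tsum X (%x z. ep x.*[X]B \<one>[A b] z) (R eP c)"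
  using bc X lo_smult[OF boD(2)[OF B]] by (intro Rs_cong) (auto simp: antipode_left)
 moreover have "... = B \<one>[A b] \<one>[A c]"
  using bc X by (intro R_counit_left_sum) (auto intro!: lB)
 ultimately show ?thesis by simp
qed

text \<open>R is a unit by assumption, so the left inverse just found is its inverse; this gives a
  formula for \<open>Rmat_inv\<close> that can be evaluated.\<close>

lemma Rmat_inv_eq:
 assumes bc: "b:cr P" "c:cr P"
 defines "T == tensor K (A b) (A c)"
 defines "Q == tsum T (%x z. pure K (A b) (A c) (S (iv b) (ph b (iv b) x)) z) (R (iv b) c)"
 shows "Ri b c = Q" and "R b c*[T]Q = \<one>[T]" and "Q*[T]R b c = \<one>[T]" and "Q:cr T"
proof -
 have Ta: "unital_algebra K T" unfolding T_def using bc by (intro unital_algebra_tensor) auto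
 interpret T: ring T using uaD(2)[OF Ta] .
 have Tm: "module K T" using uaD(1)[OF Ta] .
 have R: "R b c:cr T" unfolding T_def using bc by (rule R_closed)
 show Q: "Q:cr T"
  unfolding Q_def using bc Tm by (auto intro!: Rsum_closed simp: T_def)
 let ?p = "pure K (A b) (A c)"
 have p: "bo K (A b) (A c) T ?p" unfolding T_def using bc by (intro bilinear_pure) auto
 have "Q*[T]R b c = tsum T ?p (Q*[T]R b c)"
  using Q R bc unfolding T_def by (intro tsum_pure_id[symmetric] tensor_mult_c) auto
 also have "... = tsum T (%x y. tsum T (%x' y'. ?p (x*[A b]x') (y*[A c]y')) (R b c)) Q"
  using Q R bc p Tm unfolding T_def by (intro tsum_mult) auto
 also have "... = tsum T (%x z. tsum T (%x y. tsum T (%x' y'. ?p (x*[A b]x') (y*[A c]y')) (R b c))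
   (?p (S (iv b) (ph b (iv b) x)) z)) (R (iv b) c)"
  unfolding Q_def T_def using bc Tm[unfolded T_def] by (intro tsum_tsum[OF A_module[OF bc(1)] A_module[OF bc(2)] A_module[of "iv b"] A_module[OF bc(2)]]) (auto intro!: R_closed lin)
 also have "... = tsum T (%x z. tsum T (%x' y'. ?p (S (iv b) (ph b (iv b) x)*[A b]x') (z*[A c]y')) (R b c)) (R (iv b) c)"
  unfolding T_def using bc Tm[unfolded T_def] by (intro Rs_cong tsum_pure A_module) (auto intro!: lin)
 also have "... = ?p \<one>[A b] \<one>[A c]" using bc Tm p by (intro Rinv_left_sum) auto
 finally show QR: "Q*[T]R b c = \<one>[T]" by (simp add: T_def tensor_one)
 have U: "R b c:Units T" unfolding T_def using bc by (rule Rmat_unit)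
 have "inv\<^bsub>T\<^esub> R b c = Q"
  using T.inv_unique[OF QR T.Units_r_inv[OF U] R Q T.Units_inv_closed[OF U]] by simp
 then show "Ri b c = Q" by (simp add: Rmat_inv_def T_def)
 show "R b c*[T]Q = \<one>[T]" using \<open>inv\<^bsub>T\<^esub> R b c = Q\<close> U T.Units_r_inv by blast
qed

lemma Ri_closed:
 "b:cr P ==> c:cr P ==> Ri b c:cr (tensor K (A b) (A c))"
 using Rmat_inv_eq(1,4) by simp

lemma Rmat_inv_sum:
 assumes bc: "b:cr P" "c:cr P" and X: "module K X" and B: "bo K (A b) (A c) X B"
 shows "tsum X B (Ri b c) = tsum X (%x z. B (S (iv b) (ph b (iv b) x)) z) (R (iv b) c)"
proof -
 have "tsum X B (Ri b c)
  = tsum X (%x z. tsum X B (pure K (A b) (A c) (S (iv b) (ph b (iv b) x)) z)) (R (iv b) c)"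
  unfolding Rmat_inv_eq(1)[OF bc] using bc X B by (intro tsum_tsum[OF A_module[OF bc(1)] A_module[OF bc(2)] A_module[of "iv b"] A_module[OF bc(2)]]) (auto intro!: R_closed)
 also have "... = tsum X (%x z. B (S (iv b) (ph b (iv b) x)) z) (R (iv b) c)"
  using bc X B by (intro Rs_cong tsum_pure A_module) auto
 finally show ?thesis .
qed

lemma Rinv_right_sum:
 assumes bc: "b:cr P" "c:cr P" and X: "module K X" and B: "bo K (A b) (A c) X B"
 shows "tsum X (%y z'. tsum X (%x z. B (y*[A b]S (iv b) (ph b (iv b) x)) (z'*[A c]z)) (R (iv b) c)) (R b c)
  = B \<one>[A b] \<one>[A c]"
proof -
 let ?T = "tensor K (A b) (A c)"
 note lB = lin bilinear_left[OF B] bilinear_right[OF B]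
 let ?Q = "Ri b c"
 have Q: "?Q:cr ?T" "R b c*[?T]?Q = \<one>[?T]" using Rmat_inv_eq[OF bc] by simp_all
 have "B \<one>[A b] \<one>[A c] = tsum X B (R b c*[?T]?Q)"
  using Q(2) bc X B by (simp add: tensor_one tsum_pure)
 also have "... = tsum X (%y z'. tsum X (%x z. B (y*[A b]x) (z'*[A c]z)) ?Q) (R b c)"
  using bc X B Q(1) by (intro tsum_mult) (auto intro: R_closed)
 also have "... = tsum X (%y z'. tsum X (%x z. B (y*[A b]S (iv b) (ph b (iv b) x)) (z'*[A c]z)) (R (iv b) c)) (R b c)"
  using bc X by (intro Rs_cong Rmat_inv_sum) (auto intro!: lB)
 finally show ?thesis by simp
qed

text \<open>In H_a tensored with the opposite algebra of H_b, the element (id \<otimes>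
  S)(R_{a,b^-1}) has R_{a,b} as a right inverse and the image of R_{a^-1,b^-1} under S \<phi>
  \<otimes> S as a left inverse; hence these two agree.\<close>

lemma R_antipode_sum:
 assumes ab: "a:cr P" "b:cr P" and X: "module K X" and B: "bo K (A a) (A b) X B"
 shows "tsum X B (R a b) = tsum X (%p q. B (S (iv a) (ph a (iv a) p)) (S (iv b) q)) (R (iv a) (iv b))"
proof -
 note lB = lin bilinear_left[OF B] bilinear_right[OF B]
 let ?R = "R (iv a) (iv b)" and ?a = "R a (iv b)"
 \<comment> \<open>The right inverse: the antipode axiom applied to \<Delta> in the second slot of
   R_{a,1}.\<close>
 have *: "tsum X (%x z. tsum X (%x' y. C (x*[A a]x') (y*[A b]S (iv b) z)) (R a b)) ?a
   = C \<one>[A a] \<one>[A b]" if C: "bo K (A a) (A b) X C" for C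
 proof -
  note lC = lin bilinear_left[OF C] bilinear_right[OF C]
  have "tsum X (%x y. tsum X (%y' y''. C x (y'*[A b]S (iv b) y'')) (De b (iv b) y)) (R a eP)
   = tsum X (%x z. tsum X (%x' y. C (x*[A a]x') (y*[A b]S (iv b) z)) (R a b)) ?a"
   using ab X by (intro R_tri_right) (auto intro!: lC)
  moreover have "tsum X (%x y. tsum X (%y' y''. C x (y'*[A b]S (iv b) y'')) (De b (iv b) y)) (R a eP)
   = tsum X (%x y. C x (tsum (A b) (%y' y''. y'*[A b]S (iv b) y'') (De b (iv b) y))) (R a eP)"
   using ab X by (intro Rs_cong Ds_out[where f = "C _", symmetric]) (auto intro!: lC)
  moreover have "... = tsum X (%x y. ep y.*[X]C x \<one>[A b]) (R a eP)"
   using ab X lo_smult[OF boD(1)[OF C]] by (intro Rs_cong) (auto simp: antipode_right)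
  moreover have "... = C \<one>[A a] \<one>[A b]"
   using ab X by (intro R_counit_right_sum[where f = "%x. C x \<one>[A b]"]) (auto intro!: lC)
  ultimately show ?thesis by simp
 qed
 let ?C = "%s t. tsum X (%x' y. B (s*[A a]x') (y*[A b]S (iv b) t)) (R a b)"
 have "tsum X B (R a b) = ?C \<one>[A a] \<one>[A (iv b)]"
  using ab by (intro Rs_cong) auto
 also have "... = tsum X (%p q. tsum X (%x z. ?C (S (iv a) (ph a (iv a) p)*[A a]x) (q*[A (iv b)]z)) ?a) ?R"
  using ab X by (intro Rinv_left_sum[symmetric]) (auto intro!: lB)
 also have "... = tsum X (%p q. tsum X (%x z. tsum X (%x' y.
   B (S (iv a) (ph a (iv a) p)*[A a](x*[A a]x')) ((y*[A b]S (iv b) z)*[A b]S (iv b) q)) (R a b)) ?a) ?R"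
  using ab by (intro Rs_cong) (auto simp: S_mult A_assoc)
 also have "... = tsum X (%p q. B (S (iv a) (ph a (iv a) p)*[A a]\<one>[A a]) (\<one>[A b]*[A b]S (iv b) q)) ?R"
  using ab X by (intro Rs_cong *[where C = "%s t. B (S (iv a) (ph a (iv a) _)*[A a]s) (t*[A b]S (iv b) _)"]) (auto intro!: lB)
 also have "... = tsum X (%p q. B (S (iv a) (ph a (iv a) p)) (S (iv b) q)) ?R"
  using ab by (intro Rs_cong) auto
 finally show ?thesis .
qed

end

subsection \<open>Drinfeld elements\<close>

context quasitriangular_T_coalgebra
begin

lemma u_eq: "a:cr P ==> b = iv a ==>
  u a = tsum (A a) (%p q. S b (ph a b q)*[A a]p) (R a b)"
 by (simp add: drinfeld_def)

lemma u_closed [simp]: "a:cr P ==> u a:cA a"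
 by (simp add: u_eq)

lemma crossing_u [simp]:
 assumes "a:cr P" "b:cr P"
 shows "ph b a (u a) = u (cj b a)"
proof -
 have "ph b a (u a) = tsum (A (cj b a)) (%p q. ph b a (S (iv a) (ph a (iv a) q)*[A a]p)) (R a (iv a))"
  using assms by (simp add: u_eq Rsum_crossing)
 also have "... = tsum (A (cj b a)) (%p q. S (cj b (iv a)) (ph (cj b a) (cj b (iv a)) (ph b (iv a) q))
   *[A (cj b a)]ph b a p) (R a (iv a))"
  using assms by (intro Rs_cong) (auto simp: ph_mult S_crossing conj_elt_mult_left)
 also have "... = u (cj b a)"
  unfolding u_eq[OF conj_elt_closed[OF assms(2,1)] HOL.refl]
  using assms by (simp, intro R_crossing_sum[symmetric]) (auto intro!: lin)
 finally show ?thesis .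
qed

text \<open>Drinfeld's argument with degrees. The sum \<open>?E\<close> is evaluated twice:
  exchanging R with \<Delta> lets the antipode axiom absorb one part of h and leaves S^2(\<phi>(h))
  u, whereas expanding S as an antihomomorphism lets it absorb another part and leaves u h.\<close>

lemma u_comm:
 assumes a: "a:cr P" and h: "h:cA a"
 shows "u a*[A a]h = S (iv a) (S a (ph a a h))*[A a]u a"
proof -
 let ?A = "A a" let ?D = "De"
 let ?s = "%k. S (iv a) (S a (ph a a k))"
 let ?F = "%x y. S (iv a) (ph a (iv a) y)*[?A]x"
 let ?R = "R a (iv a)" and ?a = "?D eP a h" and ?b = "?D a eP h"
 have F: "bo K ?A (A (iv a)) ?A ?F" using a by (auto intro!: lin)
 let ?E = "tsum ?A (%g k. ?s k*[?A]tsum ?A (%p q. tsum ?A (%g1 g2.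
   ?F (p*[?A]g1) (q*[A (iv a)]g2)) (?D a (iv a) g)) ?R) ?a"
 have "?E = tsum ?A (%g k. ?s k*[?A]tsum ?A (%g1 g2. tsum ?A (%p q.
   ?F (g2*[?A]p) (ph (iv a) (iv a) g1*[A (iv a)]q)) ?R) (?D (iv a) a g)) ?a"
  using a h F by (intro Ds_cong arg_cong2[where f = "%x y. x*[?A]y"] R_comult_sum) auto
 also have "... = tsum ?A (%g k. ?s k*[?A]tsum ?A (%p q. tsum ?A (%g1 g2.
   ?F (g2*[?A]p) (ph (iv a) (iv a) g1*[A (iv a)]q)) (?D (iv a) a g)) ?R) ?a"
  using a h by (intro Ds_cong arg_cong2[where f = "%x y. x*[?A]y"] DR_swap) auto
 also have "... = tsum ?A (%g k. ?s k*[?A]tsum ?A (%p q.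
   S (iv a) (ph a (iv a) q)*[?A](tsum ?A (%g1 g2. S (iv a) g1*[?A]g2) (?D (iv a) a g)*[?A]p)) ?R) ?a"
  using a h by (intro Ds_cong arg_cong2[where f = "%x y. x*[?A]y"] Rs_cong)
   (auto simp: Ds_multL Ds_multR ph_mult S_mult A_assoc intro!: Ds_cong)
 also have "... = tsum ?A (%g k. ?s k*[?A]tsum ?A (%p q. ep g.*[?A]?F p q) ?R) ?a"
  using a h by (intro Ds_cong arg_cong2[where f = "%x y. x*[?A]y"] Rs_cong) (auto simp: antipode_left)
 also have "... = tsum ?A (%g k. ?s k*[?A](ep g.*[?A]u a)) ?a"
  using a h unfolding u_eq[OF a HOL.refl]
  by (intro Ds_cong arg_cong2[where f = "%x y. x*[?A]y"] Rs_out[symmetric]) (auto intro!: lin)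
 also have "... = tsum ?A (%g k. ep g.*[?A](?s k*[?A]u a)) ?a"
  using a h by (intro Ds_cong) auto
 also have "... = ?s h*[?A]u a"
  using a h by (intro ep_left) (auto intro!: lin)
 finally have 1: "?E = ?s h*[?A]u a" .
 let ?G = "%p q g1 g2 k. ?s k*[?A](S (iv a) (ph a (iv a) g2)*[?A](S (iv a) (ph a (iv a) q)*[?A](p*[?A]g1)))"
 have "?E = tsum ?A (%g k. tsum ?A (%p q. tsum ?A (%g1 g2. ?G p q g1 g2 k) (?D a (iv a) g)) ?R) ?a"
  using a h by (intro Ds_cong)
   (auto simp: Ds_multL Rs_multL ph_mult S_mult A_assoc intro!: Rs_cong Ds_cong)
 also have "... = tsum ?A (%p q. tsum ?A (%g k. tsum ?A (%g1 g2. ?G p q g1 g2 k) (?D a (iv a) g)) ?a) ?R"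
  using a h by (intro DR_swap) auto
 also have "... = tsum ?A (%p q. tsum ?A (%x y. tsum ?A (%y1 y2. ?G p q x y1 y2) (?D (iv a) a y)) ?b) ?R"
  using a h by (intro Rs_cong coassoc_sum') (auto intro!: lin)
 also have "... = tsum ?A (%p q. tsum ?A (%x y. tsum ?A (%y1 y2. S (iv a) (ph a (iv a) (y1*[A (iv a)]S a y2)) *[?A]
   (S (iv a) (ph a (iv a) q)*[?A](p*[?A]x))) (?D (iv a) a y)) ?b) ?R"
  using a h by (intro Rs_cong Ds_cong) (auto simp: ph_mult S_mult A_assoc S_crossing)
 also have "... = tsum ?A (%p q. tsum ?A (%x y. S (iv a) (ph a (iv a) (tsum (A (iv a)) (%y1 y2. y1*[A (iv a)]S a y2) (?D (iv a) a y))) *[?A]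
   (S (iv a) (ph a (iv a) q)*[?A](p*[?A]x))) ?b) ?R"
  using a h by (intro Rs_cong Ds_cong Ds_out[where X = "A (iv a)" and f = "%x. S (iv a) (ph a (iv a) x)*[?A]_", symmetric]) (auto intro!: lin)
 also have "... = tsum ?A (%p q. tsum ?A (%x y. ep y.*[?A](S (iv a) (ph a (iv a) q)*[?A](p*[?A]x))) ?b) ?R"
  using a h ph_hom(4)[of a "iv a"] lo_smult[OF ph_hom(1)[of a "iv a"]] lo_smult[OF antipode_linear[of "iv a"]]
  by (intro Rs_cong Ds_cong) (auto simp: antipode_right')
 also have "... = tsum ?A (%p q. S (iv a) (ph a (iv a) q)*[?A](p*[?A]h)) ?R"
  using a h by (intro Rs_cong ep_right) (auto intro!: lin)
 also have "... = u a*[?A]h"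
  using a h by (simp add: u_eq Rs_multR A_assoc) (intro Rs_cong, auto simp: A_assoc)
 finally show ?thesis using 1 by simp
qed

lemma u_unit:
 assumes a: "a:cr P"
 shows "u a:Units (A a)"
proof -
 let ?A = "A a"
 \<comment> \<open>The usual formula for the inverse of a Drinfeld element: the second leg of R
   times S^2 of the first. On either side the product with u comes down to R times its inverse,
   contracted by \<open>?B\<close>.\<close>
 let ?v = "tsum ?A (%k l. l*[?A]S (iv a) (S a k)) (R a a)"
 let ?R = "R (iv a) (iv a)" and ?a = "A (iv a)" and ?b = "R a (iv a)" and ?i = "iv (iv a)" and ?c = "R a a"
 have v: "?v:cr ?A" using a by simp
 let ?B = "%x y. S (iv a) (ph a (iv a) y)*[?A]x"
 have B: "bo K ?A ?a ?A ?B" using a by (auto intro!: lin)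
 have R': "tsum ?A (%y z'. tsum ?A (%x z. ?B (y*[?A]S (iv a) (ph a (iv a) x)) (z'*[?a]z)) ?R) ?b = \<one>[?A]"
  using a B ph_hom(4)[of a "iv a"] by (subst Rinv_right_sum) auto
 have "u a*[?A]?v = tsum ?A (%p q. (u a*[?A]q)*[?A]S (iv a) (S a p)) ?c"
  using a by (subst Rs_multL) (auto simp: A_assoc intro!: Rs_cong)
 also have "... = tsum ?A (%p q. tsum ?A (%k l. ?B (k*[?A]S (iv a) (S a p)) (l*[?a]S a q)) ?b) ?c"
 proof (intro Rs_cong a)
  fix p q assume pq: "p:cr ?A" "q:cr ?A"
  show "(u a*[?A]q)*[?A]S (iv a) (S a p)
   = tsum ?A (%k l. ?B (k*[?A]S (iv a) (S a p)) (l*[?a]S a q)) ?b"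
   unfolding u_comm[OF a pq(2)] unfolding u_eq[OF a HOL.refl]
   using a pq by (simp add: Rs_multL Rs_multR)
    (intro Rs_cong, auto simp: A_assoc ph_mult S_mult S_crossing)
 qed
 also have "... = tsum ?A (%k l. tsum ?A (%p q. ?B (k*[?A]S (iv a) (S a p)) (l*[?a]S a q)) ?c) ?b"
  using a by (intro Rs_swap) auto
 also have "... = tsum ?A (%k l. tsum ?A (%x z. ?B (k*[?A]S (iv a) (ph a (iv a) x)) (l*[?a]z)) ?R) ?b"
 proof (intro Rs_cong)
  fix k l assume *: "k:cr ?A" "l:cA (iv a)"
  have "tsum ?A (%x z. ?B (k*[?A]S (iv a) (ph a (iv a) x)) (l*[?a]z)) ?R
   = tsum ?A (%p q. ?B (k*[?A]S (iv a) (ph a (iv a) (S ?i (ph (iv a) ?i p)))) (l*[?a]S ?i q)) (R ?i ?i)"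
   using a * by (intro R_antipode_sum) (auto intro!: lin)
  also have "... = tsum ?A (%p q. ?B (k*[?A]S (iv a) (S a p)) (l*[?a]S a q)) ?c"
   using a * by simp (intro Rs_cong, auto simp: S_crossing)
  finally show "tsum ?A (%p q. ?B (k*[?A]S (iv a) (S a p)) (l*[?a]S a q)) ?c
   = tsum ?A (%x z. ?B (k*[?A]S (iv a) (ph a (iv a) x)) (l*[?a]z)) ?R" by simp
 qed (use a in auto)
 finally have uv: "u a*[?A]?v = \<one>[?A]" using R' by simp
 have "?v*[?A]u a = tsum ?A (%p q. q*[?A](S (iv a) (S a p)*[?A]u a)) ?c"
  using a by (subst Rs_multR) (auto simp: A_assoc intro!: Rs_cong)
 also have "... = tsum ?A (%p q. q*[?A](u a*[?A]ph (iv a) a p)) ?c"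
  using a by (intro Rs_cong) (auto simp: u_comm)
 also have "... = tsum ?A (%p q. S (iv a) q*[?A](u a*[?A]ph (iv a) a (S (iv a) (ph a (iv a) p)))) ?R"
  using a by (intro R_antipode_sum) (auto intro!: lin)
 also have "... = tsum ?A (%p q. S (iv a) (ph a (iv a) q)*[?A](u a*[?A]ph (iv a) a (S (iv a) (ph a (iv a) (ph a (iv a) p))))) ?R"
  using a by (intro R_crossing_sum) (auto intro!: lin)
 also have "... = tsum ?A (%p q. tsum ?A (%k l. ?B (k*[?A]S (iv a) (ph a (iv a) p)) (l*[?a]q)) ?b) ?R"
  unfolding u_eq[OF a HOL.refl]
  using a by (intro Rs_cong) (auto simp: Rs_multL Rs_multR A_assoc ph_mult S_mult S_crossing intro!: Rs_cong)
 also have "... = tsum ?A (%k l. tsum ?A (%p q. ?B (k*[?A]S (iv a) (ph a (iv a) p)) (l*[?a]q)) ?R) ?b"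
  using a by (intro Rs_swap) auto
 finally have "?v*[?A]u a = \<one>[?A]" using R' by simp
 then show ?thesis using uv v a by (auto simp: Units_def)
qed

text \<open>This is S(u) for the Drinfeld element of the inverse degree, an element of H itself. It
  is not the formal generator of RT(H), which is a square root of \<open>w\<close> = u v.\<close>

abbreviation "v a == S (iv a) (u (iv a))"

text \<open>Two applications of \<open>R_antipode_sum\<close>; the crossings they bring in are
  inverse to each other.\<close>

lemma R_S2_sum:
 assumes ab: "a:cr P" "b:cr P" and X: "module K X" and B: "bo K (A a) (A b) X B"
 shows "tsum X B (R a b) = tsum X (%p q. B (S (iv a) (S a p)) (S (iv b) (S b q))) (R a b)"
proof -
 note lB = lin bilinear_left[OF B] bilinear_right[OF B]
 have "tsum X B (R a b) = tsum X (%p q. B (S (iv a) (ph a (iv a) p)) (S (iv b) q)) (R (iv a) (iv b))"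
  using assms by (rule R_antipode_sum)
 also have "... = tsum X (%p q. B (S (iv a) (ph a (iv a) (S (iv (iv a)) (ph (iv a) (iv (iv a)) p)))) (S (iv b) (S (iv (iv b)) q))) (R (iv (iv a)) (iv (iv b)))"
  using ab X by (intro R_antipode_sum) (auto intro!: lB)
 also have "... = tsum X (%p q. B (S (iv a) (S a p)) (S (iv b) (S b q))) (R a b)"
  using ab by simp (intro Rs_cong, auto simp: S_crossing)
 finally show ?thesis .
qed

lemma S2_u:
 assumes a: "a:cr P"
 shows "S (iv a) (S a (u a)) = u a"
proof -
 have "S (iv a) (S a (u a)) = tsum (A a) (%p q. S (iv a) (ph a (iv a) (S a (S (iv a) q)))*[A a]S (iv a) (S a p)) (R a (iv a))"
  unfolding u_eq[OF a HOL.refl]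
  using a by (simp add: Rsum_antipode) (intro Rs_cong, auto simp: S_mult S_crossing)
 also have "... = u a"
  unfolding u_eq[OF a HOL.refl]
  using a R_S2_sum[OF a, of "iv a" "A a" "%p q. S (iv a) (ph a (iv a) q)*[A a]p"] by (simp add: lin)
 finally show ?thesis .
qed

text \<open>Invariance of R shifts the crossing from one leg to the other. This is the form of v
  that appears in \<open>w_sum2\<close>.\<close>

lemma v_eq_cross:
 assumes a: "a:cr P"
 shows "tsum (A a) (%p q. S (iv a) (ph a (iv a) p)*[A a]S (iv a) (S a q)) (R (iv a) a) = v a"
proof -
 have "v a = tsum (A a) (%p q. S (iv a) p*[A a]S (iv a) (S a (ph (iv a) a q))) (R (iv a) a)"
  using a by (simp add: u_eq[of "iv a" a] Rsum_antipode) (intro Rs_cong, auto simp: S_mult)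
 also have "... = tsum (A a) (%p q. S (iv a) (ph a (iv a) p)*[A a]S (iv a) (S a (ph (iv a) a (ph a a q)))) (R (iv a) a)"
  using a by (intro R_crossing_sum) (auto intro!: lin)
 also have "... = tsum (A a) (%p q. S (iv a) (ph a (iv a) p)*[A a]S (iv a) (S a q)) (R (iv a) a)"
  using a by (intro Rs_cong) auto
 finally show ?thesis by simp
qed

text \<open>By the antipode symmetry of R, v is also the sum of the first legs times S of the second
  legs, which is what a braiding leaves when its second leg is moved across the unit of a
  dual.\<close>

lemma v_eq:
 assumes a: "a:cr P"
 shows "tsum (A a) (%k l. k*[A a]S (iv a) l) (R a (iv a)) = v a"
proof -
 have "tsum (A a) (%k l. k*[A a]S (iv a) l) (R a (iv a))
  = tsum (A a) (%p q. S (iv a) (ph a (iv a) p)*[A a]S (iv a) (S (iv (iv a)) q)) (R (iv a) (iv (iv a)))"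
  using a by (intro R_antipode_sum) (auto intro!: lin)
 then show ?thesis using a v_eq_cross[OF a] by simp
qed

lemma v_closed [simp]: "a:cr P ==> v a:cA a" by simp

lemma v_comm:
 assumes a: "a:cr P" and h: "h:cA (iv a)"
 shows "S (iv a) h*[A a]v a = v a*[A a]S (iv a) (S a (S (iv a) (ph (iv a) (iv a) h)))"
proof -
 have "S (iv a) (u (iv a)*[A (iv a)]h) = S (iv a) (S a (S (iv a) (ph (iv a) (iv a) h))*[A (iv a)]u (iv a))"
  using u_comm[of "iv a" h] a h by simp
 then show ?thesis using a h by (simp add: S_mult)
qed

lemma v_unit:
 assumes a: "a:cr P"
 shows "v a:Units (A a)"
proof -
 obtain x where x: "x:cA (iv a)" "x*[A (iv a)]u (iv a) = \<one>[A (iv a)]" "u (iv a)*[A (iv a)]x = \<one>[A (iv a)]"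
  using u_unit[of "iv a"] a by (auto simp: Units_def)
 have "v a*[A a]S (iv a) x = \<one>[A a]" "S (iv a) x*[A a]v a = \<one>[A a]"
  using x a S_mult[of "iv a" x "u (iv a)" a] S_mult[of "iv a" "u (iv a)" x a] antipode_one[of "iv a"] by simp_all
 then show ?thesis using a x(1) by (auto simp: Units_def)
qed

lemma w_eq: "w a = u a*[A a]v a"
 by (simp add: drinfeld_sq_def)

lemma w_closed [simp]: "a:cr P ==> w a:cA a"
 by (simp add: w_eq)

lemma w_unit: "a:cr P ==> w a:Units (A a)"
 using u_unit v_unit monoid.Units_m_closed[OF ring.is_monoid[OF A_ring]] by (simp add: w_eq)

lemma crossing_w [simp]:
 "a:cr P ==> b:cr P ==> ph b a (w a) = w (cj b a)"
 by (simp add: w_eq ph_mult S_crossing)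

text \<open>Since S^2(u) = u, the composite of S^2 with the crossing fixes v; the commutation rule
  of u then shows that u and v commute.\<close>

lemma vu_eq:
 assumes a: "a:cr P"
 shows "v a*[A a]u a = w a"
proof -
 have "S (iv a) (S a (ph a a (v a))) = v a"
  using a S2_u[of "iv a"] by (simp add: S_crossing)
 then show ?thesis using u_comm[OF a v_closed[OF a]] by (simp add: w_eq)
qed

lemma antipode_w [simp]:
 assumes "a:cr P" "b = iv a"
 shows "S a (w a) = w b"
 using assms S2_u[of "iv a"] vu_eq[of "iv a"] by (simp add: w_eq S_mult)

text \<open>The sum left by a double braiding at an invariant element: the inner R-matrix has given
  v, and the outer one gives u once v is moved to the right by \<open>v_comm\<close>.\<close>

lemma w_sum:
 assumes a: "a:cr P"
 shows "tsum (A a) (%p q. q*[A a](v a*[A a]S (iv a) (ph (iv a) (iv a) p))) (R (iv a) a) = w a"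
proof -
 let ?R = "R (iv a) a"
 have "tsum (A a) (%p q. q*[A a](v a*[A a]S (iv a) (ph (iv a) (iv a) p))) ?R
  = tsum (A a) (%p q. S (iv a) (S a q)*[A a](v a*[A a]S (iv a) (ph (iv a) (iv a) (S a (S (iv a) p))))) ?R"
  using a R_S2_sum[of "iv a" a "A a" "%p q. q*[A a](v a*[A a]S (iv a) (ph (iv a) (iv a) p))"] by (simp add: lin)
 also have "... = tsum (A a) (%p q. S (iv a) (p*[A (iv a)]S a q)*[A a]v a) ?R"
  using a by (intro Rs_cong) (auto simp: v_comm[symmetric] S_crossing S_mult A_assoc)
 also have "... = S (iv a) (tsum (A (iv a)) (%p q. p*[A (iv a)]S a q) ?R)*[A a]v a"
  using a by (simp add: Rsum_antipode Rs_multR)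
 also have "... = w a" using v_eq[of "iv a"] a S2_u[OF a] by (simp add: w_eq)
 finally show ?thesis .
qed

text \<open>The counterpart for invariant forms: the inner R-matrix has given u, and moving u to the
  right leaves the outer sum in the form of \<open>v_eq_cross\<close>.\<close>

lemma w_sum2:
 assumes a: "a:cr P"
 shows "tsum (A a) (%p q. S (iv a) (ph a (iv a) p)*[A a](u a*[A a]ph (iv a) a q)) (R (iv a) a) = w a"
proof -
 have "tsum (A a) (%p q. S (iv a) (ph a (iv a) p)*[A a](u a*[A a]ph (iv a) a q)) (R (iv a) a)
  = tsum (A a) (%p q. (S (iv a) (ph a (iv a) p)*[A a]S (iv a) (S a q))*[A a]u a) (R (iv a) a)"
  using a by (intro Rs_cong) (auto simp: u_comm A_assoc)
 also have "... = tsum (A a) (%p q. S (iv a) (ph a (iv a) p)*[A a]S (iv a) (S a q)) (R (iv a) a)*[A a]u a"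
  using a by (simp add: Rs_multR)
 finally show ?thesis using v_eq_cross[OF a] vu_eq[OF a] by simp
qed

lemma counit_w: "ep (w eP) = \<one>[K]"
proof -
 let ?A = "A eP"
 have 1: "eP:cr P" by simp
 have i: "iv eP = eP" by simp
 let ?f = "%x. ep x.*[?A]\<one>[?A]"
 have f: "lo K ?A ?A ?f" by (auto intro!: lin)
 have "?f (u eP) = tsum ?A (%p q. ?f (S eP q*[?A]p)) (R eP eP)"
  using u_eq[OF 1 HOL.refl] Rs_out[OF 1 1 _ _ f, of "%p q. S eP q*[?A]p"]
  by (simp add: i Rs_cong[OF 1 1, of "%p q. S eP (ph eP eP q)*[?A]p" "%p q. S eP q*[?A]p"])
 also have "... = tsum ?A (%p q. ep p.*[?A]?f q) (R eP eP)"
  by (intro Rs_cong) (auto simp: counit_antipode module.smult_assoc1[OF A_module,symmetric] m_comm i)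
 also have "... = ?f \<one>[?A]"
  using f by (intro R_counit_left_sum) auto
 finally have "?f (u eP) = \<one>[?A]" by simp
 moreover have "ep (?f x) = ep x" if "x:cr ?A" for x
  using that counit_hom unfolding linear_form_def by simp
 ultimately have "ep (u eP) = \<one>[K]" using u_closed[OF 1] by (metis counit_facts(2))
 then show ?thesis using u_closed[OF 1] by (simp add: w_eq i counit_antipode)
qed

end

section \<open>Finite-dimensional spaces and their tensor products\<close>

lemma fd_module [simp]: "fd_space K V ==> module K V"
 by (simp add: fd_space_def)

context vect_universe
begin

abbreviation "ts == tsp VV"
abbreviation "tp == tpure VV"

lemma ts_fd [simp]: "fd_space K V ==> fd_space K W ==> fd_space K (ts V W)"
 using tsp by blast

lemma bilinear_tp: "fd_space K V ==> fd_space K W ==> bo K V W (ts V W) (tp V W)"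
 using tsp unfolding is_tensor_product_def by blast

lemma tp_closed [simp]:
 "fd_space K V ==> fd_space K W ==> v:cr V ==> w:cr W ==> tp V W v w:cr (ts V W)"
 using bo_closed[OF bilinear_tp] .

lemma linear_tp_left [lin]:
 "fd_space K V ==> fd_space K W ==> lo K U V f ==> w:cr W
  ==> lo K U (ts V W) (%u. tp V W (f u) w)"
 by (rule bilinear_left[OF bilinear_tp])

lemma linear_tp_right [lin]:
 "fd_space K V ==> fd_space K W ==> lo K U W f ==> v:cr V
  ==> lo K U (ts V W) (%u. tp V W v (f u))"
 by (rule bilinear_right[OF bilinear_tp])

lemma tp_smult:
 assumes "fd_space K V" "fd_space K W" "v:cr V" "w:cr W" "a:cr K"
 shows "tp V W (a.*[V]v) w = a.*[ts V W]tp V W v w"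
  and "tp V W v (a.*[W]w) = a.*[ts V W]tp V W v w"
 using lo_smult[OF boD(1)[OF bilinear_tp]] lo_smult[OF boD(2)[OF bilinear_tp]] assms
 by auto

context
 fixes V W X :: "('k, 'u) module" and B
 assumes V: "fd_space K V" and W: "fd_space K W" and X: "module K X" and B: "bo K V W X B"
begin

lemma tlift_unique:
 "\<exists>!f. f:extensional (cr (ts V W)) & lo K (ts V W) X f &
    (\<forall>v\<in>cr V. \<forall>w\<in>cr W. f (tp V W v w) = B v w)"
 using tsp[OF V W] X B unfolding is_tensor_product_def by blast

lemma tlift_pr:
 "tlift K VV V W X B:extensional (cr (ts V W))"
 "lo K (ts V W) X (tlift K VV V W X B)"
 "v:cr V ==> w:cr W ==> tlift K VV V W X B (tp V W v w) = B v w"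
 using theI'[OF tlift_unique] unfolding tlift_def by blast+

end

lemma linear_tlift [lin]:
 assumes "fd_space K V" "fd_space K W" "module K X" "lo K U (ts V W) f" "bo K V W X B"
 shows "lo K U X (%u. tlift K VV V W X B (f u))"
 using lo_compose[OF assms(4) tlift_pr(2)[OF assms(1-3,5)]] .

text \<open>The universal property speaks of extensional maps into targets of the same universe.
  Both maps, restricted to the carrier, are the lift of one bilinear map.\<close>

lemma ts_ext:
 fixes X :: "('k, 'u) module"
 assumes V: "fd_space K V" and W: "fd_space K W" and X: "module K X"
  and f: "lo K (ts V W) X f" and g: "lo K (ts V W) X g"
  and eq: "!!v w. v:cr V ==> w:cr W ==> f (tp V W v w) = g (tp V W v w)"
  and z: "z:cr (ts V W)"
 shows "f z = g z"
proof -
 let ?T = "ts V W"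
 have T: "module K ?T" using V W by simp
 let ?B = "%v w. f (tp V W v w)"
 have B: "bo K V W X ?B"
  using V W lo_compose[OF _ f] by (intro boI) (auto intro!: lin)
 have q: "h = tlift K VV V W X ?B"
  if "h:extensional (cr ?T)" "lo K ?T X h" "!!v w. v:cr V ==> w:cr W ==> h (tp V W v w) = ?B v w" for h
  unfolding tlift_def by (rule the1_equality[OF tlift_unique[OF V W X B], symmetric]) (use that in blast)
 have "restrict f (cr ?T) = tlift K VV V W X ?B"
  using V W f lo_cong[OF _ T, of "restrict f (cr ?T)" f X] by (intro q) auto
 moreover have "restrict g (cr ?T) = tlift K VV V W X ?B"
  using V W g lo_cong[OF _ T, of "restrict g (cr ?T)" g X] eq by (intro q) auto
 ultimately show ?thesis using z by (metis restrict_apply')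
qed

lemma ts_ext3:
 fixes X :: "('k, 'u) module"
 assumes U: "fd_space K U" and V: "fd_space K V" and W: "fd_space K W" and X: "module K X"
  and f: "lo K (ts (ts U V) W) X f" and g: "lo K (ts (ts U V) W) X g"
  and eq: "!!u v w. u:cr U ==> v:cr V ==> w:cr W
   ==> f (tp (ts U V) W (tp U V u v) w) = g (tp (ts U V) W (tp U V u v) w)"
  and z: "z:cr (ts (ts U V) W)"
 shows "f z = g z"
proof (rule ts_ext[OF _ W X f g _ z])
 fix x w assume x: "x:cr (ts U V)" and w: "w:cr W"
 show "f (tp (ts U V) W x w) = g (tp (ts U V) W x w)"
  by (rule ts_ext[OF U V X _ _ _ x, of "%x. f (tp (ts U V) W x w)" "%x. g (tp (ts U V) W x w)"])
   (use U V W w eq in \<open>auto intro!: lin lo_compose[OF _ f] lo_compose[OF _ g]\<close>)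
qed (use U V in simp)

lemma ts_ext3':
 fixes X :: "('k, 'u) module"
 assumes U: "fd_space K U" and V: "fd_space K V" and W: "fd_space K W" and X: "module K X"
  and f: "lo K (ts U (ts V W)) X f" and g: "lo K (ts U (ts V W)) X g"
  and eq: "!!u v w. u:cr U ==> v:cr V ==> w:cr W
   ==> f (tp U (ts V W) u (tp V W v w)) = g (tp U (ts V W) u (tp V W v w))"
  and z: "z:cr (ts U (ts V W))"
 shows "f z = g z"
proof (rule ts_ext[OF U _ X f g _ z])
 fix u x assume x: "x:cr (ts V W)" and u: "u:cr U"
 show "f (tp U (ts V W) u x) = g (tp U (ts V W) u x)"
  by (rule ts_ext[OF V W X _ _ _ x, of "%x. f (tp U (ts V W) u x)" "%x. g (tp U (ts V W) u x)"])
   (use U V W u eq in \<open>auto intro!: lin lo_compose[OF _ f] lo_compose[OF _ g]\<close>)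
qed (use V W in simp)

lemma ts_ext4:
 fixes X :: "('k, 'u) module"
 assumes U: "fd_space K U" and V: "fd_space K V" and W: "fd_space K W" and Y: "fd_space K Y" and X: "module K X"
  and f: "lo K (ts (ts (ts U V) W) Y) X f" and g: "lo K (ts (ts (ts U V) W) Y) X g"
  and eq: "!!u v w y. u:cr U ==> v:cr V ==> w:cr W ==> y:cr Y
   ==> f (tp (ts (ts U V) W) Y (tp (ts U V) W (tp U V u v) w) y)
    = g (tp (ts (ts U V) W) Y (tp (ts U V) W (tp U V u v) w) y)"
  and z: "z:cr (ts (ts (ts U V) W) Y)"
 shows "f z = g z"
proof (rule ts_ext[OF _ Y X f g _ z])
 let ?t = "ts (ts U V) W"
 fix x y assume x: "x:cr ?t" and y: "y:cr Y"
 show "f (tp ?t Y x y) = g (tp ?t Y x y)"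
  by (rule ts_ext3[OF U V W X _ _ _ x, of "%x. f (tp ?t Y x y)" "%x. g (tp ?t Y x y)"])
   (use U V W Y y eq in \<open>auto intro!: lin lo_compose[OF _ f] lo_compose[OF _ g]\<close>)
qed (use U V W in simp)

subsection \<open>The ground field\<close>

abbreviation "kk == usp VV"
abbreviation "uc == ucoeff K VV"
abbreviation "g1 == ugen VV"

lemma kk_fd [simp]: "fd_space K kk" and g1_closed [simp]: "g1:cr kk"
 using usp by auto

lemma uc_props:
 assumes "x:cr kk"
 shows "uc x:cr K" and "uc x.*[kk]g1 = x"
 using theI'[of "%a. a:cr K & x = a.*[kk]g1"] usp assms unfolding ucoeff_def by auto

lemma uc_unique [simp]: "a:cr K ==> uc (a.*[kk]g1) = a"
proof -
 assume a: "a:cr K"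
 interpret kk: module K kk by simp
 have "\<exists>!b. b:cr K & a.*[kk]g1 = b.*[kk]g1" using usp a by simp
 then show ?thesis unfolding ucoeff_def by (rule the1_equality) (use a in simp)
qed

lemma uc_g1 [simp]: "uc g1 = \<one>[K]"
 using uc_unique[of "\<one>[K]"] module.smult_one[OF fd_module[OF kk_fd] g1_closed] by simp

lemma uc_linear_form: "linear_form K kk uc"
proof -
 interpret kk: module K kk by simp
 have "uc (x+[kk]y) = uc x+[K]uc y" if "x:cr kk" "y:cr kk" for x y
  using uc_unique[of "uc x+[K]uc y"] uc_props that by (simp add: kk.smult_l_distr)
 moreover have "uc (a.*[kk]x) = a*[K]uc x" if "a:cr K" "x:cr kk" for a x
  using uc_unique[of "a*[K]uc x"] uc_props that by (simp add: kk.smult_assoc1)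
 ultimately show ?thesis using uc_props unfolding linear_form_def by auto
qed

lemma linear_uc [lin]:
 assumes "module K W" "lo K U kk f" "w:cr W"
 shows "lo K U W (%x. uc (f x).*[W]w)"
 by (rule lo_compose[OF assms(2) lo_form_smult[OF assms(1,3) uc_linear_form]])

subsection \<open>Dual spaces and dual bases\<close>

abbreviation "ds == dsp VV"
abbreviation "pr == pairing VV"

lemma ds_fd [simp]: "fd_space K V ==> fd_space K (ds V)"
 by (rule dsp)

lemma pr_closed [simp]:
 "fd_space K V ==> f:cr (ds V) ==> x:cr V ==> pr V f x:cr K"
 using pairing_form unfolding linear_form_def by blast

lemma pr_lin:
 assumes "fd_space K V" "f:cr (ds V)" "x:cr V"
 shows "y:cr V ==> pr V f (x+[V]y) = pr V f x+[K]pr V f y"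
  and "a:cr K ==> pr V f (a.*[V]x) = a*[K]pr V f x"
  and "g:cr (ds V) ==> pr V (f+[ds V]g) x = pr V f x+[K]pr V g x"
  and "a:cr K ==> pr V (a.*[ds V]f) x = a*[K]pr V f x"
 using pairing_form[OF assms(1,2)] pairing_linear[OF assms(1,3)] assms unfolding linear_form_def by auto

lemma ds_ext:
 assumes "fd_space K V" "f:cr (ds V)" "g:cr (ds V)"
  "!!x. x:cr V ==> pr V f x = pr V g x"
 shows "f = g"
 using pairing_bij[OF assms(1) pairing_form[OF assms(1,2)]] assms by metis

lemma linear_pr_left [lin]:
 assumes "module K W" "fd_space K V" "lo K U (ds V) f" "x:cr V" "w:cr W"
 shows "lo K U W (%u. pr V (f u) x.*[W]w)"
 using lo_compose[OF assms(3) lo_form_smult[OF assms(1,5) pairing_linear[OF assms(2,4)]]] .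

lemma linear_pr_right [lin]:
 assumes "module K W" "fd_space K V" "lo K U V g" "f:cr (ds V)" "w:cr W"
 shows "lo K U W (%u. pr V f (g u).*[W]w)"
 using lo_compose[OF assms(3) lo_form_smult[OF assms(1,5) pairing_form[OF assms(2,4)]]] .

text \<open>\<open>fd_space\<close> supplies a finite spanning set. One of least cardinality is a
  basis; its coordinate functions are linear forms, and the pairing represents them in the chosen
  dual space.\<close>

lemma dual_bases_exist:
 assumes V: "fd_space K V"
 shows "\<exists>E e. dual_bases K VV V E e"
proof -
 interpret V: module K V using V by simp
 define sp where "sp E \<longleftrightarrow> finite E & E <= cr V & (\<forall>x\<in>cr V. \<exists>a\<in>E \<rightarrow> cr K. x = (\<Oplus>\<^bsub>V\<^esub>e\<in>E. a e.*[V]e))" for E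
 obtain E\<^sub>0 where "sp E\<^sub>0" using V unfolding sp_def fd_space_def by blast
 then obtain E where E: "sp E" and min: "!!F. sp F ==> card E \<le> card F"
  using ex_has_least_nat[of sp E\<^sub>0 card] by blast
 have Ef: "finite E" and Ec: "E <= cr V" using E by (auto simp: sp_def)
 let ?s = "%a. \<Oplus>\<^bsub>V\<^esub>e\<in>E. a e.*[V]e"
 have scl: "(%e. a e.*[V]e):E \<rightarrow> cr V" if "a:E \<rightarrow> cr K" for a using that Ec by auto
 have comb: "?s (%e. a e+[K]c*[K]b e) = ?s a+[V]c.*[V]?s b" if "a:E \<rightarrow> cr K" "b:E \<rightarrow> cr K" "c:cr K" for a b c
 proof -
  have "?s (%e. a e+[K]c*[K]b e) = (\<Oplus>\<^bsub>V\<^esub>e\<in>E. a e.*[V]e+[V]c.*[V](b e.*[V]e))"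
   using that Ec by (intro V.M.finsum_cong') (auto simp: V.smult_l_distr V.smult_assoc1 Pi_iff subset_iff)
  also have "... = ?s a+[V](\<Oplus>\<^bsub>V\<^esub>e\<in>E. c.*[V](b e.*[V]e))" using scl that by (intro V.M.finsum_addf) auto
  also have "(\<Oplus>\<^bsub>V\<^esub>e\<in>E. c.*[V](b e.*[V]e)) = c.*[V]?s b"
   using scl that V.module_axioms
   by (intro lo_finsum_out[OF _ _ lo_smult_left[OF V.module_axioms that(3) lo_id], symmetric]) auto
  finally show ?thesis .
 qed
 have indep: "\<forall>e\<in>E. a e = \<zero>[K]" if a: "a:E \<rightarrow> cr K" and z: "?s a = \<zero>[V]" for a
 proof (rule ccontr)
  assume "\<not> (\<forall>e\<in>E. a e = \<zero>[K])"
  then obtain f where f: "f:E" "a f ~= \<zero>[K]" by blast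
  have fu: "inv\<^bsub>K\<^esub> a f:cr K" "inv\<^bsub>K\<^esub> a f*[K]a f = \<one>[K]"
   using f a field_Units by (auto simp: Pi_iff)
  let ?F = "E - {f}"
  have "\<exists>c\<in>?F \<rightarrow> cr K. x = (\<Oplus>\<^bsub>V\<^esub>e\<in>?F. c e.*[V]e)" if x: "x:cr V" for x
  proof -
   obtain b where b: "b:E \<rightarrow> cr K" "x = ?s b" using E x unfolding sp_def by blast
   \<comment> \<open>A multiple of the relation a is subtracted so that the coefficient of f
     vanishes; x is then a combination of the smaller set, against minimality.\<close>
   let ?c = "%e. b e+[K](\<ominus>\<^bsub>K\<^esub> (b f*[K]inv\<^bsub>K\<^esub> a f))*[K]a e"
   have bf: "b f:cr K" "a f:cr K" using a b f by auto
   have c: "?c:E \<rightarrow> cr K" using a b f fu bf by (auto simp: Pi_iff)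
   have "?c f = \<zero>[K]"
   proof -
    have "b f*[K]inv\<^bsub>K\<^esub> a f*[K]a f = b f" using bf fu m_assoc by simp
    then show ?thesis using bf fu by (simp add: l_minus r_neg)
   qed
   moreover have "?s ?c = x+[V](\<ominus>\<^bsub>K\<^esub> (b f*[K]inv\<^bsub>K\<^esub> a f)).*[V]?s a"
    using a b bf fu by (subst comb) auto
   then have "?s ?c = x" using z x bf fu by simp
   moreover have "?s ?c = ?c f.*[V]f+[V](\<Oplus>\<^bsub>V\<^esub>e\<in>?F. ?c e.*[V]e)"
    using V.M.finsum_insert[of ?F f "%e. ?c e.*[V]e"] Ef scl[OF c] f insert_Diff[OF f(1)] by auto
   moreover have "(\<Oplus>\<^bsub>V\<^esub>e\<in>?F. ?c e.*[V]e):cr V" using scl[OF c] by (intro V.M.finsum_closed) auto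
   ultimately have "x = (\<Oplus>\<^bsub>V\<^esub>e\<in>?F. ?c e.*[V]e)" using f Ec by auto
   then show ?thesis using c by (intro bexI[of _ ?c]) auto
  qed
  then have "card E \<le> card ?F" using Ef Ec by (intro min) (auto simp: sp_def)
  then show False using f Ef card_Diff1_less by fastforce
 qed
 have uniq: "\<forall>e\<in>E. a e = b e" if "a:E \<rightarrow> cr K" "b:E \<rightarrow> cr K" "?s a = ?s b" for a b
 proof -
  let ?m = "\<ominus>\<^bsub>K\<^esub> \<one>[K]"
  have m: "?m:cr K" by simp
  have "?s (%e. a e+[K]?m*[K]b e) = ?s b+[V]?m.*[V]?s b"
   using that by (subst comb) auto
  also have "... = \<zero>[V]"
  proof -
   have "?s b:cr V" using scl that by (intro V.M.finsum_closed) auto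
   then show ?thesis by (simp add: V.smult_l_minus V.M.r_neg)
  qed
  finally have ab: "\<forall>e\<in>E. a e+[K]?m*[K]b e = \<zero>[K]" using that by (intro indep) auto
  have m2: "x = y" if "x:cr K" "y:cr K" "x+[K]?m*[K]y = \<zero>[K]" for x y
   using that by (metis l_minus l_one minus_equality minus_minus one_closed add.inv_closed a_comm)
  show ?thesis
  proof
   fix e assume e: "e:E"
   show "a e = b e" using PiE[OF that(1),of e] PiE[OF that(2),of e] ab e by - (rule m2, auto)
  qed
 qed
 define co where "co x = (SOME a. a:E \<rightarrow> cr K & x = ?s a)" for x
 have co: "co x:E \<rightarrow> cr K" "?s (co x) = x" if x: "x:cr V" for x
 proof -
  have "\<exists>a. a:E \<rightarrow> cr K & x = ?s a" using E x unfolding sp_def by blast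
  then have "co x:E \<rightarrow> cr K & x = ?s (co x)" unfolding co_def by (rule someI_ex)
  then show "co x:E \<rightarrow> cr K" "?s (co x) = x" by simp_all
 qed
 have cc: "co x e:cr K" if "x:cr V" "e:E" for x e using co(1)[OF that(1)] that(2) by auto
 have L: "co (x+[V]c.*[V]y) e = co x e+[K]c*[K]co y e" if "x:cr V" "y:cr V" "c:cr K" "e:E" for x y c e
 proof -
  note x = co[OF that(1)] and y = co[OF that(2)]
  have z: "x+[V]c.*[V]y:cr V" using that by simp
  have "?s (co (x+[V]c.*[V]y)) = ?s (%e. co x e+[K]c*[K]co y e)"
   by (simp only: comb[OF x(1) y(1) that(3)] x(2) y(2) co(2)[OF z])
  moreover have "(%e. co x e+[K]c*[K]co y e):E \<rightarrow> cr K" using cc that by simp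
  ultimately show ?thesis using uniq[OF co(1)[OF z]] that(4) by blast
 qed
 have form: "linear_form K V (%x. co x e)" if e: "e:E" for e
  unfolding linear_form_def
 proof (intro conjI ballI funcsetI)
  have z: "co \<zero>[V] e = \<zero>[K]" using indep[OF co(1), of "\<zero>[V]"] co(2)[of "\<zero>[V]"] e by simp
  show "x:cr V ==> y:cr V ==> co (x+[V]y) e = co x e+[K]co y e" for x y
   using L[of x y "\<one>[K]" e] e cc[of y e] by simp
  show "a:cr K ==> x:cr V ==> co (a.*[V]x) e = a*[K]co x e" for a x
   using L[of "\<zero>[V]" x a e] e z cc[of x e] by simp
 qed (use cc e in auto)
 define f where "f e = (SOME f. f:cr (ds V) & (\<forall>x\<in>cr V. pr V f x = co x e))" for e
 have f: "f e:cr (ds V)" "!!x. x:cr V ==> pr V (f e) x = co x e" if "e:E" for e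
  using someI_ex[of "%f. f:cr (ds V) & (\<forall>x\<in>cr V. pr V f x = co x e)"]
   pairing_bij[OF V form[OF that]] unfolding f_def by blast+
 have "dual_bases K VV V E f"
  unfolding dual_bases_def
 proof (intro conjI ballI)
  show "f:E \<rightarrow> cr (ds V)" using f by auto
  fix x assume x: "x:cr V"
  have "(\<Oplus>\<^bsub>V\<^esub>y\<in>E. pr V (f y) x.*[V]y) = ?s (co x)"
   using f co[OF x] x Ec by (intro V.M.finsum_cong') (auto simp: Pi_iff subset_iff)
  then show "x = (\<Oplus>\<^bsub>V\<^esub>y\<in>E. pr V (f y) x.*[V]y)" using co[OF x] by simp
 next
  fix x y assume xy: "x:E" "y:E"
  let ?d = "%e. if e = y then \<one>[K] else \<zero>[K]"
  have "?s ?d = (\<Oplus>\<^bsub>V\<^esub>e\<in>E. if y = e then e else \<zero>[V])"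
   using Ec by (intro V.M.finsum_cong') auto
  also have "... = y" using V.M.finsum_singleton[OF xy(2) Ef, of "%e. e"] Ec by auto
  finally have "\<forall>e\<in>E. co y e = ?d e" using co xy Ec by (intro uniq) auto
  then show "pr V (f x) y = (if x = y then \<one>[K] else \<zero>[K])" using f xy Ec by auto
 qed (use Ef Ec in auto)
 then show ?thesis by blast
qed

end

section \<open>The category of finite-dimensional modules\<close>

context tensor_category
begin

lemma hom_set_Ob: "f:hom_set C U V ==> U:Ob C & V:Ob C"
 using dom_cod by (auto simp: hom_set_def)

lemma inverse_arrows_unique:
 assumes "inverse_arrows C f g" "inverse_arrows C f g'"
 shows "g = g'"
proof -
 have f: "f:hom_set C (Dom C f) (Cod C f)" using assms by (simp add: inverse_arrows_def hom_set_def)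
 have g: "g:hom_set C (Cod C f) (Dom C f)" "g':hom_set C (Cod C f) (Dom C f)"
  using assms by (auto simp: inverse_arrows_def)
 have "g = g \<bullet> (f \<bullet> g')" using assms comp_id[OF g(1)] by (simp add: inverse_arrows_def)
 also have "... = (g \<bullet> f) \<bullet> g'" using comp_assoc[OF g(2) f g(1)] by simp
 also have "... = g'" using assms comp_id[OF g(2)] by (simp add: inverse_arrows_def)
 finally show ?thesis .
qed

lemma inv_ar_eq: "inverse_arrows C f g ==> inv_ar C f = g"
 unfolding inv_ar_def using inverse_arrows_unique by blast

lemma inv_inv: "is_iso C f ==> inverse_arrows C f (inv_ar C f)"
 using inv_ar_eq by (auto simp: is_iso_def)

end

section \<open>Modules over a quasitriangular T-coalgebra and their morphisms\<close>

locale qt_rep = quasitriangular_T_coalgebra P K H + vect_universe K VV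
 for P :: "('g, 'm) monoid_scheme" and K :: "('k, 'c) ring_scheme"
  and H :: "('g, 'k, 'h, 'z) qt_tcoalg_scheme" and VV :: "('k, 'u) vect_choice"
begin

abbreviation "hm == is_hmod P K H"
abbreviation "hl == hmod_linear K H"
abbreviation "RC == Rep P K VV H"
abbreviation (input) comp_RC (infixr "oR" 55) where "g oR f == g\<bullet>[RC]f"
abbreviation "rh == hom_set RC"
abbreviation "rj == conj_ar RC"
abbreviation "ri == Id RC"
abbreviation "rv == inv_ar RC"
abbreviation "mt == rep_tens P K VV H"
abbreviation "mp M N == tpure VV (sp M) (sp N)"
abbreviation "ms M N == tsp VV (sp M) (sp N)"

lemma hmD [simp]:
 assumes "hm M"
 shows "gr M:cr P" "fd_space K (sp M)"
  "x:elts M ==> act M \<one>[A (gr M)] x = x"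
  "g = gr M ==> h:cA g ==> x:elts M ==> act M h x:elts M"
proof -
 show "gr M:cr P" "fd_space K (sp M)" "x:elts M ==> act M \<one>[A (gr M)] x = x"
  using assms unfolding is_hmod_def Let_def by blast+
 have "bo K (A (gr M)) (sp M) (sp M) (act M)"
  using assms unfolding is_hmod_def Let_def by blast
 then show "g = gr M ==> h:cA g ==> x:elts M ==> act M h x:elts M"
  using bo_closed by metis
qed

lemma hm_module [simp]: "hm M ==> module K (sp M)" by simp

lemma act_bilinear: "hm M ==> bo K (A (gr M)) (sp M) (sp M) (act M)"
 unfolding is_hmod_def Let_def by blast

lemma act_mult:
 "hm M ==> g = gr M ==> h:cA g ==> k:cA g ==> x:elts M
  ==> act M (h*[A g]k) x = act M h (act M k x)"
 unfolding is_hmod_def Let_def by blast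

lemma act_ext: "hm M ==> act M:extensional (cA (gr M))"
 "hm M ==> h:cA (gr M) ==> act M h:extensional (elts M)"
 unfolding is_hmod_def Let_def by blast+

lemma linear_act_left [lin]:
 "hm M ==> g = gr M ==> lo K U (A g) f ==> x:elts M ==> lo K U (sp M) (%u. act M (f u) x)"
 by hypsubst (rule bilinear_left[OF act_bilinear])

lemma linear_act_right [lin]:
 "hm M ==> lo K U (sp M) f ==> g = gr M ==> h:cA g ==> lo K U (sp M) (%u. act M h (f u))"
 by hypsubst (rule bilinear_right[OF act_bilinear])

lemma linear_act: "hm M ==> h:cA (gr M) ==> lo K (sp M) (sp M) (act M h)"
 by (rule boD(1)[OF act_bilinear])

lemma hmodI:
 assumes "gr M:cr P" "fd_space K (sp M)" "g = gr M"
  "!!h. h:cA g ==> lo K (sp M) (sp M) (act M h)"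
  "!!x. x:elts M ==> lo K (A g) (sp M) (%h. act M h x)"
  "!!h k x. h:cA g ==> k:cA g ==> x:elts M
   ==> act M (h*[A g]k) x = act M h (act M k x)"
  "!!x. x:elts M ==> act M \<one>[A g] x = x"
  "act M:extensional (cA g)"
  "!!h. h:cA g ==> act M h:extensional (elts M)"
 shows "hm M"
proof -
 have "bo K (A (gr M)) (sp M) (sp M) (act M)"
  using assms(3-5) by (intro boI) auto
 then show ?thesis using assms unfolding is_hmod_def Let_def by blast
qed

text \<open>The axioms of a T-category ask for equalities of objects under conjugation, so modules
  are compared as records and not up to isomorphism. Extensionality of the actions makes this
  possible.\<close>

lemma hmod_eqI:
 fixes M N :: "('g, 'k, 'h, 'u) hmod"
 assumes "gr M = gr N" "sp M = sp N" "g = gr N"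
  "act M:extensional (cA g)" "act N:extensional (cA g)"
  "!!h. h:cA g ==> act M h:extensional (elts N)"
  "!!h. h:cA g ==> act N h:extensional (elts N)"
  "!!h x. h:cA g ==> x:elts N ==> act M h x = act N h x"
 shows "M = N"
proof -
 have "act M = act N"
 proof (rule extensionalityI[OF assms(4,5)])
  fix h assume h: "h:cA g"
  show "act M h = act N h"
   by (rule extensionalityI[OF assms(6)[OF h] assms(7)[OF h] assms(8)[OF h]])
 qed
 then show ?thesis using assms by (cases M, cases N) simp
qed

lemma hmod_linearD:
 assumes "hl M N f"
 shows "gr M = gr N" "f:extensional (elts M)" "lo K (sp M) (sp N) f"
  "x:elts M ==> f x:elts N"
  "g = gr M ==> h:cA g ==> x:elts M ==> f (act M h x) = act N h (f x)"
 using assms by (auto simp: hmod_linear_def dest: lo_closed)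

lemma Rep_simps [simp]:
 "Ob RC = {M. hm M}" "Dom RC = adom" "Cod RC = acod"
 "Id RC M = Arr M M (\<lambda>x\<in>elts M. x)"
 "g\<bullet>[RC]f = Arr (adom f) (acod g) (compose (elts (adom f)) (amap g) (amap f))"
 "M**[RC]N = mt M N" "f***[RC]g = rep_tens_ar P K VV H f g"
 "\<I>[RC] = rep_unit P VV H" "assoc RC = rep_assoc P K VV H"
 "lunit RC = rep_lunit P K VV H" "runit RC = rep_runit P K VV H"
 "Deg RC = gr" "conj_ob RC = rep_conj P H"
 "conj_ar RC b f = Arr (rep_conj P H b (adom f)) (rep_conj P H b (acod f)) (amap f)"
 "braid RC = rep_braid P K VV H"
 by (simp_all add: Rep_def)

lemma Rep_hom_iff:
 "f:hom_set RC M N \<longleftrightarrow> hm M & hm N & adom f = M & acod f = N & hl M N (amap f)"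
 by (cases f) (auto simp: hom_set_def Rep_def)

lemma Rep_Ar_iff: "f:Ar RC \<longleftrightarrow> hm (adom f) & hm (acod f) & hl (adom f) (acod f) (amap f)"
 by (cases f) (auto simp: Rep_def)

lemma Rep_homD:
 assumes "f:hom_set RC M N"
 shows "hm M" "hm N" "adom f = M" "acod f = N" "hl M N (amap f)" "gr M = gr N"
  "lo K (sp M) (sp N) (amap f)"
  "x:elts M ==> amap f x:elts N"
  "g = gr M ==> h:cA g ==> x:elts M ==> amap f (act M h x) = act N h (amap f x)"
proof -
 have hl: "hl M N (amap f)" and *: "hm M" "hm N" "adom f = M" "acod f = N" using assms unfolding Rep_hom_iff by auto
 show "hm M" "hm N" "adom f = M" "acod f = N" "hl M N (amap f)" by fact+
 show "gr M = gr N" "lo K (sp M) (sp N) (amap f)"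
  "x:elts M ==> amap f x:elts N"
  "g = gr M ==> h:cA g ==> x:elts M ==> amap f (act M h x) = act N h (amap f x)"
  using hmod_linearD[OF hl] by blast+
qed

lemma lo_amap [lin]:
 "f:hom_set RC M N ==> lo K U (sp M) g ==> lo K U (sp N) (%u. amap f (g u))"
 using lo_compose Rep_homD(7) by blast

lemma Rep_ar_eqI:
 assumes "f:hom_set RC M N" "g:hom_set RC M N" "!!x. x:elts M ==> amap f x = amap g x"
 shows "f = g"
 using assms unfolding Rep_hom_iff hmod_linear_def
 by (intro arr.expand) (auto intro: extensionalityI)

lemma mt_simps [simp]:
 "gr (mt M N) = gr M*[P]gr N" "sp (mt M N) = ms M N"
 by (simp_all add: rep_tens_def Let_def)

lemma Rep_ar_eq2I:
 assumes "f:hom_set RC (mt M N) X" "g:hom_set RC (mt M N) X" "hm M" "hm N"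
  "!!x y. x:elts M ==> y:elts N ==> amap f (mp M N x y) = amap g (mp M N x y)"
 shows "f = g"
proof (rule Rep_ar_eqI[OF assms(1,2)])
 note f = assms(1) and g = assms(2)
 fix x assume x: "x:elts (mt M N)"
 show "amap f x = amap g x"
  by (rule ts_ext[OF hmD(2)[OF assms(3)] hmD(2)[OF assms(4)] hm_module[OF Rep_homD(2)[OF f]]
     Rep_homD(7)[OF f,unfolded mt_simps] Rep_homD(7)[OF g,unfolded mt_simps] assms(5)[unfolded mt_simps] x[unfolded mt_simps]])
qed

lemma Rep_ar_eq3I:
 assumes "f:hom_set RC (mt (mt L M) N) X" "g:hom_set RC (mt (mt L M) N) X" "hm L" "hm M" "hm N"
  "!!x y z. x:elts L ==> y:elts M ==> z:elts N
   ==> amap f (mp (mt L M) N (mp L M x y) z) = amap g (mp (mt L M) N (mp L M x y) z)"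
 shows "f = g"
proof (rule Rep_ar_eqI[OF assms(1,2)])
 note f = assms(1) and g = assms(2)
 fix x assume x: "x:elts (mt (mt L M) N)"
 show "amap f x = amap g x"
  by (rule ts_ext3[OF hmD(2)[OF assms(3)] hmD(2)[OF assms(4)] hmD(2)[OF assms(5)] hm_module[OF Rep_homD(2)[OF f]]
     Rep_homD(7)[OF f,unfolded mt_simps] Rep_homD(7)[OF g,unfolded mt_simps] assms(6)[unfolded mt_simps] x[unfolded mt_simps]])
qed

lemma Rep_ar_eq3I':
 assumes "f:hom_set RC (mt L (mt M N)) X" "g:hom_set RC (mt L (mt M N)) X" "hm L" "hm M" "hm N"
  "!!x y z. x:elts L ==> y:elts M ==> z:elts N
   ==> amap f (mp L (mt M N) x (mp M N y z)) = amap g (mp L (mt M N) x (mp M N y z))"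
 shows "f = g"
proof (rule Rep_ar_eqI[OF assms(1,2)])
 note f = assms(1) and g = assms(2)
 fix x assume x: "x:elts (mt L (mt M N))"
 show "amap f x = amap g x"
  by (rule ts_ext3'[OF hmD(2)[OF assms(3)] hmD(2)[OF assms(4)] hmD(2)[OF assms(5)] hm_module[OF Rep_homD(2)[OF f]]
     Rep_homD(7)[OF f,unfolded mt_simps] Rep_homD(7)[OF g,unfolded mt_simps] assms(6)[unfolded mt_simps] x[unfolded mt_simps]])
qed

lemma Rep_ar_eq4I:
 assumes "f:hom_set RC (mt (mt (mt L M) N) Q) X" "g:hom_set RC (mt (mt (mt L M) N) Q) X"
  "hm L" "hm M" "hm N" "hm Q"
  "!!x y z v. x:elts L ==> y:elts M ==> z:elts N ==> v:elts Q
   ==> amap f (mp (mt (mt L M) N) Q (mp (mt L M) N (mp L M x y) z) v)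
    = amap g (mp (mt (mt L M) N) Q (mp (mt L M) N (mp L M x y) z) v)"
 shows "f = g"
proof (rule Rep_ar_eqI[OF assms(1,2)])
 note f = assms(1) and g = assms(2)
 fix x assume x: "x:elts (mt (mt (mt L M) N) Q)"
 show "amap f x = amap g x"
  by (rule ts_ext4[OF hmD(2)[OF assms(3)] hmD(2)[OF assms(4)] hmD(2)[OF assms(5)] hmD(2)[OF assms(6)] hm_module[OF Rep_homD(2)[OF f]]
     Rep_homD(7)[OF f,unfolded mt_simps] Rep_homD(7)[OF g,unfolded mt_simps] assms(7)[unfolded mt_simps] x[unfolded mt_simps]])
qed

subsection \<open>Tensor products of modules\<close>

text \<open>The operator by which an element of H_\<alpha> \<otimes> H_\<beta> acts on M \<otimes>
  N. The module structure uses it at \<Delta>(h), the braiding at R, the inverse braiding at R^-1;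
  multiplicativity in t serves all three.\<close>

definition top :: "('g, 'k, 'h, 'u) hmod => ('g, 'k, 'h, 'u) hmod => ('h \<times> 'h) list set => 'u => 'u" where
 "top M N t = tlift K VV (sp M) (sp N) (ms M N)
   (%x y. tsum (ms M N) (%a b. mp M N (act M a x) (act N b y)) t)"

abbreviation "AA M N == tensor K (A (gr M)) (A (gr N))"

context
 fixes M N :: "('g, 'k, 'h, 'u) hmod" assumes M [simp]: "hm M" and N [simp]: "hm N"
begin

lemma ms_fd [simp]: "fd_space K (ms M N)" by simp

lemma linear_tsum_AA [lin]:
 "t:cr (AA M N) ==> module K X ==>
  (!!x y. x:cA (gr M) ==> y:cA (gr N) ==> lo K U X (%u. B u x y))
  ==> lo K U X (%u. tsum X (B u) t)"
 by (rule lo_tsum[of K "A (gr M)" "A (gr N)"]) auto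

lemma top_bilinear:
 "t:cr (AA M N) ==> bo K (sp M) (sp N) (ms M N)
   (%x y. tsum (ms M N) (%a b. mp M N (act M a x) (act N b y)) t)"
 by (intro boI linear_tsum_AA) (auto intro!: lin)

lemma top_act_bilinear:
 "x:elts M ==> y:elts N ==> bo K (A (gr M)) (A (gr N)) (ms M N) (%a b. mp M N (act M a x) (act N b y))"
 by (auto intro!: lin)

lemma top_pure:
 "t:cr (AA M N) ==> x:elts M ==> y:elts N ==>
  top M N t (mp M N x y) = tsum (ms M N) (%a b. mp M N (act M a x) (act N b y)) t"
 unfolding top_def by (rule tlift_pr) (auto intro!: top_bilinear)

lemma top_linear: "t:cr (AA M N) ==> lo K (ms M N) (ms M N) (top M N t)"
 unfolding top_def by (rule tlift_pr) (auto intro!: top_bilinear)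

lemma top_ext: "t:cr (AA M N) ==> top M N t:extensional (cr (ms M N))"
 unfolding top_def by (rule tlift_pr) (auto intro!: top_bilinear)

lemma top_closed [simp]: "t:cr (AA M N) ==> z:cr (ms M N) ==> top M N t z:cr (ms M N)"
 using lo_closed[OF top_linear] .

lemma linear_top_left:
 assumes z: "z:cr (ms M N)"
 shows "lo K (AA M N) (ms M N) (%t. top M N t z)"
proof (rule loI)
 interpret T: module K "AA M N" by (simp add: mod_tensor)
 interpret X: module K "ms M N" by simp
 fix t s assume t: "t:cr (AA M N)" and s: "s:cr (AA M N)"
 show "top M N (t+[AA M N]s) z = top M N t z+[ms M N]top M N s z"
 proof (rule ts_ext[OF _ _ _ _ _ _ z, where f = "top M N (t+[AA M N]s)"])
  fix v w assume *: "v:elts M" "w:elts N"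
  show "top M N (t+[AA M N]s) (mp M N v w) = top M N t (mp M N v w)+[ms M N]top M N s (mp M N v w)"
   using t s * lo_add[OF lo_tsum_tensor[OF _ _ _ top_act_bilinear[OF *]]] by (simp add: top_pure)
 qed (use t s in \<open>auto intro!: top_linear lo_plus\<close>)
next
 interpret T: module K "AA M N" by (simp add: mod_tensor)
 interpret X: module K "ms M N" by simp
 fix t a assume t: "t:cr (AA M N)" and a: "a:cr K"
 show "top M N (a.*[AA M N]t) z = a.*[ms M N]top M N t z"
 proof (rule ts_ext[OF _ _ _ _ _ _ z, where f = "top M N (a.*[AA M N]t)"])
  fix v w assume *: "v:elts M" "w:elts N"
  show "top M N (a.*[AA M N]t) (mp M N v w) = a.*[ms M N]top M N t (mp M N v w)"
   using t a * lo_smult[OF lo_tsum_tensor[OF _ _ _ top_act_bilinear[OF *]]] by (simp add: top_pure)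
 qed (use t a in \<open>auto intro!: top_linear lo_smult_left\<close>)
qed (use z in simp)

lemma top_mult:
 assumes t: "t:cr (AA M N)" and s: "s:cr (AA M N)" and z: "z:cr (ms M N)"
 shows "top M N (t*[AA M N]s) z = top M N t (top M N s z)"
proof (rule ts_ext[OF _ _ _ _ _ _ z, where f = "top M N (t*[AA M N]s)"])
 let ?m = "ms M N"
 have ts: "t*[AA M N]s:cr (AA M N)" using t s by (intro tensor_mult_c) auto
 show "lo K ?m ?m (top M N (t*[AA M N]s))" using top_linear[OF ts] .
 show "lo K ?m ?m (%z. top M N t (top M N s z))"
  using lo_compose[OF top_linear[OF s] top_linear[OF t]] .
 fix x y assume xy: "x:elts M" "y:elts N"
 have "top M N (t*[AA M N]s) (mp M N x y) = tsum ?m (%a b. tsum ?m (%c d.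
   mp M N (act M (a*[A (gr M)]c) x) (act N (b*[A (gr N)]d) y)) s) t"
  unfolding top_pure[OF ts xy] using t s top_act_bilinear[OF xy] by (intro tsum_mult) auto
 also have "... = tsum ?m (%a b. tsum ?m (%c d.
   mp M N (act M a (act M c x)) (act N b (act N d y))) s) t"
  using t s xy by (intro tsum_cong[of K "A (gr M)" "A (gr N)"]) (auto simp: act_mult)
 also have "... = tsum ?m (%c d. tsum ?m (%a b.
   mp M N (act M a (act M c x)) (act N b (act N d y))) t) s"
  using t s xy by (intro tsum_swap[of K "A (gr M)" "A (gr N)" "A (gr M)" "A (gr N)"]) auto
 also have "... = tsum ?m (%c d. top M N t (mp M N (act M c x) (act N d y))) s"
  using t s xy by (intro tsum_cong[of K "A (gr M)" "A (gr N)"]) (auto simp: top_pure)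
 also have "... = top M N t (tsum ?m (%c d. mp M N (act M c x) (act N d y)) s)"
  using t s xy by (intro tsum_out[of K "A (gr M)" "A (gr N)", symmetric]) (auto intro: top_linear)
 finally show "top M N (t*[AA M N]s) (mp M N x y) = top M N t (top M N s (mp M N x y))"
  using s xy by (simp add: top_pure)
qed auto

lemma top_one:
 assumes z: "z:cr (ms M N)"
 shows "top M N (pure K (A (gr M)) (A (gr N)) \<one>[A (gr M)] \<one>[A (gr N)]) z = z"
proof (rule ts_ext[OF _ _ _ _ _ _ z, where g = "%z. z"])
 let ?o = "pure K (A (gr M)) (A (gr N)) \<one>[A (gr M)] \<one>[A (gr N)]"
 have o: "?o:cr (AA M N)" by (intro pure_closed) auto
 then show "lo K (ms M N) (ms M N) (top M N ?o)" by (rule top_linear)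
 fix x y assume xy: "x:elts M" "y:elts N"
 show "top M N ?o (mp M N x y) = mp M N x y"
  using xy top_act_bilinear[OF xy] by (simp add: top_pure[OF o] tsum_pure)
qed (auto intro!: lin)

lemma act_mt: "act (mt M N) = (\<lambda>h\<in>cA (gr M*[P]gr N). top M N (De (gr M) (gr N) h))"
 by (simp add: rep_tens_def Let_def top_def)

lemma act_mt_pure:
 "h:cA (gr M*[P]gr N) ==> x:elts M ==> y:elts N ==>
  act (mt M N) h (mp M N x y) = tsum (ms M N) (%a b. mp M N (act M a x) (act N b y)) (De (gr M) (gr N) h)"
 by (simp add: act_mt top_pure De_closed)

lemma hm_mt [simp]: "hm (mt M N)"
proof (rule hmodI[OF _ _ HOL.refl])
 let ?g = "gr M*[P]gr N"
 let ?D = "De (gr M) (gr N)"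
 note c = De_closed[of "gr M" "gr N"]
 let ?m = "mt M N"
 let ?a = "gr ?m"
 show "lo K (sp ?m) (sp ?m) (act ?m h)" if "h:cA ?a" for h
  using that c by (simp add: act_mt top_linear)
 show "lo K (A ?a) (sp ?m) (%h. act ?m h x)" if "x:elts ?m" for x
 proof -
  have "lo K (A ?g) (ms M N) (%h. top M N (?D h) x)"
   using that by (intro lo_compose[OF _ linear_top_left] linear_comult[OF _ _ _ lo_id]) auto
  then show ?thesis
   using lo_cong[of "A ?g" "%h. act ?m h x" "%h. top M N (?D h) x" K "ms M N"] by (simp add: act_mt)
 qed
 show "act ?m (h*[A ?a]k) x = act ?m h (act ?m k x)"
  if "h:cA ?a" "k:cA ?a" "x:elts ?m" for h k x
  using that c by (simp add: act_mt comult_mult top_mult)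
 show "act ?m \<one>[A ?a] x = x" if "x:elts ?m" for x
  using that by (simp add: act_mt comult_one top_one)
 show "act ?m:extensional (cA ?a)" by (simp add: act_mt)
 show "act ?m h:extensional (elts ?m)" if "h:cA ?a" for h
  using that c by (simp add: act_mt top_ext)
qed auto

end

abbreviation "ru == rep_unit P VV H"
abbreviation "rt == rep_tens_ar P K VV H"
abbreviation "ra == rep_assoc P K VV H"
abbreviation "rl == rep_lunit P K VV H"
abbreviation "rr == rep_runit P K VV H"
abbreviation "rc == rep_conj P H"
abbreviation "rb == rep_braid P K VV H"

lemma hmod_linearI:
 assumes "gr M = gr N" "f:extensional (elts M)" "lo K (sp M) (sp N) f"
  "!!h x. h:cA (gr M) ==> x:elts M ==> f (act M h x) = act N h (f x)"
 shows "hl M N f"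
 using assms by (auto simp: hmod_linear_def)

text \<open>Linearity over H has to be verified only on pure tensors, where the action is a Sweedler
  sum. For the constraints and the braiding the remaining equation is essentially one axiom of
  H.\<close>

lemma hmod_linear_tlift:
 assumes M: "hm M" and N: "hm N" and X: "hm X" and g: "gr M*[P]gr N = gr X"
  and B: "bo K (sp M) (sp N) (sp X) B"
  and eq: "!!h x y. h:cA (gr X) ==> x:elts M ==> y:elts N ==>
   tsum (sp X) (%a b. B (act M a x) (act N b y)) (De (gr M) (gr N) h) = act X h (B x y)"
 shows "hl (mt M N) X (tlift K VV (sp M) (sp N) (sp X) B)"
proof (rule hmod_linearI)
 let ?F = "tlift K VV (sp M) (sp N) (sp X) B"
 note t = tlift_pr[OF hmD(2)[OF M] hmD(2)[OF N] hm_module[OF X] B]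
 let ?m = "mt M N"
 show "?F:extensional (elts ?m)" "lo K (sp ?m) (sp X) ?F" using t by simp_all
 fix h z assume h: "h:cA (gr ?m)" and z: "z:elts ?m"
 have h': "h:cA (gr M*[P]gr N)" "h:cA (gr X)" using h g by simp_all
 show "?F (act ?m h z) = act X h (?F z)"
 proof (rule ts_ext[OF hmD(2)[OF M] hmD(2)[OF N] hm_module[OF X] _ _ _ z[unfolded mt_simps]])
  show "lo K (ms M N) (sp X) (%z. ?F (act ?m h z))"
   using lo_compose[OF linear_act[OF hm_mt[OF M N] h, unfolded mt_simps] t(2)] .
  show "lo K (ms M N) (sp X) (%z. act X h (?F z))"
   using lo_compose[OF t(2) linear_act[OF X h'(2)]] .
  fix x y assume xy: "x:elts M" "y:elts N"
  have "?F (act ?m h (mp M N x y))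
   = tsum (sp X) (%a b. ?F (mp M N (act M a x) (act N b y))) (De (gr M) (gr N) h)"
   using M N X xy h'(1) t(2) by (simp add: act_mt_pure) (rule Ds_out, auto)
  also have "... = tsum (sp X) (%a b. B (act M a x) (act N b y)) (De (gr M) (gr N) h)"
   using M N xy h'(1) t(3) by (intro Ds_cong) auto
  also have "... = act X h (B x y)" using eq[OF h'(2) xy] .
  finally show "?F (act ?m h (mp M N x y)) = act X h (?F (mp M N x y))" using t(3) xy by simp
 qed
qed (use g in simp)

text \<open>A set-theoretic inverse of a module map is again a module map; it is restricted because
  the maps of arrows are extensional.\<close>

lemma Rep_inverse:
 assumes f: "f:rh M N" and g: "!!y. y:elts N ==> g y:elts M"
  and gf: "!!x. x:elts M ==> g (amap f x) = x" and fg: "!!y. y:elts N ==> amap f (g y) = y"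
 shows "inverse_arrows RC f (Arr N M (restrict g (elts N)))"
proof -
 note F = Rep_homD[OF f]
 interpret M: module K "sp M" using F(1) by simp
 interpret N: module K "sp N" using F(2) by simp
 let ?r = "restrict g (elts N)" and ?e = "elts N"
 have "hl N M ?r"
 proof (rule hmod_linearI)
  show "lo K (sp N) (sp M) ?r"
  proof (rule loI)
   fix x y assume xy: "x:elts N" "y:elts N"
   have "g (x+[sp N]y) = g (amap f (g x+[sp M]g y))"
    using xy g fg lo_add[OF F(7)] by simp
   then show "restrict g ?e (x+[sp N]y) = restrict g ?e x+[sp M]restrict g ?e y"
    using xy g gf by simp
  next
   fix a x assume ax: "a:cr K" "x:elts N"
   have "g (a.*[sp N]x) = g (amap f (a.*[sp M]g x))"
    using ax g fg lo_smult[OF F(7)] by simp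
   then show "restrict g ?e (a.*[sp N]x) = a.*[sp M]restrict g ?e x"
    using ax g gf by simp
  qed (use g in simp)
  fix h x assume h: "h:cA (gr N)" and x: "x:elts N"
  have "g (act N h x) = g (amap f (act M h (g x)))"
   using F(9)[of _ h "g x"] h x g fg F(6) by simp
  then show "restrict g ?e (act N h x) = act M h (restrict g ?e x)"
   using h x g gf F(1,2,6) by simp
 qed (use F in auto)
 then have gh: "Arr N M ?r:rh N M" using F(1,2) by (simp add: Rep_hom_iff)
 have "compose (elts M) ?r (amap f) = (\<lambda>x\<in>elts M. x)"
  unfolding compose_def by (rule restrict_ext) (simp add: F(8) gf)
 moreover have "compose ?e (amap f) ?r = (\<lambda>x\<in>elts N. x)"
  unfolding compose_def by (rule restrict_ext) (simp add: fg)
 moreover have "f:Ar RC" using f by (simp add: hom_set_def)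
 ultimately show ?thesis unfolding inverse_arrows_def using F(3,4) gh by simp
qed

lemma Rep_iso_amap:
 assumes f: "f:rh M N" and iso: "inverse_arrows RC f g"
 shows "g:rh N M" "x:elts M ==> amap g (amap f x) = x" "y:elts N ==> amap f (amap g y) = y"
proof -
 note F = Rep_homD[OF f]
 show g: "g:rh N M" using iso F(3,4) by (simp add: inverse_arrows_def)
 note G = Rep_homD[OF g]
 have e: "compose (elts M) (amap g) (amap f) = (\<lambda>x\<in>elts M. x)" "compose (elts N) (amap f) (amap g) = (\<lambda>x\<in>elts N. x)"
  using iso F(3,4) G(3,4) by (simp_all add: inverse_arrows_def)
 show "x:elts M ==> amap g (amap f x) = x" using fun_cong[OF e(1),of x] by (simp add: compose_def)
 show "y:elts N ==> amap f (amap g y) = y" using fun_cong[OF e(2),of y] by (simp add: compose_def)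
qed

lemma Rep_comp:
 assumes f: "f:rh L M" and g: "g:rh M N"
 shows "g oR f:rh L N" "x:elts L ==> amap (g oR f) x = amap g (amap f x)"
proof -
 note F = Rep_homD[OF f] and G = Rep_homD[OF g]
 let ?c = "compose (elts L) (amap g) (amap f)"
 have "hl L N ?c"
 proof (rule hmod_linearI)
  have "lo K (sp L) (sp N) (%x. amap g (amap f x))" using lo_compose[OF F(7) G(7)] .
  then show "lo K (sp L) (sp N) ?c"
   using lo_cong[of "sp L" "compose (elts L) (amap g) (amap f)" "%x. amap g (amap f x)" K "sp N"] F(1)
   by (simp add: compose_def)
 qed (use F G in \<open>auto simp: compose_def\<close>)
 then show "g oR f:rh L N" using F G by (simp add: Rep_hom_iff)
 show "x:elts L ==> amap (g oR f) x = amap g (amap f x)" using F by (simp add: compose_def)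
qed

lemma Rep_id: "hm M ==> ri M:rh M M"
 by (auto simp: Rep_hom_iff intro!: hmod_linearI loI dest: hm_module
   simp: abelian_monoid.a_closed[OF abelian_group.axioms(1)[OF module.axioms(2)]] module.smult_closed)

lemma Rep_tens:
 assumes f: "f:rh M M'" and g: "g:rh N N'"
 shows "rt f g:rh (mt M N) (mt M' N')"
  "x:elts M ==> y:elts N ==> amap (rt f g) (mp M N x y) = mp M' N' (amap f x) (amap g y)"
proof -
 note F = Rep_homD[OF f] and G = Rep_homD[OF g]
 let ?B = "%x y. mp M' N' (amap f x) (amap g y)"
 let ?m = "mt M' N'"
 have B: "bo K (sp M) (sp N) (ms M' N') ?B"
  using F(1-8) G(1-8) f g by (intro boI linear_tp_left linear_tp_right) auto
 have e: "amap (rt f g) = tlift K VV (sp M) (sp N) (ms M' N') ?B"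
  using F G by (simp add: rep_tens_ar_def Let_def)
 have "hl (mt M N) ?m (tlift K VV (sp M) (sp N) (sp ?m) ?B)"
 proof (rule hmod_linear_tlift)
  fix h x y assume h: "h:cA (gr ?m)" and xy: "x:elts M" "y:elts N"
  show "tsum (sp ?m) (%a b. ?B (act M a x) (act N b y)) (De (gr M) (gr N) h) = act ?m h (?B x y)"
   using h xy F(1-6,8) G(1-6,8) Rep_homD(9)[OF f HOL.refl _ xy(1)] Rep_homD(9)[OF g HOL.refl _ xy(2)]
   by (simp add: act_mt_pure) (rule Ds_cong, auto)
 qed (use F G B in auto)
 then show "rt f g:rh (mt M N) ?m"
  using F G e by (simp add: Rep_hom_iff) (simp add: rep_tens_ar_def Let_def)
 show "x:elts M ==> y:elts N ==> amap (rt f g) (mp M N x y) = mp M' N' (amap f x) (amap g y)"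
  unfolding e using F G B by (intro tlift_pr) auto
qed

lemma linear_counit_right:
 "module K X ==> h:cr (A eP) ==> lo K X X (%x. ep h.*[X]x)"
 by (rule lo_smult_left) (auto intro: lin)

lemma ru_simps [simp]: "gr ru = eP" "sp ru = kk"
 "h:cr (A eP) ==> x:cr kk ==> act ru h x = ep h.*[kk]x"
 by (simp_all add: rep_unit_def)

lemma hm_ru [simp]: "hm ru"
proof (rule hmodI[OF _ _ HOL.refl])
 interpret kk: module K kk by simp
 let ?g = "gr ru"
 have 1: "A ?g = A eP" by simp
 show "lo K (sp ru) (sp ru) (act ru h)" if "h:cA ?g" for h
  using that linear_counit_right[of kk h] lo_cong[of kk "act ru h" "%x. ep h.*[kk]x" K kk] by simp
 show "lo K (A ?g) (sp ru) (%h. act ru h x)" if "x:elts ru" for x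
  using that linear_counit[of kk x "A eP" "%h. h"] lo_cong[of "A eP" "%h. act ru h x" "%h. ep h.*[kk]x" K kk]
  by (simp add: lo_id)
 show "act ru (h*[A ?g]k) x = act ru h (act ru k x)"
  if "h:cA ?g" "k:cA ?g" "x:elts ru" for h k x
  using that by (simp add: kk.smult_assoc1)
 show "act ru \<one>[A ?g] x = x" if "x:elts ru" for x using that by simp
qed (auto simp: rep_unit_def)

lemma hmod_triple:
 assumes L: "hm L" and M: "hm M" and N: "hm N" and l: "l:elts L" and m: "m:elts M" and n: "n:elts N"
 shows "h:cA (gr L*[P]gr M*[P]gr N) ==>
  act (mt (mt L M) N) h (mp (mt L M) N (mp L M l m) n)
  = tsum (ms (mt L M) N) (%x y. tsum (ms (mt L M) N) (%x' x''. mp (mt L M) N (mp L M (act L x' l) (act M x'' m)) (act N y n))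
    (De (gr L) (gr M) x)) (De (gr L*[P]gr M) (gr N) h)"
 and "h:cA (gr L*[P](gr M*[P]gr N)) ==>
  act (mt L (mt M N)) h (mp L (mt M N) l (mp M N m n))
  = tsum (ms L (mt M N)) (%x y. tsum (ms L (mt M N)) (%y' y''. mp L (mt M N) (act L x l) (mp M N (act M y' m) (act N y'' n)))
    (De (gr M) (gr N) y)) (De (gr L) (gr M*[P]gr N) h)"
proof -
 note * = assms
 assume h: "h:cA (gr L*[P]gr M*[P]gr N)"
 have "act (mt (mt L M) N) h (mp (mt L M) N (mp L M l m) n)
  = tsum (ms (mt L M) N) (%x y. mp (mt L M) N (act (mt L M) x (mp L M l m)) (act N y n)) (De (gr L*[P]gr M) (gr N) h)"
  using * h act_mt_pure[of "mt L M" N h "mp L M l m" n] by simp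
 also have "... = tsum (ms (mt L M) N) (%x y. tsum (ms (mt L M) N) (%x' x''. mp (mt L M) N (mp L M (act L x' l) (act M x'' m)) (act N y n))
    (De (gr L) (gr M) x)) (De (gr L*[P]gr M) (gr N) h)"
  using * h by (intro Ds_cong)
   (auto simp: act_mt_pure intro!: Ds_out[where f = "%x. tp (ms L M) (sp N) x _"] linear_tp_left lo_id)
 finally show "act (mt (mt L M) N) h (mp (mt L M) N (mp L M l m) n) = ..." .
next
 note * = assms
 assume h: "h:cA (gr L*[P](gr M*[P]gr N))"
 have "act (mt L (mt M N)) h (mp L (mt M N) l (mp M N m n))
  = tsum (ms L (mt M N)) (%x y. mp L (mt M N) (act L x l) (act (mt M N) y (mp M N m n))) (De (gr L) (gr M*[P]gr N) h)"
  using * h act_mt_pure[of L "mt M N" h l "mp M N m n"] by simp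
 also have "... = tsum (ms L (mt M N)) (%x y. tsum (ms L (mt M N)) (%y' y''. mp L (mt M N) (act L x l) (mp M N (act M y' m) (act N y'' n)))
    (De (gr M) (gr N) y)) (De (gr L) (gr M*[P]gr N) h)"
  using * h by (intro Ds_cong)
   (auto simp: act_mt_pure intro!: Ds_out[where f = "%x. tp (sp L) (ms M N) _ x"] linear_tp_right lo_id)
 finally show "act (mt L (mt M N)) h (mp L (mt M N) l (mp M N m n)) = ..." .
qed

lemma linear_tlift_param [lin]:
 fixes X :: "('k, 'u) module"
 assumes U: "fd_space K U" and V: "fd_space K V" and X: "module K X" and W: "module K W"
  and C: "!!w. w:cr W ==> bo K U V X (C w)"
  and lw: "!!u v. u:cr U ==> v:cr V ==> lo K W X (%w. C w u v)"
  and x: "x:cr (ts U V)"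
 shows "lo K W X (%w. tlift K VV U V X (C w) x)"
proof (rule loI)
 interpret X: module K X by (rule X)
 interpret W: module K W by (rule W)
 note t = tlift_pr[OF U V X C]
 let ?B = "%x w. tlift K VV U V X (C w) x"
 fix w w' assume w: "w:cr W" "w':cr W"
 show "?B x (w+[W]w') = ?B x w+[X]?B x w'"
 proof (rule ts_ext[OF U V X _ _ _ x, where f = "%x. ?B x (w+[W]w')"])
  fix u v assume uv: "u:cr U" "v:cr V"
  show "?B (tp U V u v) (w+[W]w') = ?B (tp U V u v) w+[X]?B (tp U V u v) w'"
   using uv w t lo_add[OF lw[OF uv], of w w'] by simp
 qed (use w t X in \<open>auto intro!: lo_plus\<close>)
next
 interpret X: module K X by (rule X)
 interpret W: module K W by (rule W)
 note t = tlift_pr[OF U V X C]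
 let ?B = "%x w. tlift K VV U V X (C w) x"
 fix a w assume w: "w:cr W" and a: "a:cr K"
 show "?B x (a.*[W]w) = a.*[X]?B x w"
 proof (rule ts_ext[OF U V X _ _ _ x, where f = "%x. ?B x (a.*[W]w)"])
  fix u v assume uv: "u:cr U" "v:cr V"
  show "?B (tp U V u v) (a.*[W]w) = a.*[X]?B (tp U V u v) w"
   using uv w a t lo_smult[OF lw[OF uv], of a w] by simp
 qed (use w a t X in \<open>auto intro!: lo_smult_left\<close>)
qed (use x lo_closed[OF tlift_pr(2)[OF U V X C]] in blast)

text \<open>Rebracketing commutes with the action by coassociativity, applied to the trilinear map
  that places the three legs on l, m and n.\<close>

lemma ra_hom:
 assumes L [simp]: "hm L" and M [simp]: "hm M" and N [simp]: "hm N"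
 shows "ra L M N:rh (mt (mt L M) N) (mt L (mt M N))"
  "l:elts L ==> m:elts M ==> n:elts N ==>
   amap (ra L M N) (mp (mt L M) N (mp L M l m) n) = mp L (mt M N) l (mp M N m n)"
proof -
 let ?X = "mt L (mt M N)"
 let ?C = "%w u v. mp L (mt M N) u (mp M N v w)"
 let ?B = "%x w. tlift K VV (sp L) (sp M) (sp ?X) (?C w) x"
 let ?s = "sp ?X" and ?m = "mt L M" and ?a = "ms L M"
 have C: "bo K (sp L) (sp M) ?s (?C w)" if "w:elts N" for w
  using that by (auto intro!: lin)
 have X': "module K ?s" by simp
 note t = tlift_pr[OF hmD(2)[OF L] hmD(2)[OF M] X' C]
 have B: "bo K ?a (sp N) ?s ?B"
 proof (rule boI)
  show "lo K ?a ?s (%v. ?B v w)" if "w:elts N" for w using t that by simp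
  show "lo K (sp N) ?s (?B x)" if "x:cr ?a" for x
   using that C by (intro linear_tlift_param) (auto intro!: lin)
 qed
 have e: "ra L M N = Arr (mt ?m N) ?X (tlift K VV ?a (sp N) ?s ?B)"
  by (simp add: rep_assoc_def Let_def)
 have "hl (mt ?m N) ?X (tlift K VV (sp ?m) (sp N) ?s ?B)"
 proof (rule hmod_linear_tlift)
  fix h x n assume h: "h:cA (gr ?X)" and x: "x:elts ?m" and n: "n:elts N"
  have h': "h:cA (gr L*[P]gr M*[P]gr N)" "h:cA (gr L*[P](gr M*[P]gr N))"
   using h by (simp_all add: P_assoc)
  let ?f = "%x. tsum ?s (%a b. ?B (act ?m a x) (act N b n)) (De (gr ?m) (gr N) h)"
  show "?f x = act ?X h (?B x n)"
  proof (rule ts_ext[OF _ _ _ _ _ _ x[unfolded mt_simps], where f = ?f])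
   show "lo K ?a ?s ?f"
    using h' n by (intro linear_Dsum bilinear_left[OF B] linear_act[of "mt L M", simplified]) auto
   show "lo K ?a ?s (%x. act ?X h (?B x n))"
    using lo_compose[OF t(2)[OF n] linear_act[of ?X]] h by simp
   fix l m assume lm: "l:elts L" "m:elts M"
   have "?f (mp L M l m) = tsum ?s (%a b. tsum ?s (%a' a''. ?C (act N b n) (act L a' l) (act M a'' m))
     (De (gr L) (gr M) a)) (De (gr L*[P]gr M) (gr N) h)"
    unfolding mt_simps(1)
   proof (rule Ds_cong)
    fix a b assume ab: "a:cA (gr L*[P]gr M)" "b:cA (gr N)"
    have bn: "act N b n:elts N" using ab n by simp
    have "?B (act ?m a (mp L M l m)) (act N b n)
     = tsum ?s (%a' a''. ?B (mp L M (act L a' l) (act M a'' m)) (act N b n)) (De (gr L) (gr M) a)"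
     using ab lm t(2)[OF bn] by (simp add: act_mt_pure) (rule Ds_out, auto)
    also have "... = tsum ?s (%a' a''. ?C (act N b n) (act L a' l) (act M a'' m)) (De (gr L) (gr M) a)"
     using ab lm t(3)[OF bn] by (intro Ds_cong) auto
    finally show "?B (act ?m a (mp L M l m)) (act N b n)
     = tsum ?s (%a' a''. ?C (act N b n) (act L a' l) (act M a'' m)) (De (gr L) (gr M) a)" .
   qed (use h' in auto)
   also have "... = tsum ?s (%x y. tsum ?s (%y' y''. ?C (act N y'' n) (act L x l) (act M y' m))
    (De (gr M) (gr N) y)) (De (gr L) (gr M*[P]gr N) h)"
    using h' lm n by (intro coassoc_sum') (auto intro!: lin)
   also have "... = act ?X h (?B (mp L M l m) n)"
    using h' lm n t(3)[OF n] hmod_triple(2)[OF L M N lm n h'(2)] by simp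
   finally show "?f (mp L M l m) = act ?X h (?B (mp L M l m) n)" .
  qed auto
 qed (use B P_assoc in auto)
 then show "ra L M N:rh (mt ?m N) (mt L (mt M N))"
  using e by (simp add: Rep_hom_iff)
 assume *: "l:elts L" "m:elts M" "n:elts N"
 have "amap (ra L M N) (mp ?m N (mp L M l m) n) = ?B (mp L M l m) n"
  unfolding e using * B tlift_pr(3)[of "ms L M" "sp N" "sp ?X" ?B "mp L M l m" n] by simp
 then show "amap (ra L M N) (mp ?m N (mp L M l m) n) = mp L (mt M N) l (mp M N m n)"
  using * t by simp
qed

lemma ra_iso:
 assumes L [simp]: "hm L" and M [simp]: "hm M" and N [simp]: "hm N"
 shows "\<exists>g. inverse_arrows RC (ra L M N) g"
proof -
 let ?X = "mt (mt L M) N"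
 let ?C = "%u v w. mp (mt L M) N (mp L M u v) w"
 let ?B = "%u x. tlift K VV (sp M) (sp N) (sp ?X) (?C u) x"
 let ?m = "mt L (mt M N)" and ?r = "ra L M N"
 have X: "module K (sp ?X)" by simp
 have C: "bo K (sp M) (sp N) (sp ?X) (?C u)" if "u:elts L" for u
  using that by (auto intro!: lin)
 note t = tlift_pr[OF hmD(2)[OF M] hmD(2)[OF N] X C]
 have B: "bo K (sp L) (ms M N) (sp ?X) ?B"
  using C t by (intro boI linear_tlift_param) (auto intro!: lin)
 let ?g = "tlift K VV (sp L) (ms M N) (sp ?X) ?B"
 have MN: "fd_space K (ms M N)" "fd_space K (ms L M)" by simp_all
 note T = tlift_pr[OF hmD(2)[OF L] MN(1) X B]
 have gp: "?g (mp L (mt M N) u (mp M N v w)) = ?C u v w" if "u:elts L" "v:elts M" "w:elts N" for u v w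
  using that T(3)[of u "mp M N v w"] t(3) by simp
 note a = ra_hom[OF L M N]
 have "inverse_arrows RC ?r (Arr ?m ?X (restrict ?g (elts ?m)))"
 proof (rule Rep_inverse[OF a(1)])
  show "?g y:elts ?X" if "y:elts ?m" for y
   using lo_closed[OF T(2)] that by simp
  show "?g (amap ?r x) = x" if x: "x:elts ?X" for x
  proof (rule ts_ext3[OF hmD(2)[OF L] hmD(2)[OF M] hmD(2)[OF N] X, where g = "%x. x" and f = "%x. ?g (amap ?r x)"])
   show "lo K (ts (ms L M) (sp N)) (sp ?X) (%x. ?g (amap ?r x))"
    using lo_compose[OF Rep_homD(7)[OF a(1)]] T(2) by simp
  qed (use x a(2) gp in \<open>auto intro!: lin\<close>)
  show "amap ?r (?g y) = y" if y: "y:elts ?m" for y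
  proof (rule ts_ext3'[OF hmD(2)[OF L] hmD(2)[OF M] hmD(2)[OF N], where g = "%x. x" and f = "%y. amap ?r (?g y)"])
   show "lo K (ts (sp L) (ms M N)) (sp ?m) (%y. amap ?r (?g y))"
    using lo_compose[OF T(2) Rep_homD(7)[OF a(1)]] by simp
  qed (use y a(2) gp in \<open>auto intro!: lin\<close>)
 qed
 then show ?thesis by blast
qed

lemma rl_hom:
 assumes M [simp]: "hm M"
 shows "rl M:rh (mt ru M) M" "x:elts ru ==> m:elts M ==> amap (rl M) (mp ru M x m) = uc x.*[sp M]m"
  "\<exists>g. inverse_arrows RC (rl M) g"
proof -
 interpret SM: module K "sp M" by simp
 let ?B = "%x m. uc x.*[sp M]m"
 let ?t = "tlift K VV (sp ru) (sp M) (sp M) ?B" and ?m = "mt ru M"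
 have B: "bo K kk (sp M) (sp M) ?B"
  using uc_props by (intro boI lo_smult_left lo_id linear_uc) auto
 have e: "rl M = Arr ?m M ?t" by (simp add: rep_lunit_def)
 note t = tlift_pr[OF kk_fd hmD(2)[OF M] hm_module[OF M] B]
 have "hl ?m M ?t"
 proof (rule hmod_linear_tlift)
  fix h x m assume h: "h:cA (gr M)" and x: "x:elts ru" and m: "m:elts M"
  have ucs: "uc (a.*[kk]x) = a*[K]uc x" if "a:cr K" for a
   using uc_linear_form that x unfolding linear_form_def by simp
  have "tsum (sp M) (%a b. ?B (act ru a x) (act M b m)) (De (gr ru) (gr M) h)
    = tsum (sp M) (%a b. ep a.*[sp M](uc x.*[sp M]act M b m)) (De eP (gr M) h)"
   unfolding ru_simps(1) using x m h uc_props[of x] by (intro Ds_cong) (auto simp: ucs SM.smult_assoc1)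
  also have "... = uc x.*[sp M]act M h m"
   using x m h uc_props[of x] by (intro ep_left) (auto intro!: lin)
  also have "... = act M h (?B x m)"
   using x m h uc_props[of x] lo_smult[OF linear_act[OF M h]] by simp
  finally show "tsum (sp M) (%a b. ?B (act ru a x) (act M b m)) (De (gr ru) (gr M) h) = act M h (?B x m)" .
 qed (use B in auto)
 then show hom: "rl M:rh ?m M" using e by (simp add: Rep_hom_iff)
 show p: "amap (rl M) (mp ru M x m) = uc x.*[sp M]m" if "x:elts ru" "m:elts M" for x m
  using that t(3) by (simp add: e)
 have "inverse_arrows RC (rl M) (Arr M ?m (restrict (%m. mp ru M g1 m) (elts M)))"
 proof (rule Rep_inverse[OF hom])
  show "mp ru M g1 (amap (rl M) x) = x" if x: "x:elts ?m" for x
  proof (rule ts_ext[OF kk_fd hmD(2)[OF M], where g = "%x. x" and f = "%x. mp ru M g1 (amap (rl M) x)" and X = "ms ru M"])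
   show "lo K (ts kk (sp M)) (ms ru M) (%x. mp ru M g1 (amap (rl M) x))"
    using lo_compose[OF Rep_homD(7)[OF hom]] by (auto intro!: lin lo_amap[OF hom])
   show "mp ru M g1 (amap (rl M) (tp kk (sp M) v w)) = tp kk (sp M) v w" if "v:cr kk" "w:elts M" for v w
    using that p[of v w] tp_smult[of kk "sp M" g1 w "uc v"] uc_props[of v] by simp
  qed (use x in \<open>auto intro!: lin\<close>)
 qed (use p in auto)
 then show "\<exists>g. inverse_arrows RC (rl M) g" by blast
qed

lemma rr_hom:
 assumes M [simp]: "hm M"
 shows "rr M:rh (mt M ru) M" "x:elts ru ==> m:elts M ==> amap (rr M) (mp M ru m x) = uc x.*[sp M]m"
  "\<exists>g. inverse_arrows RC (rr M) g"
proof -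
 interpret SM: module K "sp M" by simp
 let ?B = "%m x. uc x.*[sp M]m"
 let ?t = "tlift K VV (sp M) (sp ru) (sp M) ?B" and ?m = "mt M ru"
 have B: "bo K (sp M) kk (sp M) ?B"
  using uc_props by (intro boI lo_smult_left lo_id linear_uc) auto
 have e: "rr M = Arr ?m M ?t" by (simp add: rep_runit_def)
 note t = tlift_pr[OF hmD(2)[OF M] kk_fd hm_module[OF M] B]
 have "hl ?m M ?t"
 proof (rule hmod_linear_tlift)
  fix h x m assume h: "h:cA (gr M)" and x: "x:elts ru" and m: "m:elts M"
  have ucs: "uc (a.*[kk]x) = a*[K]uc x" if "a:cr K" for a
   using uc_linear_form that x unfolding linear_form_def by simp
  have "tsum (sp M) (%b a. ?B (act M b m) (act ru a x)) (De (gr M) (gr ru) h)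
    = tsum (sp M) (%b a. ep a.*[sp M](uc x.*[sp M]act M b m)) (De (gr M) eP h)"
   unfolding ru_simps(1) using x m h uc_props[of x] by (intro Ds_cong) (auto simp: ucs SM.smult_assoc1)
  also have "... = uc x.*[sp M]act M h m"
   using x m h uc_props[of x] by (intro ep_right) (auto intro!: lin)
  also have "... = act M h (?B m x)"
   using x m h uc_props[of x] lo_smult[OF linear_act[OF M h]] by simp
  finally show "tsum (sp M) (%b a. ?B (act M b m) (act ru a x)) (De (gr M) (gr ru) h) = act M h (?B m x)" .
 qed (use B in auto)
 then show hom: "rr M:rh ?m M" using e by (simp add: Rep_hom_iff)
 show p: "amap (rr M) (mp M ru m x) = uc x.*[sp M]m" if "x:elts ru" "m:elts M" for x m
  using that t(3) by (simp add: e)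
 have "inverse_arrows RC (rr M) (Arr M ?m (restrict (%m. mp M ru m g1) (elts M)))"
 proof (rule Rep_inverse[OF hom])
  show "mp M ru (amap (rr M) x) g1 = x" if x: "x:elts ?m" for x
  proof (rule ts_ext[OF hmD(2)[OF M] kk_fd, where g = "%x. x" and f = "%x. mp M ru (amap (rr M) x) g1" and X = "ms M ru"])
   show "lo K (ts (sp M) kk) (ms M ru) (%x. mp M ru (amap (rr M) x) g1)"
    using lo_compose[OF Rep_homD(7)[OF hom]] by (auto intro!: lin lo_amap[OF hom])
   show "mp M ru (amap (rr M) (tp (sp M) kk w v)) g1 = tp (sp M) kk w v" if "w:elts M" "v:cr kk" for v w
    using that p[of v w] tp_smult[of "sp M" kk w g1 "uc v"] uc_props[of v] by simp
  qed (use x in \<open>auto intro!: lin\<close>)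
 qed (use p in auto)
 then show "\<exists>g. inverse_arrows RC (rr M) g" by blast
qed

lemma elts_mt [simp]: "hm M ==> hm N ==> x:elts M ==> y:elts N ==> mp M N x y:elts (mt M N)"
 by simp

lemma uc_ru: "x:elts ru ==> uc x:cr K" by (simp add: uc_props)

lemma amap_Id: "x:elts M ==> amap (ri M) x = x" by simp

text \<open>The axioms on constraints are equalities of linear maps out of iterated tensor products;
  on pure tensors both sides are computed explicitly and agree.\<close>

lemma tensor_category_Rep: "tensor_category RC"
proof
 fix U V W X f g h
 show "f:Ar RC ==> Dom RC f:Ob RC & Cod RC f:Ob RC" by (simp add: Rep_Ar_iff)
 show "U:Ob RC ==> ri U:rh U U" using Rep_id by simp
 show c: "f:rh U V ==> g:rh V W ==> g oR f:rh U W" for f g U V W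
  by (rule Rep_comp)
 show "f oR ri U = f & ri V oR f = f" if f: "f:rh U V"
 proof -
  note F = Rep_homD[OF f] note i = Rep_id[OF F(1)] Rep_id[OF F(2)]
  show ?thesis
   using Rep_ar_eqI[OF c[OF i(1) f] f] Rep_ar_eqI[OF c[OF f i(2)] f] Rep_comp(2)[OF i(1) f] Rep_comp(2)[OF f i(2)]
    F(8) by (simp del: Rep_simps(5))
 qed
 show "(h oR g) oR f = h oR (g oR f)"
  if f: "f:rh U V" and g: "g:rh V W" and h: "h:rh W X"
  by (rule Rep_ar_eqI[OF c[OF f c[OF g h]] c[OF c[OF f g] h]])
   (simp only: Rep_comp(2)[OF f c[OF g h]] Rep_comp(2)[OF c[OF f g] h] Rep_comp(2)[OF f g]
    Rep_comp(2)[OF g h] Rep_homD(8)[OF f])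
 show "U:Ob RC ==> V:Ob RC ==> U**[RC]V:Ob RC" by simp
 show "\<I>[RC]:Ob RC" by simp
 show th: "f:rh U U' ==> g:rh V V' ==> f***[RC]g:rh (U**[RC]V) (U'**[RC]V')"
  for f g U U' V V' using Rep_tens(1) by simp
 show "ri U***[RC]ri V = ri (U**[RC]V)" if "U:Ob RC" "V:Ob RC"
 proof -
  have U: "hm U" and V: "hm V" using that by auto
  note i = Rep_id[OF U] Rep_id[OF V]
  show ?thesis
   using Rep_ar_eq2I[OF Rep_tens(1)[OF i] Rep_id[OF hm_mt[OF U V]] U V] Rep_tens(2)[OF i] U V by simp
 qed
 show "(f' oR f)***[RC](g' oR g) = (f'***[RC]g') oR (f***[RC]g)"
  if f: "f:rh U U'" "f':rh U' U''" and g: "g:rh V V'" "g':rh V' V''"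
  for f f' g g' U U' U'' V V' V''
  unfolding Rep_simps(7)
  by (rule Rep_ar_eq2I[OF Rep_tens(1)[OF c[OF f] c[OF g]] c[OF Rep_tens(1)[OF f(1) g(1)] Rep_tens(1)[OF f(2) g(2)]]
     Rep_homD(1)[OF f(1)] Rep_homD(1)[OF g(1)]])
   (simp only: Rep_tens(2)[OF c[OF f] c[OF g]] Rep_comp(2)[OF Rep_tens(1)[OF f(1) g(1)] Rep_tens(1)[OF f(2) g(2)]]
    Rep_tens(2)[OF f(1) g(1)] Rep_tens(2)[OF f(2) g(2)] Rep_comp(2)[OF f] Rep_comp(2)[OF g]
    elts_mt[OF Rep_homD(1)[OF f(1)] Rep_homD(1)[OF g(1)]] Rep_homD(8)[OF f(1)] Rep_homD(8)[OF g(1)])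
 show "assoc RC U V W:rh ((U**[RC]V)**[RC]W) (U**[RC](V**[RC]W)) & is_iso RC (assoc RC U V W)"
  if "U:Ob RC" "V:Ob RC" "W:Ob RC" for U V W
  using that ra_hom ra_iso by (simp add: is_iso_def)
 show "assoc RC U' V' W' oR ((f***[RC]g)***[RC]h) = (f***[RC](g***[RC]h)) oR assoc RC U V W"
  if f: "f:rh U U'" and g: "g:rh V V'" and h: "h:rh W W'" for f g h U U' V V' W W'
 proof -
  note F = Rep_homD[OF f] note G = Rep_homD[OF g] note H = Rep_homD[OF h]
  note a = ra_hom[OF F(1) G(1) H(1)] note a' = ra_hom[OF F(2) G(2) H(2)]
  note fg = Rep_tens[OF f g] note gh = Rep_tens[OF g h]
  note fg_h = Rep_tens[OF fg(1) h] note f_gh = Rep_tens[OF f gh(1)]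
  show ?thesis
   unfolding Rep_simps(7,9)
   by (rule Rep_ar_eq3I[OF c[OF fg_h(1) a'(1)] c[OF a(1) f_gh(1)] F(1) G(1) H(1)])
    (use F(1-4,8) G(1-4,8) H(1-4,8) in \<open>simp only: Rep_comp(2)[OF fg_h(1) a'(1)] Rep_comp(2)[OF a(1) f_gh(1)] fg_h(2) f_gh(2)
     fg(2) gh(2) a(2) a'(2) elts_mt hm_mt\<close>)
 qed
 show "lunit RC U:rh (\<I>[RC]**[RC]U) U & is_iso RC (lunit RC U)" if "U:Ob RC"
  using that rl_hom by (simp add: is_iso_def)
 show "runit RC U:rh (U**[RC]\<I>[RC]) U & is_iso RC (runit RC U)" if "U:Ob RC"
  using that rr_hom by (simp add: is_iso_def)
 show "lunit RC V oR (ri \<I>[RC]***[RC]f) = f oR lunit RC U" if f: "f:rh U V"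
 proof -
  note F = Rep_homD[OF f] note i = Rep_id[OF hm_ru]
  note l = rl_hom[OF F(1)] note l' = rl_hom[OF F(2)] note t = Rep_tens[OF i f]
  show ?thesis
   unfolding Rep_simps(7,8,10)
   by (rule Rep_ar_eq2I[OF c[OF t(1) l'(1)] c[OF l(1) f] hm_ru F(1)])
    (use F(1,2,8) lo_smult[OF F(7)] uc_ru in \<open>simp add: Rep_comp(2)[OF t(1) l'(1)] Rep_comp(2)[OF l(1) f] t(2) l(2) l'(2) elts_mt amap_Id del: Rep_simps(4,5) ru_simps(2,3)\<close>)
 qed
 show "runit RC V oR (f***[RC]ri \<I>[RC]) = f oR runit RC U" if f: "f:rh U V"
 proof -
  note F = Rep_homD[OF f] note i = Rep_id[OF hm_ru]
  note l = rr_hom[OF F(1)] note l' = rr_hom[OF F(2)] note t = Rep_tens[OF f i]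
  show ?thesis
   unfolding Rep_simps(7,8,11)
   by (rule Rep_ar_eq2I[OF c[OF t(1) l'(1)] c[OF l(1) f] F(1) hm_ru])
    (use F(1,2,8) lo_smult[OF F(7)] uc_ru in \<open>simp add: Rep_comp(2)[OF t(1) l'(1)] Rep_comp(2)[OF l(1) f] t(2) l(2) l'(2) elts_mt amap_Id del: Rep_simps(4,5) ru_simps(2,3)\<close>)
 qed
 show "assoc RC U V (W**[RC]X) oR assoc RC (U**[RC]V) W X =
   (ri U***[RC]assoc RC V W X) oR assoc RC U (V**[RC]W) X oR (assoc RC U V W***[RC]ri X)"
  if "U:Ob RC" "V:Ob RC" "W:Ob RC" "X:Ob RC"
 proof -
  have o: "hm U" "hm V" "hm W" "hm X" using that by auto
  note a1 = ra_hom[OF hm_mt[OF o(1,2)] o(3,4)] note a2 = ra_hom[OF o(1,2) hm_mt[OF o(3,4)]]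
  note a3 = ra_hom[OF o(1-3)] note a4 = ra_hom[OF o(1) hm_mt[OF o(2,3)] o(4)] note a5 = ra_hom[OF o(2-4)]
  note t1 = Rep_tens[OF a3(1) Rep_id[OF o(4)]] note t2 = Rep_tens[OF Rep_id[OF o(1)] a5(1)]
  show ?thesis
   unfolding Rep_simps(6,7,9)
   by (rule Rep_ar_eq4I[OF c[OF a1(1) a2(1)] c[OF c[OF t1(1) a4(1)] t2(1)] o])
    (use o in \<open>simp add: Rep_comp(2)[OF a1(1) a2(1)] Rep_comp(2)[OF c[OF t1(1) a4(1)] t2(1)]
     Rep_comp(2)[OF t1(1) a4(1)] a1(2) a2(2) a3(2) a4(2) a5(2) t1(2) t2(2) amap_Id del: Rep_simps(4,5) mt_simps hm_module\<close>)
 qed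
 show "(ri U***[RC]lunit RC V) oR assoc RC U \<I>[RC] V = runit RC U***[RC]ri V"
  if "U:Ob RC" "V:Ob RC"
 proof -
  have o: "hm U" "hm V" using that by auto
  note a = ra_hom[OF o(1) hm_ru o(2)] note l = rl_hom[OF o(2)] note r = rr_hom[OF o(1)]
  note t1 = Rep_tens[OF Rep_id[OF o(1)] l(1)] note t2 = Rep_tens[OF r(1) Rep_id[OF o(2)]]
  show ?thesis
   unfolding Rep_simps(7,8,9,10,11)
   by (rule Rep_ar_eq3I[OF c[OF a(1) t1(1)] t2(1) o(1) hm_ru o(2)])
    (use o uc_ru tp_smult in \<open>simp add: Rep_comp(2)[OF a(1) t1(1)] a(2) l(2) r(2) t1(2) t2(2) elts_mt amap_Id module.smult_closed[OF hm_module]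
      del: Rep_simps(4,5) mt_simps ru_simps(2,3)\<close>)
 qed
qed

sublocale RC: tensor_category "RC" by (rule tensor_category_Rep)

subsection \<open>Conjugation\<close>

lemma rc_simps [simp]:
 "gr (rc b M) = cj b (gr M)" "sp (rc b M) = sp M"
 by (simp_all add: rep_conj_def Let_def)

lemma act_rc [simp]:
 "g = cj b (gr M) ==> h:cA g ==> x:elts M ==> act (rc b M) h x = act M (ph (iv b) g h) x"
 by (simp add: rep_conj_def Let_def)

lemma act_rc_ext [simp]:
 "act (rc b M):extensional (cA (cj b (gr M)))"
 "h:cA (cj b (gr M)) ==> act (rc b M) h:extensional (elts M)"
 by (simp_all add: rep_conj_def Let_def)

lemma hm_rc [simp]:
 assumes M [simp]: "hm M" and b [simp]: "b:cr P"
 shows "hm (rc b M)"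
proof (rule hmodI[OF _ _ HOL.refl])
 let ?g = "cj b (gr M)"
 let ?r = "rc b M"
 have cl: "ph (iv b) ?g h:cA (gr M)" if "h:cA ?g" for h using that by simp
 show "lo K (sp ?r) (sp ?r) (act ?r h)" if "h:cA (gr ?r)" for h
  using that linear_act[OF M cl] lo_cong[of "sp M" "act ?r h" "act M (ph (iv b) ?g h)" K "sp M"] by simp
 show "lo K (A (gr ?r)) (sp ?r) (%h. act ?r h x)" if "x:elts ?r" for x
 proof -
  have "lo K (A ?g) (sp M) (%h. act M (ph (iv b) ?g h) x)" using that by (auto intro!: lin)
  then show ?thesis
   using that lo_cong[of "A ?g" "%h. act ?r h x" "%h. act M (ph (iv b) ?g h) x" K "sp M"] by simp
 qed
 show "act ?r (h*[A (gr ?r)]k) x = act ?r h (act ?r k x)"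
  if "h:cA (gr ?r)" "k:cA (gr ?r)" "x:elts ?r" for h k x
  using that ph_mult[of "iv b" ?g "gr M" h k] by (simp add: act_mult)
 show "act ?r \<one>[A (gr ?r)] x = x" if "x:elts ?r" for x
  using that ph_hom(4)[of "iv b" ?g] by simp
qed auto

text \<open>Conjugation does not change the space, and the two actions agree since the crossing
  preserves the comultiplication; hence an equality and not merely an isomorphism.\<close>

lemma rc_mt:
 assumes M [simp]: "hm M" and N [simp]: "hm N" and b [simp]: "b:cr P"
 shows "rc b (mt M N) = mt (rc b M) (rc b N)"
proof (rule hmod_eqI[OF _ _ HOL.refl])
 let ?g = "gr M*[P]gr N" let ?c = "cj b"
 let ?m = "mt (rc b M) (rc b N)" and ?a = "mt M N" and ?b = "ms M N" and ?d = "?c ?g"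
 have cg: "?c ?g = ?c (gr M)*[P]?c (gr N)" by (simp add: conj_elt_mult)
 show "gr (rc b ?a) = gr ?m" using cg by simp
 show "act (rc b ?a):extensional (cA (gr ?m))" using act_rc_ext(1)[of b "mt M N"] cg by simp
 show "act ?m:extensional (cA (gr ?m))" using act_ext(1)[of "mt (rc b M) (rc b N)"] by simp
 fix h assume h: "h:cA (gr ?m)"
 have h': "h:cA ?d" "h:cA (?c (gr M)*[P]?c (gr N))" using h cg by simp_all
 have hc: "ph (iv b) ?d h:cA ?g" using h'(1) by simp
 show "act (rc b ?a) h:extensional (elts ?m)" using act_rc_ext(2)[of h b "mt M N"] h' by simp
 show "act ?m h:extensional (elts ?m)" using act_ext(2)[of "mt (rc b M) (rc b N)" h] h by simp
 fix x assume "x:elts ?m"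
 then have x: "x:cr ?b" by simp
 have "act ?a (ph (iv b) ?d h) x = act ?m h x"
 proof (rule ts_ext[OF hmD(2)[OF M] hmD(2)[OF N] _ _ _ _ x])
  show "lo K ?b ?b (act ?a (ph (iv b) ?d h))"
   using linear_act[of "mt M N"] hc by simp
  show "lo K ?b ?b (act ?m h)"
   using linear_act[of "mt (rc b M) (rc b N)"] h by simp
  fix m n assume mn: "m:elts M" "n:elts N"
  let ?B = "%x y. mp M N (act M x m) (act N y n)"
  have "act ?a (ph (iv b) ?d h) (mp M N m n) = tsum ?b ?B (De (gr M) (gr N) (ph (iv b) ?d h))"
   using hc mn by (simp add: act_mt_pure)
  also have "... = tsum ?b (%x y. ?B (ph (iv b) (?c (gr M)) x) (ph (iv b) (?c (gr N)) y)) (De (?c (gr M)) (?c (gr N)) h)"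
  proof -
   have "bo K (A (gr M)) (A (gr N)) ?b ?B" using mn by (auto intro!: lin)
   then show ?thesis
    using crossing_comult_sum[of "?c (gr M)" "?c (gr N)" "iv b" h "ms M N" ?B] h' cg by simp
  qed
  also have "... = act ?m h (mp M N m n)"
   using act_mt_pure[of "rc b M" "rc b N" h m n] h' mn by simp (rule Ds_cong, auto)
  finally show "act ?a (ph (iv b) ?d h) (mp M N m n) = act ?m h (mp M N m n)" .
 qed simp
 then show "act (rc b ?a) h x = act ?m h x" using x h' by simp
qed simp

lemma rc_ru: "b:cr P ==> rc b ru = ru"
proof (rule hmod_eqI[OF _ _ HOL.refl])
 assume b: "b:cr P"
 show "act (rc b ru):extensional (cA (gr ru))" using act_rc_ext(1)[of b ru] b by simp
 show "act (rc b ru) h:extensional (elts ru)" if "h:cA (gr ru)" for h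
  using act_rc_ext(2)[of h b ru] b that by simp
 show "act (rc b ru) h x = act ru h x" if "h:cA (gr ru)" "x:elts ru" for h x
  using that b crossing_counit[of "iv b" h] by simp
qed (auto intro: act_ext simp: rep_unit_def)

lemma rc_one:
 fixes M :: "('g, 'k, 'h, 'u) hmod"
 assumes M: "hm M"
 shows "rc eP M = M"
proof (rule hmod_eqI[OF _ _ HOL.refl])
 show "act (rc eP M):extensional (cA (gr M))" using act_rc_ext(1)[of "eP" M] M by simp
 show "act (rc eP M) h:extensional (elts M)" if "h:cA (gr M)" for h
  using act_rc_ext(2)[of h "eP" M] M that by simp
qed (use M in \<open>auto intro: act_ext\<close>)

lemma rc_rc:
 fixes M :: "('g, 'k, 'h, 'u) hmod"
 assumes M: "hm M" and b: "b:cr P" and c: "c:cr P"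
 shows "rc (b*[P]c) M = rc b (rc c M)"
proof (rule hmod_eqI[OF _ _ HOL.refl])
 let ?r = "rc b (rc c M)" and ?a = "rc (b*[P]c) M"
 have g: "gr ?r = cj (b*[P]c) (gr M)" using assms by simp
 show "act ?a:extensional (cA (gr ?r))"
  "act ?r:extensional (cA (gr ?r))"
  using act_rc_ext(1)[of "b*[P]c" M] act_rc_ext(1)[of b "rc c M"] g by simp_all
 fix h assume h: "h:cA (gr ?r)"
 show "act ?a h:extensional (elts ?r)"
  "act ?r h:extensional (elts ?r)"
  using act_rc_ext(2)[of h "b*[P]c" M] act_rc_ext(2)[of h b "rc c M"] h g by simp_all
 fix x assume x: "x:elts ?r"
 show "act ?a h x = act ?r h x"
  using h x assms by (simp add: group.inv_mult_group[OF group_axioms] P_assoc[symmetric])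
qed (use assms in auto)

lemma rc_ar_hom:
 assumes "b:cr P" "f:rh M N"
 shows "rj b f:rh (rc b M) (rc b N)"
 using Rep_homD(1-5)[OF assms(2)] assms Rep_homD(6-9)[OF assms(2)]
 by (auto simp: Rep_hom_iff hmod_linear_def)

lemma conj_ra:
 assumes "hm L" "hm M" "hm N" "b:cr P"
 shows "rj b (ra L M N) = ra (rc b L) (rc b M) (rc b N)"
 using assms by (simp add: rep_assoc_def Let_def rc_mt)

lemma T_category_Rep: "T_category P RC"
proof
 fix U V W b c f g
 show "U:Ob RC ==> Deg RC U:cr P" by simp
 show "f:Ar RC ==> Deg RC (Dom RC f) = Deg RC (Cod RC f)" by (simp add: Rep_Ar_iff hmod_linear_def)
 show "U:Ob RC ==> V:Ob RC ==> Deg RC (U**[RC]V) = Deg RC U*[P]Deg RC V" by simp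
 show "b:cr P ==> U:Ob RC ==> conj_ob RC b U:Ob RC" by simp
 show "b:cr P ==> U:Ob RC ==> Deg RC (conj_ob RC b U) = cj b (Deg RC U)" by simp
 show "b:cr P ==> f:rh U V ==> rj b f:rh (conj_ob RC b U) (conj_ob RC b V)"
  using rc_ar_hom[of b f U V] by simp
 show "b:cr P ==> U:Ob RC ==> rj b (ri U) = ri (conj_ob RC b U)" by simp
 show "b:cr P ==> f:rh U V ==> g:rh V W ==> rj b (g oR f) = rj b g oR rj b f"
  by simp
 show "b:cr P ==> U:Ob RC ==> V:Ob RC ==> conj_ob RC b (U**[RC]V) = conj_ob RC b U**[RC]conj_ob RC b V"
  using rc_mt by simp
 show "b:cr P ==> f:Ar RC ==> g:Ar RC ==> rj b (f***[RC]g) = rj b f***[RC]rj b g"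
  using rc_mt by (simp add: Rep_Ar_iff rep_tens_ar_def Let_def)
 show "b:cr P ==> conj_ob RC b \<I>[RC] = \<I>[RC]" using rc_ru by simp
 show "b:cr P ==> U:Ob RC ==> V:Ob RC ==> W:Ob RC ==>
   rj b (assoc RC U V W) = assoc RC (conj_ob RC b U) (conj_ob RC b V) (conj_ob RC b W)"
  using conj_ra by simp
 show "b:cr P ==> U:Ob RC ==> rj b (lunit RC U) = lunit RC (conj_ob RC b U)"
  by (simp add: rep_lunit_def rc_mt rc_ru)
 show "b:cr P ==> U:Ob RC ==> rj b (runit RC U) = runit RC (conj_ob RC b U)"
  by (simp add: rep_runit_def rc_mt rc_ru)
 show "U:Ob RC ==> conj_ob RC eP U = U" by (simp add: rc_one)
 show "f:Ar RC ==> rj eP f = f" by (cases f) (simp add: rc_one Rep_Ar_iff)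
 show "b:cr P ==> c:cr P ==> U:Ob RC ==> conj_ob RC (b*[P]c) U = conj_ob RC b (conj_ob RC c U)"
  by (simp add: rc_rc)
 show "b:cr P ==> c:cr P ==> f:Ar RC ==> rj (b*[P]c) f = rj b (rj c f)"
  by (simp add: rc_rc Rep_Ar_iff)
qed

subsection \<open>The braiding\<close>

lemma rb_bilinear:
 "hm M ==> hm N ==> bo K (sp M) (sp N) (ms N M)
  (%x y. tsum (ms N M) (%p q. mp N M (act N q y) (act M p x)) (R (gr M) (gr N)))"
 by (intro boI linear_Rsum) (auto intro!: lin)

text \<open>Linearity is the exchange rule of R and \<Delta>; the crossing in that rule is the one
  in the action on the conjugate of N.\<close>

lemma rb_hom:
 assumes M [simp]: "hm M" and N [simp]: "hm N"
 shows "rb M N:rh (mt M N) (mt (rc (gr M) N) M)"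
  "x:elts M ==> y:elts N ==>
   amap (rb M N) (mp M N x y) = tsum (ms N M) (%k l. mp N M (act N l y) (act M k x)) (R (gr M) (gr N))"
proof -
 let ?X = "mt (rc (gr M) N) M"
 let ?B = "%x y. tsum (ms N M) (%k l. mp N M (act N l y) (act M k x)) (R (gr M) (gr N))"
 note B = rb_bilinear[OF M N]
 let ?R = "R (gr M) (gr N)" and ?m = "ms N M"
 have e: "rb M N = Arr (mt M N) ?X (tlift K VV (sp M) (sp N) ?m ?B)"
  by (simp add: rep_braid_def Let_def)
 have gX: "gr M*[P]gr N = gr ?X" by simp
 have "hl (mt M N) ?X (tlift K VV (sp M) (sp N) (sp ?X) ?B)"
 proof (rule hmod_linear_tlift[OF M N _ gX])
  fix h x y assume h: "h:cA (gr ?X)" and x: "x:elts M" and y: "y:elts N"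
  have h': "h:cA (gr M*[P]gr N)" using h by simp
  let ?c = "cj (gr M) (gr N)"
  have h'': "h:cA (?c*[P]gr M)" using h by simp
  let ?C = "%p q. mp N M (act N q y) (act M p x)"
  have "tsum (sp ?X) (%a b. ?B (act M a x) (act N b y)) (De (gr M) (gr N) h)
   = tsum ?m (%a b. tsum ?m (%k l. ?C (k*[A (gr M)]a) (l*[A (gr N)]b)) ?R)
     (De (gr M) (gr N) h)"
   using h' x y by simp (intro Ds_cong Rs_cong, auto simp: act_mult)
  also have "... = tsum ?m (%k l. tsum ?m (%a b. ?C (k*[A (gr M)]a) (l*[A (gr N)]b))
     (De (gr M) (gr N) h)) ?R"
   using h' x y by (intro DR_swap) auto
  also have "... = tsum ?m (%h1 h2. tsum ?m (%k l. ?C (h2*[A (gr M)]k) (ph (iv (gr M)) ?c h1*[A (gr N)]l))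
     ?R) (De ?c (gr M) h)"
   using h' x y by (intro R_comult_sum) (auto intro!: lin)
  also have "... = tsum ?m (%h1 h2. tsum ?m (%k l. mp N M (act (rc (gr M) N) h1 (act N l y)) (act M h2 (act M k x)))
     ?R) (De ?c (gr M) h)"
   using h'' x y by (intro Ds_cong Rs_cong) (auto simp: act_mult)
  also have "... = tsum ?m (%k l. tsum ?m (%h1 h2. mp N M (act (rc (gr M) N) h1 (act N l y)) (act M h2 (act M k x)))
     (De ?c (gr M) h)) ?R"
   using h'' x y by (intro DR_swap) auto
  also have "... = tsum ?m (%k l. act ?X h (mp N M (act N l y) (act M k x))) ?R"
   using h'' x y act_mt_pure[of "rc (gr M) N" M h] by (intro Rs_cong) auto
  also have "... = act ?X h (?B x y)"
   using h x y linear_act[of ?X h] by (intro Rs_out[symmetric]) auto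
  finally show "tsum (sp ?X) (%a b. ?B (act M a x) (act N b y)) (De (gr M) (gr N) h) = act ?X h (?B x y)" .
 qed (use B in auto)
 then show "rb M N:rh (mt M N) (mt (rc (gr M) N) M)" using e by (simp add: Rep_hom_iff)
 show "x:elts M ==> y:elts N ==> amap (rb M N) (mp M N x y) = ?B x y"
  unfolding e using tlift_pr(3)[OF _ _ _ B] by simp
qed

definition flip where "flip M N = tlift K VV (sp M) (sp N) (ms N M) (%x y. mp N M y x)"

lemma flip_props:
 assumes "hm M" "hm N"
 shows "lo K (ms M N) (ms N M) (flip M N)"
  "x:elts M ==> y:elts N ==> flip M N (mp M N x y) = mp N M y x"
  "z:cr (ms M N) ==> flip M N z:cr (ms N M)"
  "z:cr (ms M N) ==> flip N M (flip M N z) = z"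
proof -
 have t: "lo K (ms M N) (ms N M) (flip M N) & (\<forall>x\<in>elts M. \<forall>y\<in>elts N. flip M N (mp M N x y) = mp N M y x)"
  if M: "hm M" and N: "hm N" for M N :: "('g, 'k, 'h, 'u) hmod"
 proof -
  have "bo K (sp M) (sp N) (ms N M) (%x y. mp N M y x)" using M N by (auto intro!: lin)
  then show ?thesis
   using tlift_pr(2,3)[OF hmD(2)[OF M] hmD(2)[OF N], of "ms N M" "%x y. mp N M y x"] M N
   unfolding flip_def by simp
 qed
 show 1: "lo K (ms M N) (ms N M) (flip M N)"
  "x:elts M ==> y:elts N ==> flip M N (mp M N x y) = mp N M y x"
  "z:cr (ms M N) ==> flip M N z:cr (ms N M)"
  using t[OF assms] by (auto dest: lo_closed)
 show "z:cr (ms M N) ==> flip N M (flip M N z) = z"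
  by (rule ts_ext[OF hmD(2)[OF assms(1)] hmD(2)[OF assms(2)], where f = "%z. flip N M (flip M N z)" and g = "%z. z" and X = "ms M N"])
   (use assms t lo_compose[OF 1(1) conjunct1[OF t[OF assms(2,1)]]] in \<open>auto intro!: lin\<close>)
qed

text \<open>With the braiding split into the action of R and a flip, its inverse becomes the flip
  followed by the action of R^-1.\<close>

lemma rb_top:
 assumes M [simp]: "hm M" and N [simp]: "hm N" and z: "z:cr (ms M N)"
 shows "amap (rb M N) z = flip M N (top M N (R (gr M) (gr N)) z)"
proof (rule ts_ext[OF hmD(2)[OF M] hmD(2)[OF N] _ _ _ _ z])
 let ?R = "R (gr M) (gr N)"
 have R: "R (gr M) (gr N):cr (AA M N)" by (simp add: R_closed)
 note f = flip_props[OF M N]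
 show "lo K (ms M N) (ms N M) (amap (rb M N))" using Rep_homD(7)[OF rb_hom(1)[OF M N]] by simp
 show "lo K (ms M N) (ms N M) (%z. flip M N (top M N ?R z))"
  using lo_compose[OF top_linear[OF M N R] f(1)] .
 fix x y assume xy: "x:elts M" "y:elts N"
 have "flip M N (top M N ?R (mp M N x y))
  = tsum (ms N M) (%p q. flip M N (mp M N (act M p x) (act N q y))) ?R"
  using R xy f(1) by (simp add: top_pure) (rule Rs_out, auto)
 also have "... = amap (rb M N) (mp M N x y)"
  using xy f by (simp add: rb_hom) (rule Rs_cong, auto)
 finally show "amap (rb M N) (mp M N x y) = flip M N (top M N ?R (mp M N x y))" by simp
qed simp

lemma rb_iso:
 assumes M [simp]: "hm M" and N [simp]: "hm N"
 shows "inverse_arrows RC (rb M N) (Arr (mt (rc (gr M) N) M) (mt M N)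
  (restrict (%z. top M N (Ri (gr M) (gr N)) (flip N M z)) (cr (ms N M))))"
proof -
 let ?a = "gr M" and ?b = "gr N"
 have R: "R ?a ?b:cr (AA M N)" "Ri ?a ?b:cr (AA M N)" by (simp_all add: R_closed Ri_closed)
 note f = flip_props[OF M N] and f' = flip_props[OF N M]
 have inv: "Ri ?a ?b*[AA M N]R ?a ?b = pure K (A ?a) (A ?b) \<one>[A ?a] \<one>[A ?b]"
  "R ?a ?b*[AA M N]Ri ?a ?b = pure K (A ?a) (A ?b) \<one>[A ?a] \<one>[A ?b]"
  using Rmat_inv_eq[of ?a ?b] by (simp_all add: tensor_one)
 have 1: "top M N (Ri ?a ?b) (top M N (R ?a ?b) z) = z"
  "top M N (R ?a ?b) (top M N (Ri ?a ?b) z) = z" if "z:cr (ms M N)" for z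
  using top_mult[OF M N R(2,1) that] top_mult[OF M N R that] inv top_one[OF M N that] by simp_all
 have "inverse_arrows RC (rb M N) (Arr (mt (rc ?a N) M) (mt M N)
  (restrict (%z. top M N (Ri ?a ?b) (flip N M z)) (elts (mt (rc ?a N) M))))"
  by (rule Rep_inverse[OF rb_hom(1)[OF M N]])
   (use R f f' 1 in \<open>auto simp: rb_top\<close>)
 then show ?thesis by simp
qed

lemma linear_act_rc:
 "hm M ==> b:cr P ==> g = cj b (gr M) ==> lo K U (A g) f ==> x:elts M
  ==> lo K U (sp M) (%u. act (rc b M) (f u) x)"
 using linear_act_left[of "rc b M" g U f x] by simp

lemma amap_Rsum:
 "f:rh M N ==> X = sp M ==> a:cr P ==> b:cr P ==>
  (!!x y. x:cA a ==> y:cA b ==> B x y:cr X) ==>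
  amap f (tsum X B (R a b)) = tsum (sp N) (%x y. amap f (B x y)) (R a b)"
 by (rule Rs_out) (auto dest: Rep_homD)

lemma tp_Rsum_left:
 "fd_space K V ==> fd_space K W ==> a:cr P ==> b:cr P ==>
  (!!x y. x:cA a ==> y:cA b ==> B x y:cr V) ==> p:cr W ==>
  tp V W (tsum V B (R a b)) p = tsum (ts V W) (%x y. tp V W (B x y) p) (R a b)"
 by (rule Rs_out[where f = "%x. tp V W x p"]) (auto intro!: lin)

lemma tp_Rsum_right:
 "fd_space K V ==> fd_space K W ==> a:cr P ==> b:cr P ==>
  (!!x y. x:cA a ==> y:cA b ==> B x y:cr W) ==> p:cr V ==>
  tp V W p (tsum W B (R a b)) = tsum (ts V W) (%x y. tp V W p (B x y)) (R a b)"
 by (rule Rs_out[where f = "%x. tp V W p x"]) (auto intro!: lin)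

lemma inv_ra:
 assumes L: "hm L" and M: "hm M" and N: "hm N"
 shows "rv (ra L M N):rh (mt L (mt M N)) (mt (mt L M) N)"
  "l:elts L ==> m:elts M ==> n:elts N ==>
   amap (rv (ra L M N)) (mp L (mt M N) l (mp M N m n)) = mp (mt L M) N (mp L M l m) n"
proof -
 note a = ra_hom[OF assms]
 have i: "inverse_arrows RC (ra L M N) (rv (ra L M N))"
  using RC.inv_inv ra_iso[OF assms] by (simp add: is_iso_def)
 note r = Rep_iso_amap[OF a(1) i]
 show "rv (ra L M N):rh (mt L (mt M N)) (mt (mt L M) N)" by (rule r)
 assume "l:elts L" "m:elts M" "n:elts N"
 then show "amap (rv (ra L M N)) (mp L (mt M N) l (mp M N m n)) = mp (mt L M) N (mp L M l m) n"
  using a(2)[of l m n] r(2)[of "mp (mt L M) N (mp L M l m) n"] assms by simp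
qed

text \<open>This hexagon is the axiom for (\<Delta> \<otimes> id)(R), acting on U, V and W. The
  crossed copy of R in the axiom belongs to the braiding of U with the conjugate W'.\<close>

lemma rb_tens_left:
 assumes U [simp]: "hm U" and V [simp]: "hm V" and W [simp]: "hm W"
 defines "W' == rc (gr V) W"
 shows "rb (mt U V) W = ra (rc (gr U) W') U V oR rt (rb U W') (ri V) oR rv (ra U W' V)
   oR rt (ri U) (rb V W) oR ra U V W" (is "?l = ?a5 oR ?a4 oR ?a3 oR ?a2 oR ?a1")
proof -
 let ?u = "gr U" and ?v = "gr V" and ?w = "gr W"
 let ?R = "R ?v ?w" and ?a = "R ?u (cj ?v ?w)" and ?b = "?a5 oR ?a4 oR ?a3 oR ?a2 oR ?a1"
 have W': "hm W'" "sp W' = sp W" "gr W' = cj ?v ?w" by (simp_all add: W'_def)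
 have W'': "hm (rc ?u W')" "rc (?u*[P]?v) W = rc ?u W'" using W' by (simp_all add: W'_def rc_rc)
 note h1 = ra_hom[OF U V W]
 note h2 = Rep_tens[OF Rep_id[OF U] rb_hom(1)[OF V W], folded W'_def]
 note h3 = inv_ra[OF U W'(1) V]
 note h4 = Rep_tens[OF rb_hom(1)[OF U W'(1)] Rep_id[OF V]]
 note h5 = ra_hom[OF W''(1) U V]
 note c2 = Rep_comp[OF h1(1) h2(1)] note c3 = Rep_comp[OF c2(1) h3(1)]
 note c4 = Rep_comp[OF c3(1) h4(1)] note c5 = Rep_comp[OF c4(1) h5(1)]
 have hl: "?l:rh (mt (mt U V) W) (mt (rc ?u W') (mt U V))"
  using rb_hom(1)[OF hm_mt[OF U V] W] W''(2) by simp
 show ?thesis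
 proof (rule Rep_ar_eq3I[OF hl c5(1) U V W])
  fix x y z assume x: "x:elts U" and y: "y:elts V" and z: "z:elts W"
  let ?SU = "sp U" and ?SV = "sp V" and ?SW = "sp W"
  let ?X = "ts ?SW (ts ?SU ?SV)"
  let ?p = "mp (mt U V) W (mp U V x y) z"
  let ?d = "cj (iv ?v) ?u"
  let ?B = "%a b c. tp ?SW (ts ?SU ?SV) (act W c z) (tp ?SU ?SV (act U a x) (act V b y))"
  have "amap ?l ?p = tsum ?X (%k l. tp ?SW (ts ?SU ?SV) (act W l z) (act (mt U V) k (mp U V x y))) (R (?u*[P]?v) ?w)"
   using rb_hom(2)[OF hm_mt[OF U V] W, of "mp U V x y" z] x y z by simp
  also have "... = tsum ?X (%k l. tsum ?X (%a b. ?B a b l) (De ?u ?v k)) (R (?u*[P]?v) ?w)"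
   using x y z by (intro Rs_cong)
    (auto simp: act_mt_pure intro!: Ds_out[where f = "%x. tp ?SW (ts ?SU ?SV) _ x"] lin)
  also have "... = tsum ?X (%p q. tsum ?X (%b c. ?B (ph ?v ?d p) b (q*[A ?w]c)) ?R) (R ?d ?w)"
   using x y z by (intro R_tri_left) (auto intro!: lin)
  finally have L: "amap ?l ?p = ..." .
  let ?Y3 = "ts (ts ?SU ?SW) ?SV" let ?Y4 = "ts (ts ?SW ?SU) ?SV"
  have e1: "amap ?a1 ?p = tp ?SU (ts ?SV ?SW) x (tp ?SV ?SW y z)" using h1(2) x y z by simp
  have e2: "amap ?a2 (tp ?SU (ts ?SV ?SW) x (tp ?SV ?SW y z))
    = tsum (ts ?SU (ts ?SW ?SV)) (%k l. tp ?SU (ts ?SW ?SV) x (tp ?SW ?SV (act W l z) (act V k y))) ?R"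
   using h2(2)[of x "mp V W y z"] x y z W' by (simp add: rb_hom(2) tp_Rsum_right)
  have e3: "amap ?a3 (tsum (ts ?SU (ts ?SW ?SV)) (%k l. tp ?SU (ts ?SW ?SV) x (tp ?SW ?SV (act W l z) (act V k y))) ?R)
    = tsum ?Y3 (%k l. tp (ts ?SU ?SW) ?SV (tp ?SU ?SW x (act W l z)) (act V k y)) ?R"
   using x y z W' h3(2) by (subst amap_Rsum[OF h3(1)]) (auto intro!: Rs_cong)
  have e4: "amap ?a4 (tsum ?Y3 (%k l. tp (ts ?SU ?SW) ?SV (tp ?SU ?SW x (act W l z)) (act V k y)) ?R)
    = tsum ?Y4 (%k l. tsum ?Y4 (%k' l'. tp (ts ?SW ?SU) ?SV (tp ?SW ?SU (act W' l' (act W l z)) (act U k' x)) (act V k y))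
      ?a) ?R"
  proof -
   have "amap ?a4 (tp (ts ?SU ?SW) ?SV (tp ?SU ?SW x (act W l z)) (act V k y))
    = tsum ?Y4 (%k' l'. tp (ts ?SW ?SU) ?SV (tp ?SW ?SU (act W' l' (act W l z)) (act U k' x)) (act V k y))
      ?a"
    if "k:cA ?v" "l:cA ?w" for k l
    using h4(2)[of "mp U W' x (act W l z)" "act V k y"] that x y z W' rb_hom(2)[OF U W'(1), of x "act W l z"]
     hmD(4)[OF W'(1)] by (simp add: tp_Rsum_left)
   then show ?thesis
    using x y z W' by (subst amap_Rsum[OF h4(1)]) (auto intro!: Rs_cong)
  qed
  have e5: "amap ?a5 (tsum ?Y4 (%k l. tsum ?Y4 (%k' l'. tp (ts ?SW ?SU) ?SV (tp ?SW ?SU (act W' l' (act W l z)) (act U k' x)) (act V k y))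
      ?a) ?R)
    = tsum ?X (%k l. tsum ?X (%k' l'. tp ?SW (ts ?SU ?SV) (act W' l' (act W l z)) (tp ?SU ?SV (act U k' x) (act V k y)))
      ?a) ?R"
   using x y z W' h5(2) hmD(4)[OF W'(1)]
   by (subst amap_Rsum[OF h5(1)]) (auto intro!: Rs_cong simp: amap_Rsum[OF h5(1)])
  \<comment> \<open>The braiding of U with W' uses R in the degrees u and v w v^-1; invariance under
    the crossing by v brings it to the degrees v^-1 u v and w of the axiom.\<close>
  have "tsum ?X (%k l. tsum ?X (%k' l'. tp ?SW (ts ?SU ?SV) (act W' l' (act W l z)) (tp ?SU ?SV (act U k' x) (act V k y)))
      ?a) ?R
    = tsum ?X (%k l. tsum ?X (%p q. tp ?SW (ts ?SU ?SV) (act W' (ph ?v ?w q) (act W l z)) (tp ?SU ?SV (act U (ph ?v ?d p) x) (act V k y)))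
      (R ?d ?w)) ?R"
   using x y z unfolding W'_def by (intro Rs_cong R_crossing_sum) (auto intro!: lin linear_act_rc)
  also have "... = tsum ?X (%k l. tsum ?X (%p q. ?B (ph ?v ?d p) k (q*[A ?w]l)) (R ?d ?w)) ?R"
   using x y z by (intro Rs_cong) (auto simp: W'_def act_mult)
  also have "... = tsum ?X (%p q. tsum ?X (%b c. ?B (ph ?v ?d p) b (q*[A ?w]c)) ?R) (R ?d ?w)"
   using x y z by (intro Rs_swap) auto
  finally have Rr: "tsum ?X (%k l. tsum ?X (%k' l'. tp ?SW (ts ?SU ?SV) (act W' l' (act W l z)) (tp ?SU ?SV (act U k' x) (act V k y)))
      ?a) ?R = ..." .
  have p: "?p:elts (mt (mt U V) W)" using x y z by simp
  have "amap ?b ?p = amap ?a5 (amap ?a4 (amap ?a3 (amap ?a2 (amap ?a1 ?p))))"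
   by (simp only: c5(2)[OF p] c4(2)[OF p] c3(2)[OF p] c2(2)[OF p])
  then show "amap ?l ?p = amap ?b ?p"
   using L Rr e1 e2 e3 e4 e5 by simp
 qed
qed

text \<open>Both R-matrices have U in their first slot, so the axiom for (id \<otimes> \<Delta>)(R)
  applies without a crossing; the two sums only come in the opposite order.\<close>

lemma rb_tens_right:
 assumes U [simp]: "hm U" and V [simp]: "hm V" and W [simp]: "hm W"
 defines "V' == rc (gr U) V" and "W' == rc (gr U) W"
 shows "rb U (mt V W) = rv (ra V' W' U) oR rt (ri V') (rb U W) oR ra V' U W
   oR rt (rb U V) (ri W) oR rv (ra U V W)" (is "?l = ?a5 oR ?a4 oR ?a3 oR ?a2 oR ?a1")
proof -
 let ?u = "gr U" and ?v = "gr V" and ?w = "gr W"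
 let ?R = "R ?u ?v" and ?a = "R ?u ?w" and ?b = "?a5 oR ?a4 oR ?a3 oR ?a2 oR ?a1"
 have V': "hm V'" "sp V' = sp V" by (simp_all add: V'_def)
 have W': "hm W'" "sp W' = sp W" by (simp_all add: W'_def)
 note h1 = inv_ra[OF U V W]
 note h2 = Rep_tens[OF rb_hom(1)[OF U V] Rep_id[OF W], folded V'_def]
 note h3 = ra_hom[OF V'(1) U W]
 note h4 = Rep_tens[OF Rep_id[OF V'(1)] rb_hom(1)[OF U W], folded W'_def]
 note h5 = inv_ra[OF V'(1) W'(1) U]
 note c2 = Rep_comp[OF h1(1) h2(1)] note c3 = Rep_comp[OF c2(1) h3(1)]
 note c4 = Rep_comp[OF c3(1) h4(1)] note c5 = Rep_comp[OF c4(1) h5(1)]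
 have hl: "?l:rh (mt U (mt V W)) (mt (mt V' W') U)"
  using rb_hom(1)[OF U hm_mt[OF V W]] by (simp add: rc_mt V'_def W'_def)
 show ?thesis
 proof (rule Rep_ar_eq3I'[OF hl c5(1) U V W])
  fix x y z assume x: "x:elts U" and y: "y:elts V" and z: "z:elts W"
  let ?SU = "sp U" and ?SV = "sp V" and ?SW = "sp W"
  let ?X = "ts (ts ?SV ?SW) ?SU"
  let ?p = "mp U (mt V W) x (mp V W y z)"
  let ?B = "%a b c. tp (ts ?SV ?SW) ?SU (tp ?SV ?SW (act V b y) (act W c z)) (act U a x)"
  have "amap ?l ?p = tsum ?X (%k l. tp (ts ?SV ?SW) ?SU (act (mt V W) l (mp V W y z)) (act U k x)) (R ?u (?v*[P]?w))"
   using rb_hom(2)[OF U hm_mt[OF V W], of x "mp V W y z"] x y z by simp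
  also have "... = tsum ?X (%k l. tsum ?X (%b c. ?B k b c) (De ?v ?w l)) (R ?u (?v*[P]?w))"
   using x y z by (intro Rs_cong)
    (auto simp: act_mt_pure intro!: Ds_out[where f = "%x. tp (ts ?SV ?SW) ?SU x _"] lin)
  also have "... = tsum ?X (%a c. tsum ?X (%a' b. ?B (a*[A ?u]a') b c) ?R) ?a"
   using x y z by (intro R_tri_right) (auto intro!: lin)
  also have "... = tsum ?X (%a' b. tsum ?X (%a c. ?B (a*[A ?u]a') b c) ?a) ?R"
   using x y z by (intro Rs_swap) auto
  finally have L: "amap ?l ?p = ..." .
  have e1: "amap ?a1 ?p = tp (ts ?SU ?SV) ?SW (tp ?SU ?SV x y) z" using h1(2) x y z by simp
  let ?Y2 = "ts (ts ?SV ?SU) ?SW" let ?Y3 = "ts ?SV (ts ?SU ?SW)" let ?Y4 = "ts ?SV (ts ?SW ?SU)"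
  have e2: "amap ?a2 (tp (ts ?SU ?SV) ?SW (tp ?SU ?SV x y) z)
    = tsum ?Y2 (%a' b. tp (ts ?SV ?SU) ?SW (tp ?SV ?SU (act V b y) (act U a' x)) z) ?R"
   using h2(2)[of "mp U V x y" z] x y z V' by (simp add: rb_hom(2) tp_Rsum_left)
  have e3: "amap ?a3 (tsum ?Y2 (%a' b. tp (ts ?SV ?SU) ?SW (tp ?SV ?SU (act V b y) (act U a' x)) z) ?R)
    = tsum ?Y3 (%a' b. tp ?SV (ts ?SU ?SW) (act V b y) (tp ?SU ?SW (act U a' x) z)) ?R"
   using x y z V' h3(2) by (subst amap_Rsum[OF h3(1)]) (auto intro!: Rs_cong)
  have e4: "amap ?a4 (tsum ?Y3 (%a' b. tp ?SV (ts ?SU ?SW) (act V b y) (tp ?SU ?SW (act U a' x) z)) ?R)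
    = tsum ?Y4 (%a' b. tsum ?Y4 (%a c. tp ?SV (ts ?SW ?SU) (act V b y) (tp ?SW ?SU (act W c z) (act U a (act U a' x)))) ?a) ?R"
  proof -
   have "amap ?a4 (tp ?SV (ts ?SU ?SW) (act V b y) (tp ?SU ?SW (act U a' x) z))
    = tsum ?Y4 (%a c. tp ?SV (ts ?SW ?SU) (act V b y) (tp ?SW ?SU (act W c z) (act U a (act U a' x)))) ?a"
    if "a':cA ?u" "b:cA ?v" for a' b
    using h4(2)[of "act V b y" "mp U W (act U a' x) z"] that x y z V' W' rb_hom(2)[OF U W, of "act U a' x" z]
    by (simp add: tp_Rsum_right)
   then show ?thesis
    using x y z V' W' by (subst amap_Rsum[OF h4(1)]) (auto intro!: Rs_cong)
  qed
  have e5: "amap ?a5 (tsum ?Y4 (%a' b. tsum ?Y4 (%a c. tp ?SV (ts ?SW ?SU) (act V b y) (tp ?SW ?SU (act W c z) (act U a (act U a' x)))) ?a) ?R)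
    = tsum ?X (%a' b. tsum ?X (%a c. ?B (a*[A ?u]a') b c) ?a) ?R"
   using x y z V' W' h5(2)
   by (subst amap_Rsum[OF h5(1)]) (auto intro!: Rs_cong simp: amap_Rsum[OF h5(1)] act_mult)
  have p: "?p:elts (mt U (mt V W))" using x y z by simp
  have "amap ?b ?p = amap ?a5 (amap ?a4 (amap ?a3 (amap ?a2 (amap ?a1 ?p))))"
   by (simp only: c5(2)[OF p] c4(2)[OF p] c3(2)[OF p] c2(2)[OF p])
  then show "amap ?l ?p = amap ?b ?p"
   using L e1 e2 e3 e4 e5 by simp
 qed
qed

lemma rb_conj:
 assumes M [simp]: "hm M" and N [simp]: "hm N" and b [simp]: "b:cr P"
 shows "rj b (rb M N) = rb (rc b M) (rc b N)"
proof -
 let ?r = "rc b N" and ?a = "rc b M"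
 let ?b = "mt (rc (cj b (gr M)) ?r) ?a"
 have c: "b*[P]gr M = cj b (gr M)*[P]b" by simp
 have cod: "rc b (rc (gr M) N) = rc (cj b (gr M)) ?r"
  using c by (simp add: rc_rc[symmetric])
 have h1: "rj b (rb M N):rh (mt ?a ?r) ?b"
  using rc_ar_hom[OF b rb_hom(1)[OF M N]] cod by (simp add: rc_mt)
 have h2: "rb ?a ?r:rh (mt ?a ?r) ?b"
  using rb_hom(1)[of "rc b M" "rc b N"] by simp
 show ?thesis
 proof (rule Rep_ar_eq2I[OF h1 h2])
  fix x y assume x: "x:elts ?a" and y: "y:elts ?r"
  let ?m = "gr M" and ?n = "gr N"
  have "amap (rb ?a ?r) (mp ?a ?r x y)
   = tsum (ms N M) (%p q. mp N M (act ?r q y) (act ?a p x)) (R (cj b ?m) (cj b ?n))"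
   using rb_hom(2)[of "rc b M" "rc b N" x y] x y by simp
  also have "... = tsum (ms N M) (%p q. mp N M (act ?r (ph b ?n q) y) (act ?a (ph b ?m p) x)) (R ?m ?n)"
   using x y by (intro R_crossing_sum) (auto intro!: lin linear_act_rc)
  also have "... = tsum (ms N M) (%p q. mp N M (act N q y) (act M p x)) (R ?m ?n)"
   using x y by (intro Rs_cong) auto
  also have "... = amap (rb M N) (mp M N x y)" using x y by (simp add: rb_hom(2))
  finally show "amap (rj b (rb M N)) (mp ?a ?r x y) = amap (rb ?a ?r) (mp ?a ?r x y)"
   by simp
 qed simp_all
qed

lemma rb_natural:
 assumes f: "f:rh M M'" and g: "g:rh N N'"
 shows "rt (rj (gr M) g) f oR rb M N = rb M' N' oR rt f g"
proof -
 note F = Rep_homD[OF f] and G = Rep_homD[OF g]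
 have [simp]: "hm M" "hm N" "hm M'" "hm N'" using F G by auto
 note cg = rc_ar_hom[OF hmD(1)[OF F(1)] g]
 note t1 = Rep_tens[OF cg f] note t2 = Rep_tens[OF f g]
 note b1 = rb_hom[OF F(1) G(1)] note b2 = rb_hom[OF F(2) G(2)]
 note c1 = Rep_comp[OF b1(1) t1(1)]
 note c2 = Rep_comp[OF t2(1) b2(1)[folded F(6)]]
 show ?thesis
 proof (rule Rep_ar_eq2I[OF c1(1) c2(1) F(1) G(1)])
  fix x y assume x: "x:elts M" and y: "y:elts N"
  let ?m = "gr M" and ?n = "gr N"
  have "amap (rt (rj ?m g) f) (amap (rb M N) (mp M N x y))
   = tsum (ms N' M') (%p q. amap (rt (rj ?m g) f) (mp N M (act N q y) (act M p x))) (R ?m ?n)"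
   unfolding b1(2)[OF x y] using x y by (subst amap_Rsum[OF t1(1)]) auto
  also have "... = tsum (ms N' M') (%p q. mp N' M' (act N' q (amap g y)) (act M' p (amap f x))) (R ?m ?n)"
   using x y t1(2) F(9) G(9) by (intro Rs_cong) auto
  also have "... = amap (rb M' N') (amap (rt f g) (mp M N x y))"
   unfolding t2(2)[OF x y] b2(2)[OF F(8)[OF x] G(8)[OF y]] using F(6) G(6) by simp
  finally show "amap (rt (rj ?m g) f oR rb M N) (mp M N x y) = amap (rb M' N' oR rt f g) (mp M N x y)"
   using c1(2)[of "mp M N x y"] c2(2)[of "mp M N x y"] x y by (simp del: Rep_simps(5,14))
 qed
qed

lemma braided_T_category_Rep: "braided_T_category P RC"
proof -
 interpret T: T_category P "RC" by (rule T_category_Rep)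
 show ?thesis
 proof
  fix U V W b f g U' V'
  show "U:Ob RC ==> V:Ob RC ==>
   braid RC U V:rh (U**[RC]V) (U \<rhd>\<^sub>o\<^bsub>RC\<^esub> V**[RC]U) & is_iso RC (braid RC U V)"
   using rb_hom(1)[of U V] rb_iso[of U V] by (auto simp: is_iso_def)
  show "f:rh U U' ==> g:rh V V' ==>
   ((U \<rhd>\<^sub>a\<^bsub>RC\<^esub> g)***[RC]f) oR braid RC U V = braid RC U' V' oR (f***[RC]g)"
   using rb_natural[of f U U' g V V'] by (simp only: Rep_simps(7,12,15))
  show "U:Ob RC ==> V:Ob RC ==> W:Ob RC ==>
   braid RC (U**[RC]V) W = assoc RC (U \<rhd>\<^sub>o\<^bsub>RC\<^esub> V \<rhd>\<^sub>o\<^bsub>RC\<^esub> W) U V oR (braid RC U (V \<rhd>\<^sub>o\<^bsub>RC\<^esub> W)***[RC]ri V)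
    oR rv (assoc RC U (V \<rhd>\<^sub>o\<^bsub>RC\<^esub> W) V) oR (ri U***[RC]braid RC V W) oR assoc RC U V W"
   using rb_tens_left[of U V W] by (simp only: Rep_simps(1,6,7,9,12,13,15) mem_Collect_eq)
  show "U:Ob RC ==> V:Ob RC ==> W:Ob RC ==>
   braid RC U (V**[RC]W) = rv (assoc RC (U \<rhd>\<^sub>o\<^bsub>RC\<^esub> V) (U \<rhd>\<^sub>o\<^bsub>RC\<^esub> W) U) oR (ri (U \<rhd>\<^sub>o\<^bsub>RC\<^esub> V)***[RC]braid RC U W)
    oR assoc RC (U \<rhd>\<^sub>o\<^bsub>RC\<^esub> V) U W oR (braid RC U V***[RC]ri W) oR rv (assoc RC U V W)"
   using rb_tens_right[of U V W] by (simp only: Rep_simps(1,6,7,9,12,13,15) mem_Collect_eq)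
  show "b:cr P ==> U:Ob RC ==> V:Ob RC ==> rj b (braid RC U V) = braid RC (conj_ob RC b U) (conj_ob RC b V)"
   using rb_conj[of U V b] by (simp only: Rep_simps(1,13,15) mem_Collect_eq)
 qed
qed

text \<open>The braiding with the unit object is trivial because (\<epsilon> \<otimes> id)(R) = 1.
  This makes the unit constraints compatible with twists.\<close>

lemma rb_unit_left:
 assumes M [simp]: "hm M"
 shows "rr M oR rb ru M = rl M"
proof -
 have b: "rb ru M:rh (mt ru M) (mt M ru)" using rb_hom(1)[OF hm_ru M] by (simp add: rc_one)
 note c = Rep_comp[OF b rr_hom(1)[OF M]]
 show ?thesis
 proof (rule Rep_ar_eq2I[OF c(1) rl_hom(1)[OF M] hm_ru M])
  fix x y assume x: "x:elts ru" and y: "y:elts M"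
  have x': "x:cr kk" using x by simp
  have "amap (rb ru M) (mp ru M x y) = tsum (ms M ru) (%p q. ep p.*[ms M ru]mp M ru (act M q y) x) (R eP (gr M))"
   unfolding rb_hom(2)[OF hm_ru M x y] using x y by simp (rule Rs_cong, auto simp: tp_smult)
  also have "... = mp M ru (act M \<one>[A (gr M)] y) x"
   using x y by (intro R_counit_left_sum) (auto intro!: lin)
  finally have e: "amap (rb ru M) (mp ru M x y) = mp M ru y x" using y by simp
  show "amap (rr M oR rb ru M) (mp ru M x y) = amap (rl M) (mp ru M x y)"
   unfolding rl_hom(2)[OF M x y] c(2)[OF elts_mt[OF hm_ru M x y]] e using rr_hom(2)[OF M x y] .
 qed
qed

lemma rb_unit_right:
 assumes M [simp]: "hm M"
 shows "rl M oR rb M ru = rr M"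
proof -
 have b: "rb M ru:rh (mt M ru) (mt ru M)" using rb_hom(1)[OF M hm_ru] by (simp add: rc_ru)
 note c = Rep_comp[OF b rl_hom(1)[OF M]]
 show ?thesis
 proof (rule Rep_ar_eq2I[OF c(1) rr_hom(1)[OF M] M hm_ru])
  fix y x assume x: "x:elts ru" and y: "y:elts M"
  have x': "x:cr kk" using x by simp
  have "amap (rb M ru) (mp M ru y x) = tsum (ms ru M) (%p q. ep q.*[ms ru M]mp ru M x (act M p y)) (R (gr M) eP)"
   unfolding rb_hom(2)[OF M hm_ru y x] using x y by simp (rule Rs_cong, auto simp: tp_smult)
  also have "... = mp ru M x (act M \<one>[A (gr M)] y)"
   using x y by (intro R_counit_right_sum) (auto intro!: lin)
  finally have e: "amap (rb M ru) (mp M ru y x) = mp ru M x y" using y by simp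
  show "amap (rl M oR rb M ru) (mp M ru y x) = amap (rr M) (mp M ru y x)"
   unfolding rr_hom(2)[OF M x y] c(2)[OF elts_mt[OF M hm_ru y x]] e using rl_hom(2)[OF M x y] .
 qed
qed

end

section \<open>The twist extension of a braided T-category\<close>

text \<open>The axioms are stated for hom sets; here they become conditional rewrite rules in terms
  of \<open>Ar\<close>, \<open>Dom\<close> and \<open>Cod\<close>, by which long composites are
  normalised.\<close>

named_theorems cat

section \<open>Rewriting of composites by domain and codomain\<close>

context tensor_category
begin

lemma Ar_hom: "f:Ar C ==> f:hom_set C (Dom C f) (Cod C f)"
 by (simp add: hom_set_def)

lemma Ar_Ob [cat]: "f:Ar C ==> Dom C f:Ob C" "f:Ar C ==> Cod C f:Ob C"
 using dom_cod by auto

lemma Id_cat [cat]: "U:Ob C ==> Id C U:Ar C" "U:Ob C ==> Dom C (Id C U) = U" "U:Ob C ==> Cod C (Id C U) = U"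
 using id_hom by (auto simp: hom_set_def)

lemma comp_cat [cat]:
 assumes "f:Ar C" "g:Ar C" "Dom C g = Cod C f"
 shows "g \<bullet> f:Ar C" "Dom C (g \<bullet> f) = Dom C f" "Cod C (g \<bullet> f) = Cod C g"
 using comp_hom[of f "Dom C f" "Cod C f" g "Cod C g"] assms by (auto simp: hom_set_def)

lemma comp_Id_cat [cat]:
 "f:Ar C ==> Dom C f = U ==> f \<bullet> Id C U = f" "f:Ar C ==> Cod C f = V ==> Id C V \<bullet> f = f"
 using comp_id[OF Ar_hom] by auto

lemma comp_assoc_cat [cat]:
 "f:Ar C ==> g:Ar C ==> h:Ar C ==> Dom C g = Cod C f ==> Dom C h = Cod C g ==>
  (h \<bullet> g) \<bullet> f = h \<bullet> (g \<bullet> f)"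
 using comp_assoc[of f "Dom C f" "Cod C f" g "Cod C g" h "Cod C h"] by (auto simp: hom_set_def)

lemma tens_cat [cat]:
 "f:Ar C ==> g:Ar C ==> f *** g:Ar C"
 "f:Ar C ==> g:Ar C ==> Dom C (f *** g) = Dom C f ** Dom C g"
 "f:Ar C ==> g:Ar C ==> Cod C (f *** g) = Cod C f ** Cod C g"
 using tens_ar_hom[OF Ar_hom Ar_hom] by (auto simp: hom_set_def)

lemma tens_Id_cat [cat]: "U:Ob C ==> V:Ob C ==> Id C U *** Id C V = Id C (U ** V)"
 by (rule tens_id)

lemma interchange:
 "f:Ar C ==> f':Ar C ==> Dom C f' = Cod C f ==> g:Ar C ==> g':Ar C ==> Dom C g' = Cod C g ==>
  (f' *** g') \<bullet> (f *** g) = (f' \<bullet> f) *** (g' \<bullet> g)"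
 using tens_comp[of f "Dom C f" "Cod C f" f' "Cod C f'" g "Dom C g" "Cod C g" g' "Cod C g'"] by (auto simp: hom_set_def)

lemma interchange':
 assumes "f:Ar C" "f':Ar C" "Dom C f' = Cod C f" "g:Ar C" "g':Ar C" "Dom C g' = Cod C g"
  "h:Ar C" "Cod C h = Dom C f ** Dom C g"
 shows "(f' *** g') \<bullet> ((f *** g) \<bullet> h) = ((f' \<bullet> f) *** (g' \<bullet> g)) \<bullet> h"
proof -
 have "(f' *** g') \<bullet> ((f *** g) \<bullet> h) = ((f' *** g') \<bullet> (f *** g)) \<bullet> h"
  using assms by (simp add: cat)
 then show ?thesis using assms by (simp add: interchange)
qed

lemma Ob_cat [cat]: "U:Ob C ==> V:Ob C ==> U ** V:Ob C" "\<I>:Ob C"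
 using tens_ob_closed unit_closed by auto

lemma assoc_cat [cat]:
 assumes "U:Ob C" "V:Ob C" "W:Ob C"
 shows "assoc C U V W:Ar C" "Dom C (assoc C U V W) = (U ** V) ** W"
  "Cod C (assoc C U V W) = U ** (V ** W)" "is_iso C (assoc C U V W)"
 using assoc_iso[OF assms] by (auto simp: hom_set_def)

lemma lunit_cat [cat]:
 assumes "U:Ob C"
 shows "lunit C U:Ar C" "Dom C (lunit C U) = \<I> ** U" "Cod C (lunit C U) = U" "is_iso C (lunit C U)"
 using lunit_iso[OF assms] by (auto simp: hom_set_def)

lemma runit_cat [cat]:
 assumes "U:Ob C"
 shows "runit C U:Ar C" "Dom C (runit C U) = U ** \<I>" "Cod C (runit C U) = U" "is_iso C (runit C U)"
 using runit_iso[OF assms] by (auto simp: hom_set_def)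

lemma inv_ar_cat [cat]:
 assumes "is_iso C f"
 shows "inv_ar C f:Ar C" "Dom C (inv_ar C f) = Cod C f" "Cod C (inv_ar C f) = Dom C f"
  "inv_ar C f \<bullet> f = Id C (Dom C f)" "f \<bullet> inv_ar C f = Id C (Cod C f)"
 using inv_inv[OF assms] by (auto simp: inverse_arrows_def hom_set_def)

lemma is_iso_Ar: "is_iso C f ==> f:Ar C"
 by (auto simp: is_iso_def inverse_arrows_def)

lemma inv_ar_cancel [cat]:
 assumes "is_iso C f" "h:Ar C"
 shows "Cod C h = Dom C f ==> inv_ar C f \<bullet> (f \<bullet> h) = h" "Cod C h = Cod C f ==> f \<bullet> (inv_ar C f \<bullet> h) = h"
proof -
 note f = is_iso_Ar[OF assms(1)] note i = inv_ar_cat[OF assms(1)]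
 show "Cod C h = Dom C f ==> inv_ar C f \<bullet> (f \<bullet> h) = h"
  using comp_assoc_cat[of h f "inv_ar C f"] f i assms(2) comp_Id_cat(2) by simp
 show "Cod C h = Cod C f ==> f \<bullet> (inv_ar C f \<bullet> h) = h"
  using comp_assoc_cat[of h "inv_ar C f" f] f i assms(2) comp_Id_cat(2) by simp
qed

lemma inverse_arrowsI:
 "f:Ar C ==> g:Ar C ==> Dom C g = Cod C f ==> Cod C g = Dom C f ==> g \<bullet> f = Id C (Dom C f)
  ==> f \<bullet> g = Id C (Cod C f) ==> inverse_arrows C f g"
 by (simp add: inverse_arrows_def hom_set_def)

lemma is_iso_comp [cat]:
 assumes "is_iso C f" "is_iso C g" "Dom C g = Cod C f"
 shows "is_iso C (g \<bullet> f)"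
proof -
 note c = is_iso_Ar[OF assms(1)] is_iso_Ar[OF assms(2)] assms
 have "inverse_arrows C (g \<bullet> f) (inv_ar C f \<bullet> inv_ar C g)"
  using c by (intro inverse_arrowsI) (simp_all add: cat)
 then show ?thesis by (auto simp: is_iso_def)
qed

lemma is_iso_tens [cat]:
 assumes "is_iso C f" "is_iso C g"
 shows "is_iso C (f *** g)"
proof -
 note c = is_iso_Ar[OF assms(1)] is_iso_Ar[OF assms(2)] assms
 have "inverse_arrows C (f *** g) (inv_ar C f *** inv_ar C g)"
  using c by (intro inverse_arrowsI) (simp_all add: cat interchange)
 then show ?thesis by (auto simp: is_iso_def)
qed

lemma is_iso_Id [cat]: "U:Ob C ==> is_iso C (Id C U)"
 using inverse_arrowsI[of "Id C U" "Id C U"] by (auto simp: is_iso_def cat)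

lemma is_iso_inv [cat]: "is_iso C f ==> is_iso C (inv_ar C f)"
 using inverse_arrowsI[of "inv_ar C f" f] is_iso_Ar[of f] by (auto simp: is_iso_def cat)

lemma assoc_natural_cat:
 "f:Ar C ==> g:Ar C ==> h:Ar C ==> Cod C f = U ==> Cod C g = V ==> Cod C h = W ==>
  assoc C U V W \<bullet> ((f *** g) *** h) = (f *** (g *** h)) \<bullet> assoc C (Dom C f) (Dom C g) (Dom C h)"
 using assoc_natural[OF Ar_hom Ar_hom Ar_hom] by auto

lemma lunit_natural_cat:
 "f:Ar C ==> Cod C f = V ==> lunit C V \<bullet> (Id C \<I> *** f) = f \<bullet> lunit C (Dom C f)"
 using lunit_natural[OF Ar_hom] by auto

lemma runit_natural_cat:
 "f:Ar C ==> Cod C f = V ==> runit C V \<bullet> (f *** Id C \<I>) = f \<bullet> runit C (Dom C f)"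
 using runit_natural[OF Ar_hom] by auto

end

context T_category
begin

abbreviation "dg == Deg C"
abbreviation "cob == conj_ob C"
abbreviation "cab == conj_ar C"

lemma P_simps [simp]:
 "a:cr P ==> b:cr P ==> c:cr P ==> (a*[P]b)*[P]c = a*[P](b*[P]c)"
 "a:cr P ==> b:cr P ==> inv\<^bsub>P\<^esub> (a*[P]b) = inv\<^bsub>P\<^esub> b*[P]inv\<^bsub>P\<^esub> a"
 by (simp_all add: m_assoc inv_mult_group)

lemma conj_elt_expand:
 "conj_elt P b a = b*[P](a*[P]inv\<^bsub>P\<^esub> b)" if "a:cr P" "b:cr P"
 using that by (simp add: conj_elt_def)

lemma deg_cat [cat]:
 "U:Ob C ==> dg U:cr P"
 "U:Ob C ==> V:Ob C ==> dg (U ** V) = dg U*[P]dg V"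
 "b:cr P ==> U:Ob C ==> dg (cob b U) = b*[P](dg U*[P]inv\<^bsub>P\<^esub> b)"
 "f:Ar C ==> dg (Cod C f) = dg (Dom C f)"
 using deg_closed deg_tens deg_conj deg_arrow conj_elt_expand by auto

lemma deg_unit [cat]: "dg \<I> = \<one>[P]"
proof -
 have "dg (\<I> ** \<I>) = dg \<I>" using deg_arrow[of "lunit C \<I>"] by (simp add: cat)
 then show ?thesis using deg_cat(1)[of "\<I>"] by (simp add: cat)
qed

lemma conj_ob_cat [cat]:
 "b:cr P ==> U:Ob C ==> cob b U:Ob C"
 "b:cr P ==> U:Ob C ==> V:Ob C ==> cob b (U ** V) = cob b U ** cob b V"
 "b:cr P ==> cob b \<I> = \<I>"
 "U:Ob C ==> cob \<one>[P] U = U"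
 "b:cr P ==> c:cr P ==> U:Ob C ==> cob b (cob c U) = cob (b*[P]c) U"
 using conj_ob_closed conj_tens_ob conj_unit conj_one conj_mult by auto

lemma conj_ar_cat [cat]:
 assumes "b:cr P" "f:Ar C"
 shows "cab b f:Ar C" "Dom C (cab b f) = cob b (Dom C f)" "Cod C (cab b f) = cob b (Cod C f)"
  "c:cr P ==> cab b (cab c f) = cab (b*[P]c) f"
  "g:Ar C ==> cab b (f *** g) = cab b f *** cab b g"
  "g:Ar C ==> Dom C g = Cod C f ==> cab b (g \<bullet> f) = cab b g \<bullet> cab b f"
 using conj_ar_hom[OF assms(1) Ar_hom[OF assms(2)]] conj_mult(2) conj_tens_ar assms
  conj_comp[OF assms(1) Ar_hom[OF assms(2)], of g "Cod C g"] by (auto simp: hom_set_def)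

lemma conj_ar_one [cat]: "f:Ar C ==> cab \<one>[P] f = f"
 by (rule conj_one)

lemma conj_struct_cat [cat]:
 assumes "b:cr P"
 shows "U:Ob C ==> cab b (Id C U) = Id C (cob b U)"
  "U:Ob C ==> V:Ob C ==> W:Ob C ==> cab b (assoc C U V W) = assoc C (cob b U) (cob b V) (cob b W)"
  "U:Ob C ==> cab b (lunit C U) = lunit C (cob b U)"
  "U:Ob C ==> cab b (runit C U) = runit C (cob b U)"
 using conj_id conj_assoc conj_lunit conj_runit assms by auto

lemma is_iso_conj [cat]:
 assumes "b:cr P" "is_iso C f"
 shows "is_iso C (cab b f)"
proof -
 note f = is_iso_Ar[OF assms(2)] assms
 have "inverse_arrows C (cab b f) (cab b (inv_ar C f))"
  using f conj_ar_cat(6)[of b f "inv_ar C f"] conj_ar_cat(6)[of b "inv_ar C f" f]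
  by (intro inverse_arrowsI) (simp_all add: cat)
 then show ?thesis by (auto simp: is_iso_def)
qed

end

section \<open>Double braidings and twists of tensor products\<close>

context braided_T_category
begin

lemma braid_cat [cat]:
 assumes "U:Ob C" "V:Ob C"
 shows "braid C U V:Ar C" "Dom C (braid C U V) = U ** V" "Cod C (braid C U V) = cob (dg U) V ** U"
  "is_iso C (braid C U V)" "b:cr P ==> cab b (braid C U V) = braid C (cob b U) (cob b V)"
 using braid_iso[OF assms] conj_braid assms by (auto simp: hom_set_def)

lemma braid_natural_cat:
 "f:Ar C ==> g:Ar C ==> Cod C f = U ==> Cod C g = V ==>
  braid C U V \<bullet> (f *** g) = (cab (dg (Dom C f)) g *** f) \<bullet> braid C (Dom C f) (Dom C g)"
 using braid_natural[OF Ar_hom Ar_hom,of f g] by auto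

text \<open>Naturality of the braiding of U along c_{V,W}, with the hexagons substituted. The form
  is chosen so that the braidings of U with V \<otimes> W and of U \<otimes> V with W stay
  unexpanded.\<close>

lemma Yang_Baxter:
 assumes [simp]: "U:Ob C" "V:Ob C" "W:Ob C"
 shows "assoc C (cob (dg U*[P]dg V) W) (cob (dg U) V) U \<bullet>
   (cab (dg U) (braid C V W) *** Id C U) \<bullet> braid C U (V ** W) \<bullet> assoc C U V W
  = (Id C (cob (dg U*[P]dg V) W) *** braid C U V) \<bullet> braid C (U ** V) W"
proof -
 let ?c = "cab (dg U) (braid C V W) *** Id C U" and ?a = "cob (dg U*[P]dg V) W"
 have 1: "?c \<bullet> braid C U (V ** W)
   = braid C U (cob (dg V) W ** V) \<bullet> (Id C U *** braid C V W)"
  by (subst braid_natural_cat) (simp_all add: cat)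
 have "assoc C ?a (cob (dg U) V) U \<bullet>
   ?c \<bullet> braid C U (V ** W) \<bullet> assoc C U V W
  = assoc C ?a (cob (dg U) V) U \<bullet>
   (?c \<bullet> braid C U (V ** W)) \<bullet> assoc C U V W"
  by (simp add: cat)
 also have "... = (Id C ?a *** braid C U V) \<bullet> braid C (U ** V) W"
  unfolding 1 by (subst braid_tens_right) (simp_all add: cat braid_tens_left)
 finally show ?thesis .
qed

lemma braid_natural_cat':
 assumes "f:Ar C" "g:Ar C" "Cod C f = U" "Cod C g = V" "h:Ar C" "Cod C h = Dom C f ** Dom C g"
 shows "braid C U V \<bullet> ((f *** g) \<bullet> h) = (cab (dg (Dom C f)) g *** f) \<bullet> braid C (Dom C f) (Dom C g) \<bullet> h"
proof -
 let ?D = "Dom C f"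
 have [simp]: "U:Ob C" "V:Ob C" "Dom C f:Ob C" "Dom C g:Ob C" using Ar_Ob assms by auto
 have d: "dg U = dg ?D" using deg_cat(4)[OF assms(1)] assms(3) by simp
 have "braid C U V \<bullet> ((f *** g) \<bullet> h) = (braid C U V \<bullet> (f *** g)) \<bullet> h"
  using assms by (simp add: cat)
 also have "... = ((cab (dg ?D) g *** f) \<bullet> braid C ?D (Dom C g)) \<bullet> h"
  using assms by (simp add: braid_natural_cat)
 also have "... = (cab (dg ?D) g *** f) \<bullet> braid C ?D (Dom C g) \<bullet> h"
  using assms d by (simp add: cat)
 finally show ?thesis .
qed

definition double_braid :: "'o => 'o => 'a" where
 "double_braid U V = braid C (cob (dg U) V) U \<bullet> braid C U V"

lemma double_braid_cat [cat]:
 assumes "U:Ob C" "V:Ob C"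
 shows "double_braid U V:Ar C" "Dom C (double_braid U V) = U ** V"
  "Cod C (double_braid U V) = cob (dg U*[P](dg V*[P]inv\<^bsub>P\<^esub> dg U)) U ** cob (dg U) V"
  "is_iso C (double_braid U V)"
 using assms by (simp_all add: double_braid_def cat)

text \<open>The double braiding of U \<otimes> V with W followed by that of U with V equals the one
  of U with V \<otimes> W followed by that of V with W: two Yang-Baxter moves and naturality of the
  braiding. Here \<open>e\<close> is the degree of W conjugated by U \<otimes> V.\<close>

lemma double_braid_tens:
 assumes [simp]: "U:Ob C" "V:Ob C" "W:Ob C"
 defines "u == dg U" and "v == dg V" and "e == dg U*[P](dg V*[P](dg W*[P](inv\<^bsub>P\<^esub> dg V*[P]inv\<^bsub>P\<^esub> dg U)))"
 shows "assoc C (cob (e*[P](u*[P](v*[P]inv\<^bsub>P\<^esub> u))) U) (cob (e*[P]u) V) (cob (u*[P]v) W)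
   \<bullet> (cab e (double_braid U V) *** Id C (cob (u*[P]v) W)) \<bullet> double_braid (U ** V) W
  = (Id C (cob (e*[P](u*[P](v*[P]inv\<^bsub>P\<^esub> u))) U) *** cab u (double_braid V W)) \<bullet> double_braid U (V ** W) \<bullet> assoc C U V W"
  (is "?a \<bullet> _ \<bullet> _ = _")
proof -
 let ?b = "V ** W" and ?d = "U ** V"
 have [simp]: "u:cr P" "v:cr P" "e:cr P" "dg U = u" "dg V = v"
  by (simp_all add: u_def v_def e_def cat)
 let ?W = "cob (u*[P]v) W" and ?U = "cob (e*[P](u*[P](v*[P]inv\<^bsub>P\<^esub> u))) U" and ?V = "cob u V"
 let ?c = "%X Y. braid C X Y"
 have e: "dg ?W = e" by (simp add: e_def cat flip: u_def v_def)
 have e': "u*[P](v*[P](dg W*[P]inv\<^bsub>P\<^esub> u)) = e*[P](u*[P](v*[P]inv\<^bsub>P\<^esub> u))"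
  by (simp add: e_def cat flip: u_def v_def)
 have "?a \<bullet> (cab e (double_braid U V) *** Id C ?W) \<bullet> double_braid ?d W
  = ?a \<bullet> (cab e (?c ?V U) *** Id C ?W) \<bullet> (cab e (?c U V) *** Id C ?W) \<bullet> ?c ?W ?d \<bullet> ?c ?d W"
  by (simp add: double_braid_def cat e e' interchange')
 also have "(cab e (?c U V) *** Id C ?W) \<bullet> ?c ?W ?d \<bullet> ?c ?d W
  = ?c ?W (?V ** U) \<bullet> (Id C ?W *** ?c U V) \<bullet> ?c ?d W"
  using braid_natural_cat'[of "Id C ?W" "?c U V" ?W "?V ** U" "?c ?d W"] by (simp add: cat e)
 also have "(Id C ?W *** ?c U V) \<bullet> ?c ?d W
  = assoc C ?W ?V U \<bullet> (cab u (?c V W) *** Id C U) \<bullet> ?c U ?b \<bullet> assoc C U V W"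
  using Yang_Baxter[of U V W] by simp
 also have "?a \<bullet> (cab e (?c ?V U) *** Id C ?W) \<bullet> ?c ?W (?V ** U) \<bullet> assoc C ?W ?V U \<bullet> (cab u (?c V W) *** Id C U) \<bullet> ?c U ?b \<bullet> assoc C U V W
  = (?a \<bullet> (cab e (?c ?V U) *** Id C ?W) \<bullet> ?c ?W (?V ** U) \<bullet> assoc C ?W ?V U) \<bullet> (cab u (?c V W) *** Id C U) \<bullet> ?c U ?b \<bullet> assoc C U V W"
  by (simp add: cat e)
 also have "?a \<bullet> (cab e (?c ?V U) *** Id C ?W) \<bullet> ?c ?W (?V ** U) \<bullet> assoc C ?W ?V U
  = (Id C ?U *** cab u (?c (cob v W) V)) \<bullet> ?c (?W ** ?V) U"
  using Yang_Baxter[of ?W ?V U] by (simp add: cat e)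
 also have "(...) \<bullet> (cab u (?c V W) *** Id C U) \<bullet> ?c U ?b \<bullet> assoc C U V W
  = (Id C ?U *** cab u (?c (cob v W) V)) \<bullet> (?c (?W ** ?V) U \<bullet> (cab u (?c V W) *** Id C U) \<bullet> ?c U ?b \<bullet> assoc C U V W)"
  by (simp add: cat e)
 also have "?c (?W ** ?V) U \<bullet> (cab u (?c V W) *** Id C U) \<bullet> ?c U ?b \<bullet> assoc C U V W
  = (Id C ?U *** cab u (?c V W)) \<bullet> ?c (cob u ?b) U \<bullet> ?c U ?b \<bullet> assoc C U V W"
  using braid_natural_cat'[of "cab u (?c V W)" "Id C U" "?W ** ?V" U "?c U ?b \<bullet> assoc C U V W"]
  by (simp add: cat e_def flip: u_def v_def)
 finally show ?thesis
  by (simp add: double_braid_def cat e e' interchange')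
qed

definition twisting :: "'o => 'a => bool" where
 "twisting U t \<longleftrightarrow> U:Ob C & t:Ar C & Dom C t = U & Cod C t = cob (dg U) U & is_iso C t"

lemma twD:
 "twisting U t ==> U:Ob C" "twisting U t ==> t:Ar C" "twisting U t ==> Dom C t = U"
 "twisting U t ==> Cod C t = cob (dg U) U" "twisting U t ==> is_iso C t"
 by (auto simp: twisting_def)

text \<open>The braidings are applied before the twists, as in the tensor product of Rib(H). The
  twist extension applies them after the twists, and naturality of the braiding identifies the two
  forms (\<open>twist_tensor_eq\<close>).\<close>

definition twist_tensor :: "'o => 'a => 'o => 'a => 'a" where
 "twist_tensor U t V t' =
  (cab (dg (cob (dg U) V)) t *** cab (dg U) t') \<bullet> double_braid U V"

lemma twisting_tensor:
 "twisting U t ==> twisting V t' ==> twisting (U ** V) (twist_tensor U t V t')"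
 by (auto simp: twisting_def twist_tensor_def cat)

lemma twist_tensor_eq:
 assumes "twisting U t" "twisting V t'"
 shows "twist_tensor U t V t' = braid C (cob (dg (U ** V)) V) (cob (dg U) U)
   \<bullet> braid C (cob (dg U) U) (cob (dg V) V) \<bullet> (t *** t')"
proof -
 note [simp] = twD[OF assms(1)] twD[OF assms(2)]
 have "braid C (cob (dg U) U) (cob (dg V) V) \<bullet> (t *** t')
   = (cab (dg U) t' *** t) \<bullet> braid C U V"
  by (subst braid_natural_cat) (simp_all add: cat)
 then show ?thesis
  by (simp add: cat braid_natural_cat' twist_tensor_def double_braid_def)
qed

lemma double_braid_natural:
 assumes "f:Ar C" "g:Ar C"
 shows "double_braid (Cod C f) (Cod C g) \<bullet> (f *** g)
  = (cab (dg (cob (dg (Dom C f)) (Dom C g))) f *** cab (dg (Dom C f)) g) \<bullet> double_braid (Dom C f) (Dom C g)"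
proof -
 have "double_braid (Cod C f) (Cod C g) \<bullet> (f *** g)
   = braid C (cob (dg (Dom C f)) (Cod C g)) (Cod C f) \<bullet> braid C (Cod C f) (Cod C g) \<bullet> (f *** g)"
  using assms by (simp add: double_braid_def cat)
 also have "braid C (Cod C f) (Cod C g) \<bullet> (f *** g) = (cab (dg (Dom C f)) g *** f) \<bullet> braid C (Dom C f) (Dom C g)"
  using assms by (simp add: braid_natural_cat)
 finally show ?thesis
  using assms by (simp add: cat braid_natural_cat' double_braid_def)
qed

lemma twist_tensor_natural:
 assumes t: "twisting U t" "twisting V s" "twisting U' t'" "twisting V' s'"
  and f: "f:Ar C" "Dom C f = U" "Cod C f = U'" "t' \<bullet> f = cab (dg U) f \<bullet> t"
  and g: "g:Ar C" "Dom C g = V" "Cod C g = V'" "s' \<bullet> g = cab (dg V) g \<bullet> s"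
 shows "twist_tensor U' t' V' s' \<bullet> (f *** g) = cab (dg (U ** V)) (f *** g) \<bullet> twist_tensor U t V s"
proof -
 have [simp]: "dg U' = dg U" "dg V' = dg V" using f g deg_cat(4) by metis+
 note [simp] = t[THEN twD(1)] t[THEN twD(2)] t[THEN twD(3)] t[THEN twD(4)] f(1-3) g(1-3)
 let ?e = "dg (cob (dg U) V)"
 have [simp]: "?e:cr P" by (simp add: cat)
 have "twist_tensor U' t' V' s' \<bullet> (f *** g)
   = (cab ?e t' *** cab (dg U) s') \<bullet> double_braid U' V' \<bullet> (f *** g)"
  by (simp add: twist_tensor_def cat)
 also have "double_braid U' V' \<bullet> (f *** g) = (cab ?e f *** cab (dg U) g) \<bullet> double_braid U V"
  using double_braid_natural[OF f(1) g(1)] by simp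
 also have "(cab ?e t' *** cab (dg U) s') \<bullet> ...
   = (cab ?e (t' \<bullet> f) *** cab (dg U) (s' \<bullet> g)) \<bullet> double_braid U V"
  by (simp add: cat interchange')
 also have "... = cab (dg (U ** V)) (f *** g) \<bullet> twist_tensor U t V s"
  unfolding f(4) g(4) by (simp add: twist_tensor_def cat interchange')
 finally show ?thesis .
qed

text \<open>All twists can be collected on the left of the composites, and what remains is
  \<open>double_braid_tens\<close>. The arrows x, y, z are the twists conjugated to the degrees they
  have in the triple product.\<close>

lemma twist_tensor_assoc:
 assumes t: "twisting U t" "twisting V s" "twisting W r"
 shows "twist_tensor U t (V ** W) (twist_tensor V s W r) \<bullet> assoc C U V W
  = cab (dg ((U ** V) ** W)) (assoc C U V W) \<bullet> twist_tensor (U ** V) (twist_tensor U t V s) W r"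
proof -
 note [simp] = t[THEN twD(1)] t[THEN twD(2)] t[THEN twD(3)] t[THEN twD(4)]
 define e where "e = dg U*[P](dg V*[P](dg W*[P](inv\<^bsub>P\<^esub> dg V*[P]inv\<^bsub>P\<^esub> dg U)))"
 define u where "u = dg U"
 define v where "v = dg V"
 define x where "x = cab (e*[P](u*[P](v*[P]inv\<^bsub>P\<^esub> u))) t"
 define y where "y = cab (e*[P]u) s"
 define z where "z = cab (u*[P]v) r"
 let ?D = double_braid
 have [simp]: "u:cr P" "v:cr P" "e:cr P" "dg U = u" "dg V = v"
  by (simp_all add: u_def v_def e_def cat)
 have e: "dg (cob (u*[P]v) W) = e" "u*[P](v*[P](dg W*[P](inv\<^bsub>P\<^esub> v*[P]inv\<^bsub>P\<^esub> u))) = e"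
  "u*[P](v*[P](dg W*[P]inv\<^bsub>P\<^esub> u)) = e*[P](u*[P](v*[P]inv\<^bsub>P\<^esub> u))"
  "u*[P](v*[P](dg W*[P]inv\<^bsub>P\<^esub> v)) = e*[P]u"
  "u*[P](v*[P]dg W) = e*[P](u*[P]v)"
  by (simp_all add: e_def cat flip: u_def v_def)
 have [simp]: "x:Ar C" "y:Ar C" "z:Ar C"
   "Dom C x = cob (e*[P](u*[P](v*[P]inv\<^bsub>P\<^esub> u))) U" "Dom C y = cob (e*[P]u) V" "Dom C z = cob (u*[P]v) W"
   "Cod C x = cob (e*[P](u*[P]v)) U" "Cod C y = cob (e*[P](u*[P]v)) V" "Cod C z = cob (e*[P](u*[P]v)) W"
  by (simp_all add: x_def y_def z_def cat e)
 have "cab (dg ((U ** V) ** W)) (assoc C U V W) \<bullet> twist_tensor (U ** V) (twist_tensor U t V s) W r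
   = (assoc C (Cod C x) (Cod C y) (Cod C z) \<bullet> ((x *** y) *** z)) \<bullet> (cab e (?D U V) *** Id C (Dom C z)) \<bullet> ?D (U ** V) W"
  by (simp add: twist_tensor_def cat e interchange' flip: x_def y_def z_def)
 also have "... = (x *** (y *** z)) \<bullet> assoc C (Dom C x) (Dom C y) (Dom C z) \<bullet> (cab e (?D U V) *** Id C (Dom C z)) \<bullet> ?D (U ** V) W"
  by (subst assoc_natural_cat) (simp_all add: cat e)
 also have "assoc C (Dom C x) (Dom C y) (Dom C z) \<bullet> (cab e (?D U V) *** Id C (Dom C z)) \<bullet> ?D (U ** V) W
   = (Id C (Dom C x) *** cab u (?D V W)) \<bullet> ?D U (V ** W) \<bullet> assoc C U V W"
  using double_braid_tens[of U V W] by (simp add: e)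
 also have "(x *** (y *** z)) \<bullet> ... = twist_tensor U t (V ** W) (twist_tensor V s W r) \<bullet> assoc C U V W"
  by (simp add: twist_tensor_def cat e interchange' flip: x_def y_def z_def)
 finally show ?thesis by simp
qed

lemma twist_tensor_braid:
 assumes t: "twisting U t" "twisting V s"
 shows "twist_tensor (cob (dg U) V) (cab (dg U) s) U t \<bullet> braid C U V
  = cab (dg (U ** V)) (braid C U V) \<bullet> twist_tensor U t V s"
proof -
 note [simp] = t[THEN twD(1)] t[THEN twD(2)] t[THEN twD(3)] t[THEN twD(4)]
 show ?thesis
  by (simp add: twist_tensor_def double_braid_def cat braid_natural_cat')
qed

lemma twist_tensor_conj:
 assumes t: "twisting U t" "twisting V s" "b:cr P"
 shows "twisting (cob b U) (cab b t)"
  "cab b (twist_tensor U t V s) = twist_tensor (cob b U) (cab b t) (cob b V) (cab b s)"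
 using assms by (auto simp: twisting_def twist_tensor_def double_braid_def cat)

end

text \<open>Covers both the twist extension and Rib(H): D has as objects some pairs (U, t), closed
  under the operations, and as arrows all arrows compatible with the twists. \<open>D_Ob\<close> is
  an implication only, so D may be a proper full subcategory, and the balanced axioms are proved for
  both at once.\<close>

locale twisted_category = B?: braided_T_category P B
 for P :: "('g, 'm) monoid_scheme" and B :: "('g, 'o, 'a, 'y) braided_tcat_scheme" +
 fixes D :: "('g, 'o \<times> 'a, ('o \<times> 'a, 'a) arr, 'z) balanced_tcat_scheme"
 assumes unit_braids: "U:Ob B ==> runit B U\<bullet>[B]braid B \<I>[B] U = lunit B U"
   "U:Ob B ==> lunit B U\<bullet>[B]braid B U \<I>[B] = runit B U"
  and D_Ob: "X:Ob D ==> twisting (fst X) (snd X)"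
  and D_closed: "X:Ob D ==> Y:Ob D ==> X**[D]Y:Ob D" "\<I>[D]:Ob D"
   "b:cr P ==> X:Ob D ==> conj_ob D b X:Ob D"
  and D_tens: "X:Ob D ==> Y:Ob D ==>
   X**[D]Y = (fst X**[B]fst Y, twist_tensor (fst X) (snd X) (fst Y) (snd Y))"
  and D_Ar: "Ar D = {Arr X Y f | X Y f. X:Ob D & Y:Ob D & f:hom_set B (fst X) (fst Y) &
   snd Y\<bullet>[B]f = cab (dg (fst X)) f\<bullet>[B]snd X}"
  and D_simps: "Dom D = adom" "Cod D = acod" "Id D X = Arr X X (Id B (fst X))"
   "k\<bullet>[D]h = Arr (adom h) (acod k) (amap k\<bullet>[B]amap h)"
   "h***[D]k = Arr (adom h**[D]adom k) (acod h**[D]acod k) (amap h***[B]amap k)"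
   "\<I>[D] = (\<I>[B], Id B \<I>[B])"
   "assoc D X Y Z = Arr ((X**[D]Y)**[D]Z) (X**[D](Y**[D]Z)) (assoc B (fst X) (fst Y) (fst Z))"
   "lunit D X = Arr (\<I>[D]**[D]X) X (lunit B (fst X))"
   "runit D X = Arr (X**[D]\<I>[D]) X (runit B (fst X))"
   "Deg D X = dg (fst X)"
   "conj_ob D b X = (cob b (fst X), cab b (snd X))"
   "conj_ar D b h = Arr (conj_ob D b (adom h)) (conj_ob D b (acod h)) (cab b (amap h))"
   "braid D X Y = Arr (X**[D]Y) (conj_ob D (dg (fst X)) Y**[D]X) (braid B (fst X) (fst Y))"
   "twist D X = Arr X (conj_ob D (dg (fst X)) X) (snd X)"
begin

lemma D_homI:
 assumes "X:Ob D" "Y:Ob D" "f:Ar B" "Dom B f = fst X" "Cod B f = fst Y"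
  "snd Y\<bullet>[B]f = cab (dg (fst X)) f\<bullet>[B]snd X"
 shows "Arr X Y f:hom_set D X Y"
 using assms by (simp add: hom_set_def D_Ar D_simps del: split_paired_Ex)

lemma D_homE:
 assumes "h:hom_set D X Y"
 obtains f where "h = Arr X Y f" "X:Ob D" "Y:Ob D" "f:Ar B" "Dom B f = fst X" "Cod B f = fst Y"
  "snd Y\<bullet>[B]f = cab (dg (fst X)) f\<bullet>[B]snd X" "dg (fst Y) = dg (fst X)"
proof -
 have "h:Ar D" and h: "adom h = X" "acod h = Y" using assms by (simp_all add: hom_set_def D_simps(1,2))
 then obtain f where f: "h = Arr X Y f" "X:Ob D" "Y:Ob D" "f:hom_set B (fst X) (fst Y)"
  "snd Y\<bullet>[B]f = cab (dg (fst X)) f\<bullet>[B]snd X"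
  unfolding D_Ar by fastforce
 have g: "f:Ar B" "Dom B f = fst X" "Cod B f = fst Y" using f(4) by (auto simp: hom_set_def)
 have "dg (fst Y) = dg (fst X)" using deg_cat(4)[OF g(1)] g by simp
 then show ?thesis using that f g by auto
qed

lemma D_Ob': "X:Ob D ==> fst X:Ob B" "X:Ob D ==> snd X:Ar B" "X:Ob D ==> Dom B (snd X) = fst X"
 "X:Ob D ==> Cod B (snd X) = cob (dg (fst X)) (fst X)" "X:Ob D ==> is_iso B (snd X)"
 by (auto dest!: D_Ob simp: twisting_def)

lemmas D_fld = D_simps(1-5,7-10,12-14)

lemma D_fs:
 "X:Ob D ==> Y:Ob D ==> fst (X**[D]Y) = fst X**[B]fst Y"
 "X:Ob D ==> Y:Ob D ==> snd (X**[D]Y) = twist_tensor (fst X) (snd X) (fst Y) (snd Y)"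
 "fst \<I>[D] = \<I>[B]" "snd \<I>[D] = Id B \<I>[B]"
 "fst (conj_ob D b X) = cob b (fst X)" "snd (conj_ob D b X) = cab b (snd X)"
 by (simp_all add: D_tens D_simps(6,11))

text \<open>The inverse of an arrow compatible with the twists is again compatible, so the inverses
  of constraints and braidings may be computed in B.\<close>

lemma D_iso:
 assumes "Arr X Y f:hom_set D X Y" "is_iso B f"
 shows "inverse_arrows D (Arr X Y f) (Arr Y X (inv_ar B f))"
proof -
 let ?d = "dg (fst X)" and ?i = "inv_ar B f"
 obtain f: "X:Ob D" "Y:Ob D" "f:Ar B" "Dom B f = fst X" "Cod B f = fst Y"
  "snd Y\<bullet>[B]f = cab ?d f\<bullet>[B]snd X" "dg (fst Y) = dg (fst X)"
  using D_homE[OF assms(1)] by (metis arr.inject)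
 note [simp] = f(1-5) f(7) assms(2)
 have i: "cab ?d ?i\<bullet>[B]cab ?d f = Id B (cob ?d (fst X))"
  by (simp add: D_Ob' cat flip: conj_ar_cat(6))
 have "snd X\<bullet>[B]inv_ar B f = cab (dg (fst Y)) ?i\<bullet>[B]snd Y"
 proof -
  have "snd X = (cab ?d ?i\<bullet>[B]cab ?d f)\<bullet>[B]snd X"
   unfolding i by (simp add: D_Ob' cat)
  also have "... = cab ?d ?i\<bullet>[B]snd Y\<bullet>[B]f"
   by (simp add: D_Ob' cat f(6))
  finally have "snd X\<bullet>[B]inv_ar B f = (cab ?d ?i\<bullet>[B]snd Y\<bullet>[B]f)\<bullet>[B]inv_ar B f"
   by simp
  then show ?thesis by (simp add: D_Ob' cat)
 qed
 then have "Arr Y X ?i:hom_set D Y X"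
  by (intro D_homI) (simp_all add: cat)
 then show ?thesis
  using assms(1) by (simp add: inverse_arrows_def hom_set_def D_simps cat)
qed

lemma D_iso_is_iso: "Arr X Y f:hom_set D X Y ==> is_iso B f ==> is_iso D (Arr X Y f)"
 unfolding is_iso_def[of D] by (rule exI, rule D_iso)

lemma tens_hom:
 assumes "h:hom_set D X X'" "k:hom_set D Y Y'"
 shows "h***[D]k:hom_set D (X**[D]Y) (X'**[D]Y')"
proof -
 obtain f g where f: "h = Arr X X' f" "X:Ob D" "X':Ob D" "f:Ar B" "Dom B f = fst X" "Cod B f = fst X'"
  "snd X'\<bullet>[B]f = cab (dg (fst X)) f\<bullet>[B]snd X"
  and g: "k = Arr Y Y' g" "Y:Ob D" "Y':Ob D" "g:Ar B" "Dom B g = fst Y" "Cod B g = fst Y'"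
  "snd Y'\<bullet>[B]g = cab (dg (fst Y)) g\<bullet>[B]snd Y"
  using assms by (elim D_homE) blast
 have "twist_tensor (fst X') (snd X') (fst Y') (snd Y')\<bullet>[B](f***[B]g)
   = cab (dg (fst X**[B]fst Y)) (f***[B]g)\<bullet>[B]twist_tensor (fst X) (snd X) (fst Y) (snd Y)"
  using f g by (intro twist_tensor_natural D_Ob)
 then show ?thesis
  using f g by (auto simp: D_fld intro!: D_homI) (simp_all add: D_closed D_fs cat)
qed

lemma assoc_hom:
 assumes "X:Ob D" "Y:Ob D" "Z:Ob D"
 shows "assoc D X Y Z:hom_set D ((X**[D]Y)**[D]Z) (X**[D](Y**[D]Z))"
 using assms unfolding D_fld
 by (intro D_homI) (simp_all add: D_closed D_fs D_Ob' assoc_cat twist_tensor_assoc D_Ob)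

text \<open>By \<open>unit_braids\<close>, the double braiding with the unit is absorbed by the unit
  constraint.\<close>

lemma unit_hom:
 assumes "X:Ob D"
 shows "lunit D X:hom_set D (\<I>[D]**[D]X) X" "runit D X:hom_set D (X**[D]\<I>[D]) X"
proof -
 note [simp] = D_Ob'[OF assms]
 let ?U = "fst X" and ?t = "cab \<one>[P] (snd X)"
 let ?C = "Cod B ?t" and ?I = "Id B \<I>[B]***[B]?t" and ?a = "?t***[B]Id B \<I>[B]"
 have [simp]: "?t = snd X" by (simp add: cat)
 have "lunit B ?C\<bullet>[B]?I\<bullet>[B]braid B ?U \<I>[B]\<bullet>[B]braid B \<I>[B] ?U
   = (lunit B ?C\<bullet>[B]?I)\<bullet>[B]braid B ?U \<I>[B]\<bullet>[B]braid B \<I>[B] ?U"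
  by (simp add: cat)
 also have "... = snd X\<bullet>[B](lunit B ?U\<bullet>[B]braid B ?U \<I>[B])\<bullet>[B]braid B \<I>[B] ?U"
  by (subst lunit_natural_cat) (simp_all add: cat)
 finally have l: "lunit B ?C\<bullet>[B]?I\<bullet>[B]braid B ?U \<I>[B]\<bullet>[B]braid B \<I>[B] ?U = snd X\<bullet>[B]lunit B ?U"
  by (simp only: unit_braids D_Ob'[OF assms])
 have "runit B ?C\<bullet>[B]?a\<bullet>[B]braid B \<I>[B] ?U\<bullet>[B]braid B ?U \<I>[B]
   = (runit B ?C\<bullet>[B]?a)\<bullet>[B]braid B \<I>[B] ?U\<bullet>[B]braid B ?U \<I>[B]"
  by (simp add: cat)
 also have "... = snd X\<bullet>[B](runit B ?U\<bullet>[B]braid B \<I>[B] ?U)\<bullet>[B]braid B ?U \<I>[B]"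
  by (subst runit_natural_cat) (simp_all add: cat)
 finally have r: "runit B ?C\<bullet>[B]?a\<bullet>[B]braid B \<I>[B] ?U\<bullet>[B]braid B ?U \<I>[B] = snd X\<bullet>[B]runit B ?U"
  by (simp only: unit_braids D_Ob'[OF assms])
 show "lunit D X:hom_set D (\<I>[D]**[D]X) X" "runit D X:hom_set D (X**[D]\<I>[D]) X"
  unfolding D_fld using l r assms
  by (auto intro!: D_homI) (simp_all add: D_closed D_fs cat twist_tensor_def double_braid_def)
qed

lemma braid_hom:
 assumes "X:Ob D" "Y:Ob D"
 shows "braid D X Y:hom_set D (X**[D]Y) (conj_ob D (dg (fst X)) Y**[D]X)"
 using assms unfolding D_fld
 by (intro D_homI) (simp_all add: D_closed D_fs D_Ob D_Ob' cat twist_tensor_braid)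

lemma conj_hom:
 assumes "b:cr P" "h:hom_set D X Y"
 shows "conj_ar D b h:hom_set D (conj_ob D b X) (conj_ob D b Y)"
proof -
 obtain f where f: "h = Arr X Y f" "X:Ob D" "Y:Ob D" "f:Ar B" "Dom B f = fst X" "Cod B f = fst Y"
  "snd Y\<bullet>[B]f = cab (dg (fst X)) f\<bullet>[B]snd X" "dg (fst Y) = dg (fst X)"
  using assms by (elim D_homE) blast
 have "cab b (snd Y\<bullet>[B]f) = cab b (cab (dg (fst X)) f\<bullet>[B]snd X)"
  by (simp add: f(7))
 then show ?thesis
  using f(1-6,8) assms by (auto simp: D_fld intro!: D_homI) (simp_all add: D_closed D_fs D_Ob' cat)
qed

lemma comp_hom_D:
 assumes "h:hom_set D X Y" "k:hom_set D Y Z"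
 shows "k\<bullet>[D]h:hom_set D X Z"
proof -
 obtain f g where f: "h = Arr X Y f" "X:Ob D" "Y:Ob D" "f:Ar B" "Dom B f = fst X" "Cod B f = fst Y"
  "snd Y\<bullet>[B]f = cab (dg (fst X)) f\<bullet>[B]snd X" "dg (fst Y) = dg (fst X)"
  and g: "k = Arr Y Z g" "Z:Ob D" "g:Ar B" "Dom B g = fst Y" "Cod B g = fst Z"
  "snd Z\<bullet>[B]g = cab (dg (fst Y)) g\<bullet>[B]snd Y"
  using assms by (elim D_homE) blast
 have "snd Z\<bullet>[B](g\<bullet>[B]f) = (snd Z\<bullet>[B]g)\<bullet>[B]f"
  using f(1-6) g(1-5) by (simp add: D_Ob' cat)
 also have "... = cab (dg (fst X)) (g\<bullet>[B]f)\<bullet>[B]snd X"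
  unfolding g(6) using f g(1-5) by (simp add: D_Ob' cat)
 finally show ?thesis
  using f g(1-5) by (auto simp: D_fld intro!: D_homI) (simp_all add: cat)
qed

lemma tensor_category_D: "tensor_category D"
proof (unfold_locales, goal_cases)
 case (1 f)
 then show ?case by (auto simp: D_Ar D_simps)
next
 case (2 U)
 then show ?case by (auto intro!: D_homI simp: D_Ob' cat D_simps)
next
 case 3
 then show ?case by (rule comp_hom_D)
next
 case 4
 then show ?case by (auto elim!: D_homE simp: D_simps cat)
next
 case 5
 then show ?case by (auto elim!: D_homE simp: D_simps cat)
next
 case 6
 then show ?case by (rule D_closed)
next
 case 7
 then show ?case by (rule D_closed)
next
 case 8
 then show ?case by (rule tens_hom)
next
 case 9
 then show ?case by (simp add: D_simps D_tens D_Ob' cat)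
next
 case 10
 then show ?case by (auto elim!: D_homE simp: D_simps B.interchange)
next
 case (11 U V W)
 then show ?case using assoc_hom[OF 11] D_iso_is_iso[of _ _ "assoc B (fst U) (fst V) (fst W)"] by (simp add: D_simps(7) D_Ob' cat)
next
 case 12
 then show ?case by (auto elim!: D_homE simp: D_simps B.assoc_natural_cat)
next
 case (13 U)
 then show ?case using unit_hom[OF 13] D_iso_is_iso[of _ _ "lunit B (fst U)"] by (simp add: D_simps(8) D_Ob' cat)
next
 case 14
 then show ?case by (elim D_homE) (simp add: D_simps lunit_natural_cat)
next
 case (15 U)
 then show ?case using unit_hom[OF 15] D_iso_is_iso[of _ _ "runit B (fst U)"] by (simp add: D_simps(9) D_Ob' cat)
next
 case 16
 then show ?case by (elim D_homE) (simp add: D_simps runit_natural_cat)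
next
 case 17
 then show ?case by (simp add: D_simps D_Ob' B.pentagon D_tens)
next
 case 18
 then show ?case by (simp add: D_simps D_Ob' B.triangle D_tens)
qed

lemma inv_D:
 assumes "Arr X Y f:hom_set D X Y" "is_iso B f"
 shows "inv_ar D (Arr X Y f) = Arr Y X (inv_ar B f)"
 by (rule tensor_category.inv_ar_eq[OF tensor_category_D D_iso[OF assms]])

lemma conj_tens_D:
 assumes "b:cr P" "X:Ob D" "Y:Ob D"
 shows "conj_ob D b (X**[D]Y) = conj_ob D b X**[D]conj_ob D b Y" "conj_ob D b \<I>[D] = \<I>[D]"
 using assms by (simp_all add: prod_eq_iff D_closed D_fs D_Ob' D_Ob cat twist_tensor_conj)

lemma conj_conj_D:
 "b:cr P ==> c:cr P ==> X:Ob D ==> conj_ob D b (conj_ob D c X) = conj_ob D (b*[P]c) X"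
 by (simp add: prod_eq_iff D_fs D_Ob' cat)

lemma D_ArD:
 assumes "h:Ar D"
 shows "amap h:Ar B" "Dom B (amap h) = fst (adom h)" "Cod B (amap h) = fst (acod h)" "adom h:Ob D" "acod h:Ob D"
 using assms unfolding D_Ar by (fastforce simp: hom_set_def)+

lemma T_category_D: "T_category P D"
proof (intro T_category.intro T_category_axioms.intro, goal_cases)
 case 1
 show ?case by (rule group_axioms)
next
 case 2
 show ?case by (rule tensor_category_D)
next
 case 3
 then show ?case by (simp add: D_simps D_Ob' cat)
next
 case (4 f)
 then have "f:hom_set D (Dom D f) (Cod D f)" by (simp add: hom_set_def)
 then show ?case by (elim D_homE) (auto simp: D_fld)
next
 case 5
 then show ?case by (simp add: D_simps(10) D_fs D_Ob' cat)
next
 case 6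
 then show ?case by (rule D_closed)
next
 case 7
 then show ?case by (simp add: D_simps(10) D_fs D_Ob' deg_conj)
next
 case 8
 then show ?case by (rule conj_hom)
next
 case 9
 then show ?case by (simp add: D_fld D_fs D_Ob' cat)
next
 case 10
 then show ?case by (auto elim!: D_homE simp: D_fld cat)
next
 case 11
 then show ?case by (simp add: conj_tens_D)
next
 case (12 b f g)
 then show ?case by (simp add: D_fld conj_tens_D cat D_ArD)
next
 case 13
 then show ?case by (simp add: prod_eq_iff D_fs cat)
next
 case 14
 then show ?case by (simp add: D_fld D_fs D_Ob' D_closed conj_tens_D cat)
next
 case 15
 then show ?case by (simp add: D_fld D_fs D_Ob' D_closed conj_tens_D cat)
next
 case 16
 then show ?case by (simp add: D_fld D_fs D_Ob' D_closed conj_tens_D cat)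
next
 case 17
 then show ?case by (simp add: prod_eq_iff D_fs D_Ob' cat)
next
 case (18 f)
 then show ?case by (simp add: arr.expand D_fld prod_eq_iff D_fs D_Ob' cat D_ArD)
next
 case 19
 then show ?case by (simp add: prod_eq_iff D_fs D_Ob' cat)
next
 case (20 b c f)
 then show ?case by (simp add: D_fld prod_eq_iff D_fs D_Ob' cat D_ArD)
qed

text \<open>As t itself serves as the twist, naturality of the twist is the definition of an arrow,
  and its tensor axiom is \<open>twist_tensor_eq\<close>. The braiding axioms are those of
  B.\<close>

lemma balanced_T_category_D: "balanced_T_category P D"
proof (intro balanced_T_category.intro braided_T_category.intro balanced_T_category_axioms.intro braided_T_category_axioms.intro T_category_D, goal_cases)
 case (1 U V)
 then show ?case using braid_hom[OF 1] D_iso_is_iso[of _ _ "braid B (fst U) (fst V)"]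
  by (simp add: D_fld D_Ob' cat)
next
 case (2 f U U' g V V')
 then show ?case by (elim D_homE) (simp add: D_fld conj_tens_D cat braid_natural_cat)
next
 case (3 U V W)
 then show ?case using assoc_hom[of U "conj_ob D (dg (fst V)) W" V]
  by (simp add: D_fld D_fs D_Ob' D_closed conj_tens_D conj_conj_D cat inv_D braid_tens_left)
next
 case (4 U V W)
 then show ?case using assoc_hom[of U V W] assoc_hom[of "conj_ob D (dg (fst U)) V" "conj_ob D (dg (fst U)) W" U]
  by (simp add: D_fld D_fs D_Ob' D_closed conj_tens_D conj_conj_D cat inv_D braid_tens_right)
next
 case 5
 then show ?case by (simp add: D_fld D_fs D_Ob' D_closed conj_tens_D cat prod_eq_iff)
next
 case (6 U)
 then have "twist D U:hom_set D U (conj_ob D (Deg D U) U)"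
  by (auto simp: D_fld D_closed D_fs D_Ob' cat intro!: D_homI)
 with 6 show ?case using D_iso_is_iso[of U "conj_ob D (Deg D U) U" "snd U"]
  by (simp add: D_fld D_Ob' cat)
next
 case 7
 then show ?case by (elim D_homE) (simp add: D_fld)
next
 case (8 U V)
 then show ?case using twist_tensor_eq[of "fst U" "snd U" "fst V" "snd V"] D_Ob
  by (simp add: D_fld D_fs D_Ob' D_closed conj_tens_D cat prod_eq_iff)
next
 case 9
 then show ?case by (simp add: D_fld D_fs D_Ob' D_closed conj_tens_D cat prod_eq_iff)
qed

lemma inv_struct_D:
 "X:Ob D ==> inv_ar D (lunit D X) = Arr X (\<I>[D]**[D]X) (inv_ar B (lunit B (fst X)))"
 "X:Ob D ==> inv_ar D (runit D X) = Arr X (X**[D]\<I>[D]) (inv_ar B (runit B (fst X)))"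
 "X:Ob D ==> Y:Ob D ==> Z:Ob D ==> inv_ar D (assoc D X Y Z)
  = Arr (X**[D](Y**[D]Z)) ((X**[D]Y)**[D]Z) (inv_ar B (assoc B (fst X) (fst Y) (fst Z)))"
 using inv_D[of "\<I>[D]**[D]X" X "lunit B (fst X)"] unit_hom[of X] inv_D[of "X**[D]\<I>[D]" X "runit B (fst X)"]
  inv_D[of "(X**[D]Y)**[D]Z" _ "assoc B (fst X) (fst Y) (fst Z)"] assoc_hom[of X Y Z]
 by (simp_all add: D_fld D_Ob' cat)

end

section \<open>Transport of structure along a bijection on objects and arrows\<close>

text \<open>D is a bare record: only bijections carrying each operation of C to that of D are
  assumed. The axioms for D become a consequence, which is how \<open>good_subcat\<close> and the
  representations of RT(H) are seen to be balanced.\<close>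

locale strict_isomorphism = C?: balanced_T_category P C
 for P :: "('g, 'm) monoid_scheme" and C :: "('g, 'o, 'a, 'y) balanced_tcat_scheme" +
 fixes D :: "('g, 'p, 'b, 'z) balanced_tcat_scheme" and F :: "'o => 'p" and f :: "'a => 'b"
 assumes bij: "bij_betw F (Ob C) (Ob D)" "bij_betw f (Ar C) (Ar D)"
  and F_dom: "h:Ar C ==> Dom D (f h) = F (Dom C h)" "h:Ar C ==> Cod D (f h) = F (Cod C h)"
  and F_id: "U:Ob C ==> Id D (F U) = f (Id C U)"
  and F_comp: "h:Ar C ==> k:Ar C ==> Dom C k = Cod C h ==> f k\<bullet>[D]f h = f (k\<bullet>[C]h)"
  and F_tens: "U:Ob C ==> V:Ob C ==> F U**[D]F V = F (U**[C]V)"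
  and f_tens: "h:Ar C ==> k:Ar C ==> f h***[D]f k = f (h***[C]k)"
  and F_unit: "\<I>[D] = F \<I>[C]"
  and F_assoc: "U:Ob C ==> V:Ob C ==> W:Ob C ==> assoc D (F U) (F V) (F W) = f (assoc C U V W)"
  and F_lunit: "U:Ob C ==> lunit D (F U) = f (lunit C U)"
  and F_runit: "U:Ob C ==> runit D (F U) = f (runit C U)"
  and F_deg: "U:Ob C ==> Deg D (F U) = dg U"
  and F_conj: "b:cr P ==> U:Ob C ==> conj_ob D b (F U) = F (cob b U)"
  and f_conj: "b:cr P ==> h:Ar C ==> conj_ar D b (f h) = f (cab b h)"
  and F_braid: "U:Ob C ==> V:Ob C ==> braid D (F U) (F V) = f (braid C U V)"
  and F_twist: "U:Ob C ==> twist D (F U) = f (twist C U)"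
begin

lemmas F_simps = F_dom F_id F_comp F_tens f_tens F_unit F_assoc F_lunit F_runit F_deg F_conj f_conj F_braid F_twist

lemma F_Ob: "U:Ob C ==> F U:Ob D" "h:Ar C ==> f h:Ar D"
 using bij by (auto simp: bij_betw_def)

lemma F_inj: "U:Ob C ==> V:Ob C ==> F U = F V \<longleftrightarrow> U = V"
 using bij by (auto simp: bij_betw_def inj_on_def)

lemma D_ObE: assumes "U:Ob D" obtains U' where "U':Ob C" "U = F U'"
 using assms bij by (metis bij_betw_imp_surj_on imageE)

lemma D_ArE: assumes "h:Ar D" obtains h' where "h':Ar C" "h = f h'"
 using assms bij by (metis bij_betw_imp_surj_on imageE)

lemma D_homE:
 assumes "h:hom_set D U V"
 obtains h' where "h':Ar C" "h = f h'" "F (Dom C h') = U" "F (Cod C h') = V"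
 using assms by (auto simp: hom_set_def F_dom elim!: D_ArE)

lemma twist_cat: "U:Ob C ==> twist C U:Ar C" "U:Ob C ==> Dom C (twist C U) = U"
 "U:Ob C ==> Cod C (twist C U) = cob (dg U) U" "U:Ob C ==> is_iso C (twist C U)"
 using twist_iso by (auto simp: hom_set_def)

lemma F_inverse: "inverse_arrows C h k ==> inverse_arrows D (f h) (f k)"
 by (auto simp: inverse_arrows_def hom_set_def F_simps F_Ob cat simp flip: F_id)

lemma F_iso: "is_iso C h ==> is_iso D (f h)"
 using F_inverse by (auto simp: is_iso_def)

lemma f_hom: "h:Ar C ==> U = F (Dom C h) ==> V = F (Cod C h) ==> f h:hom_set D U V"
 by (simp add: hom_set_def F_Ob F_dom)

lemma tensor_category_D: "tensor_category D"
proof (unfold_locales, goal_cases)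
 case 1
 then show ?case by (auto elim!: D_ArE simp: F_simps F_Ob cat)
next
 case 2
 then show ?case by (auto elim!: D_ObE intro!: f_hom simp: F_simps cat)
next
 case 3
 then show ?case by (elim D_homE) (auto intro!: f_hom simp: F_simps F_inj cat)
next
 case 4
 then show ?case by (elim D_homE) (auto simp: F_simps F_inj cat)
next
 case 5
 then show ?case by (elim D_homE) (auto simp: F_simps F_inj cat)
next
 case 6
 then show ?case by (auto elim!: D_ObE intro!: F_Ob simp: F_simps cat)
next
 case 7
 then show ?case by (auto intro!: F_Ob simp: F_simps cat)
next
 case 8
 then show ?case by (elim D_homE) (auto intro!: f_hom simp: F_simps F_inj cat)
next
 case 9
 then show ?case by (auto elim!: D_ObE simp: F_simps cat)
next
 case 10
 then show ?case by (elim D_homE) (auto simp: F_simps F_inj cat interchange)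
next
 case 11
 then show ?case by (auto elim!: D_ObE intro!: f_hom F_iso simp: F_simps cat)
next
 case 12
 then show ?case by (elim D_homE) (auto simp: F_simps F_inj cat assoc_natural_cat)
next
 case 13
 then show ?case by (auto elim!: D_ObE intro!: f_hom F_iso simp: F_simps cat)
next
 case 14
 then show ?case by (elim D_homE) (auto simp: F_simps F_inj cat lunit_natural_cat)
next
 case 15
 then show ?case by (auto elim!: D_ObE intro!: f_hom F_iso simp: F_simps cat)
next
 case 16
 then show ?case by (elim D_homE) (auto simp: F_simps F_inj cat runit_natural_cat)
next
 case 17
 then show ?case by (auto elim!: D_ObE simp: F_simps cat pentagon)
next
 case 18
 then show ?case by (auto elim!: D_ObE simp: F_simps cat triangle)
qed

lemma F_inv: "is_iso C h ==> inv_ar D (f h) = f (inv_ar C h)"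
 by (intro tensor_category.inv_ar_eq[OF tensor_category_D] F_inverse inv_inv)

lemma T_category_D: "T_category P D"
proof (intro T_category.intro T_category_axioms.intro tensor_category_D group_axioms, goal_cases)
 case 4
 then show ?case by (auto elim!: D_ObE intro!: F_Ob simp: F_simps cat)
next
 case 6
 then show ?case by (elim D_homE) (auto intro!: f_hom simp: F_simps F_inj cat)
next
 case 8
 then show ?case by (elim D_homE) (auto simp: F_simps F_inj cat)
qed (auto elim!: D_ObE D_ArE simp: F_simps F_inj cat conj_elt_expand)

lemma balanced_T_category_D: "balanced_T_category P D"
proof (intro balanced_T_category.intro braided_T_category.intro balanced_T_category_axioms.intro braided_T_category_axioms.intro T_category_D, goal_cases)
 case 1
 then show ?case by (auto elim!: D_ObE intro!: f_hom F_iso simp: F_simps cat)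
next
 case 2
 then show ?case by (elim D_homE) (auto simp: F_simps F_inj cat braid_natural_cat)
next
 case 3
 then show ?case by (auto elim!: D_ObE simp: F_simps F_inv cat braid_tens_left)
next
 case 4
 then show ?case by (auto elim!: D_ObE simp: F_simps F_inv cat braid_tens_right)
next
 case 6
 then show ?case by (auto elim!: D_ObE intro!: f_hom F_iso simp: F_simps cat twist_cat)
next
 case 7
 then show ?case by (elim D_homE) (auto simp: F_simps F_inj cat twist_cat twist_natural[OF Ar_hom])
next
 case 8
 then show ?case by (auto elim!: D_ObE simp: F_simps F_inv cat twist_cat twist_tens)
qed (auto elim!: D_ObE simp: F_simps F_inj cat twist_cat conj_twist)

text \<open>F preserves tensor products and the unit on the nose, so the structure isomorphisms of
  the tensor functor are identities.\<close>

lemma balanced_isomorphism: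
 "balanced_T_isomorphism P C D F f (%U V. Id D (F (U**[C]V))) (Id D (F \<I>[C]))"
proof (intro balanced_T_isomorphism.intro T_functor.intro T_functor_axioms.intro T_category_D T_category_axioms
  balanced_T_isomorphism_axioms.intro bij balanced_T_category_axioms balanced_T_category_D, goal_cases)
 case 1
 then show ?case by (auto simp: hom_set_def F_Ob F_simps)
next
 case 2
 then show ?case by (simp add: F_simps)
next
 case 3
 then show ?case by (auto simp: hom_set_def F_simps)
next
 case 4
 then show ?case by (auto intro!: f_hom F_iso simp: F_simps cat)
next
 case 5
 then show ?case by (auto intro!: f_hom F_iso simp: F_simps cat)
next
 case 6
 then show ?case by (auto simp: hom_set_def F_simps cat)
qed (auto simp: F_simps cat twist_cat)

end

locale strict_ribbon_isomorphism = strict_isomorphism P C D F f + C?: ribbon_T_category P C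
 for P :: "('g, 'm) monoid_scheme" and C :: "('g, 'o, 'a, 'y) ribbon_tcat_scheme"
  and D :: "('g, 'p, 'b, 'z) ribbon_tcat_scheme" and F :: "'o => 'p" and f :: "'a => 'b" +
 assumes F_dual: "U:Ob C ==> dual_ob D (F U) = F (dual_ob C U)"
  and F_coev: "U:Ob C ==> coev D (F U) = f (coev C U)"
  and F_ev: "U:Ob C ==> ev D (F U) = f (ev C U)"
begin

lemma dual_cat:
 assumes "U:Ob C"
 shows "dual_ob C U:Ob C" "coev C U:Ar C" "Dom C (coev C U) = \<I>[C]"
  "Cod C (coev C U) = U**[C]dual_ob C U" "ev C U:Ar C" "Cod C (ev C U) = \<I>[C]"
  "Dom C (ev C U) = dual_ob C U**[C]U"
 using dual[OF assms] by (auto simp: left_dual_def hom_set_def)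

lemma ribbon_T_category_D: "ribbon_T_category P D"
proof (intro ribbon_T_category.intro ribbon_T_category_axioms.intro balanced_T_category_D, goal_cases)
 case (1 U)
 then obtain V where V: "V:Ob C" "U = F V" by (auto elim: D_ObE)
 show ?case
  using dual[OF V(1)] V unfolding left_dual_def
  by (auto simp: F_dual F_coev F_ev F_simps F_inv dual_cat cat F_Ob intro!: f_hom)
next
 case 2
 then show ?case by (auto elim!: D_ObE simp: F_dual F_simps dual_cat deg_dual)
next
 case 3
 then show ?case using conj_dual by (auto elim!: D_ObE simp: F_dual F_coev F_ev F_simps dual_cat cat)
next
 case (4 U)
 then obtain V where V: "V:Ob C" "U = F V" by (auto elim: D_ObE)
 have "dual_ob C (cob (dg V) V) = cob (dg V) (dual_ob C V)"
  using conj_dual[of "dg V" V] V(1) by (simp add: cat)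
 with V show ?case
  using ribbon[OF V(1)] by (auto simp: F_dual F_coev F_ev F_simps dual_cat cat twist_cat)
qed

lemma ribbon_isomorphism:
 "ribbon_T_isomorphism P C D F f (%U V. Id D (F (U**[C]V))) (Id D (F \<I>[C]))"
 by (intro ribbon_T_isomorphism.intro ribbon_T_isomorphism_axioms.intro balanced_isomorphism ribbon_T_category_axioms ribbon_T_category_D)
  (auto simp: F_dual F_coev F_ev F_simps dual_cat cat)

end

section \<open>Duals of representations\<close>

context vect_universe
begin

abbreviation "lft V W X B == tlift K VV V W X B"
abbreviation "ce V == canonical_elt K VV V"

text \<open>Pairings are scalars; multiplied by the generator of the one-dimensional space they lie
  in a module, where finite sums can be taken out of linear maps.\<close>

lemma ds_ext_kk:
 assumes V: "fd_space K V" and f: "f:cr (ds V)" and g: "g:cr (ds V)"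
  and eq: "!!x. x:cr V ==> pr V f x.*[kk]g1 = pr V g x.*[kk]g1"
 shows "f = g"
 using eq uc_unique V f g by (intro ds_ext[OF V f g]) (metis pr_closed)

lemma dual_expand:
 assumes V: "fd_space K V" and E: "dual_bases K VV V E e" and f: "f:cr (ds V)"
 shows "f = (\<Oplus>\<^bsub>ds V\<^esub>y\<in>E. pr V f y.*[ds V]e y)"
proof -
 interpret V: module K V using V by simp
 interpret D: module K "ds V" using V by simp
 interpret k: module K kk by simp
 have E': "finite E" "!!y. y:E ==> y:cr V" "!!y. y:E ==> e y:cr (ds V)"
  "!!x. x:cr V ==> x = (\<Oplus>\<^bsub>V\<^esub>y\<in>E. pr V (e y) x.*[V]y)"
  using E by (auto simp: dual_bases_def)
 note [simp] = V f E'(2,3)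
 show ?thesis
 proof (rule ds_ext_kk[OF V f])
  show "(\<Oplus>\<^bsub>ds V\<^esub>y\<in>E. pr V f y.*[ds V]e y):cr (ds V)" by (rule D.M.finsum_closed) simp
  fix x assume x [simp]: "x:cr V"
  have l1: "lo K (ds V) kk (%f. pr V f x.*[kk]g1)" by (auto intro!: lin)
  have l2: "lo K V kk (%x. pr V f x.*[kk]g1)" by (auto intro!: lin)
  have "pr V f x.*[kk]g1 = pr V f (\<Oplus>\<^bsub>V\<^esub>y\<in>E. pr V (e y) x.*[V]y).*[kk]g1"
   using E'(4)[OF x] by simp
  also have "... = (\<Oplus>\<^bsub>kk\<^esub>y\<in>E. pr V f (pr V (e y) x.*[V]y).*[kk]g1)"
   by (rule lo_finsum_out[OF _ _ l2]) simp_all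
  also have "... = (\<Oplus>\<^bsub>kk\<^esub>y\<in>E. pr V (pr V f y.*[ds V]e y) x.*[kk]g1)"
   by (rule k.M.finsum_cong') (auto simp: pr_lin m_comm)
  also have "... = pr V (\<Oplus>\<^bsub>ds V\<^esub>y\<in>E. pr V f y.*[ds V]e y) x.*[kk]g1"
   by (rule lo_finsum_out[OF _ _ l1,symmetric]) simp_all
  finally show "pr V f x.*[kk]g1 = ..." .
 qed
qed

lemma bilinear_contract [simp]:
 "fd_space K V ==> module K X ==> lo K V X L ==> x:cr V ==>
  bo K V (ds V) X (%v f. pr V f x.*[X]L v)"
 "fd_space K V ==> module K X ==> lo K (ds V) X M ==> g:cr (ds V) ==>
  bo K V (ds V) X (%v f. pr V g v.*[X]M f)"
 by (auto intro!: boI lin dest: lo_closed)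

text \<open>An element of V tensored with its dual space is determined by the endomorphism of V that
  it induces by contraction: dual bases recover it from the values of that endomorphism.\<close>

lemma dual_tensor_ext:
 assumes V: "fd_space K V" and z: "z:cr (ts V (ds V))" "z':cr (ts V (ds V))"
  and eq: "!!x. x:cr V ==> lft V (ds V) V (%v f. pr V f x.*[V]v) z = lft V (ds V) V (%v f. pr V f x.*[V]v) z'"
 shows "z = z'"
proof -
 obtain E e where E: "dual_bases K VV V E e" using dual_bases_exist[OF V] by blast
 have E': "finite E" "!!y. y:E ==> y:cr V" "!!y. y:E ==> e y:cr (ds V)"
  using E by (auto simp: dual_bases_def)
 interpret V: module K V using V by simp
 interpret D: module K "ds V" using V by simp
 interpret T: module K "ts V (ds V)" using V by simp
 note [simp] = V E'(2,3)
 have "z = (\<Oplus>\<^bsub>ts V (ds V)\<^esub>y\<in>E. tp V (ds V) (lft V (ds V) V (%v f. pr V f y.*[V]v) z) (e y))"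
  if "z:cr (ts V (ds V))" for z
 proof (rule ts_ext[OF V _ _ _ _ _ that, where X="ts V (ds V)"])
  fix v f assume [simp]: "v:cr V" "f:cr (ds V)"
  have c: "lft V (ds V) V (%v f. pr V f y.*[V]v) (tp V (ds V) v f) = pr V f y.*[V]v" if "y:E" for y
   using that by (intro tlift_pr(3)) (auto intro!: lin)
  have "tp V (ds V) v f = tp V (ds V) v (\<Oplus>\<^bsub>ds V\<^esub>y\<in>E. pr V f y.*[ds V]e y)"
   using dual_expand[OF V E,of f] by simp
  also have "... = (\<Oplus>\<^bsub>ts V (ds V)\<^esub>y\<in>E. tp V (ds V) v (pr V f y.*[ds V]e y))"
   by (rule lo_finsum_out[where f="tp V (ds V) v"]) (auto intro!: lin)
  also have "... = (\<Oplus>\<^bsub>ts V (ds V)\<^esub>y\<in>E. tp V (ds V) (pr V f y.*[V]v) (e y))"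
   by (rule T.M.finsum_cong') (auto simp: tp_smult)
  also have "... = (\<Oplus>\<^bsub>ts V (ds V)\<^esub>y\<in>E. tp V (ds V) (lft V (ds V) V (%v f. pr V f y.*[V]v) (tp V (ds V) v f)) (e y))"
   using c by (intro T.M.finsum_cong') auto
  finally show "tp V (ds V) v f = ..." .
 qed (auto intro!: lin bilinear_contract)
 note x = this
 have "lft V (ds V) V (%v f. pr V f y.*[V]v) z':cr V" if "y:cr V" for y
  using that z by (intro lo_closed[OF tlift_pr(2)] bilinear_contract) (auto intro!: lin)
 then have "z = (\<Oplus>\<^bsub>ts V (ds V)\<^esub>y\<in>E. tp V (ds V) (lft V (ds V) V (%v f. pr V f y.*[V]v) z') (e y))"
  using eq z(2) by (subst x[OF z(1)], intro T.M.finsum_cong') auto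
 then show ?thesis using x[OF z(2)] by simp
qed

text \<open>\<open>canonical_elt\<close> is a definite description over all dual bases, so all of
  them must give one element: each induces the identity of V by contraction. The two contraction
  formulas are what the duality relations need.\<close>

lemma ce_props:
 assumes V: "fd_space K V"
 shows "ce V:cr (ts V (ds V))"
  "module K X ==> lo K V X L ==> x:cr V ==> lft V (ds V) X (%v f. pr V f x.*[X]L v) (ce V) = L x"
  "module K X ==> lo K (ds V) X M ==> g:cr (ds V) ==> lft V (ds V) X (%v f. pr V g v.*[X]M f) (ce V) = M g"
proof -
 interpret V: module K V using V by simp
 interpret D: module K "ds V" using V by simp
 interpret T: module K "ts V (ds V)" using V by simp
 let ?c = "%E e. \<Oplus>\<^bsub>ts V (ds V)\<^esub>y\<in>E. tp V (ds V) y (e y)"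
 have E': "finite E" "!!y. y:E ==> y:cr V" "!!y. y:E ==> e y:cr (ds V)"
  "!!x. x:cr V ==> (\<Oplus>\<^bsub>V\<^esub>y\<in>E. pr V (e y) x.*[V]y) = x"
  if "dual_bases K VV V E e" for E e using that by (auto simp: dual_bases_def)
 have c: "?c E e:cr (ts V (ds V))" if "dual_bases K VV V E e" for E e
  using E'[OF that] V by (intro T.M.finsum_closed) auto
 have lc: "lft V (ds V) X B (?c E e) = (\<Oplus>\<^bsub>X\<^esub>y\<in>E. B y (e y))"
  if "dual_bases K VV V E e" "bo K V (ds V) X B" "module K X" for E e and X :: "('k, 'u) module" and B
 proof -
  interpret X: module K X by fact
  have l: "lo K (ts V (ds V)) X (lft V (ds V) X B)" using V that by (intro tlift_pr(2)) auto
  have "lft V (ds V) X B (?c E e) = (\<Oplus>\<^bsub>X\<^esub>y\<in>E. lft V (ds V) X B (tp V (ds V) y (e y)))"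
   using E'[OF that(1)] V that by (intro lo_finsum_out[OF _ _ l]) auto
  also have "... = (\<Oplus>\<^bsub>X\<^esub>y\<in>E. B y (e y))"
   using E'[OF that(1)] V that by (intro X.M.finsum_cong') (auto simp: tlift_pr intro: bo_closed)
  finally show ?thesis .
 qed
 have c1: "lft V (ds V) X (%v f. pr V f x.*[X]L v) (?c E e) = L x"
  if E: "dual_bases K VV V E e" and [simp]: "module K X" "lo K V X L" "x:cr V" for E e and X :: "('k, 'u) module" and L x
 proof -
  interpret X: module K X by fact
  have l: "lo K V X L" by fact
  have "lft V (ds V) X (%v f. pr V f x.*[X]L v) (?c E e) = (\<Oplus>\<^bsub>X\<^esub>y\<in>E. pr V (e y) x.*[X]L y)"
   using lc[OF E] V by simp
  also have "... = (\<Oplus>\<^bsub>X\<^esub>y\<in>E. L (pr V (e y) x.*[V]y))"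
   using E'[OF E] V by (intro X.M.finsum_cong') (auto simp: loD[OF l])
  also have "... = L (\<Oplus>\<^bsub>V\<^esub>y\<in>E. pr V (e y) x.*[V]y)"
   using E'[OF E] V by (intro lo_finsum_out[OF _ _ l,symmetric]) auto
  finally show ?thesis using E'(4)[OF E] by simp
 qed
 have c2: "lft V (ds V) X (%v f. pr V g v.*[X]M f) (?c E e) = M g"
  if E: "dual_bases K VV V E e" and [simp]: "module K X" "lo K (ds V) X M" "g:cr (ds V)" for E e and X :: "('k, 'u) module" and M g
 proof -
  interpret X: module K X by fact
  have l: "lo K (ds V) X M" by fact
  have "lft V (ds V) X (%v f. pr V g v.*[X]M f) (?c E e) = (\<Oplus>\<^bsub>X\<^esub>y\<in>E. pr V g y.*[X]M (e y))"
   using lc[OF E] V by simp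
  also have "... = (\<Oplus>\<^bsub>X\<^esub>y\<in>E. M (pr V g y.*[ds V]e y))"
   using E'[OF E] V by (intro X.M.finsum_cong') (auto simp: loD[OF l])
  also have "... = M (\<Oplus>\<^bsub>ds V\<^esub>y\<in>E. pr V g y.*[ds V]e y)"
   using E'[OF E] V by (intro lo_finsum_out[OF _ _ l,symmetric]) auto
  finally show ?thesis using dual_expand[OF V E] by simp
 qed
 obtain E e where E: "dual_bases K VV V E e" using dual_bases_exist[OF V] by blast
 have "ce V = ?c E e"
  unfolding canonical_elt_def
 proof (rule the_equality)
  show "\<exists>F e'. dual_bases K VV V F e' & ?c E e = ?c F e'" using E by blast
  fix t assume "\<exists>F e'. dual_bases K VV V F e' & t = ?c F e'"
  then obtain F e' where F: "dual_bases K VV V F e'" "t = ?c F e'" by blast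
  show "t = ?c E e"
  proof (rule dual_tensor_ext[OF V])
   fix x assume x: "x:cr V"
   show "lft V (ds V) V (%v f. pr V f x.*[V]v) t = lft V (ds V) V (%v f. pr V f x.*[V]v) (?c E e)"
    unfolding F(2) c1[OF E V.module_axioms lo_id x] c1[OF F(1) V.module_axioms lo_id x] ..
  qed (simp_all add: F(2) c[OF E] c[OF F(1)])
 qed
 then show "ce V:cr (ts V (ds V))"
  "module K X ==> lo K V X L ==> x:cr V ==> lft V (ds V) X (%v f. pr V f x.*[X]L v) (ce V) = L x"
  "module K X ==> lo K (ds V) X M ==> g:cr (ds V) ==> lft V (ds V) X (%v f. pr V g v.*[X]M f) (ce V) = M g"
  using c[OF E] c1[OF E] c2[OF E] by simp_all
qed

lemma tlift_cong:
 "(!!v w. v:cr V ==> w:cr W ==> B v w = C v w) ==> lft V W X B = lft V W X C"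
 unfolding tlift_def by (rule arg_cong[where f=The], rule ext) auto

lemma tlift_out:
 fixes X Y :: "('k, 'u) module"
 assumes "fd_space K V" "fd_space K W" "module K X" "module K Y" "lo K X Y L" "bo K V W X C" "z:cr (ts V W)"
 shows "L (lft V W X C z) = lft V W Y (%v f. L (C v f)) z"
proof -
 have b: "bo K V W Y (%v f. L (C v f))"
  using lo_compose[OF boD(1)[OF assms(6)] assms(5)] lo_compose[OF boD(2)[OF assms(6)] assms(5)]
  by (intro boI)
 show ?thesis
  by (rule ts_ext[OF assms(1,2,4) _ _ _ assms(7)])
   (use assms b lo_compose[OF tlift_pr(2)[OF assms(1-3,6)] assms(5)] in \<open>simp_all add: tlift_pr\<close>)
qed

lemma tlift_tlift:
 fixes X Y :: "('k, 'u) module"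
 assumes "fd_space K V" "fd_space K W" "fd_space K V'" "fd_space K W'" "module K Y" "bo K V' W' Y B"
  "bo K V W (ts V' W') C" "z:cr (ts V W)"
 shows "lft V' W' Y B (lft V W (ts V' W') C z) = lft V W Y (%v f. lft V' W' Y B (C v f)) z"
 using assms by (intro tlift_out[where X="ts V' W'"] tlift_pr(2)) simp_all

lemma tlift_tsum:
 fixes X :: "('k, 'u) module"
 assumes V: "fd_space K V" and W: "fd_space K W" and X: "module K X" and U: "module K U" "module K U'"
  and t: "t:cr (tensor K U U')" and z: "z:cr (ts V W)"
  and B: "!!a b. a:cr U ==> b:cr U' ==> bo K V W X (B a b)"
 shows "lft V W X (%v f. tsum X (%a b. B a b v f) t) z = tsum X (%a b. lft V W X (B a b) z) t"
proof -
 have b: "bo K V W X (%v f. tsum X (%a b. B a b v f) t)"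
  using boD[OF B] by (intro boI lo_tsum[OF U X t]) auto
 show ?thesis
 proof (rule ts_ext[OF V W X _ _ _ z])
  show "lo K (ts V W) X (%z. tsum X (%a b. lft V W X (B a b) z) t)"
   using tlift_pr(2)[OF V W X B] by (intro lo_tsum[OF U X t])
 qed (use b V W X U t B in \<open>auto intro!: tlift_pr(2) tsum_cong[OF U t] simp: tlift_pr\<close>)
qed

text \<open>The canonical element corresponds to the identity of V; applying T to its first factor
  or the transpose of T to its second gives the element corresponding to T in both cases.\<close>

lemma canonical_elt_transpose:
 assumes V: "fd_space K V" and X: "module K X" and B: "bo K V (ds V) X B"
  and T: "lo K V V T" and T': "lo K (ds V) (ds V) T'"
  and eq: "!!x f. x:cr V ==> f:cr (ds V) ==> pr V (T' f) x = pr V f (T x)"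
 shows "lft V (ds V) X (%v f. B (T v) f) (ce V) = lft V (ds V) X (%v f. B v (T' f)) (ce V)"
proof -
 note [simp] = V ds_fd[OF V] X lo_closed[OF T] lo_closed[OF T'] ce_props(1)[OF V]
 interpret V: module K V by simp
 let ?D = "ds V" and ?p = "tp V (ds V)"
 let ?c = "%x v f. pr V f x.*[V]v"
 let ?t = "ts V ?D"
 have b1: "bo K V ?D ?t (%v f. ?p (T v) f)"
  using T by (auto intro!: lin)
 have b2: "bo K V ?D ?t (%v f. ?p v (T' f))"
  using T' by (auto intro!: lin)
 have c: "bo K V ?D V (?c x)" if "x:cr V" for x
  using that by (auto intro!: lin)
 have "lft V ?D ?t (%v f. ?p (T v) f) (ce V) = lft V ?D ?t (%v f. ?p v (T' f)) (ce V)"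
 proof (rule dual_tensor_ext[OF V])
  fix x assume [simp]: "x:cr V"
  have "lft V ?D V (?c x) (lft V ?D ?t (%v f. ?p (T v) f) (ce V))
    = lft V ?D V (%v f. pr V f x.*[V]T v) (ce V)"
   by (simp add: tlift_tlift c b1, rule fun_cong[OF tlift_cong]) (simp add: tlift_pr c)
  also have "... = T x" using T by (intro ce_props) auto
  also have "... = lft V ?D V (%v f. pr V f (T x).*[V]v) (ce V)"
   by (rule ce_props(2)[symmetric]) (auto intro!: lin)
  also have "... = lft V ?D V (?c x) (lft V ?D ?t (%v f. ?p v (T' f)) (ce V))"
   by (simp add: tlift_tlift c b2, rule fun_cong[OF tlift_cong]) (simp add: tlift_pr c eq)
  finally show "lft V ?D V (?c x) (lft V ?D ?t (%v f. ?p (T v) f) (ce V))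
    = lft V ?D V (?c x) (lft V ?D ?t (%v f. ?p v (T' f)) (ce V))" .
 qed (auto intro!: lo_closed[OF tlift_pr(2)] b1 b2 ce_props)
 then have "lft V ?D X B (lft V ?D ?t (%v f. ?p (T v) f) (ce V)) = lft V ?D X B (lft V ?D ?t (%v f. ?p v (T' f)) (ce V))"
  by simp
 moreover have "lft V ?D X B (lft V ?D ?t (%v f. ?p (T v) f) (ce V)) = lft V (ds V) X (%v f. B (T v) f) (ce V)"
  by (simp add: tlift_tlift B b1, rule fun_cong[OF tlift_cong]) (simp add: tlift_pr B)
 moreover have "lft V ?D X B (lft V ?D ?t (%v f. ?p v (T' f)) (ce V)) = lft V (ds V) X (%v f. B v (T' f)) (ce V)"
  by (simp add: tlift_tlift B b2, rule fun_cong[OF tlift_cong]) (simp add: tlift_pr B)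
 ultimately show ?thesis by simp
qed

end

section \<open>The dual module with its unit and counit\<close>

context qt_rep
begin

declare ce_props(1) [simp]

abbreviation "rd == rep_dual P VV H"
abbreviation "rco == rep_coev P K VV H"
abbreviation "re == rep_ev P K VV H"

lemma rd_simps [simp]: "gr (rd M) = iv (gr M)" "sp (rd M) = ds (sp M)"
 by (simp_all add: rep_dual_def Let_def)

lemma act_rd:
 assumes M [simp]: "hm M" and g: "g = iv (gr M)" and h: "h:cA g" and f: "f:cr (ds (sp M))"
 shows "act (rd M) h f:cr (ds (sp M))"
  "x:elts M ==> pr (sp M) (act (rd M) h f) x = pr (sp M) f (act M (S g h) x)"
proof -
 have Sh: "S g h:cA (gr M)" using g h by simp
 have "linear_form K (sp M) (%x. pr (sp M) f (act M (S g h) x))"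
  using pairing_form[OF hmD(2)[OF M] f] loD[OF linear_act[OF M Sh]]
  by (auto simp: linear_form_def)
 from theI'[OF pairing_bij[OF hmD(2)[OF M] this]]
 show "act (rd M) h f:cr (ds (sp M))"
  "x:elts M ==> pr (sp M) (act (rd M) h f) x = pr (sp M) f (act M (S g h) x)"
  using h f by (simp_all add: rep_dual_def Let_def g)
qed

lemma hm_rd [simp]:
 assumes M [simp]: "hm M"
 shows "hm (rd M)"
proof (rule hmodI[OF _ _ HOL.refl])
 note a = act_rd[OF M HOL.refl]
 interpret SM: module K "sp M" by simp
 interpret D: module K "ds (sp M)" by simp
 let ?g = "iv (gr M)"
 let ?a = "gr (rd M)" and ?s = "sp (rd M)"
 have e: "f = g" if "f:cr (ds (sp M))" "g:cr (ds (sp M))"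
  "!!x. x:elts M ==> pr (sp M) f x = pr (sp M) g x" for f g
  using ds_ext[OF hmD(2)[OF M] that] .
 note p = pr_lin[OF hmD(2)[OF M]]
 show "gr (rd M):cr P" "fd_space K ?s" by simp_all
 show "lo K ?s ?s (act (rd M) h)" if "h:cA ?a" for h
  using that a by (intro loI e) (auto simp: p)
 show "lo K (A ?a) ?s (%h. act (rd M) h f)" if "f:elts (rd M)" for f
  using that a loD[OF antipode_linear[of ?g]] loD[OF linear_act_left[OF M HOL.refl lo_id]]
  by (intro loI e) (auto simp: p)
 show "act (rd M) (h*[A ?a]k) f = act (rd M) h (act (rd M) k f)"
  if "h:cA ?a" "k:cA ?a" "f:elts (rd M)" for h k f
  using that a by (intro e) (auto simp: S_mult[OF _ _ _ HOL.refl] act_mult[OF M HOL.refl])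
 show "act (rd M) \<one>[A ?a] f = f" if "f:elts (rd M)" for f
  using that a by (intro e) auto
 show "act (rd M):extensional (cA ?a)" "!!h. h:cA ?a ==> act (rd M) h:extensional (elts (rd M))"
  by (simp_all add: rep_dual_def Let_def)
qed

lemma rd_rc:
 fixes M :: "('g, 'k, 'h, 'u) hmod"
 assumes M [simp]: "hm M" and b [simp]: "b:cr P"
 shows "rd (rc b M) = rc b (rd M)"
proof (rule hmod_eqI[OF _ _ HOL.refl])
 note a = act_rd[OF M HOL.refl] act_rd[OF hm_rc[OF M b] HOL.refl]
 show "act (rd (rc b M)) h f = act (rc b (rd M)) h f" if "h:cA (gr (rc b (rd M)))" "f:elts (rc b (rd M))" for h f
  using that a by (intro ds_ext[OF hmD(2)[OF M]]) (auto simp: S_crossing)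
qed (use act_ext[OF hm_rd[OF hm_rc[OF M b]]] act_ext[OF hm_rc[OF hm_rd[OF M] b]] in auto)

lemma ev_hom:
 assumes M [simp]: "hm M"
 shows "re M:rh (mt (rd M) M) ru"
  "f:elts (rd M) ==> x:elts M ==> amap (re M) (mp (rd M) M f x) = pr (sp M) f x.*[kk]g1"
proof -
 interpret k: module K kk by simp
 let ?B = "%f x. pr (sp M) f x.*[kk]g1" and ?g = "gr M"
 have B: "bo K (ds (sp M)) (sp M) kk ?B" by (auto intro!: lin)
 have "hl (mt (rd M) M) ru (tlift K VV (sp (rd M)) (sp M) (sp ru) ?B)"
 proof (rule hmod_linear_tlift)
  fix h f x assume h: "h:cA (gr ru)" and f: "f:elts (rd M)" and x: "x:elts M"
  have l: "lo K (A ?g) kk (%k. ?B f (act M k x))" using f x by (auto intro!: lin)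
  have "tsum (sp ru) (%a b. ?B (act (rd M) a f) (act M b x)) (De (gr (rd M)) (gr M) h)
    = tsum kk (%a b. ?B f (act M (S (iv ?g) a*[A ?g]b) x)) (De (iv ?g) ?g h)"
   unfolding rd_simps ru_simps using x f h by (intro Ds_cong) (auto simp: act_rd act_mult[OF M HOL.refl])
  also have "... = ?B f (act M (tsum (A ?g) (%a b. S (iv ?g) a*[A ?g]b) (De (iv ?g) ?g h)) x)"
   using h by (intro Ds_out[OF _ _ _ _ _ l,symmetric]) auto
  also have "... = ?B f (act M (ep h.*[A ?g]\<one>[A ?g]) x)"
   using h by (simp add: antipode_left)
  also have "... = ep h.*[kk]?B f x"
   using h x f lo_smult[OF l] by simp
  finally show "tsum (sp ru) (%a b. ?B (act (rd M) a f) (act M b x)) (De (gr (rd M)) (gr M) h) = act ru h (?B f x)"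
   using h f x by simp
 qed (use B in auto)
 then show "re M:rh (mt (rd M) M) ru" by (simp add: Rep_hom_iff rep_ev_def)
 show "f:elts (rd M) ==> x:elts M ==> amap (re M) (mp (rd M) M f x) = pr (sp M) f x.*[kk]g1"
  using B by (simp add: rep_ev_def tlift_pr)
qed

abbreviation "cm M == ce (sp M)"

text \<open>As an endomorphism of M, the canonical element moved by h sends x to the sum of h'
  S(h'') x, and the antipode axiom turns this into \<epsilon>(h) x.\<close>

lemma act_canonical:
 assumes M [simp]: "hm M" and h: "h:cr (A eP)"
 shows "act (mt M (rd M)) h (cm M) = ep h.*[ms M (rd M)]cm M"
proof -
 let ?V = "sp M" and ?g = "gr M" and ?T = "ts (sp M) (ds (sp M))" and ?p = "tp (sp M) (ds (sp M))"
 interpret V: module K ?V by simp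
 interpret T: module K "?T" by simp
 let ?D = "De ?g (iv ?g) h" and ?c = "%x v f. pr ?V f x.*[?V]v"
 let ?d = "ds ?V" and ?m = "mt M (rd M)"
 have h': "h:cA (?g*[P]iv ?g)" using h by simp
 have t: "?D:cr (tensor K (A ?g) (A (iv ?g)))" using h' by (simp add: De_closed)
 have C: "bo K ?V ?d (?T) (%x y. tsum (?T) (%a b. ?p (act M a x) (act (rd M) b y)) ?D)"
  using top_bilinear[OF M hm_rd[OF M]] t by simp
 have 1: "act ?m h (cm M) = lft ?V ?d (?T) (%x y. tsum (?T) (%a b. ?p (act M a x) (act (rd M) b y)) ?D) (cm M)"
  using h' by (simp add: act_mt top_def)
 show ?thesis
  unfolding rd_simps
 proof (rule dual_tensor_ext[OF hmD(2)[OF M]])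
  show "act ?m h (cm M):cr (ts ?V ?d)"
   using h hmD(4)[of "mt M (rd M)" "eP" h] ce_props(1)[of ?V] by simp
  show "ep h.*[?T]cm M:cr (ts ?V ?d)"
   using h ce_props(1)[of ?V] T.smult_closed by simp
  fix x assume x [simp]: "x:elts M"
  have c: "bo K ?V ?d ?V (?c x)" by (auto intro!: lin)
  have lc: "lo K (ts ?V ?d) ?V (lft ?V ?d ?V (?c x))" using c by (intro tlift_pr(2)) auto
  have "lft ?V ?d ?V (?c x) (act ?m h (cm M))
    = lft ?V ?d ?V (%v f. tsum ?V (%a b. pr ?V f (act M (S (iv ?g) b) x).*[?V]act M a v) ?D) (cm M)"
   unfolding 1
  proof (rule HOL.trans, rule tlift_tlift, goal_cases)
   case 9
   show ?case
   proof (rule fun_cong[OF tlift_cong])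
    fix v f assume [simp]: "v:elts M" "f:cr ?d"
    have "lft ?V ?d ?V (?c x) (tsum (?T) (%a b. ?p (act M a v) (act (rd M) b f)) ?D)
     = tsum ?V (%a b. lft ?V ?d ?V (?c x) (?p (act M a v) (act (rd M) b f))) ?D"
     using h' lc by (intro Ds_out) (auto simp: act_rd)
    also have "... = tsum ?V (%a b. pr ?V f (act M (S (iv ?g) b) x).*[?V]act M a v) ?D"
     using h' c by (intro Ds_cong) (auto simp: act_rd tlift_pr)
    finally show "lft ?V ?d ?V (?c x) (tsum (?T) (%a b. ?p (act M a v) (act (rd M) b f)) ?D) = ..." .
   qed
  qed (use c C ce_props in auto)
  also have "... = tsum ?V (%a b. lft ?V ?d ?V (%v f. pr ?V f (act M (S (iv ?g) b) x).*[?V]act M a v) (cm M)) ?D"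
   by (intro tlift_tsum[OF _ _ _ A_module A_module t] ce_props) (auto intro!: lin)
  also have "... = tsum ?V (%a b. act M (a*[A ?g]S (iv ?g) b) x) ?D"
   using h' by (intro Ds_cong) (auto simp: act_mult[OF M HOL.refl] intro!: ce_props(2) linear_act)
  also have "... = act M (tsum (A ?g) (%a b. a*[A ?g]S (iv ?g) b) ?D) x"
   using h' by (intro Ds_out[symmetric]) (auto intro!: lin)
  also have "... = ep h.*[?V]x"
   using h lo_smult[OF linear_act_left[OF M HOL.refl lo_id x]] by (simp add: antipode_right)
  also have "... = lft ?V ?d ?V (?c x) (ep h.*[?T]cm M)"
   using h lo_smult[OF lc] ce_props(1)[of ?V] ce_props(2)[of ?V ?V "%x. x" x] by (simp add: lo_id)
  finally show "lft ?V ?d ?V (?c x) (act ?m h (cm M)) = lft ?V ?d ?V (?c x) (ep h.*[?T]cm M)" .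
 qed
qed

lemma co_hom:
 assumes M [simp]: "hm M"
 shows "rco M:rh ru (mt M (rd M))" "x:cr kk ==> amap (rco M) x = uc x.*[ms M (rd M)]cm M"
proof -
 let ?m = "ms M (rd M)"
 have l: "lo K kk ?m (%x. uc x.*[?m]cm M)"
  by (intro linear_uc) (auto simp: ce_props intro!: lin)
 show "rco M:rh ru (mt M (rd M))"
  unfolding Rep_hom_iff rep_coev_def Let_def arr.sel mt_simps
 proof (intro conjI hmod_linearI HOL.refl hm_ru hm_mt hm_rd M)
  fix h x assume h: "h:cA (gr ru)" and x: "x:elts ru"
  let ?f = "%x. uc x.*[?m]cm M"
  interpret T: module K "ms M (rd M)" by simp
  interpret k: module K kk by simp
  have "?f (act ru h x) = ep h.*[?m]?f x"
   using h x lo_smult[OF l] by simp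
  also have "... = uc x.*[?m](ep h.*[?m]cm M)"
   using h x uc_props T.smult_assoc1[of "ep h" "uc x" "cm M"] T.smult_assoc1[of "uc x" "ep h" "cm M"] m_comm[of "uc x" "ep h"]
   by (simp add: ce_props)
  also have "... = act (mt M (rd M)) h (?f x)"
   using h x uc_props act_canonical[OF M,of h] lo_smult[OF linear_act[OF hm_mt[OF M hm_rd[OF M]]], of h "uc x" "cm M"] by simp
  finally show "restrict ?f (cr kk) (act ru h x) = act (mt M (rd M)) h (restrict ?f (cr kk) x)"
   using h x by simp
 qed (use l in \<open>simp_all add: lo_cong[where f="restrict _ _"]\<close>)
 show "x:cr kk ==> amap (rco M) x = uc x.*[?m]cm M" by (simp add: rep_coev_def Let_def)
qed

lemma as_tlift:
 assumes "fd_space K V" "fd_space K W" "module K X" "lo K (ts V W) X L" "z:cr (ts V W)"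
 shows "L z = lft V W X (%v f. L (tp V W v f)) z"
proof -
 have b: "bo K V W X (%v f. L (tp V W v f))"
  using assms lo_compose[OF boD(1)[OF bilinear_tp] assms(4)] lo_compose[OF boD(2)[OF bilinear_tp] assms(4)]
  by (intro boI) auto
 show ?thesis
  using assms b by (intro ts_ext[OF assms(1-4) _ _ assms(5)]) (auto intro!: tlift_pr(2) simp: tlift_pr)
qed

lemma inv_rl:
 assumes M [simp]: "hm M"
 shows "rv (rl M):rh M (mt ru M)" "x:elts M ==> amap (rv (rl M)) x = mp ru M g1 x"
proof -
 interpret SM: module K "sp M" by simp
 note r = Rep_iso_amap[OF rl_hom(1)[OF M] RC.inv_inv]
 have i: "is_iso RC (rl M)" using rl_hom(3)[OF M] by (simp add: is_iso_def)
 show "rv (rl M):rh M (mt ru M)" by (rule r(1)[OF i])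
 show "x:elts M ==> amap (rv (rl M)) x = mp ru M g1 x"
  using r(2)[OF i, of "mp ru M g1 x"] rl_hom(2)[OF M,of g1 x] by simp
qed

lemma inv_rr:
 assumes M [simp]: "hm M"
 shows "rv (rr M):rh M (mt M ru)" "x:elts M ==> amap (rv (rr M)) x = mp M ru x g1"
proof -
 interpret SM: module K "sp M" by simp
 note r = Rep_iso_amap[OF rr_hom(1)[OF M] RC.inv_inv]
 have i: "is_iso RC (rr M)" using rr_hom(3)[OF M] by (simp add: is_iso_def)
 show "rv (rr M):rh M (mt M ru)" by (rule r(1)[OF i])
 show "x:elts M ==> amap (rv (rr M)) x = mp M ru x g1"
  using r(2)[OF i, of "mp M ru x g1"] rr_hom(2)[OF M,of g1 x] by simp
qed

text \<open>Stated for arbitrary arrows b and d instead of the canonical unit and counit, since a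
  good left dual may be any left dual. The arrow b enters through its value at the generator of the
  ground field.\<close>

lemma zigzag_eval:
 assumes M [simp]: "hm M" and N [simp]: "hm N"
  and b: "b:rh ru (mt M N)" and d: "d:rh (mt N M) ru"
 defines "z == rr M oR rt (ri M) d oR ra M N M oR rt b (ri M) oR rv (rl M)"
 shows "z:rh M M"
  "x:elts M ==> amap z x = lft (sp M) (sp N) (sp M) (%y f. uc (amap d (mp N M f x)).*[sp M]y) (amap b g1)"
proof -
 note i = Rep_id[OF M]
 note a1 = inv_rl[OF M] note a2 = Rep_tens[OF b i] note a3 = ra_hom[OF M N M]
 note a4 = Rep_tens[OF i d] note a5 = rr_hom[OF M]
 note c1 = Rep_comp[OF a1(1) a2(1)] note c2 = Rep_comp[OF c1(1) a3(1)] note c3 = Rep_comp[OF c2(1) a4(1)]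
 note c4 = Rep_comp[OF c3(1) a5(1)]
 let ?a = "amap b g1"
 show "z:rh M M" unfolding z_def by (rule c4(1))
 assume x [simp]: "x:elts M"
 have bg [simp]: "amap b g1:cr (ms M N)" using Rep_homD(8)[OF b,of g1] by simp
 let ?L = "%z. amap (rr M) (amap (rt (ri M) d) (amap (ra M N M) (mp (mt M N) M z x)))"
 have L: "lo K (ms M N) (sp M) ?L"
  by (intro lo_amap[OF a5(1)] lo_amap[OF a4(1)] lo_amap[OF a3(1)]) (auto intro!: lin)
 have "amap z x = ?L ?a"
  unfolding z_def using c4(2)[OF x] c3(2)[OF x] c2(2)[OF x] c1(2)[OF x] a1(2)[OF x] a2(2)[of g1 x] amap_Id[OF x] by simp
 also have "... = lft (sp M) (sp N) (sp M) (%y f. ?L (mp M N y f)) ?a"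
  using L by (intro as_tlift) auto
 also have "... = lft (sp M) (sp N) (sp M) (%y f. uc (amap d (mp N M f x)).*[sp M]y) ?a"
  using a3(2) a4(2) a5(2) amap_Id Rep_homD(8)[OF d] by (intro fun_cong[OF tlift_cong]) simp
 finally show "amap z x = lft (sp M) (sp N) (sp M) (%y f. uc (amap d (mp N M f x)).*[sp M]y) ?a" .
qed

lemma dual_arrow_eval:
 assumes M [simp]: "hm M" and N [simp]: "hm N" and N' [simp]: "hm N'" and f: "f:rh M M'"
  and b: "b:rh ru (mt M N)" and d: "d:rh (mt N' M') ru"
 shows "dual_arrow RC N b N' d f:rh N' N"
  "x:elts N' ==> amap (dual_arrow RC N b N' d f) x
   = lft (sp M) (sp N) (sp N) (%y g. uc (amap d (mp N' M' x (amap f y))).*[sp N]g) (amap b g1)"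
proof -
 let ?a = "amap b g1"
 have M' [simp]: "hm M'" using Rep_homD(2)[OF f] .
 have e: "dual_arrow RC N b N' d f = rl N oR rt d (ri N) oR rv (ra N' M' N) oR rt (ri N') (rt f (ri N) oR b) oR rv (rr N')"
  using Rep_homD(4)[OF f] by (simp add: dual_arrow_def del: Rep_simps(4,5))
 note i = Rep_id[OF N] note i' = Rep_id[OF N']
 note fb0 = Rep_tens[OF f i] note fb = Rep_comp[OF b fb0(1)]
 note a1 = inv_rr[OF N'] note a2 = Rep_tens[OF i' fb(1)] note a3 = inv_ra[OF N' M' N]
 note a4 = Rep_tens[OF d i] note a5 = rl_hom[OF N]
 note c1 = Rep_comp[OF a1(1) a2(1)] note c2 = Rep_comp[OF c1(1) a3(1)] note c3 = Rep_comp[OF c2(1) a4(1)]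
 note c4 = Rep_comp[OF c3(1) a5(1)]
 show "dual_arrow RC N b N' d f:rh N' N" unfolding e by (rule c4(1))
 assume x [simp]: "x:elts N'"
 have bg [simp]: "amap b g1:cr (ms M N)" using Rep_homD(8)[OF b,of g1] by simp
 let ?L = "%z. amap (rl N) (amap (rt d (ri N)) (amap (rv (ra N' M' N)) (mp N' (mt M' N) x (amap (rt f (ri N)) z))))"
 have L: "lo K (ms M N) (sp N) ?L"
  by (intro lo_amap[OF a5(1)] lo_amap[OF a4(1)] lo_amap[OF a3(1)])
   (use Rep_homD(7)[OF fb0(1)] in \<open>auto intro!: lin\<close>)
 have "amap (dual_arrow RC N b N' d f) x = ?L ?a"
  unfolding e using c4(2)[OF x] c3(2)[OF x] c2(2)[OF x] c1(2)[OF x] a1(2)[OF x] a2(2)[of x g1] fb(2)[of g1] amap_Id[OF x] by simp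
 also have "... = lft (sp M) (sp N) (sp N) (%y g. ?L (mp M N y g)) ?a"
  using L by (intro as_tlift) auto
 also have "... = lft (sp M) (sp N) (sp N) (%y g. uc (amap d (mp N' M' x (amap f y))).*[sp N]g) ?a"
  using a3(2) a4(2) a5(2) fb0(2) amap_Id Rep_homD(8)[OF d] Rep_homD(8)[OF f] by (intro fun_cong[OF tlift_cong]) simp
 finally show "amap (dual_arrow RC N b N' d f) x
   = lft (sp M) (sp N) (sp N) (%y g. uc (amap d (mp N' M' x (amap f y))).*[sp N]g) ?a" .
qed

text \<open>The second duality relation says that the dual of the identity is the identity.\<close>

lemma left_dual_dual_arrow:
 assumes M [simp]: "hm M" and N [simp]: "hm N" and b: "b:rh ru (mt M N)"
 shows "rl N oR rt d (ri N) oR rv (ra N M N) oR rt (ri N) b oR rv (rr N)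
  = dual_arrow RC N b N d (ri M)"
proof -
 have "rt (ri M) (ri N) oR b = b"
  using RC.tens_id[of M N] RC.comp_id[OF b] by (simp del: Rep_simps(4,5))
 then show ?thesis by (simp add: dual_arrow_def del: Rep_simps(5))
qed

lemma co_g1 [simp]: "hm M ==> amap (rco M) g1 = cm M"
 using module.smult_one[of K "ms M (rd M)" "cm M"] by (simp add: co_hom)

lemma left_dual_Rep:
 assumes M [simp]: "hm M"
 shows "left_dual RC M (rd M) (rco M) (re M)"
proof -
 note co = co_hom(1)[OF M] note ev = ev_hom[OF M]
 note z = zigzag_eval[OF M hm_rd[OF M] co ev(1)]
 note i = Rep_id[OF M]
 note da = dual_arrow_eval[OF M hm_rd[OF M] hm_rd[OF M] i co ev(1)]
 have 1: "rr M oR rt (ri M) (re M) oR ra M (rd M) M oR rt (rco M) (ri M) oR rv (rl M) = ri M"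
 proof (rule Rep_ar_eqI[OF z(1) i])
  fix x assume x: "x:elts M"
  show "amap (rr M oR rt (ri M) (re M) oR ra M (rd M) M oR rt (rco M) (ri M) oR rv (rl M)) x = amap (ri M) x"
   unfolding z(2)[OF x] amap_Id[OF x] co_g1[OF M] rd_simps
   using x unfolding rd_simps by (intro HOL.trans[OF fun_cong[OF tlift_cong] ce_props(2)]) (auto simp: ev(2)[unfolded rd_simps] intro!: lin)
 qed
 have 2: "dual_arrow RC (rd M) (rco M) (rd M) (re M) (ri M) = ri (rd M)"
 proof (rule Rep_ar_eqI[OF da(1) Rep_id[OF hm_rd[OF M]]])
  fix x assume x: "x:elts (rd M)"
  show "amap (dual_arrow RC (rd M) (rco M) (rd M) (re M) (ri M)) x = amap (ri (rd M)) x"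
   unfolding da(2)[OF x] amap_Id[OF x] co_g1[OF M]
   using x amap_Id[of _ M] unfolding rd_simps by (intro HOL.trans[OF fun_cong[OF tlift_cong] ce_props(3)]) (auto simp: ev(2)[unfolded rd_simps] intro!: lin)
 qed
 show ?thesis
  unfolding left_dual_def Rep_simps(6-11) 1 left_dual_dual_arrow[OF M hm_rd[OF M] co] 2
  using co ev(1) by simp
qed

lemma conj_dual_Rep:
 assumes M [simp]: "hm M" and b [simp]: "b:cr P"
 shows "rj b (rco M) = rco (rc b M)" "rj b (re M) = re (rc b M)"
proof -
 let ?r = "rc b M"
 have r: "rc b (mt M (rd M)) = mt ?r (rd ?r)" "rc b (mt (rd M) M) = mt (rd ?r) ?r"
  by (simp_all add: rc_mt rd_rc)
 show "rj b (rco M) = rco ?r"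
 proof (rule Rep_ar_eqI)
  show "rj b (rco M):rh ru (mt ?r (rd ?r))"
   using rc_ar_hom[OF b co_hom(1)[OF M]] by (simp add: r rc_ru)
  show "rco ?r:rh ru (mt ?r (rd ?r))" by (rule co_hom) simp
 qed (simp add: co_hom)
 show "rj b (re M) = re ?r"
 proof (rule Rep_ar_eq2I)
  show "rj b (re M):rh (mt (rd ?r) ?r) ru"
   using rc_ar_hom[OF b ev_hom(1)[OF M]] by (simp add: r rc_ru)
  show "re ?r:rh (mt (rd ?r) ?r) ru" by (rule ev_hom) simp
 qed (use ev_hom(2)[OF M] ev_hom(2)[OF hm_rc[OF M b]] in auto)
qed

end

section \<open>Invariant elements and forms\<close>

context qt_rep
begin

text \<open>Invariance of the form suffices: \<epsilon> of the second part of h is expanded as h''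
  S(h''') acting on x, coassociativity groups h' with h'', and invariance turns this pair into a
  counit.\<close>

lemma ev_antipode:
 assumes N [simp]: "hm N" and M [simp]: "hm M" and g: "gr M = iv (gr N)" and d: "d:rh (mt N M) ru"
  and h: "h:cA (gr N)" and f [simp]: "f:elts N" and x [simp]: "x:elts M"
 shows "amap d (mp N M (act N h f) x) = amap d (mp N M f (act M (S (gr N) h) x))"
proof -
 let ?a = "gr N" let ?b = "iv ?a" let ?D = "%a b. De a b"
 let ?d = "%f x. amap d (mp N M f x)"
 interpret k: module K kk by simp
 have dl: "lo K U kk (%y. amap d (l y))" if "lo K U (ms N M) l" for U :: "('k, 'q) module" and l
  using lo_amap[OF d,of U l] that by simp
 have dc [simp]: "?d f x:cr kk" if "f:elts N" "x:elts M" for f x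
  using Rep_homD(8)[OF d, of "mp N M f x"] that by simp
 have inv: "tsum kk (%p q. ?d (act N p f) (act M q y)) (?D ?a ?b k) = ep k.*[kk]?d f y"
  if "k:cr (A eP)" "y:elts M" for k y
 proof -
  have "tsum kk (%p q. ?d (act N p f) (act M q y)) (?D ?a ?b k) = amap d (tsum (ms N M) (%p q. mp N M (act N p f) (act M q y)) (?D ?a ?b k))"
   using that g Rep_homD(7)[OF d] by (intro Ds_out[symmetric]) auto
  also have "... = amap d (act (mt N M) k (mp N M f y))" using that g by (simp add: act_mt_pure)
  also have "... = ep k.*[kk]?d f y"
   using that Rep_homD(9)[OF d, of _ k "mp N M f y"] g by simp
  finally show ?thesis .
 qed
 have "?d (act N h f) x = tsum kk (%p q. ep q.*[kk]?d (act N p f) x) (?D ?a eP h)"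
  using h by (intro ep_right[symmetric]) (auto intro!: lin dl)
 also have "... = tsum kk (%p q. tsum kk (%q' q''. ?d (act N p f) (act M (q'*[A ?b]S ?a q'') x)) (?D ?b ?a q)) (?D ?a (?b*[P]?a) h)"
 proof -
  have "ep q.*[kk]?d (act N p f) x = tsum kk (%q' q''. ?d (act N p f) (act M (q'*[A ?b]S ?a q'') x)) (?D ?b ?a q)"
   if "p:cA ?a" and q: "q:cr (A eP)" for p q
  proof -
   have l: "lo K (A ?b) kk (%k. ?d (act N p f) (act M k x))" using that g by (auto intro!: lin dl)
   have "tsum kk (%q' q''. ?d (act N p f) (act M (q'*[A ?b]S ?a q'') x)) (?D ?b ?a q)
    = ?d (act N p f) (act M (tsum (A ?b) (%q' q''. q'*[A ?b]S ?a q'') (?D ?b ?a q)) x)"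
    using q by (intro Ds_out[OF _ _ _ _ _ l,symmetric]) auto
   also have "... = ep q.*[kk]?d (act N p f) x"
    using q lo_smult[OF l, of "ep q" "\<one>[A ?b]"] hmD(3)[OF M x] g by (simp add: antipode_right')
   finally show ?thesis by simp
  qed
  then show ?thesis using h by simp (rule Ds_cong, auto)
 qed
 also have "... = tsum kk (%p q. tsum kk (%p' p''. ?d (act N p' f) (act M (p''*[A ?b]S ?a q) x)) (?D ?a ?b p)) (?D (?a*[P]?b) ?a h)"
  using h g by (intro coassoc_sum) (auto intro!: lin dl)
 also have "... = tsum kk (%p q. ep p.*[kk]?d f (act M (S ?a q) x)) (?D eP ?a h)"
  using h g inv by simp (rule Ds_cong, auto simp: act_mult cong: Ds_cong)
 also have "... = ?d f (act M (S ?a h) x)"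
  using h g by (intro ep_left) (auto intro!: lin dl)
 finally show ?thesis .
qed

text \<open>Invariance of the element b(1), stated through a bilinear B: elements of M \<otimes> N
  that are not pure tensors are accessible by lifting bilinear maps.\<close>

lemma invariant_elt:
 assumes M [simp]: "hm M" and N [simp]: "hm N" and g: "gr M*[P]gr N = eP" and b: "b:rh ru (mt M N)"
  and X: "module K X" and B: "bo K (sp M) (sp N) X B" and h: "h:cr (A eP)"
 shows "lft (sp M) (sp N) X (%x f. tsum X (%p q. B (act M p x) (act N q f)) (De (gr M) (gr N) h)) (amap b g1)
  = ep h.*[X]lft (sp M) (sp N) X B (amap b g1)"
proof -
 let ?a = "amap b g1" and ?m = "ms M N"
 have bg [simp]: "amap b g1:cr ?m" using Rep_homD(8)[OF b,of g1] by simp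
 have h': "h:cA (gr M*[P]gr N)" using h g by simp
 let ?D = "De (gr M) (gr N) h"
 have t: "?D:cr (AA M N)" using h' by (simp add: De_closed)
 have l: "lo K ?m X (lft (sp M) (sp N) X B)" using X B by (intro tlift_pr(2)) auto
 have "amap b (act ru h g1) = act (mt M N) h ?a" using h Rep_homD(9)[OF b] by simp
 then have "lft (sp M) (sp N) X B (act (mt M N) h ?a) = ep h.*[X]lft (sp M) (sp N) X B ?a"
  using h lo_smult[OF Rep_homD(7)[OF b], of "ep h" g1] lo_smult[OF l] by simp
 moreover have "act (mt M N) h ?a = lft (sp M) (sp N) ?m (%x y. tsum ?m (%p q. mp M N (act M p x) (act N q y)) ?D) ?a"
  using h' by (simp add: act_mt top_def)
 moreover have "lft (sp M) (sp N) X B (lft (sp M) (sp N) ?m (%x y. tsum ?m (%p q. mp M N (act M p x) (act N q y)) ?D) ?a)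
  = lft (sp M) (sp N) X (%x f. tsum X (%p q. B (act M p x) (act N q f)) ?D) ?a"
 proof (rule HOL.trans, rule tlift_tlift, goal_cases)
  case 9
  show ?case
  proof (rule fun_cong[OF tlift_cong])
   fix x f assume [simp]: "x:elts M" "f:elts N"
   have "lft (sp M) (sp N) X B (tsum ?m (%p q. mp M N (act M p x) (act N q f)) ?D)
    = tsum X (%p q. lft (sp M) (sp N) X B (mp M N (act M p x) (act N q f))) ?D"
    using h' l X by (intro Ds_out) auto
   also have "... = tsum X (%p q. B (act M p x) (act N q f)) ?D"
    using h' X B by (intro Ds_cong) (auto simp: tlift_pr)
   finally show "lft (sp M) (sp N) X B (tsum ?m (%p q. mp M N (act M p x) (act N q f)) ?D) = ..." .
  qed
 qed (use X B top_bilinear[OF M N t] in auto)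
 ultimately show ?thesis by simp
qed

text \<open>The dual of \<open>ev_antipode\<close>: an operator moves from the second factor of an
  invariant element to the first at the price of an antipode. The lift \<open>?l\<close> plays the
  part of the invariant element.\<close>

lemma coev_antipode:
 assumes M [simp]: "hm M" and N [simp]: "hm N" and g: "gr M = iv (gr N)" and b: "b:rh ru (mt M N)"
  and X: "module K X" and B: "bo K (sp M) (sp N) X B" and h: "h:cA (gr N)"
 shows "lft (sp M) (sp N) X (%x f. B x (act N h f)) (amap b g1)
  = lft (sp M) (sp N) X (%x f. B (act M (S (gr N) h) x) f) (amap b g1)"
proof -
 let ?a = "gr N" let ?b = "iv ?a" let ?D = "%a b. De a b" let ?l = "%B. lft (sp M) (sp N) X B (amap b g1)"
 have bg [simp]: "amap b g1:cr (ms M N)" using Rep_homD(8)[OF b,of g1] by simp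
 interpret X: module K X by fact
 note B' = boD[OF B]
 have Bl: "lo K U X (%u. B (l u) f)" if "lo K U (sp M) l" "f:elts N" for U :: "('k, 'q) module" and l f
  using lo_compose[OF that(1) B'(2)[OF that(2)]] .
 have Br: "lo K U X (%u. B x (l u))" if "lo K U (sp N) l" "x:elts M" for U :: "('k, 'q) module" and l x
  using lo_compose[OF that(1) B'(1)[OF that(2)]] .
 have Bc [simp]: "x:elts M ==> f:elts N ==> B x f:cr X" for x f using bo_closed[OF B] .
 have bil: "bo K (sp M) (sp N) X (%x f. B (act M p x) (act N q f))" if "p:cA ?b" "q:cA ?a" for p q
  using that g by (intro boI Bl Br) (auto intro!: lin)
 have ll: "lo K U X (%u. ?l (%x f. B (act M (p u) x) (act N (q u) f)))"
  if "!!x f. x:elts M ==> f:elts N ==> lo K U X (%u. B (act M (p u) x) (act N (q u) f))"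
   "module K U" "!!u. u:cr U ==> p u:cA ?b" "!!u. u:cr U ==> q u:cA ?a"
  for U :: "('k, 'q) module" and p q
  using that bil by (intro linear_tlift_param X) auto
 note [simp] = ce_props(1)
 have "?l (%x f. B (act M (S ?a h) x) f) = ?l (%x f. B (act M (S ?a h) x) (act N \<one>[A ?a] f))"
  by (rule fun_cong[OF tlift_cong]) simp
 also have "... = tsum X (%p q. ep q.*[X]?l (%x f. B (act M (S ?a p) x) (act N \<one>[A ?a] f))) (?D ?a eP h)"
  using h g by (intro ep_right[symmetric] ll X Bl) (auto intro!: lin)
 also have "... = tsum X (%p q. tsum X (%q' q''. ?l (%x f. B (act M (S ?a p*[A ?b]q') x) (act N q'' f))) (?D ?b ?a q)) (?D ?a (?b*[P]?a) h)"
 proof -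
  have "ep q.*[X]?l (%x f. B (act M (S ?a p) x) (act N \<one>[A ?a] f)) = tsum X (%q' q''. ?l (%x f. B (act M (S ?a p*[A ?b]q') x) (act N q'' f))) (?D ?b ?a q)"
   if p: "p:cA ?a" and q: "q:cr (A eP)" for p q
  proof -
   have t: "?D ?b ?a q:cr (tensor K (A ?b) (A ?a))" using q by (simp add: De_closed)
   have "ep q.*[X]?l (%x f. B (act M (S ?a p) x) (act N \<one>[A ?a] f))
    = ?l (%x f. tsum X (%q' q''. B (act M (S ?a p) (act M q' x)) (act N \<one>[A ?a] (act N q'' f))) (?D ?b ?a q))"
    using p q g by (subst invariant_elt[OF M N _ b X bil[of "S ?a p" "\<one>[A ?a]"] q, symmetric]) auto
   also have "... = ?l (%x f. tsum X (%q' q''. B (act M (S ?a p*[A ?b]q') x) (act N q'' f)) (?D ?b ?a q))"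
    using p q g by (intro fun_cong[OF tlift_cong] Ds_cong) (auto simp: act_mult)
   also have "... = tsum X (%q' q''. ?l (%x f. B (act M (S ?a p*[A ?b]q') x) (act N q'' f))) (?D ?b ?a q)"
    using p by (intro tlift_tsum[OF _ _ X A_module A_module t] bil) auto
   finally show ?thesis .
  qed
  then show ?thesis using h by simp (rule Ds_cong, auto)
 qed
 also have "... = tsum X (%p q. tsum X (%p' p''. ?l (%x f. B (act M (S ?a p'*[A ?b]p'') x) (act N q f))) (?D ?a ?b p)) (?D (?a*[P]?b) ?a h)"
  using h g by (intro coassoc_sum ll X Bl Br) (auto intro!: lin)
 also have "... = tsum X (%p q. ep p.*[X]?l (%x f. B (act M \<one>[A ?b] x) (act N q f))) (?D eP ?a h)"
 proof -
  have "tsum X (%p' p''. ?l (%x f. B (act M (S ?a p'*[A ?b]p'') x) (act N q f))) (?D ?a ?b p) = ep p.*[X]?l (%x f. B (act M \<one>[A ?b] x) (act N q f))"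
   if p: "p:cr (A eP)" and q: "q:cA ?a" for p q
  proof -
   have l: "lo K (A ?b) X (%k. ?l (%x f. B (act M k x) (act N q f)))" using q g by (intro ll Bl) (auto intro!: lin)
   have "tsum X (%p' p''. ?l (%x f. B (act M (S ?a p'*[A ?b]p'') x) (act N q f))) (?D ?a ?b p)
    = ?l (%x f. B (act M (tsum (A ?b) (%p' p''. S ?a p'*[A ?b]p'') (?D ?a ?b p)) x) (act N q f))"
    using p by (intro Ds_out[OF _ _ _ _ _ l,symmetric] X) auto
   also have "... = ep p.*[X]?l (%x f. B (act M \<one>[A ?b] x) (act N q f))"
    using p lo_smult[OF l, of "ep p" "\<one>[A ?b]"] by (simp add: antipode_left')
   finally show ?thesis .
  qed
  then show ?thesis using h by simp (rule Ds_cong, auto)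
 qed
 also have "... = ?l (%x f. B (act M \<one>[A ?b] x) (act N h f))"
  using h g by (intro ep_left ll X Br) (auto intro!: lin)
 also have "... = ?l (%x f. B x (act N h f))"
  using g hmD(3)[OF M] by (intro fun_cong[OF tlift_cong]) simp
 finally show ?thesis by simp
qed

section \<open>Twists and double braidings in terms of the R-matrix\<close>

abbreviation "twisting == braided_T_category.twisting RC"
abbreviation "tt == braided_T_category.twist_tensor RC"

lemmas bRC = braided_T_category_Rep

lemma tw_iff:
 "twisting M t \<longleftrightarrow> t:rh M (rc (gr M) M) & is_iso RC t"
 unfolding braided_T_category.twisting_def[OF bRC] using RC.hom_set_Ob[of t M "rc (gr M) M"] by (auto simp: hom_set_def Rep_Ar_iff)

lemma twD:
 assumes t: "twisting M t"
 shows "hm M" "t:rh M (rc (gr M) M)" "is_iso RC t"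
  "lo K (sp M) (sp M) (amap t)" "x:elts M ==> amap t x:elts M"
  "h:cA (gr M) ==> x:elts M ==> amap t (act M h x) = act M (ph (iv (gr M)) (gr M) h) (amap t x)"
proof -
 show t': "t:rh M (rc (gr M) M)" and "is_iso RC t" using t by (simp_all add: tw_iff)
 note r = Rep_homD[OF t']
 show hm: "hm M" by (rule r(1))
 show "lo K (sp M) (sp M) (amap t)" "x:elts M ==> amap t x:elts M" using r(7,8) by simp_all
 then show "h:cA (gr M) ==> x:elts M ==> amap t (act M h x) = act M (ph (iv (gr M)) (gr M) h) (amap t x)"
  using r(9)[of _ h x] hm by simp
qed

lemma twisting_bij:
 assumes t: "twisting M t"
 shows "bij_betw (amap t) (elts M) (elts M)"
proof -
 note r = Rep_iso_amap[OF twD(2)[OF t] RC.inv_inv[OF twD(3)[OF t]]]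
 show ?thesis
  by (rule bij_betwI[where g = "amap (rv t)"]) (use r Rep_homD(8)[OF r(1)] twD(5)[OF t] in auto)
qed

text \<open>All four legs of the two R-matrices are made explicit; in each factor the leg of the
  second braiding stands to the left of that of the first.\<close>

lemma db_eval:
 assumes M [simp]: "hm M" and N [simp]: "hm N"
 defines "c == rb (rc (gr M) N) M oR rb M N" and "g == cj (gr M) (gr N)"
 shows "c:rh (mt M N) (mt (rc g M) (rc (gr M) N))"
  "x:elts M ==> y:elts N ==> amap c (mp M N x y) = tsum (ms M N) (%p q. tsum (ms M N) (%p' q'.
    mp M N (act M (q'*[A (gr M)]p) x) (act N (ph (iv (gr M)) g p'*[A (gr N)]q) y)) (R g (gr M))) (R (gr M) (gr N))"
proof -
 let ?R = "R (gr M) (gr N)"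
 have [simp]: "g:cr P" "cj (iv (gr M)) g = gr N" by (simp_all add: g_def)
 note b1 = rb_hom[OF M N] note b2 = rb_hom[OF hm_rc[OF N hmD(1)[OF M]] M]
 note b2' = b2[unfolded rc_simps, folded g_def]
 note c = Rep_comp[OF b1(1) b2'(1)]
 show "c:rh (mt M N) (mt (rc g M) (rc (gr M) N))" unfolding c_def by (rule c(1))
 assume x [simp]: "x:elts M" and y [simp]: "y:elts N"
 have "amap c (mp M N x y) = amap (rb (rc (gr M) N) M) (tsum (ms N M) (%p q. mp N M (act N q y) (act M p x)) ?R)"
  unfolding c_def using c(2) b1(2) by simp
 also have "... = tsum (ms M N) (%p q. amap (rb (rc (gr M) N) M) (mp N M (act N q y) (act M p x))) ?R"
  using amap_Rsum[OF b2'(1)] by simp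
 also have "... = tsum (ms M N) (%p q. tsum (ms M N) (%p' q'.
    mp M N (act M (q'*[A (gr M)]p) x) (act N (ph (iv (gr M)) g p'*[A (gr N)]q) y)) (R g (gr M))) ?R"
  using b2'(2) by (intro Rs_cong) (auto simp: act_mult[OF M HOL.refl] act_mult[OF N HOL.refl] g_def[symmetric] intro!: Rs_cong)
 finally show "amap c (mp M N x y) = ..." .
qed

lemma tt_eval:
 assumes t: "twisting M t" and s: "twisting N s"
 defines "g == cj (gr M) (gr N)"
 shows "twisting (mt M N) (tt M t N s)"
  "x:elts M ==> y:elts N ==> amap (tt M t N s) (mp M N x y) = tsum (ms M N) (%p q. tsum (ms M N) (%p' q'.
    mp M N (amap t (act M (q'*[A (gr M)]p) x)) (amap s (act N (ph (iv (gr M)) g p'*[A (gr N)]q) y))) (R g (gr M))) (R (gr M) (gr N))"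
proof -
 note T = twD[OF t] note S = twD[OF s] note [simp] = T(1,5) S(1,5)
 let ?m = "ms M N"
 show "twisting (mt M N) (tt M t N s)"
  using braided_T_category.twisting_tensor[OF bRC t s] by simp
 have [simp]: "g:cr P" "cj (iv (gr M)) g = gr N" by (simp_all add: g_def)
 assume x [simp]: "x:elts M" and y [simp]: "y:elts N"
 note c = db_eval[OF T(1) S(1),folded g_def]
 define t1 where "t1 = rj g t"
 define s1 where "s1 = rj (gr M) s"
 have t1: "t1:rh (rc g M) (rc g (rc (gr M) M))" "amap t1 = amap t"
  and s1: "s1:rh (rc (gr M) N) (rc (gr M) (rc (gr N) N))" "amap s1 = amap s"
  using rc_ar_hom[OF _ T(2),of g] rc_ar_hom[OF _ S(2), of "gr M"] by (simp_all add: t1_def s1_def)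
 note f = Rep_tens[OF t1(1) s1(1)]
 note e = Rep_comp[OF c(1) f(1)]
 have fl: "lo K ?m ?m (amap (rt t1 s1))" using Rep_homD(7)[OF f(1)] by simp
 have "amap (tt M t N s) (mp M N x y) = amap (rt t1 s1) (amap (rb (rc (gr M) N) M oR rb M N) (mp M N x y))"
  using e(2)[of "mp M N x y"]
  by (simp add: braided_T_category.twist_tensor_def[OF bRC] braided_T_category.double_braid_def[OF bRC] g_def s1_def t1_def del: Rep_simps(5,14))
 also have "... = tsum ?m (%p q. tsum ?m (%p' q'. amap (rt t1 s1)
    (mp M N (act M (q'*[A (gr M)]p) x) (act N (ph (iv (gr M)) g p'*[A (gr N)]q) y))) (R g (gr M))) (R (gr M) (gr N))"
  unfolding c(2)[OF x y] by (simp add: Rs_out[OF _ _ _ _ fl] cong: Rs_cong)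
 also have "... = tsum ?m (%p q. tsum ?m (%p' q'.
    mp M N (amap t (act M (q'*[A (gr M)]p) x)) (amap s (act N (ph (iv (gr M)) g p'*[A (gr N)]q) y))) (R g (gr M))) (R (gr M) (gr N))"
  using f(2) by (simp add: t1(2) s1(2) cong: Rs_cong)
 finally show "amap (tt M t N s) (mp M N x y) = ..." .
qed

text \<open>The legs acting on N are carried to M by \<open>ev_antipode\<close>, where the four legs
  multiply to the summand \<open>?k\<close>; its sum is \<open>w\<close> by \<open>w_sum2\<close>.
  As d is arbitrary, the result serves the evaluation of M as well as the pairing of two tensor
  products.\<close>

lemma ev_twist:
 assumes M: "twisting M t" and N: "twisting N s" and g: "gr N = iv (gr M)" and d: "d:rh (mt N M) ru"
  and f: "f:elts N" and x: "x:elts M"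
 shows "amap d (amap (tt N s M t) (mp N M f x)) = amap d (mp N M (amap s f) (act M (w (gr M)) (amap t x)))"
proof -
 let ?m = "gr M" let ?b = "iv ?m"
 note t = twD[OF M] and s = twD[OF N]
 note [simp] = t(1,5) s(1,5) f x
 have m [simp]: "?m:cr P" by simp
 have dl: "lo K (ms N M) kk (amap d)" using Rep_homD(7)[OF d] by simp
 let ?L = "%k. amap d (mp N M (amap s f) (act M k (amap t x)))"
 have L: "lo K (A ?m) kk ?L" by (rule lo_compose[OF _ dl]) (auto intro!: lin)
 let ?k = "%p q p' q'. S ?b (ph ?m ?b p)*[A ?m]((S ?b (ph ?m ?b q')*[A ?m]p')*[A ?m]ph ?b ?m q)"
 have "amap d (amap (tt N s M t) (mp N M f x)) = tsum kk (%p q. tsum kk (%p' q'.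
    amap d (mp N M (amap s (act N (q'*[A ?b]p) f)) (amap t (act M (ph ?m ?m p'*[A ?m]q) x)))) (R ?m ?b)) (R ?b ?m)"
  unfolding tt_eval(2)[OF N M f x] g conj_elt_simps(2)[OF m]
  using g by (simp add: Rs_out[OF _ _ _ _ dl] cong: Rs_cong)
 also have "... = tsum kk (%p q. tsum kk (%p' q'. ?L (?k p q p' q')) (R ?m ?b)) (R ?b ?m)"
 proof (intro Rs_cong)
  fix p q p' q' assume [simp]: "p:cA ?b" "q:cA ?m" "p':cA ?m" "q':cA ?b"
  have "amap d (mp N M (amap s (act N (q'*[A ?b]p) f)) (amap t (act M (ph ?m ?m p'*[A ?m]q) x)))
   = amap d (mp N M (act N (ph ?m ?b (q'*[A ?b]p)) (amap s f)) (act M (p'*[A ?m]ph ?b ?m q) (amap t x)))"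
   using s(6)[of "q'*[A ?b]p" f] t(6)[of "ph ?m ?m p'*[A ?m]q" x] g by (simp add: ph_mult)
  also have "... = ?L (?k p q p' q')"
   using ev_antipode[OF s(1) t(1) _ d, of "ph ?m ?b (q'*[A ?b]p)" "amap s f" "act M (p'*[A ?m]ph ?b ?m q) (amap t x)"] g
   by (simp add: ph_mult S_mult A_assoc flip: act_mult[OF t(1)])
  finally show "amap d (mp N M (amap s (act N (q'*[A ?b]p) f)) (amap t (act M (ph ?m ?m p'*[A ?m]q) x))) = ?L (?k p q p' q')" .
 qed simp_all
 also have "... = ?L (tsum (A ?m) (%p q. tsum (A ?m) (%p' q'. ?k p q p' q') (R ?m ?b)) (R ?b ?m))"
  by (simp add: Rs_out[OF _ _ _ _ L] cong: Rs_cong)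
 also have "tsum (A ?m) (%p q. tsum (A ?m) (%p' q'. ?k p q p' q') (R ?m ?b)) (R ?b ?m) = w ?m"
  unfolding w_sum2[OF m,symmetric] u_eq[OF m HOL.refl]
  by (simp add: Rs_multL[symmetric] Rs_multR[symmetric] cong: Rs_cong)
 finally show ?thesis .
qed

text \<open>For an invariant element, \<open>coev_antipode\<close> moves the legs on N to M, and
  there the summand \<open>?k\<close> adds up to \<open>w\<close> by \<open>w_sum\<close>.\<close>

lemma coev_twist:
 assumes M: "twisting M t" and N: "twisting N s" and g: "gr N = iv (gr M)" and b: "b:rh ru (mt M N)"
 shows "amap (tt M t N s) (amap b g1) = lft (sp M) (sp N) (ms M N) (%x f. mp M N (amap t (act M (w (gr M)) x)) (amap s f)) (amap b g1)"
proof -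
 let ?m = "gr M" let ?b = "iv ?m"
 note t = twD[OF M] and s = twD[OF N]
 note [simp] = t(1,5) s(1,5)
 let ?R = "R ?b ?m" and ?a = "R ?m ?b"
 have m [simp]: "?m:cr P" by simp
 have bg [simp]: "amap b g1:cr (ms M N)" using Rep_homD(8)[OF b,of g1] by simp
 let ?l = "%B. lft (sp M) (sp N) (ms M N) B (amap b g1)" and ?T = "ms M N"
 let ?B = "%x f. mp M N (amap t x) (amap s f)"
 have B: "bo K (sp M) (sp N) ?T ?B" using t(4) s(4) by (auto intro!: lin)
 let ?L = "%k. ?l (%x f. ?B (act M k x) f)"
 have tl: "lo K U (sp M) (%u. amap t (p u))" if "lo K U (sp M) p" for U :: "('k, 'q) module" and p
  using lo_compose[OF that t(4)] .
 have sl: "lo K U (sp N) (%u. amap s (p u))" if "lo K U (sp N) p" for U :: "('k, 'q) module" and p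
  using lo_compose[OF that s(4)] .
 have L: "lo K (A ?m) ?T ?L" by (intro linear_tlift_param) (auto intro!: lin tl sl)
 let ?k = "%i j i' j'. j'*[A ?m]((i*[A ?m]S ?b j)*[A ?m]S ?b (ph ?b ?b i'))"
 have Rc: "R x y:cr (tensor K (A x) (A y))" if "x:cr P" "y:cr P" for x y using that by (rule R_closed)
 have "amap (tt M t N s) (amap b g1) = ?l (%x f. amap (tt M t N s) (mp M N x f))"
  using twD(4)[OF tt_eval(1)[OF M N]] by (intro as_tlift) auto
 also have "... = ?l (%x f. tsum ?T (%i j. tsum ?T (%i' j'.
    ?B (act M (j'*[A ?m]i) x) (act N (ph ?b ?b i'*[A ?b]j) f)) ?R) ?a)"
  using tt_eval(2)[OF M N] g by (intro fun_cong[OF tlift_cong]) simp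
 also have "... = tsum ?T (%i j. ?l (%x f. tsum ?T (%i' j'.
    ?B (act M (j'*[A ?m]i) x) (act N (ph ?b ?b i'*[A ?b]j) f)) ?R)) ?a"
  using g by (intro tlift_tsum[OF _ _ _ A_module A_module Rc]) (auto intro!: lin tl sl)
 also have "... = tsum ?T (%i j. tsum ?T (%i' j'. ?l (%x f.
    ?B (act M (j'*[A ?m]i) x) (act N (ph ?b ?b i'*[A ?b]j) f))) ?R) ?a"
  using g by (intro Rs_cong tlift_tsum[OF _ _ _ A_module A_module Rc]) (auto intro!: lin tl sl)
 also have "... = tsum ?T (%i j. tsum ?T (%i' j'. ?L (?k i j i' j')) ?R) ?a"
 proof (intro Rs_cong)
  fix i j i' j' assume [simp]: "i':cA ?b" "j':cA ?m" "i:cA ?m" "j:cA ?b"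
  let ?h = "ph ?b ?b i'*[A ?b]j"
  have B1: "bo K (sp M) (sp N) ?T (%x. ?B (act M (j'*[A ?m]i) x))" by (auto intro!: lin tl sl)
  have "?l (%x f. ?B (act M (j'*[A ?m]i) x) (act N ?h f)) = ?l (%x f. ?B (act M (j'*[A ?m]i) (act M (S ?b ?h) x)) f)"
   using coev_antipode[OF t(1) s(1) _ b _ B1,of ?h] g by simp
  also have "... = ?L (?k i j i' j')"
   by (intro fun_cong[OF tlift_cong]) (simp add: S_mult A_assoc flip: act_mult[OF t(1)])
  finally show "?l (%x f. ?B (act M (j'*[A ?m]i) x) (act N ?h f)) = ?L (?k i j i' j')" .
 qed simp_all
 also have "... = tsum ?T (%i' j'. tsum ?T (%i j. ?L (?k i j i' j')) ?a) ?R"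
  using lo_closed[OF L] by (intro Rs_swap) auto
 also have "... = ?L (tsum (A ?m) (%i' j'. tsum (A ?m) (%i j. ?k i j i' j') ?a) ?R)"
  by (simp add: Rs_out[OF _ _ _ _ L] cong: Rs_cong)
 also have "tsum (A ?m) (%i' j'. tsum (A ?m) (%i j. ?k i j i' j') ?a) ?R = w ?m"
  unfolding w_sum[OF m,symmetric] v_eq[OF m,symmetric]
  by (simp add: Rs_multL[symmetric] Rs_multR[symmetric] cong: Rs_cong)
 finally show ?thesis .
qed

lemma twisting_square:
 assumes "twisting M t"
 shows "rj (gr M) t oR t:rh M (rc (gr M) (rc (gr M) M))"
  "is_iso RC (rj (gr M) t oR t)"
  "x:elts M ==> amap (rj (gr M) t oR t) x = amap t (amap t x)"
proof -
 note t = twD[OF assms]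
 interpret RC: T_category P RC by (rule T_category_Rep)
 have m: "gr M:cr P" using t(1) by simp
 note c = rc_ar_hom[OF m t(2)]
 show "rj (gr M) t oR t:rh M (rc (gr M) (rc (gr M) M))"
  "x:elts M ==> amap (rj (gr M) t oR t) x = amap t (amap t x)"
  using Rep_comp[OF t(2) c] by simp_all
 show "is_iso RC (rj (gr M) t oR t)"
  using t(3) RC.is_iso_conj[OF m t(3)] Rep_homD(3,4)[OF t(2)] by (intro RC.is_iso_comp) auto
qed

text \<open>As t is bijective, the condition on the inverse square can be stated without inverses: w
  t t = 1.\<close>

lemma is_rib_iff:
 "is_rib P K VV H (M, t) \<longleftrightarrow> twisting M t & (\<forall>x\<in>elts M. act M (w (gr M)) (amap t (amap t x)) = x)"
proof (cases "twisting M t")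
 case True
 note t = twD[OF True]
 note h = twisting_square(1,3)[OF True] and i = twisting_square(2)[OF True]
 note r = Rep_iso_amap[OF h(1) RC.inv_inv[OF i]]
 have "(\<forall>x\<in>elts M. amap (rv (rj (gr M) t oR t)) x = act M (w (gr M)) x)
   \<longleftrightarrow> (\<forall>x\<in>elts M. act M (w (gr M)) (amap t (amap t x)) = x)" (is "?l \<longleftrightarrow> ?r")
 proof
  assume ?l
  then show ?r using r(2) h(2) t(5) by metis
 next
  assume ?r
  show ?l
  proof
   fix y assume y: "y:elts M"
   then obtain z where z: "z:elts M" "amap t z = y" using twisting_bij[OF True] by (metis bij_betw_imp_surj_on imageE)
   obtain x where x: "x:elts M" "amap t x = z" using twisting_bij[OF True] z by (metis bij_betw_imp_surj_on imageE)
   show "amap (rv (rj (gr M) t oR t)) y = act M (w (gr M)) y"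
    using r(2)[OF x(1)] h(2)[OF x(1)] x z \<open>?r\<close> by metis
  qed
 qed
 then show ?thesis
  using True t(1-3) unfolding is_rib_def Let_def fst_conv snd_conv by (simp del: Rep_simps(5,14))
next
 case False
 then show ?thesis unfolding is_rib_def Let_def fst_conv snd_conv tw_iff by auto
qed

text \<open>\<omega> contracts b with d through two R-matrices. Moving the legs by
  \<open>ev_antipode\<close> separates an operator on M from the bare contraction, which is the
  identity by the first duality relation; the operator is \<open>w\<close> by
  \<open>w_sum\<close>.\<close>

lemma omega_eval:
 assumes M [simp]: "hm M" and N [simp]: "hm N"
  and b: "b:rh ru (mt M N)" and d: "d:rh (mt N M) ru"
  and zz: "rr M oR rt (ri M) d oR ra M N M oR rt b (ri M) oR rv (rl M) = ri M"
 shows "omega RC M N b d:rh (rc (gr M) (rc (gr M) M)) M"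
  "x:elts M ==> amap (omega RC M N b d) x = act M (w (gr M)) x"
proof -
 let ?m = "gr M" let ?b = "iv ?m"
 let ?R = "R ?b ?m" and ?a = "amap b g1" and ?c = "R ?m ?b" and ?r = "rb M N" and ?d = "ms M M"
 define M1 where "M1 = rc ?m M"
 define M2 where "M2 = rc ?m M1"
 define N1 where "N1 = rc ?m N"
 define N2 where "N2 = rc ?m N1"
 define b1 where "b1 = rj ?m b"
 define d2 where "d2 = rj ?m (rj ?m d)"
 have m [simp]: "?m:cr P" by simp
 \<comment> \<open>The degree of N is no part of the hypotheses; it follows from the existence of
   the arrow b from the unit object.\<close>
 have gn: "gr N = ?b"
 proof -
  have "?m*[P]gr N = eP" using Rep_homD(6)[OF b] by simp
  then show ?thesis using inv_equality[of "gr N" ?m] inv_comm[of ?m "gr N"] by simp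
 qed
 have [simp]: "hm M1" "hm M2" "hm N1" "hm N2" "sp M1 = sp M" "sp M2 = sp M" "sp N1 = sp N" "sp N2 = sp N"
   "gr M1 = ?m" "gr M2 = ?m" "gr N1 = ?b" by (simp_all add: M1_def M2_def N1_def N2_def gn)
 have bg [simp]: "amap b g1:cr (ms M N)" using Rep_homD(8)[OF b,of g1] by simp
 have b1: "b1:rh ru (mt M1 N1)" "amap b1 = amap b"
  using rc_ar_hom[OF m b] by (simp_all add: b1_def M1_def N1_def rc_mt rc_ru)
 have d2: "d2:rh (mt N2 M2) ru" "amap d2 = amap d"
  using rc_ar_hom[OF m rc_ar_hom[OF m d]] by (simp_all add: d2_def M1_def N1_def M2_def N2_def rc_mt rc_ru)
 have c: "rb M1 N1:rh (mt M1 N1) (mt N2 M1)" using rb_hom(1)[of M1 N1] by (simp add: N2_def)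
 \<comment> \<open>Conjugation leaves underlying maps unchanged, so the braiding of the conjugates
   is evaluated as that of M and N.\<close>
 have cm: "amap (rb M1 N1) = amap ?r"
  using rb_conj[OF M N m] by (simp add: M1_def N1_def rep_braid_def Let_def)
 have k: "inverse_arrows RC (rb M2 M) (Arr (mt M1 M2) (mt M2 M) (restrict (%z. top M2 M (Ri ?m ?m) (flip M M2 z)) (cr (ms M M2))))"
  using rb_iso[of M2 M] by (simp add: M1_def)
 have kh: "rb M2 M:rh (mt M2 M) (mt M1 M2)" using rb_hom(1)[of M2 M] by (simp add: M1_def)
 have ih: "rv (rb M2 M):rh (mt M1 M2) (mt M2 M)"
  using Rep_iso_amap(1)[OF kh RC.inv_inv] k by (auto simp: is_iso_def)
 have ie: "amap (rv (rb M2 M)) (mp M M p x) = tsum ?d (%\<xi> \<zeta>. mp M M (act M (S ?b (ph ?b ?b \<xi>)) x) (act M \<zeta> p)) ?R"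
  if [simp]: "p:elts M" "x:elts M" for p x
 proof -
  have bil: "bo K (A ?m) (A ?m) ?d (%\<xi> \<zeta>. mp M2 M (act M2 \<xi> x) (act M \<zeta> p))"
   using linear_act_left[of M2 ?m "A ?m" "%\<xi>. \<xi>" x] hmD(4)[of M2 ?m _ x] by (auto intro!: lin)
  have "amap (rv (rb M2 M)) (mp M M p x) = top M2 M (Ri ?m ?m) (mp M2 M x p)"
   using RC.inv_ar_eq[OF k] flip_props(2)[of M M2 p x] by simp
  also have "... = tsum ?d (%\<xi> \<zeta>. mp M2 M (act M2 \<xi> x) (act M \<zeta> p)) (Ri ?m ?m)"
   using top_pure[of M2 M "Ri ?m ?m" x p] by (simp add: Ri_closed)
  also have "... = tsum ?d (%\<xi> \<zeta>. mp M2 M (act M2 (S ?b (ph ?m ?b \<xi>)) x) (act M \<zeta> p)) ?R"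
   by (rule Rmat_inv_sum[OF m m _ bil]) simp
  also have "... = tsum ?d (%\<xi> \<zeta>. mp M M (act M (S ?b (ph ?b ?b \<xi>)) x) (act M \<zeta> p)) ?R"
   by (intro Rs_cong) (auto simp: M2_def M1_def S_crossing)
  finally show ?thesis .
 qed
 note i = Rep_id[OF M] note i2 = Rep_id[of M2] note j2 = Rep_id[of N2]
 note a0 = Rep_comp[OF b1(1) c]
 note a1 = inv_rl[of M2] note a2 = Rep_tens[OF a0(1) i2] note a3 = ra_hom[of N2 M1 M2]
 note a4 = Rep_tens[OF j2 ih] note a5 = inv_ra[of N2 M2 M] note a6 = Rep_tens[OF d2(1) i] note a7 = rl_hom[OF M]
 note c1 = Rep_comp[OF a1(1) a2(1)] note c2 = Rep_comp[OF c1(1) a3(1)] note c3 = Rep_comp[OF c2(1) a4(1)]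
 note c4 = Rep_comp[OF c3(1) a5(1)] note c5 = Rep_comp[OF c4(1) a6(1)] note c6 = Rep_comp[OF c5(1) a7(1)]
 have e: "omega RC M N b d = rl M oR rt d2 (ri M) oR rv (ra N2 M2 M) oR rt (ri N2) (rv (rb M2 M))
   oR ra N2 M1 M2 oR rt (rb M1 N1 oR b1) (ri M2) oR rv (rl M2)"
  by (simp add: omega_def Let_def M1_def M2_def N1_def N2_def d2_def b1_def del: Rep_simps(4,5,14))
 show "omega RC M N b d:rh (rc ?m (rc ?m M)) M"
  unfolding e M1_def[symmetric] M2_def[symmetric] using c6(1) by simp
 assume x [simp]: "x:elts M"
 define G where "G = (%z. amap (rl M) (amap (rt d2 (ri M)) (amap (rv (ra N2 M2 M)) (amap (rt (ri N2) (rv (rb M2 M))) (amap (ra N2 M1 M2) (mp (mt N2 M1) M2 z x))))))"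
 have G: "lo K (ms N M) (sp M) G"
  unfolding G_def
  by (intro lo_amap[OF a7(1)] lo_amap[OF a6(1)] lo_amap[OF a5(1)] lo_amap[OF a4(1)] lo_amap[OF a3(1)]) (auto intro!: lin)
 have bl: "lo K (ms M N) (ms N M) (amap ?r)" using Rep_homD(7)[OF rb_hom(1)[OF M N]] by simp
 have [simp]: "uc (amap d (mp N M f y)):cr K" if "f:elts N" "y:elts M" for f y
  using Rep_homD(8)[OF d, of "mp N M f y"] that by (simp add: uc_props)
 interpret SM: module K "sp M" by simp
 have Gp: "G (mp N M f p) = tsum (sp M) (%\<xi> \<zeta>. uc (amap d (mp N M f (act M (S ?b (ph ?b ?b \<xi>)) x))).*[sp M]act M \<zeta> p) ?R"
  if [simp]: "f:elts N" "p:elts M" for f p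
 proof -
  let ?K = "%z. amap (rl M) (amap (rt d2 (ri M)) (amap (rv (ra N2 M2 M)) (mp N2 (mt M2 M) f z)))"
  have Kl: "lo K ?d (sp M) ?K"
   by (intro lo_amap[OF a7(1)] lo_amap[OF a6(1)] lo_amap[OF a5(1)]) (auto intro!: lin)
  have "G (mp N M f p) = ?K (amap (rv (rb M2 M)) (mp M M p x))"
   using a3(2)[of f p x] a4(2)[of f "mp M1 M2 p x"] by (simp add: G_def)
  also have "... = tsum (sp M) (%\<xi> \<zeta>. ?K (mp M M (act M (S ?b (ph ?b ?b \<xi>)) x) (act M \<zeta> p))) ?R"
   unfolding ie[OF that(2) x] by (intro Rs_out[OF _ _ _ _ Kl]) auto
  also have "... = tsum (sp M) (%\<xi> \<zeta>. uc (amap d (mp N M f (act M (S ?b (ph ?b ?b \<xi>)) x))).*[sp M]act M \<zeta> p) ?R"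
   using a5(2) a6(2) a7(2) Rep_homD(8)[OF d] d2(2) by (intro Rs_cong) auto
  finally show ?thesis .
 qed
 have dl: "lo K U (sp M) (%u. uc (amap d (l u)).*[sp M]p)" if "lo K U (ms N M) l" "p:elts M" for U :: "('k, 'q) module" and l p
  using lo_amap[OF d,of U l] that by (intro linear_uc) auto
 \<comment> \<open>The first duality relation with an operator k carried along; it removes b and d
   once the operators are separated.\<close>
 have zig: "lft (sp M) (sp N) (sp M) (%p f. uc (amap d (mp N M f y)).*[sp M]act M k p) ?a = act M k y"
  if k: "k:cA ?m" and y [simp]: "y:elts M" for k y
 proof -
  let ?B = "%p f. uc (amap d (mp N M f y)).*[sp M]p"
  have bil: "bo K (sp M) (sp N) (sp M) ?B"
   by (auto intro!: lin dl)
  have "act M k y = act M k (lft (sp M) (sp N) (sp M) ?B ?a)"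
   using zigzag_eval(2)[OF M N b d y] unfolding zz amap_Id[OF y] by simp
  also have "... = lft (sp M) (sp N) (sp M) (%p f. act M k (?B p f)) ?a"
   using linear_act[OF M k] bil by (intro tlift_out) auto
  also have "... = lft (sp M) (sp N) (sp M) (%p f. uc (amap d (mp N M f y)).*[sp M]act M k p) ?a"
   using lo_smult[OF linear_act[OF M k]] by (intro fun_cong[OF tlift_cong]) simp
  finally show ?thesis by simp
 qed
 have Rc: "R x y:cr (tensor K (A x) (A y))" if "x:cr P" "y:cr P" for x y using that by (rule R_closed)
 let ?C = "%\<xi> \<zeta> \<xi>' \<zeta>' p f. uc (amap d (mp N M f (act M (S ?b \<zeta>*[A ?m]S ?b (ph ?b ?b \<xi>')) x))).*[sp M]act M (\<zeta>'*[A ?m]\<xi>) p"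
 let ?k = "%\<xi> \<zeta> \<xi>' \<zeta>'. \<zeta>'*[A ?m]((\<xi>*[A ?m]S ?b \<zeta>)*[A ?m]S ?b (ph ?b ?b \<xi>'))"
 have "amap (omega RC M N b d) x = G (amap ?r ?a)"
  unfolding e using c6(2)[of x] c5(2)[of x] c4(2)[of x] c3(2)[of x] c2(2)[of x] c1(2)[of x] a1(2)[of x] a2(2)[of g1 x] a0(2)[of g1] amap_Id[of x M2]
  by (simp add: G_def b1(2) cm del: Rep_simps(4,5))
 also have "... = lft (sp M) (sp N) (sp M) (%p f. G (amap ?r (mp M N p f))) ?a"
  using lo_compose[OF bl G] by (intro as_tlift) auto
 also have "... = lft (sp M) (sp N) (sp M) (%p f. tsum (sp M) (%\<xi> \<zeta>. tsum (sp M) (%\<xi>' \<zeta>'. ?C \<xi> \<zeta> \<xi>' \<zeta>' p f) ?R) ?c) ?a"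
 proof (rule fun_cong[OF tlift_cong])
  fix p f assume [simp]: "p:elts M" "f:elts N"
  have "G (amap ?r (mp M N p f)) = tsum (sp M) (%\<xi> \<zeta>. G (mp N M (act N \<zeta> f) (act M \<xi> p))) ?c"
   unfolding rb_hom(2)[OF M N \<open>p:elts M\<close> \<open>f:elts N\<close>] gn using gn by (intro Rs_out[OF _ _ _ _ G]) auto
  also have "... = tsum (sp M) (%\<xi> \<zeta>. tsum (sp M) (%\<xi>' \<zeta>'. ?C \<xi> \<zeta> \<xi>' \<zeta>' p f) ?R) ?c"
   using ev_antipode[OF N M _ d] gn by (intro Rs_cong) (simp_all add: Gp act_mult[OF M HOL.refl] cong: Rs_cong)
  finally show "G (amap ?r (mp M N p f)) = ..." .
 qed
 also have "... = tsum (sp M) (%\<xi> \<zeta>. lft (sp M) (sp N) (sp M) (%p f. tsum (sp M) (%\<xi>' \<zeta>'. ?C \<xi> \<zeta> \<xi>' \<zeta>' p f) ?R) ?a) ?c"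
  by (intro tlift_tsum[OF _ _ _ A_module A_module Rc]) (auto intro!: lin dl)
 also have "... = tsum (sp M) (%\<xi> \<zeta>. tsum (sp M) (%\<xi>' \<zeta>'. lft (sp M) (sp N) (sp M) (?C \<xi> \<zeta> \<xi>' \<zeta>') ?a) ?R) ?c"
  by (intro Rs_cong tlift_tsum[OF _ _ _ A_module A_module Rc]) (auto intro!: lin dl)
 also have "... = tsum (sp M) (%\<xi> \<zeta>. tsum (sp M) (%\<xi>' \<zeta>'. act M (?k \<xi> \<zeta> \<xi>' \<zeta>') x) ?R) ?c"
  by (intro Rs_cong) (simp_all add: zig A_assoc act_mult[OF M HOL.refl])
 also have "... = tsum (sp M) (%\<xi>' \<zeta>'. tsum (sp M) (%\<xi> \<zeta>. act M (?k \<xi> \<zeta> \<xi>' \<zeta>') x) ?c) ?R"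
  by (intro Rs_swap) auto
 also have "... = act M (tsum (A ?m) (%\<xi>' \<zeta>'. tsum (A ?m) (%\<xi> \<zeta>. ?k \<xi> \<zeta> \<xi>' \<zeta>') ?c) ?R) x"
  by (simp add: Rs_out[OF _ _ _ _ linear_act_left[OF M HOL.refl lo_id x]] cong: Rs_cong)
 also have "tsum (A ?m) (%\<xi>' \<zeta>'. tsum (A ?m) (%\<xi> \<zeta>. ?k \<xi> \<zeta> \<xi>' \<zeta>') ?c) ?R = w ?m"
  unfolding w_sum[OF m,symmetric] v_eq[OF m,symmetric]
  by (simp add: Rs_multL[symmetric] Rs_multR[symmetric] cong: Rs_cong)
 finally show "amap (omega RC M N b d) x = act M (w ?m) x" .
qed

end

section \<open>The twist extension as a category of twisted objects\<close>

context braided_T_category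
begin

lemma twist_ext_Ob: "X:Ob (twist_ext C) \<longleftrightarrow> twisting (fst X) (snd X)"
 by (cases X) (auto simp: twist_ext_def Let_def twisting_def hom_set_def)

lemma twisted_category_twist_ext:
 assumes "!!U. U:Ob C ==> runit C U \<bullet> braid C \<I> U = lunit C U" "!!U. U:Ob C ==> lunit C U \<bullet> braid C U \<I> = runit C U"
 shows "twisted_category P C (twist_ext C)"
proof -
 have *: "(U, t):Ob (twist_ext C) \<longleftrightarrow> twisting U t" for U t
  by (simp add: twist_ext_Ob)
 show ?thesis
proof (intro twisted_category.intro twisted_category_axioms.intro braided_T_category_axioms assms, goal_cases)
 case (3 X)
 then show ?case by (auto simp: twist_ext_def Let_def twisting_def hom_set_def)
next
 case (4 X Y)
 then show ?case
  using * twisting_tensor[of "fst X" "snd X" "fst Y" "snd Y"] twist_tensor_eq[of "fst X" "snd X" "fst Y" "snd Y"]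
  by (cases X; cases Y) (simp add: twist_ext_def Let_def)
next
 case 5
 have "twisting \<I> (Id C \<I>)" by (simp add: twisting_def cat)
 then show ?case using * by (simp add: twist_ext_def Let_def)
next
 case (6 b X)
 then show ?case using * twist_tensor_conj(1)[of "fst X" "snd X" "fst X" "snd X" b] by (cases X) (simp add: twist_ext_def Let_def)
next
 case (7 X Y)
 then show ?case
  using * twist_tensor_eq[of "fst X" "snd X" "fst Y" "snd Y"] by (cases X; cases Y) (simp add: twist_ext_def Let_def)
next
 case 8
 show ?case using deg_cat(4) by (auto simp: twist_ext_def Let_def hom_set_def)
qed (simp_all add: twist_ext_def Let_def split_beta assms)
qed

end

context quasitriangular_T_coalgebra
begin

text \<open>The antipode symmetry of R, used for each of the two R-matrices of a double braiding.
  The left side arises by transposition from the double braiding on the duals in reversed order, the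
  right side from that on M \<otimes> N once the operators are pulled through the twists; B stands
  for the value of the pairing.\<close>

lemma R_double_antipode:
 assumes m: "m:cr P" and n: "n:cr P" and X: "module K X" and B: "bo K (A m) (A n) X B"
 shows "tsum X (%g h. tsum X (%g' h'. B (S (iv m) (ph n (conj_elt P (iv n) (iv m)) g'*[A (iv m)]h)) (S (iv n) (h'*[A (iv n)]g)))
   (R (conj_elt P (iv n) (iv m)) (iv n))) (R (iv n) (iv m))
  = tsum X (%g h. tsum X (%g' h'. B (ph (iv m) m (h'*[A m]g)) (ph (iv n) n (ph (iv m) (conj_elt P m n) g'*[A n]h)))
   (R (conj_elt P m n) m)) (R m n)"
proof -
 note [simp] = m n X
 let ?c = "conj_elt P m n" and ?R = "R (iv n) (iv m)" and ?a = "R (iv m) (iv n)"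
 have Bl: "lo K U X (%u. B (l u) y)" if "lo K U (A m) l" "y:cA n" for U :: "('k, 'q) module" and l y
  using lo_compose[OF that(1) boD(2)[OF B that(2)]] .
 have Br: "lo K U X (%u. B x (l u))" if "lo K U (A n) l" "x:cA m" for U :: "('k, 'q) module" and l x
  using lo_compose[OF that(1) boD(1)[OF B that(2)]] .
 note [simp] = bo_closed[OF B]
 let ?F = "%g h g' h'. B (h'*[A m]ph (iv m) m g) (ph (iv n) n g'*[A n]ph (iv n) n h)"
 let ?g = "conj_elt P (iv n) (iv m)"
 have "tsum X (%g h. tsum X (%g' h'. B (S (iv m) (ph n ?g g'*[A (iv m)]h)) (S (iv n) (h'*[A (iv n)]g))) (R ?g (iv n))) ?R
  = tsum X (%g h. tsum X (%p q. ?F (S (iv m) (ph m (iv m) p)) (S (iv n) q) (S (iv n) (ph n (iv n) g)) (S (iv m) h)) ?a) ?R"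
 proof (intro Rs_cong)
  fix g h assume [simp]: "g:cA (iv n)" "h:cA (iv m)"
  have "tsum X (%g' h'. B (S (iv m) (ph n ?g g'*[A (iv m)]h)) (S (iv n) (h'*[A (iv n)]g))) (R ?g (iv n))
   = tsum X (%p q. B (S (iv m) (ph n ?g (ph (iv n) (iv m) p)*[A (iv m)]h)) (S (iv n) (ph (iv n) (iv n) q*[A (iv n)]g))) ?a"
   by (rule R_crossing_sum) (auto intro!: lin Bl Br)
  also have "... = tsum X (%p q. ?F (S (iv m) (ph m (iv m) p)) (S (iv n) q) (S (iv n) (ph n (iv n) g)) (S (iv m) h)) ?a"
   by (intro Rs_cong) (simp_all add: S_mult S_crossing)
  finally show "tsum X (%g' h'. B (S (iv m) (ph n ?g g'*[A (iv m)]h)) (S (iv n) (h'*[A (iv n)]g))) (R ?g (iv n)) = ..." .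
 qed simp_all
 also have "... = tsum X (%g h. tsum X (%p q. ?F p q (S (iv n) (ph n (iv n) g)) (S (iv m) h)) (R m n)) ?R"
  by (intro Rs_cong R_antipode_sum[symmetric]) (auto intro!: lin Bl Br)
 also have "... = tsum X (%p q. tsum X (%g h. ?F p q (S (iv n) (ph n (iv n) g)) (S (iv m) h)) ?R) (R m n)"
  by (intro Rs_swap) auto
 also have "... = tsum X (%p q. tsum X (%g' h'. ?F p q g' h') (R n m)) (R m n)"
  by (intro Rs_cong R_antipode_sum[symmetric]) (auto intro!: lin Bl Br)
 also have "... = tsum X (%g h. tsum X (%g' h'. B (ph (iv m) m (h'*[A m]g)) (ph (iv n) n (ph (iv m) ?c g'*[A n]h)))
   (R ?c m)) (R m n)"
 proof (intro Rs_cong)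
  fix g h assume [simp]: "g:cA m" "h:cA n"
  have "tsum X (%g' h'. B (ph (iv m) m (h'*[A m]g)) (ph (iv n) n (ph (iv m) ?c g'*[A n]h))) (R ?c m)
   = tsum X (%g' h'. B (ph (iv m) m (ph m m h'*[A m]g)) (ph (iv n) n (ph (iv m) ?c (ph m n g')*[A n]h))) (R n m)"
   by (rule R_crossing_sum) (auto intro!: lin Bl Br)
  also have "... = tsum X (%g' h'. ?F g h g' h') (R n m)"
   by (intro Rs_cong) (simp_all add: ph_mult)
  finally show "tsum X (%g' h'. ?F g h g' h') (R n m) = tsum X (%g' h'. B (ph (iv m) m (h'*[A m]g)) (ph (iv n) n (ph (iv m) ?c g'*[A n]h))) (R ?c m)"
   by simp
 qed simp_all
 finally show ?thesis .
qed

end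

section \<open>The category \<open>Rib(H)\<close> is a ribbon T-category\<close>

context qt_rep
begin

abbreviation "rib == is_rib P K VV H"

lemma twisted_category_Rep: "twisted_category P RC (twist_ext RC)"
 by (rule braided_T_category.twisted_category_twist_ext[OF bRC]) (use rb_unit_left rb_unit_right in \<open>simp_all del: Rep_simps(5)\<close>)

lemma twisting_w:
 assumes t: "twisting M t" and "x:elts M"
 shows "amap t (act M (w (gr M)) x) = act M (w (gr M)) (amap t x)"
 using assms twD(1)[OF t] twD(6)[OF t, of "w (gr M)" x] by simp

lemma ribD:
 assumes "rib (M, t)"
 shows "twisting M t" "hm M" "x:elts M ==> act M (w (gr M)) (amap t (amap t x)) = x"
  "x:elts M ==> amap t (act M (w (gr M)) (amap t x)) = x"
  "x:elts M ==> amap t (amap t (act M (w (gr M)) x)) = x"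
proof -
 show t: "twisting M t" and w: "!!x. x:elts M ==> act M (w (gr M)) (amap t (amap t x)) = x" using assms by (auto simp: is_rib_iff)
 show "hm M" using twD(1)[OF t] .
 then show a: "amap t (act M (w (gr M)) (amap t x)) = x" if "x:elts M" for x using that w twD(5,6)[OF t] by simp
 show "amap t (amap t (act M (w (gr M)) x)) = x" if "x:elts M" for x
  using that w \<open>hm M\<close> twD(5,6)[OF t] by simp
qed

lemma Rep_iso_bij:
 assumes f: "f:rh M N" and bij: "bij_betw (amap f) (elts M) (elts N)"
 shows "is_iso RC f"
 unfolding is_iso_def
 by (intro exI, rule Rep_inverse[OF f, where g="inv_into (elts M) (amap f)"])
  (use bij in \<open>auto simp: bij_betw_def inv_into_into f_inv_into_f\<close>)

lemma dual_pullback: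
 assumes V: "fd_space K V" and T: "lo K V V T" and g: "g:cr (ds V)"
 obtains k where "k:cr (ds V)" "!!x. x:cr V ==> pr V k x = pr V g (T x)"
proof -
 have "linear_form K V (%x. pr V g (T x))"
  using pairing_form[OF V g] loD[OF T] by (auto simp: linear_form_def)
 then show ?thesis using pairing_bij[OF V] that by blast
qed

text \<open>The twist component of the dual in Rib(H), named separately because as a map it is just
  the transpose of t (\<open>dual_twist\<close>).\<close>

definition dtw :: "('g, 'k, 'h, 'u) hmod => ('g, 'k, 'h, 'u) harr => ('g, 'k, 'h, 'u) harr" where
 "dtw M t = snd (rib_dual P K VV H (M, t))"

lemma rib_dual_eq: "rib_dual P K VV H (M, t) = (rd M, dtw M t)"
 by (simp add: dtw_def rib_dual_def Let_def)

text \<open>Conjugations do not affect underlying maps, so the dual arrow of t with respect to the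
  canonical unit and counit is, as a map, the transpose of t. The transpose of a bijection is a
  bijection.\<close>

lemma dual_twist:
 assumes t: "twisting M t"
 shows "twisting (rd M) (dtw M t)"
  "f:elts (rd M) ==> x:elts M ==> pr (sp M) (amap (dtw M t) f) x = pr (sp M) f (amap t x)"
proof -
 note T = twD[OF t]
 note [simp] = T(1,5)
 let ?d = "dtw M t" and ?a = "ds (sp M)"
 have m [simp]: "gr M:cr P" by simp
 let ?N = "rc (gr M) M"
 define s where "s = dual_arrow RC (rd M) (rco M) (rd ?N) (re ?N) t"
 have e: "dtw M t = rj (iv (gr M)) s" by (simp add: dtw_def rib_dual_def s_def Let_def)
 note da = dual_arrow_eval[OF T(1) hm_rd[OF T(1)] hm_rd[OF hm_rc[OF T(1) m]] T(2) co_hom(1)[OF T(1)] ev_hom(1)[OF hm_rc[OF T(1) m]], folded s_def]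
 have ev: "amap s f:cr ?a & (\<forall>x\<in>elts M. pr (sp M) (amap s f) x = pr (sp M) f (amap t x))"
  if f: "f:cr ?a" for f
 proof -
  obtain k where k: "k:cr ?a" "!!x. x:elts M ==> pr (sp M) k x = pr (sp M) f (amap t x)"
   using dual_pullback[OF hmD(2)[OF T(1)] T(4) f] by blast
  have "amap s f = lft (sp M) ?a ?a (%y g. uc (amap (re ?N) (mp (rd ?N) ?N f (amap t y))).*[?a]g) (cm M)"
   using da(2)[of f] f by simp
  also have "... = lft (sp M) ?a ?a (%y g. pr (sp M) k y.*[?a]g) (cm M)"
   using ev_hom(2)[OF hm_rc[OF T(1) m]] f k(2) by (intro fun_cong[OF tlift_cong]) simp
  also have "... = k" using k(1) by (intro ce_props(3)) (auto intro!: lin)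
  finally show ?thesis using k by simp
 qed
 show p: "pr (sp M) (amap ?d f) x = pr (sp M) f (amap t x)" if "f:elts (rd M)" "x:elts M" for f x
  using ev that by (simp add: e)
 have h: "dtw M t:rh (rd M) (rc (gr (rd M)) (rd M))"
  using rc_ar_hom[OF _ da(1), of "iv (gr M)"] rc_rc[of "rd M" "iv (gr M)" "gr M"] by (simp add: e rd_rc rc_one)
 have "bij_betw (amap ?d) (elts (rd M)) (elts (rd M))"
  unfolding bij_betw_def
 proof
  have sur: "\<exists>z\<in>elts M. x = amap t z" if "x:elts M" for x
   using twisting_bij[OF t] that by (auto simp: bij_betw_def)
  show "inj_on (amap ?d) (elts (rd M))"
  proof (rule inj_onI)
   fix f g assume f: "f:elts (rd M)" and g: "g:elts (rd M)" and eq: "amap ?d f = amap ?d g"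
   show "f = g"
   proof (rule ds_ext[OF hmD(2)[OF T(1)]])
    fix x assume "x:elts M"
    with sur obtain z where "z:elts M" "x = amap t z" by blast
    with p[OF f] p[OF g] eq show "pr (sp M) f x = pr (sp M) g x" by metis
   qed (use f g in simp_all)
  qed
  note i = Rep_iso_amap[OF T(2) RC.inv_inv[OF T(3)]]
  have il: "lo K (sp M) (sp M) (amap (rv t))" using Rep_homD(7)[OF i(1)] by simp
  show "amap ?d ` elts (rd M) = elts (rd M)"
  proof
   show "amap ?d ` elts (rd M) <= elts (rd M)" using Rep_homD(8)[OF h] by auto
   show "elts (rd M) <= amap ?d ` elts (rd M)"
   proof
    fix f assume f: "f:elts (rd M)"
    obtain k where k: "k:cr ?a" "!!x. x:elts M ==> pr (sp M) k x = pr (sp M) f (amap (rv t) x)"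
     using dual_pullback[OF hmD(2)[OF T(1)] il, of f] f by auto
    have "amap ?d k = f"
     using k f i(2) p[of k] Rep_homD(8)[OF h,of k] by (intro ds_ext[OF hmD(2)[OF T(1)]]) auto
    then show "f:amap ?d ` elts (rd M)" using k by auto
   qed
  qed
 qed
 then show "twisting (rd M) ?d"
  using Rep_iso_bij[OF h] h by (simp add: tw_iff)
qed

text \<open>Transposing t t w = 1 gives the condition for the dual, because S maps \<open>w\<close>
  to the \<open>w\<close> of the inverse degree.\<close>

lemma rib_dual_rib:
 assumes "rib (M, t)"
 shows "rib (rd M, dtw M t)"
proof -
 note r = ribD[OF assms] note d = dual_twist[OF r(1)] note D = twD[OF d(1)] note [simp] = r(2) D(5)
 let ?d = "dtw M t" and ?w = "w (gr (rd M))"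
 show ?thesis
  unfolding is_rib_iff
 proof (intro conjI ballI d)
  fix f assume f: "f:elts (rd M)"
  show "act (rd M) ?w (amap ?d (amap ?d f)) = f"
  proof (rule ds_ext[OF hmD(2)[OF r(2)]])
   show "act (rd M) ?w (amap ?d (amap ?d f)):cr (ds (sp M))"
    using f D(1) D(5) hmD(4)[OF D(1) HOL.refl] by simp
   fix x assume x: "x:elts M"
   then show "pr (sp M) (act (rd M) ?w (amap ?d (amap ?d f))) x = pr (sp M) f x"
    using f D(5)[of f] D(5)[of "amap ?d f"] r(5)[OF x] twD(5)[OF r(1)] d(2) by (simp add: act_rd)
  qed (use f in simp)
 qed
qed

text \<open>On the unit object \<open>w\<close> acts by its counit, which is 1.\<close>

lemma rib_unit: "rib (ru, ri ru)"
proof -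
 have "ri ru:rh ru (rc (gr ru) ru)" using Rep_id[OF hm_ru] by (simp add: rc_ru)
 then show ?thesis
  using Rep_iso_bij[of "ri ru" ru "rc (gr ru) ru"] module.smult_one[of K kk]
  by (auto simp: is_rib_iff tw_iff counit_w bij_betw_def inj_on_def)
qed

lemma rib_conj:
 assumes "rib (M, t)" and b [simp]: "b:cr P"
 shows "rib (rc b M, rj b t)"
proof -
 note r = ribD[OF assms(1)] note [simp] = r(2) twD(5)[OF r(1)]
 have "twisting (rc b M) (rj b t)"
  using braided_T_category.twist_tensor_conj(1)[OF bRC r(1) r(1) b] by simp
 then show ?thesis using r(3) by (simp add: is_rib_iff)
qed

section \<open>Closure of Rib(H) under tensor products\<close>

lemma tensor_left_ext:
 assumes V: "fd_space K V" and W: "fd_space K W" and z: "z:cr (ts V W)" "z':cr (ts V W)"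
  and eq: "!!f. f:cr (ds V) ==> lft V W W (%v y. pr V f v.*[W]y) z = lft V W W (%v y. pr V f v.*[W]y) z'"
 shows "z = z'"
proof -
 obtain E e where E: "dual_bases K VV V E e" using dual_bases_exist[OF V] by blast
 have E': "finite E" "!!y. y:E ==> y:cr V" "!!y. y:E ==> e y:cr (ds V)"
  "!!x. x:cr V ==> (\<Oplus>\<^bsub>V\<^esub>y\<in>E. pr V (e y) x.*[V]y) = x"
  using E by (auto simp: dual_bases_def)
 note [simp] = V W E'(2,3)
 interpret V: module K V by simp
 interpret W: module K W by simp
 interpret T: module K "ts V W" by simp
 let ?c = "%f. lft V W W (%v y. pr V f v.*[W]y)"
 have b: "bo K V W W (%v y. pr V f v.*[W]y)" if "f:cr (ds V)" for f
  using that by (auto intro!: lin)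
 have cl: "lo K (ts V W) W (?c f)" if "f:cr (ds V)" for f using b[OF that] by (intro tlift_pr(2)) auto
 have x: "z = (\<Oplus>\<^bsub>ts V W\<^esub>y\<in>E. tp V W y (?c (e y) z))" if "z:cr (ts V W)" for z
 proof (rule ts_ext[OF V W _ _ _ _ that, where X="ts V W"])
  fix v y assume [simp]: "v:cr V" "y:cr W"
  have "tp V W v y = tp V W (\<Oplus>\<^bsub>V\<^esub>x\<in>E. pr V (e x) v.*[V]x) y" using E'(4) by simp
  also have "... = (\<Oplus>\<^bsub>ts V W\<^esub>x\<in>E. tp V W (pr V (e x) v.*[V]x) y)"
   by (rule lo_finsum_out[where f="%x. tp V W x y"]) (auto intro!: lin)
  also have "... = (\<Oplus>\<^bsub>ts V W\<^esub>x\<in>E. tp V W x (?c (e x) (tp V W v y)))"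
   using b by (intro T.M.finsum_cong') (auto simp: tp_smult tlift_pr)
  finally show "tp V W v y = ..." .
 qed (use b in \<open>auto intro!: lin\<close>)
 have "z = (\<Oplus>\<^bsub>ts V W\<^esub>y\<in>E. tp V W y (?c (e y) z'))"
  using eq z lo_closed[OF cl z(2)] by (subst x[OF z(1)], intro T.M.finsum_cong') auto
 then show ?thesis using x[OF z(2)] by simp
qed

lemma pairing_ext:
 assumes V: "fd_space K V" and x: "x:cr V" "y:cr V"
  and eq: "!!f. f:cr (ds V) ==> pr V f x = pr V f y"
 shows "x = y"
proof -
 obtain E e where E: "dual_bases K VV V E e" using dual_bases_exist[OF V] by blast
 then have *: "e i:cr (ds V)" "i:cr V" if "i:E" for i using that by (auto simp: dual_bases_def)
 interpret V: module K V using V by simp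
 have "x = (\<Oplus>\<^bsub>V\<^esub>i\<in>E. pr V (e i) x.*[V]i)" using E x by (simp add: dual_bases_def)
 also have "... = (\<Oplus>\<^bsub>V\<^esub>i\<in>E. pr V (e i) y.*[V]i)" using eq * x V by (intro V.M.finsum_cong') auto
 also have "... = y" using E x by (simp add: dual_bases_def)
 finally show ?thesis .
qed

text \<open>The evaluation is an arrow of the twist extension: by \<open>ev_twist\<close>, the twist
  followed by the evaluation pairs f with t w t x, and t w t = 1.\<close>

lemma ev_twist_rib:
 assumes "rib (M, t)"
 shows "ri ru oR re M = rj eP (re M) oR tt (rd M) (dtw M t) M t"
proof -
 note r = ribD[OF assms] note d = dual_twist[OF r(1)] note T = tt_eval(1)[OF d(1) r(1)]
 note [simp] = r(2) twD(5)[OF r(1)] twD(5)[OF d(1),unfolded rd_simps]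
 note ev = ev_hom[OF r(2)]
 have c: "rj eP (re M) = re M" using conj_dual_Rep(2)[OF r(2), of "eP"] by (simp add: rc_one del: Rep_simps)
 have th: "tt (rd M) (dtw M t) M t:rh (mt (rd M) M) (mt (rd M) M)"
  using twD(2)[OF T] by (simp add: rc_one)
 note cc = Rep_comp[OF th ev(1)]
 have "re M = re M oR tt (rd M) (dtw M t) M t"
 proof (rule Rep_ar_eq2I[OF ev(1) cc(1)])
  fix f x assume f: "f:elts (rd M)" and x: "x:elts M"
  show "amap (re M) (mp (rd M) M f x) = amap (re M oR tt (rd M) (dtw M t) M t) (mp (rd M) M f x)"
   using cc(2)[of "mp (rd M) M f x"] ev_twist[OF r(1) d(1) _ ev(1) f x] ev(2) f x d(2) r(4)[OF x] by simp
 qed simp_all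
 then show ?thesis unfolding c using RC.comp_id[OF ev(1)] by (simp del: Rep_simps(4,5))
qed

text \<open>With d the nested pairing, T the twist of M \<otimes> N and T' that of the duals, d(p, T
  w T z) = d(T' p, w T z) = d(p, z). The first equation is adjointness of the twists; the second is
  \<open>ev_twist\<close> for the product modules together with the compatibility of d with twists.
  Nondegeneracy of d yields T w T = 1.\<close>

lemma rib_tensor:
 assumes X: "rib (M, t)" and Y: "rib (N, s)"
 shows "rib (mt M N, tt M t N s)"
proof -
 note x = ribD[OF X] and y = ribD[OF Y]
 note x' = ribD[OF rib_dual_rib[OF X]] and y' = ribD[OF rib_dual_rib[OF Y]]
 let ?b = "ds (sp M)" and ?c = "ms M N" and ?f = "ds (sp N)"
 define t' where "t' = dtw M t"
 define s' where "s' = dtw N s"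
 note [simp] = x(2) y(2) twD(5)[OF x(1)] twD(5)[OF y(1)]
 have t': "twisting (rd M) t'" "!!f x. f:cr ?b ==> x:elts M ==> pr (sp M) (amap t' f) x = pr (sp M) f (amap t x)"
  and s': "twisting (rd N) s'" "!!f x. f:cr ?f ==> x:elts N ==> pr (sp N) (amap s' f) x = pr (sp N) f (amap s x)"
  using dual_twist[OF x(1)] dual_twist[OF y(1)] by (simp_all add: t'_def s'_def)
 note [simp] = twD(5)[OF t'(1),unfolded rd_simps] twD(5)[OF s'(1),unfolded rd_simps]
 let ?M = "rd M" and ?N = "rd N" let ?W = "mt M N" and ?W' = "mt ?N ?M"
 let ?T = "tt M t N s" and ?T' = "tt ?N s' ?M t'"
 have T: "twisting ?W ?T" and T': "twisting ?W' ?T'" using tt_eval(1) x(1) y(1) t' s' by blast+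
 interpret TE: twisted_category P RC "twist_ext RC" by (rule twisted_category_Rep)
 interpret E: tensor_category "twist_ext RC" by (rule TE.tensor_category_D)
 let ?E = "twist_ext RC"
 let ?X = "(M, t)" and ?Y = "(N, s)" and ?X' = "(?M, t')" and ?Y' = "(?N, s')"
 have Ob: "?X:Ob ?E" "?Y:Ob ?E" "?X':Ob ?E" "?Y':Ob ?E"
  using x(1) y(1) t' s' by (simp_all add: braided_T_category.twist_ext_Ob[OF bRC])
 have ts: "?X**[?E]?Y = (?W, ?T)" "?Y'**[?E]?X' = (?W', ?T')"
  using Ob by (simp_all add: TE.D_tens)
 have evE: "Arr ((rd L, dtw L r)**[?E](L, r)) \<I>[?E] (re L):hom_set ?E ((rd L, dtw L r)**[?E](L, r)) \<I>[?E]"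
  if L: "rib (L, r)" for L r
 proof -
  have Ob: "(L, r):Ob ?E" "(rd L, dtw L r):Ob ?E"
   using ribD(1)[OF L] dual_twist(1)[OF ribD(1)[OF L]] by (simp_all add: braided_T_category.twist_ext_Ob[OF bRC])
  then show ?thesis
   using ev_hom(1)[OF ribD(2)[OF L]] ev_twist_rib[OF L] ribD(2)[OF L] by (intro TE.D_homI E.tens_ob_closed E.unit_closed)
    (simp_all add: TE.D_fs hom_set_def del: Rep_simps(4,5,14))
 qed
 \<comment> \<open>k contracts the dual of M with M, and d then contracts the dual of N with the
   result. Both are composed of evaluations and constraints, so d has a counterpart in the twist
   extension.\<close>
 define k where "k = rl N oR rt (re M) (ri N) oR rv (ra ?M M N)"
 define d where "d = re N oR rt (ri ?N) k oR ra ?N ?M ?W"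
 note i = Rep_id[of N] note i' = Rep_id[of ?N]
 note k1 = inv_ra[of ?M M N] note k2 = Rep_tens[OF ev_hom(1)[OF x(2)] i] note k3 = rl_hom[of N]
 note kc1 = Rep_comp[OF k1(1) k2(1)] note kc2 = Rep_comp[OF kc1(1) k3(1),folded k_def]
 note d1 = ra_hom[of ?N ?M ?W] note d2 = Rep_tens[OF i' kc2(1)] note d3 = ev_hom[OF y(2)]
 note dc1 = Rep_comp[OF d1(1) d2(1)] note dc2 = Rep_comp[OF dc1(1) d3(1),folded d_def]
 have ke: "amap k (mp ?M ?W f (mp M N a b)) = pr (sp M) f a.*[sp N]b"
  if "f:cr ?b" "a:elts M" "b:elts N" for f a b
 proof -
  interpret k: module K kk by simp
  show ?thesis
   using that kc1(2)[of "mp ?M ?W f (mp M N a b)"] kc2(2)[of "mp ?M ?W f (mp M N a b)"] k1(2)[of f a b] k2(2)[of "mp ?M M f a" b] k3(2)[of "pr (sp M) f a.*[kk]g1" b] ev_hom(2)[OF x(2),of f a]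
   by simp
 qed
 have de: "amap d (mp ?W' ?W (mp ?N ?M g f) z) = pr (sp N) g (amap k (mp ?M ?W f z)).*[kk]g1"
  if "g:cr ?f" "f:cr ?b" "z:cr ?c" for g f z
  using that dc1(2)[of "mp ?W' ?W (mp ?N ?M g f) z"] dc2(2)[of "mp ?W' ?W (mp ?N ?M g f) z"] d1(2)[of g f z] d2(2)[of g "mp ?M ?W f z"]
   d3(2)[of g "amap k (mp ?M ?W f z)"] Rep_homD(8)[OF kc2(1), of "mp ?M ?W f z"] by simp
 \<comment> \<open>The same composite formed in the twist extension is an arrow there, hence
   compatible with the twists of its source and target; the target is the unit object with the
   identity as twist.\<close>
 have d_nat: "amap d (amap (tt ?W' ?T' ?W ?T) z) = amap d z" if "z:cr (ms ?W' ?W)" for z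
 proof -
  let ?a = "assoc ?E ?X' ?X ?Y" and ?e = "Arr (?X'**[?E]?X) \<I>[?E] (re M)" and ?e' = "Arr (?Y'**[?E]?Y) \<I>[?E] (re N)"
  let ?k = "lunit ?E ?Y\<bullet>[?E](?e***[?E]Id ?E ?Y)\<bullet>[?E]inv_ar ?E ?a"
  let ?d = "?e'\<bullet>[?E](Id ?E ?Y'***[?E]?k)\<bullet>[?E]assoc ?E ?Y' ?X' (?X**[?E]?Y)"
  have ah: "?a:hom_set ?E ((?X'**[?E]?X)**[?E]?Y) (?X'**[?E](?X**[?E]?Y))" "is_iso ?E ?a" using E.assoc_iso Ob by blast+
  have ih: "inv_ar ?E ?a:hom_set ?E (?X'**[?E](?X**[?E]?Y)) ((?X'**[?E]?X)**[?E]?Y)"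
   using E.inv_ar_cat(1-3)[OF ah(2)] ah(1) by (simp add: hom_set_def)
  have kh: "?k:hom_set ?E (?X'**[?E](?X**[?E]?Y)) ?Y"
   by (rule E.comp_hom[OF E.comp_hom[OF ih E.tens_ar_hom[OF evE[OF X,folded t'_def] E.id_hom[OF Ob(2)]]] conjunct1[OF E.lunit_iso[OF Ob(2)]]])
  have dh: "?d:hom_set ?E ((?Y'**[?E]?X')**[?E](?X**[?E]?Y)) \<I>[?E]"
   by (rule E.comp_hom[OF E.comp_hom[OF conjunct1[OF E.assoc_iso] E.tens_ar_hom[OF E.id_hom[OF Ob(4)] kh]] evE[OF Y,folded s'_def]])
    (simp_all only: Ob E.tens_ob_closed)
  have "inv_ar ?E ?a = Arr (?X'**[?E](?X**[?E]?Y)) ((?X'**[?E]?X)**[?E]?Y) (rv (ra ?M M N))"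
   using TE.inv_D[OF ah(1)[unfolded TE.D_fld]] ra_iso[of ?M M N] by (simp add: TE.D_fld is_iso_def)
  then have ad: "amap ?d = d"
   by (simp only: TE.D_fld arr.sel d_def k_def fst_conv snd_conv Rep_simps(7-11) ts)
  have g: "gr ?W'*[P]gr ?W = eP" by (simp add: m_assoc)
  obtain d' where "?d = Arr ((?Y'**[?E]?X')**[?E](?X**[?E]?Y)) \<I>[?E] d'"
   "snd \<I>[?E] oR d' = rj (Deg RC (fst ((?Y'**[?E]?X')**[?E](?X**[?E]?Y)))) d' oR snd ((?Y'**[?E]?X')**[?E](?X**[?E]?Y))"
   using dh by (rule TE.D_homE)
  then have "ri ru oR d = rj eP d oR tt ?W' ?T' ?W ?T"
   using ad E.tens_ob_closed[OF Ob(4,3)] E.tens_ob_closed[OF Ob(1,2)] g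
   by (simp add: TE.D_fs ts del: Rep_simps(4,5,14))
  moreover have th: "tt ?W' ?T' ?W ?T:rh (mt ?W' ?W) (mt ?W' ?W)"
   using twD(1,2)[OF tt_eval(1)[OF T' T]] g by (simp add: rc_one)
  moreover have "rj eP d = d"
   by (intro T_category.conj_one[OF T_category_Rep]) (use dc2(1) in \<open>simp add: hom_set_def\<close>)
  ultimately have "d = d oR tt ?W' ?T' ?W ?T"
   using RC.comp_id[OF dc2(1)] by (simp del: Rep_simps(4,5,14))
  then show ?thesis
   using that Rep_comp(2)[OF th dc2(1),of z] by (simp del: Rep_simps(5))
 qed
 have dd: "lo K (ms ?W' ?W) kk (amap d)" using Rep_homD(7)[OF dc2(1)] by simp
 have dp: "amap d (mp ?W' ?W (mp ?N ?M g f) (mp M N a b)) = pr (sp M) f a.*[kk](pr (sp N) g b.*[kk]g1)"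
  if "g:cr ?f" "f:cr ?b" "a:elts M" "b:elts N" for g f a b
 proof -
  interpret kk: module K kk by simp
  show ?thesis using that de[of g f "mp M N a b"] ke[of f a b] by (simp add: pr_lin kk.smult_assoc1)
 qed
 \<comment> \<open>Adjointness of T and T' on pure tensors, where it becomes
   \<open>R_double_antipode\<close>.\<close>
 have d_pure: "amap d (mp ?W' ?W (amap ?T' (mp ?N ?M g f)) (mp M N a b)) = amap d (mp ?W' ?W (mp ?N ?M g f) (amap ?T (mp M N a b)))"
  if [simp]: "g:cr ?f" "f:cr ?b" "a:elts M" "b:elts N" for g f a b
 proof -
  let ?m = "gr M" and ?n = "gr N"
  let ?g = "cj (iv ?n) (iv ?m)"
  let ?B = "%p q. pr (sp M) f (act M p (amap t a)).*[kk](pr (sp N) g (act N q (amap s b)).*[kk]g1)"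
  interpret kk: module K kk by simp
  have B: "bo K (A ?m) (A ?n) kk ?B"
   by (intro boI lo_smult_left) (auto intro!: lin)
  have dl1: "lo K (ms ?N ?M) kk (%p. amap d (mp ?W' ?W p (mp M N a b)))"
   by (rule lo_compose[OF _ dd]) (auto intro!: lin)
  have dl2: "lo K ?c kk (%z. amap d (mp ?W' ?W (mp ?N ?M g f) z))"
   by (rule lo_compose[OF _ dd]) (auto intro!: lin)
  have "amap d (mp ?W' ?W (amap ?T' (mp ?N ?M g f)) (mp M N a b))
   = tsum kk (%\<xi> \<zeta>. tsum kk (%\<xi>' \<zeta>'. amap d (mp ?W' ?W (mp ?N ?M (amap s' (act ?N (\<zeta>'*[A (iv ?n)]\<xi>) g))
     (amap t' (act ?M (ph ?n ?g \<xi>'*[A (iv ?m)]\<zeta>) f))) (mp M N a b))) (R ?g (iv ?n))) (R (iv ?n) (iv ?m))"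
   unfolding tt_eval(2)[OF s'(1) t'(1),unfolded rd_simps,OF that(1,2)] rd_simps
   by (simp add: act_rd Rs_out[OF _ _ _ _ dl1[unfolded rd_simps mt_simps]] cong: Rs_cong)
  also have "... = tsum kk (%\<xi> \<zeta>. tsum kk (%\<xi>' \<zeta>'. ?B (S (iv ?m) (ph ?n ?g \<xi>'*[A (iv ?m)]\<zeta>)) (S (iv ?n) (\<zeta>'*[A (iv ?n)]\<xi>)))
   (R ?g (iv ?n))) (R (iv ?n) (iv ?m))"
   by (intro Rs_cong) (simp_all add: dp[unfolded rd_simps mt_simps] act_rd t'(2) s'(2))
  also have "... = tsum kk (%\<xi> \<zeta>. tsum kk (%\<xi>' \<zeta>'. ?B (ph (iv ?m) ?m (\<zeta>'*[A ?m]\<xi>)) (ph (iv ?n) ?n (ph (iv ?m) (cj ?m ?n) \<xi>'*[A ?n]\<zeta>)))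
   (R (cj ?m ?n) ?m)) (R ?m ?n)"
   by (rule R_double_antipode[OF _ _ _ B]) simp_all
  also have "... = tsum kk (%\<xi> \<zeta>. tsum kk (%\<xi>' \<zeta>'. amap d (mp ?W' ?W (mp ?N ?M g f) (mp M N (amap t (act M (\<zeta>'*[A ?m]\<xi>) a))
    (amap s (act N (ph (iv ?m) (cj ?m ?n) \<xi>'*[A ?n]\<zeta>) b))))) (R (cj ?m ?n) ?m)) (R ?m ?n)"
   using twD(6)[OF x(1)] twD(6)[OF y(1)] by (intro Rs_cong) (simp_all add: dp[unfolded rd_simps mt_simps])
  also have "... = amap d (mp ?W' ?W (mp ?N ?M g f) (amap ?T (mp M N a b)))"
   using tt_eval(2)[OF x(1) y(1),of a b] by (simp add: Rs_out[OF _ _ _ _ dl2[unfolded rd_simps mt_simps]] cong: Rs_cong)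
  finally show ?thesis .
 qed
 have d_T: "amap d (mp ?W' ?W (amap ?T' p) z) = amap d (mp ?W' ?W p (amap ?T z))" if p: "p:elts ?W'" and z: "z:elts ?W" for p z
 proof -
  note l = twD(4,5)[OF T,unfolded mt_simps] and l' = twD(4,5)[OF T',unfolded mt_simps]
  have "amap d (mp ?W' ?W (amap ?T' p) z) = amap d (mp ?W' ?W p (amap ?T z))"
   if [simp]: "a:elts M" "b:elts N" and z: "z = mp M N a b" for a b z
  proof (rule ts_ext[where f="%p. amap d (mp ?W' ?W (amap ?T' p) z)" and g="%p. amap d (mp ?W' ?W p (amap ?T z))" and X=kk])
   show "lo K (ts (sp ?N) (sp ?M)) kk (%p. amap d (mp ?W' ?W (amap ?T' p) z))"
    by (rule lo_compose[OF _ dd]) (use l' z in \<open>auto intro!: lin\<close>)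
   show "lo K (ts (sp ?N) (sp ?M)) kk (%p. amap d (mp ?W' ?W p (amap ?T z)))"
    by (rule lo_compose[OF _ dd]) (use l z in \<open>auto intro!: lin\<close>)
  qed (use p d_pure z in simp_all)
  note * = this
  show ?thesis
  proof (rule ts_ext[where f="%z. amap d (mp ?W' ?W (amap ?T' p) z)" and g="%z. amap d (mp ?W' ?W p (amap ?T z))" and X=kk])
   show "lo K ?c kk (%z. amap d (mp ?W' ?W (amap ?T' p) z))"
    by (rule lo_compose[OF _ dd]) (use l' p in \<open>auto intro!: lin\<close>)
   show "lo K ?c kk (%z. amap d (mp ?W' ?W p (amap ?T z)))"
    by (rule lo_compose[OF _ dd]) (use l p in \<open>auto intro!: lin\<close>)
  qed (use z * in simp_all)
 qed
 \<comment> \<open>Nondegeneracy in the second argument, one factor at a time: forms on M separate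
   elements of M \<otimes> N, then forms on N separate the values.\<close>
 have ext: "z = z'" if z: "z:elts ?W" "z':elts ?W" and eq: "!!p. p:elts ?W' ==> amap d (mp ?W' ?W p z) = amap d (mp ?W' ?W p z')" for z z'
 proof (rule tensor_left_ext[OF hmD(2)[OF x(2)] hmD(2)[OF y(2)]])
  show "z:cr ?c" "z':cr ?c" using z by simp_all
  fix f assume f [simp]: "f:cr ?b"
  have kf: "lft (sp M) (sp N) (sp N) (%v y. pr (sp M) f v.*[sp N]y) q = amap k (mp ?M ?W f q)" if "q:cr ?c" for q
  proof -
   have l: "lo K ?c (sp N) (%q. amap k (mp ?M ?W f q))" by (rule lo_amap[OF kc2(1)]) (auto intro!: lin)
   show ?thesis
    unfolding as_tlift[OF hmD(2)[OF x(2)] hmD(2)[OF y(2)] hm_module[OF y(2)] l that]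
    using ke by (intro fun_cong[OF tlift_cong]) simp
  qed
  have kz: "amap k (mp ?M ?W f z):elts N" "amap k (mp ?M ?W f z'):elts N" using z Rep_homD(8)[OF kc2(1)] by simp_all
  have "amap k (mp ?M ?W f z) = amap k (mp ?M ?W f z')"
  proof (rule pairing_ext[OF hmD(2)[OF y(2)]])
   fix g assume "g:cr ?f"
   then have "pr (sp N) g (amap k (mp ?M ?W f z)).*[kk]g1 = pr (sp N) g (amap k (mp ?M ?W f z')).*[kk]g1"
    using eq[of "mp ?N ?M g f"] de[of g f z] de[of g f z'] z by simp
   from arg_cong[OF this,of uc] show "pr (sp N) g (amap k (mp ?M ?W f z)) = pr (sp N) g (amap k (mp ?M ?W f z'))"
    using kz \<open>g:cr (ds (sp N))\<close> by simp
  qed (rule kz)+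
  then show "lft (sp M) (sp N) (sp N) (%v y. pr (sp M) f v.*[sp N]y) z = lft (sp M) (sp N) (sp N) (%v y. pr (sp M) f v.*[sp N]y) z'"
   using kf z by simp
 qed
 have gW: "gr ?W' = iv (gr ?W)" by (simp add: inv_mult_group)
 show ?thesis
  unfolding is_rib_iff
 proof (intro conjI ballI T)
  fix z assume z: "z:elts ?W"
  note T2 = twD[OF T]
  have "amap ?T (act ?W (w (gr ?W)) (amap ?T z)) = z"
  proof (rule ext)
   show "amap ?T (act ?W (w (gr ?W)) (amap ?T z)):elts ?W" using z T2(1,5) hmD(4)[OF T2(1) HOL.refl] by simp
   fix p assume p: "p:elts ?W'"
   have "amap d (mp ?W' ?W p (amap ?T (act ?W (w (gr ?W)) (amap ?T z)))) = amap d (mp ?W' ?W (amap ?T' p) (act ?W (w (gr ?W)) (amap ?T z)))"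
    using p z T2(1,5) hmD(4)[OF T2(1) HOL.refl] by (intro d_T[symmetric]) simp_all
   also have "... = amap d (amap (tt ?W' ?T' ?W ?T) (mp ?W' ?W p z))"
    using ev_twist[OF T T' gW dc2(1) p z] by simp
   also have "... = amap d (mp ?W' ?W p z)" using p z by (intro d_nat) simp
   finally show "amap d (mp ?W' ?W p (amap ?T (act ?W (w (gr ?W)) (amap ?T z)))) = amap d (mp ?W' ?W p z)" .
  qed (rule z)
  then show "act ?W (w (gr ?W)) (amap ?T (amap ?T z)) = z"
   using z T2(5) twisting_w[OF T] by simp
 qed
qed

section \<open>Balanced structure, duals and ribbon axiom of Rib(H)\<close>

abbreviation "RB == Rib P K VV H"

lemma Rib_Ob: "X:Ob RB \<longleftrightarrow> rib X"
 by (simp add: Rib_def Let_def)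

lemma Rib_tens: "rib_tens P K VV H (M, t) (N, s) = (mt M N, tt M t N s)"
 by (simp add: rib_tens_def braided_T_category.twist_tensor_def[OF bRC] braided_T_category.double_braid_def[OF bRC] Let_def)

lemma tcat_Rib: "twisted_category P RC RB"
proof (intro twisted_category.intro twisted_category_axioms.intro bRC, goal_cases)
 case 1
 then show ?case using rb_unit_left by simp
next
 case 2
 then show ?case using rb_unit_right by simp
next
 case (3 X)
 then show ?case by (cases X) (auto simp: Rib_Ob is_rib_iff)
next
 case (4 X Y)
 then show ?case using rib_tensor[of "fst X" "snd X" "fst Y" "snd Y"] Rib_tens[of "fst X" "snd X" "fst Y" "snd Y"]
  by (cases X; cases Y) (simp add: Rib_def Let_def)
next
 case 5
 then show ?case using rib_unit by (simp add: Rib_def Let_def)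
next
 case (6 b X)
 then show ?case using rib_conj[of "fst X" "snd X" b] by (cases X) (simp add: Rib_def Let_def)
next
 case (7 X Y)
 then show ?case using Rib_tens[of "fst X" "snd X" "fst Y" "snd Y"] by (cases X; cases Y) (simp add: Rib_def Let_def)
qed (simp_all add: Rib_def Let_def split_beta)

text \<open>By \<open>coev_twist\<close>, the twist applied to the canonical element puts t w on the
  first factor and the transpose of t on the second; \<open>canonical_elt_transpose\<close> moves
  the latter over, and t w t = 1.\<close>

lemma co_twist:
 assumes "rib (M, t)"
 shows "tt M t (rd M) (dtw M t) oR rco M = rj eP (rco M) oR ri ru"
proof -
 note r = ribD[OF assms] note d = dual_twist[OF r(1)] note T = tt_eval(1)[OF r(1) d(1)]
 note [simp] = r(2) twD(5)[OF r(1)]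
 note co = co_hom[OF r(2)] note T2 = twD[OF T] note t = twD[OF r(1)] note s = twD[OF d(1)]
 let ?V = "sp M" and ?m = "gr M" and ?l = "%B. lft (sp M) (ds (sp M)) (ms M (rd M)) B (cm M)" and ?p = "tp (sp M) (ds (sp M))"
 let ?d = "dtw M t"
 have c: "rj eP (rco M) = rco M" using conj_dual_Rep(1)[OF r(2), of "eP"] by (simp add: rc_one del: Rep_simps)
 have Th: "tt M t (rd M) ?d:rh (mt M (rd M)) (mt M (rd M))" using T2(2) by (simp add: rc_one)
 have tl: "lo K U ?V (%u. amap t (p u))" if "lo K U ?V p" for U :: "('k, 'q) module" and p
  using lo_compose[OF that t(4)] .
 have "amap (tt M t (rd M) ?d) (cm M) = ?l (%x f. ?p (amap t (act M (w ?m) x)) (amap ?d f))"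
  using coev_twist[OF r(1) d(1) _ co(1)] by simp
 also have "... = ?l (%x f. ?p (amap t (act M (w ?m) (amap t x))) f)"
  using s(4) d(2) by (intro canonical_elt_transpose[symmetric, where B="%x f. ?p (amap t (act M (w ?m) x)) f"]) (auto intro!: lin tl t(4))
 also have "... = ?l (%x f. ?p x f)"
  using r(4) by (intro fun_cong[OF tlift_cong]) simp
 also have "... = cm M"
  using as_tlift[of ?V "ds ?V" "ms M (rd M)" "%x. x" "cm M"] by (simp add: lo_id)
 finally have e: "amap (tt M t (rd M) ?d) (cm M) = cm M" .
 have "tt M t (rd M) ?d oR rco M = rco M"
 proof (rule Rep_ar_eqI[OF Rep_comp(1)[OF co(1) Th] co(1)])
  fix x assume "x:elts ru"
  then show "amap (tt M t (rd M) ?d oR rco M) x = amap (rco M) x"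
   using Rep_comp(2)[OF co(1) Th,of x] co(2)[of x] lo_smult[OF T2(4)[unfolded mt_simps rd_simps], of "uc x" "cm M"] e uc_props[of x] by simp
 qed
 then show ?thesis using RC.comp_id[OF co(1)] c by (simp del: Rep_simps(4,5,14))
qed

lemma dtw_conj:
 assumes t: "twisting M t" and b [simp]: "b:cr P"
 shows "rj b (dtw M t) = dtw (rc b M) (rj b t)"
proof -
 note [simp] = twD(1,5)[OF t]
 let ?r = "rd (rc b M)"
 have t': "twisting (rc b M) (rj b t)"
  using braided_T_category.twist_tensor_conj(1)[OF bRC t t b] by simp
 note d = dual_twist[OF t] note d' = dual_twist[OF t']
 have h: "rj b (dtw M t):rh ?r (rc (gr ?r) ?r)"
  using twD(2)[OF braided_T_category.twist_tensor_conj(1)[OF bRC d(1) d(1) b]] by (simp add: rd_rc del: Rep_simps(14))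
 show ?thesis
 proof (rule Rep_ar_eqI[OF h twD(2)[OF d'(1)]])
  fix f assume "f:elts ?r"
  then show "amap (rj b (dtw M t)) f = amap (dtw (rc b M) (rj b t)) f"
   using d(2)[of f] d'(2)[of f] twD(5)[OF d(1),of f] twD(5)[OF d'(1),of f] by (intro ds_ext[of "sp M"]) simp_all
 qed
qed

text \<open>Up to conjugations, which leave the maps unchanged, the ribbon axiom compares t on the
  first factor of the canonical element with its transpose on the second; it is an instance of
  \<open>canonical_elt_transpose\<close>.\<close>

lemma ribbon_Rep_eq:
 assumes "twisting M t"
 shows "rt (ri (rc (gr M) M)) (rj (gr M) (dtw M t)) oR rco (rc (gr M) M) = rt t (ri (rd M)) oR rco M"
proof -
 note t = twD[OF assms] note d = dual_twist[OF assms] note s = twD[OF d(1)]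
 note [simp] = t(1,5) s(5)[unfolded rd_simps]
 let ?m = "gr M" let ?N = "rc ?m M" and ?V = "sp M" and ?D = "ds (sp M)" and ?p = "tp (sp M) (ds (sp M))"
 let ?t = "ts ?V ?D" and ?r = "rt t (ri (rd M))"
 define r where "r = rj ?m (dtw M t)"
 have r: "r:rh (rd ?N) (rd M)" "amap r = amap (dtw M t)"
  using rc_ar_hom[OF _ s(2),of ?m] rc_rc[of "rd M" ?m "iv ?m"] by (simp_all add: r_def rd_rc rc_one)
 have N: "hm ?N" by simp
 note h1 = Rep_tens[OF Rep_id[OF N] r(1)] and h2 = Rep_tens[OF t(2) Rep_id[OF hm_rd[OF t(1)]]]
 note c1 = co_hom[OF N] and c2 = co_hom[OF t(1)]
 note e1 = Rep_comp[OF c1(1) h1(1)] and e2 = Rep_comp[OF c2(1) h2(1)]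
 have l: "lo K ?t ?t (amap (rt (ri ?N) r))" "lo K ?t ?t (amap ?r)"
  using Rep_homD(7)[OF h1(1)] Rep_homD(7)[OF h2(1)] by simp_all
 have B: "bo K ?V ?D ?t ?p" by (auto intro!: lin)
 have "amap (rt (ri ?N) r) (cm M) = lft ?V ?D ?t (%x f. amap (rt (ri ?N) r) (?p x f)) (cm M)"
  by (rule as_tlift[OF _ _ _ l(1)]) simp_all
 also have "... = lft ?V ?D ?t (%x f. ?p x (amap (dtw M t) f)) (cm M)"
  using h1(2) r(2) by (intro fun_cong[OF tlift_cong]) simp
 also have "... = lft ?V ?D ?t (%x f. ?p (amap t x) f) (cm M)"
  using t(4) s(4) d(2) B by (intro canonical_elt_transpose[symmetric]) simp_all
 also have "... = lft ?V ?D ?t (%x f. amap ?r (?p x f)) (cm M)"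
  using h2(2) by (intro fun_cong[OF tlift_cong]) simp
 also have "... = amap ?r (cm M)"
  by (rule as_tlift[OF _ _ _ l(2),symmetric]) simp_all
 finally have e: "amap (rt (ri ?N) r) (cm M) = amap ?r (cm M)" .
 show ?thesis
  unfolding r_def[symmetric]
 proof (rule Rep_ar_eqI[OF e1(1) e2(1)])
  fix x assume x: "x:elts ru"
  show "amap (rt (ri ?N) r oR rco ?N) x = amap (rt t (ri (rd M)) oR rco M) x"
   unfolding e1(2)[OF x] e2(2)[OF x]
   using x e lo_smult[OF l(1), of "uc x" "cm M"] lo_smult[OF l(2), of "uc x" "cm M"] uc_props[of x] by (simp add: c1(2) c2(2) del: Rep_simps(4))
 qed
qed

lemma ribbon_Rib: "ribbon_T_category P RB"
proof -
 interpret RB: twisted_category P RC RB by (rule tcat_Rib)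
 interpret BB: balanced_T_category P RB by (rule RB.balanced_T_category_D)
 have D: "dual_ob RB X = rib_dual P K VV H X" "coev RB X = Arr \<I>[RB] (X**[RB]dual_ob RB X) (rco (fst X))"
  "ev RB X = Arr (dual_ob RB X**[RB]X) \<I>[RB] (re (fst X))" for X
  by (simp_all add: Rib_def Let_def)
 have dO: "rib_dual P K VV H X = (rd (fst X), dtw (fst X) (snd X))" for X by (cases X) (simp add: rib_dual_eq)
 have dual_Ob: "dual_ob RB X:Ob RB" if "X:Ob RB" for X
  using that rib_dual_rib[of "fst X" "snd X"] by (simp add: D Rib_Ob dO)
 show ?thesis
 proof (intro ribbon_T_category.intro ribbon_T_category_axioms.intro RB.balanced_T_category_D, goal_cases)
  case (1 X)
  obtain M t where X: "X = (M, t)" by (cases X)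
  note r = 1[unfolded X Rib_Ob]
  note O = 1[unfolded X] dual_Ob[OF 1,unfolded D dO X fst_conv snd_conv]
  have [simp]: "hm M" using ribD(2)[OF r] .
  have c: "coev RB X:hom_set RB \<I>[RB] (X**[RB]dual_ob RB X)"
   unfolding D dO X fst_conv snd_conv
   by (rule RB.D_homI) (use O co_twist[OF r] co_hom(1)[of M] in \<open>simp_all add: BB.tens_ob_closed BB.unit_closed RB.D_fs hom_set_def del: Rep_simps(4,5,14)\<close>)
  have e: "ev RB X:hom_set RB (dual_ob RB X**[RB]X) \<I>[RB]"
   unfolding D dO X fst_conv snd_conv
   by (rule RB.D_homI) (use O ev_twist_rib[OF r] ev_hom(1)[of M] in \<open>simp_all add: BB.tens_ob_closed BB.unit_closed RB.D_fs hom_set_def del: Rep_simps(4,5,14)\<close>)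
  have O': "X:Ob RB" "dual_ob RB X:Ob RB" using 1 dual_Ob by auto
  have f: "fst X = M" "fst (dual_ob RB X) = rd M" by (simp_all add: X D dO)
  show ?case
   unfolding left_dual_def
   apply (intro conjI O' c e)
   using left_dual_Rep[of M]
   unfolding left_dual_def RB.inv_struct_D(1)[OF O'(1)] RB.inv_struct_D(2)[OF O'(2)] RB.inv_struct_D(3)[OF O'(2,1,2)]
   apply (simp_all add: RB.D_fld f D(2,3) del: Rep_simps(4,5))
   done
 next
  case 2
  then show ?case by (simp add: D dO RB.D_fld)
 next
  case (3 b X)
  obtain M t where X: "X = (M, t)" by (cases X)
  note r = 3(2)[unfolded X Rib_Ob] note [simp] = 3(1) ribD(2)[OF r]
  have d: "conj_ob RB b (dual_ob RB X) = dual_ob RB (conj_ob RB b X)"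
   using dtw_conj[OF ribD(1)[OF r] 3(1)] by (simp add: D dO X RB.D_simps rd_rc del: Rep_simps(14))
  show ?case
   using d conj_dual_Rep[of M b] 3 by (simp add: D(2,3) RB.D_fld RB.D_fs RB.conj_tens_D dual_Ob X del: Rep_simps(14))
 next
  case (4 X)
  obtain M t where X: "X = (M, t)" by (cases X)
  note r = 4[unfolded X Rib_Ob] note [simp] = ribD(2)[OF r]
  have f: "fst X = M" "fst (dual_ob RB X) = rd M" "snd (dual_ob RB X) = dtw M t" "snd X = t" by (simp_all add: X D dO)
  have d: "conj_ob RB b (dual_ob RB X) = dual_ob RB (conj_ob RB b X)" if "b:cr P" for b
   using dtw_conj[OF ribD(1)[OF r] that] that by (simp add: D dO X RB.D_simps rd_rc del: Rep_simps(14))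
  have f': "fst (dual_ob RB (conj_ob RB (gr M) X)) = rc (gr M) (rd M)" "snd (dual_ob RB (conj_ob RB (gr M) X)) = rj (gr M) (dtw M t)"
   using RB.D_fs(5,6)[of "gr M" "dual_ob RB X"] d[of "gr M"] by (simp_all add: f)
  note e = ribbon_Rep_eq[OF ribD(1)[OF r]]
  have c: "conj_ob RB (iv (gr M)) (conj_ob RB (gr M) (dual_ob RB X)) = dual_ob RB X"
   using RB.conj_conj_D[of "iv (gr M)" "gr M" "dual_ob RB X"] dual_Ob[OF 4] BB.conj_one by simp
  show ?case
   using e c by (simp add: RB.D_fld RB.D_fs f f' D(2,3) d del: Rep_simps(4,5,14))
 qed
qed

end

section \<open>Left duals, dual arrows and \<omega> in categories of twisted objects\<close>

context twisted_category
begin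

lemma left_dual_D:
 "left_dual D X Y b d \<longleftrightarrow> X:Ob D & Y:Ob D & b:hom_set D \<I>[D] (X**[D]Y) & d:hom_set D (Y**[D]X) \<I>[D] &
  left_dual B (fst X) (fst Y) (amap b) (amap d)"
proof (cases "X:Ob D & Y:Ob D & b:hom_set D \<I>[D] (X**[D]Y) & d:hom_set D (Y**[D]X) \<I>[D]")
 case True
 then have O: "X:Ob D" "Y:Ob D" by auto
 obtain b' where b: "b = Arr \<I>[D] (X**[D]Y) b'" "b':Ar B" "Dom B b' = fst \<I>[D]" "Cod B b' = fst (X**[D]Y)" using True by (auto elim!: D_homE)
 obtain d' where d: "d = Arr (Y**[D]X) \<I>[D] d'" "d':Ar B" "Dom B d' = fst (Y**[D]X)" "Cod B d' = fst \<I>[D]" using True by (auto elim!: D_homE)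
 show ?thesis
  using True b d O unfolding left_dual_def inv_struct_D(1)[OF O(1)] inv_struct_D(2)[OF O(2)] inv_struct_D(3)[OF O(2,1,2)]
  by (simp add: D_fld D_fs D_Ob' hom_set_def)
next
 case False
 then show ?thesis by (auto simp: left_dual_def)
qed

lemma omega_D:
 assumes O: "X:Ob D" "Y:Ob D"
 shows "omega D X Y b d = Arr (conj_ob D (Deg B (fst X)) (conj_ob D (Deg B (fst X)) X)) X (omega B (fst X) (fst Y) (amap b) (amap d))"
proof -
 let ?u = "Deg B (fst X)"
 let ?X1 = "conj_ob D ?u X" and ?Y1 = "conj_ob D ?u Y"
 let ?X2 = "conj_ob D ?u ?X1" and ?Y2 = "conj_ob D ?u ?Y1"
 have O': "?X1:Ob D" "?Y1:Ob D" "?X2:Ob D" "?Y2:Ob D" using O by (simp_all add: D_closed D_Ob' cat)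
 have [simp]: "?u:cr P" using O by (simp add: D_Ob' cat)
 have c: "inv_ar D (braid D ?X2 X) = Arr (conj_ob D (Deg B (fst ?X2)) X**[D]?X2) (?X2**[D]X) (inv_ar B (braid B (fst ?X2) (fst X)))"
  using braid_hom[OF O'(3) O(1)] O O' inv_D[of "?X2**[D]X" _ "braid B (fst ?X2) (fst X)"] by (simp add: D_fld D_Ob' cat)
 show ?thesis
  unfolding omega_def Let_def D_fld(9)
  unfolding c inv_struct_D(1)[OF O'(3)] inv_struct_D(3)[OF O'(4,3) O(1)]
  by (simp add: D_fld D_fs)
qed

lemma dual_arrow_D:
 assumes O: "Y:Ob D" "Z:Ob D" and f: "f:Ar D"
 shows "dual_arrow D Y b Z d f = Arr Z Y (dual_arrow B (fst Y) (amap b) (fst Z) (amap d) (amap f))"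
 using D_ArD[OF f] O unfolding dual_arrow_def D_fld(2) inv_struct_D(2)[OF O(2)] inv_struct_D(3)[OF O(2) D_ArD(5)[OF f] O(1)]
 by (simp add: D_fld D_fs)

end

section \<open>Objects with a good left dual\<close>

context qt_rep
begin

abbreviation "TE == twist_ext RC"

text \<open>Whatever the left dual, \<omega> acts as \<open>w\<close>; so the first condition on a
  good left dual depends on (M, t) only.\<close>

lemma rib_iff_omega:
 assumes X: "(M, t):Ob TE" and d: "left_dual TE (M, t) Y b d"
 shows "inv_ar TE (conj_ar TE (Deg TE (M, t)) (twist TE (M, t))\<bullet>[TE]twist TE (M, t)) = omega TE (M, t) Y b d \<longleftrightarrow> rib (M, t)"
proof -
 interpret TE: twisted_category P RC TE by (rule twisted_category_Rep)
 interpret TB: balanced_T_category P TE by (rule TE.balanced_T_category_D)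
 have t: "twisting M t" using X by (simp add: braided_T_category.twist_ext_Ob[OF bRC])
 note T = twD[OF t] note [simp] = T(1)
 let ?m = "gr M"
 have m [simp]: "?m:cr P" by simp
 define q where "q = rj ?m t oR t"
 note q = twisting_square(1)[OF t,folded q_def] and i = twisting_square(2)[OF t,folded q_def]
 have ih: "rv q:rh (rc ?m (rc ?m M)) M" using Rep_iso_amap(1)[OF q RC.inv_inv[OF i]] .
 note D = d[unfolded TE.left_dual_D fst_conv]
 have Y: "fst Y:Ob RC" "Y:Ob TE" and l: "left_dual RC M (fst Y) (amap b) (amap d)" using D TE.D_Ob'(1) by auto
 note l' = l[unfolded left_dual_def Rep_simps(6-11)]
 have N: "hm (fst Y)" using Y by simp
 note o = omega_eval[OF T(1) N, of "amap b" "amap d"]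
 have oh: "omega RC M (fst Y) (amap b) (amap d):rh (rc ?m (rc ?m M)) M"
  "!!x. x:elts M ==> amap (omega RC M (fst Y) (amap b) (amap d)) x = act M (w ?m) x"
  using o l' by blast+
 let ?X = "(M, t)"
 have "twist TE ?X:hom_set TE ?X (conj_ob TE ?m ?X)"
  using TB.twist_iso[OF X] by (simp add: TE.D_fld)
 moreover have "conj_ar TE ?m (twist TE ?X):hom_set TE (conj_ob TE ?m ?X) (conj_ob TE ?m (conj_ob TE ?m ?X))"
  by (rule TE.conj_hom[OF m calculation])
 ultimately have "conj_ar TE ?m (twist TE ?X)\<bullet>[TE]twist TE ?X:hom_set TE ?X (conj_ob TE ?m (conj_ob TE ?m ?X))"
  by (rule TE.comp_hom_D)
 moreover have e: "conj_ar TE ?m (twist TE ?X)\<bullet>[TE]twist TE ?X = Arr ?X (conj_ob TE ?m (conj_ob TE ?m ?X)) q"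
  by (simp add: TE.D_fld q_def del: Rep_simps(5,14))
 ultimately have "inv_ar TE (conj_ar TE ?m (twist TE ?X)\<bullet>[TE]twist TE ?X) = Arr (conj_ob TE ?m (conj_ob TE ?m ?X)) ?X (rv q)"
  using TE.inv_D[OF _ i] by simp
 then have "inv_ar TE (conj_ar TE (Deg TE ?X) (twist TE ?X)\<bullet>[TE]twist TE ?X) = omega TE ?X Y b d \<longleftrightarrow> rv q = omega RC M (fst Y) (amap b) (amap d)"
  using TE.omega_D[OF X Y(2),of b d] by (simp add: TE.D_fld(9) del: Rep_simps(5,14))
 also have "... \<longleftrightarrow> (\<forall>x\<in>elts M. amap (rv q) x = act M (w ?m) x)"
  using Rep_ar_eqI[OF ih oh(1)] oh(2) by auto
 also have "... \<longleftrightarrow> rib ?X"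
  using t T(1-3) unfolding is_rib_def Let_def fst_conv snd_conv q_def by (simp del: Rep_simps(5,14))
 finally show ?thesis .
qed

text \<open>The dual of (M, t) in Rib(H) serves as the good dual: its unit and counit are compatible
  with all conjugations, which gives stability, and its twist is by construction the conjugated dual
  arrow demanded by the second condition.\<close>

lemma rib_good:
 assumes "rib (M, t)"
 shows "\<exists>Y b d. good_left_dual P TE (M, t) Y b d"
proof -
 interpret TE: twisted_category P RC TE by (rule twisted_category_Rep)
 interpret E: tensor_category TE by (rule TE.tensor_category_D)
 note r = ribD[OF assms] note t = r(1) note T = twD[OF t] note [simp] = r(2) note dt = dual_twist[OF t]
 have X: "(M, t):Ob TE" and Y: "(rd M, dtw M t):Ob TE" using t dt(1) by (simp_all add: braided_T_category.twist_ext_Ob[OF bRC])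
 let ?X = "(M, t)" and ?Y = "(rd M, dtw M t)" and ?m = "gr M"
 let ?b = "Arr \<I>[TE] (?X**[TE]?Y) (rco M)" and ?d = "Arr (?Y**[TE]?X) \<I>[TE] (re M)"
 have b: "?b:hom_set TE \<I>[TE] (?X**[TE]?Y)"
  by (rule TE.D_homI) (use X Y co_twist[OF assms] co_hom(1)[of M] in \<open>simp_all add: E.tens_ob_closed E.unit_closed TE.D_fs hom_set_def del: Rep_simps(4,5,14)\<close>)
 have d: "?d:hom_set TE (?Y**[TE]?X) \<I>[TE]"
  by (rule TE.D_homI) (use X Y ev_twist_rib[OF assms] ev_hom(1)[of M] in \<open>simp_all add: E.tens_ob_closed E.unit_closed TE.D_fs hom_set_def del: Rep_simps(4,5,14)\<close>)
 have l: "left_dual TE ?X ?Y ?b ?d"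
  using X Y b d left_dual_Rep[of M] by (simp add: TE.left_dual_D)
 \<comment> \<open>A conjugation fixing M and t also fixes their dual, so it sends unit and counit
   to those of the same pair of objects.\<close>
 have "conj_ar TE \<beta> ?b = ?b & conj_ar TE \<beta> ?d = ?d" if \<beta>: "\<beta>:cr P" and c: "conj_ob TE \<beta> ?X = ?X" for \<beta>
 proof -
  have c': "rc \<beta> M = M" "rj \<beta> t = t" using c by (simp_all add: TE.D_simps(11))
  then have cY: "conj_ob TE \<beta> ?Y = ?Y" using dtw_conj[OF t \<beta>] rd_rc[of M \<beta>] \<beta> by (simp add: TE.D_simps(11) del: Rep_simps(14))
  show ?thesis
   using c cY c' conj_dual_Rep[of M \<beta>] \<beta> X Y by (simp add: TE.D_fld TE.conj_tens_D del: Rep_simps(14))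
 qed
 then have s: "stable_left_dual P TE ?X ?Y ?b ?d" using l by (simp add: stable_left_dual_def)
 have "twist TE ?Y = conj_ar TE (Deg TE ?Y) (dual_arrow TE ?Y ?b (conj_ob TE (Deg TE ?X) ?Y) (conj_ar TE (Deg TE ?X) ?d) (twist TE ?X))"
 proof -
  have f: "twist TE ?X:Ar TE" using balanced_T_category.twist_iso[OF TE.balanced_T_category_D X] by (simp add: hom_set_def)
  have c: "conj_ob TE ?m ?Y:Ob TE" by (rule TE.D_closed) (use Y in simp_all)
  have cc: "conj_ob TE (iv ?m) (conj_ob TE ?m ?Y) = ?Y"
   using TE.conj_conj_D[of "iv ?m" ?m ?Y] T_category.conj_one(1)[OF TE.T_category_D Y] Y by simp
  have "dtw M t = rj (iv ?m) (dual_arrow RC (rd M) (rco M) (rc ?m (rd M)) (rj ?m (re M)) t)"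
   by (simp add: dtw_def rib_dual_def Let_def conj_dual_Rep rd_rc del: Rep_simps(14))
  then show ?thesis
   unfolding TE.dual_arrow_D[OF Y c[folded TE.D_fld(9)[of ?X,simplified]] f]
   using cc by (simp add: TE.dual_arrow_D[OF Y c f] TE.D_fld TE.D_fs del: Rep_simps(14))
 qed
 then show ?thesis
  using s rib_iff_omega[OF X l] assms unfolding good_left_dual_def by blast
qed

text \<open>Both categories have the same objects, and in both the arrows are all arrows of the
  twist extension between them; so identity maps on objects and arrows do.\<close>

lemma Rib_good_subcat: "strict_isomorphism P RB (good_subcat P TE) (%X. X) (%f. f)"
proof -
 interpret TE: twisted_category P RC TE by (rule twisted_category_Rep)
 interpret RB: twisted_category P RC RB by (rule tcat_Rib)
 let ?g = "good_subcat P TE"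
 have Ob: "Ob ?g = Ob RB"
 proof -
  have "X:Ob TE & (\<exists>Y b d. good_left_dual P TE X Y b d) \<longleftrightarrow> rib X" for X
  proof
   assume "X:Ob TE & (\<exists>Y b d. good_left_dual P TE X Y b d)"
   then show "rib X"
    using rib_iff_omega[of "fst X" "snd X"] unfolding good_left_dual_def stable_left_dual_def prod.collapse by blast
  next
   assume "rib X"
   then show "X:Ob TE & (\<exists>Y b d. good_left_dual P TE X Y b d)"
    using rib_good[of "fst X" "snd X"] ribD(1)[of "fst X" "snd X"]
    unfolding braided_T_category.twist_ext_Ob[OF bRC] prod.collapse by blast
  qed
  then show ?thesis by (auto simp: good_subcat_def Let_def Rib_Ob)
 qed
 have O: "X:Ob TE" if "X:Ob RB" for X
  using that ribD(1)[of "fst X" "snd X"] by (simp add: Rib_Ob braided_T_category.twist_ext_Ob[OF bRC])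
 have f: "Dom ?g = adom" "Cod ?g = acod" "Id ?g = Id TE" "Comp ?g = Comp TE"
  "tens_ob ?g = tens_ob TE" "tens_ar ?g = tens_ar TE" "unit_ob ?g = unit_ob TE"
  "assoc ?g = assoc TE" "lunit ?g = lunit TE" "runit ?g = runit TE" "Deg ?g = Deg TE"
  "conj_ob ?g = conj_ob TE" "conj_ar ?g = conj_ar TE" "braid ?g = braid TE" "twist ?g = twist TE"
  by (simp_all add: good_subcat_def Let_def TE.D_simps(1,2))
 have "Ar ?g = {h:Ar TE. adom h:Ob RB & acod h:Ob RB}"
  unfolding Ob[symmetric] by (simp add: good_subcat_def Let_def TE.D_simps(1,2))
 also have "... = Ar RB"
  unfolding TE.D_Ar RB.D_Ar using O by (auto simp del: split_paired_Ex split_paired_All Rep_simps)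
 finally have Ar: "Ar ?g = Ar RB" .
 have u: "\<I>[TE] = \<I>[RB]" by (simp add: TE.D_simps(6) RB.D_simps(6))
 have c: "conj_ob TE b X = conj_ob RB b X" for b X by (simp add: TE.D_simps(11) RB.D_simps(11))
 have t: "X**[TE]Y = X**[RB]Y" if "X:Ob RB" "Y:Ob RB" for X Y
  using that O TE.D_tens RB.D_tens by simp
 have g: "Deg RC (fst X):cr P" if "X:Ob RB" for X using RB.D_Ob'(1)[OF that] by simp
 show ?thesis
  by (intro strict_isomorphism.intro strict_isomorphism_axioms.intro RB.balanced_T_category_D)
   (simp_all add: f Ob Ar O u c t g bij_betw_def RB.D_fld TE.D_fld RB.D_closed RB.D_ArD RB.D_Ob' del: Rep_simps)
qed

end

section \<open>Representations of the ribbon extension\<close>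

context qt_rep
begin

section \<open>The algebras of RT(H)\<close>

abbreviation "A2 == RT_alg P H"
abbreviation "hm2 == is_hmod P K (RT P K H)"

lemma A2_simps [simp]:
 "cr (A2 a) = cA a \<times> cA a"
 "(h, k)+[A2 a](h', k') = (h+[A a]h', k+[A a]k')"
 "r.*[A2 a](h, k) = (r.*[A a]h, r.*[A a]k)"
 "\<one>[A2 a] = (\<one>[A a], \<zero>[A a])" "\<zero>[A2 a] = (\<zero>[A a], \<zero>[A a])"
 "(h, k)*[A2 a](h', k') = (h*[A a]h'+[A a]k*[A a]ph a a k'*[A a]w a, h*[A a]k'+[A a]k*[A a]ph a a h')"
 by (simp_all add: RT_alg_def Let_def)

lemma A2_module [simp]:
 assumes a: "a:cr P"
 shows "module K (A2 a)"
proof -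
 interpret M: module K "A a" using a by (rule A_module)
 show ?thesis
 proof (rule moduleI, rule module.axioms(1)[OF A_module[OF a]], rule abelian_groupI)
  fix x assume "x:cr (A2 a)"
  then show "\<exists>y\<in>cr (A2 a). y+[A2 a]x = \<zero>[A2 a]"
   by (intro bexI[of _ "(\<ominus>\<^bsub>A a\<^esub> fst x, \<ominus>\<^bsub>A a\<^esub> snd x)"]) (auto simp: M.M.l_neg)
 qed (auto simp: M.M.a_ac M.smult_l_distr M.smult_r_distr M.smult_assoc1)
qed

definition winv :: "'g => 'h" where "winv a = inv\<^bsub>A a\<^esub> w a"

lemma winv:
 assumes a: "a:cr P"
 shows "winv a:cA a" "winv a*[A a]w a = \<one>[A a]" "w a*[A a]winv a = \<one>[A a]" "ph a a (winv a) = winv a"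
  "x:cA a ==> x*[A a]w a = \<one>[A a] ==> x = winv a"
proof -
 interpret A: ring "A a" using a by (rule A_ring)
 have u: "w a:Units (A a)" using a by (rule w_unit)
 show c: "winv a:cA a" "winv a*[A a]w a = \<one>[A a]" "w a*[A a]winv a = \<one>[A a]"
  using u by (simp_all add: winv_def)
 show q: "x = winv a" if "x:cA a" "x*[A a]w a = \<one>[A a]" for x
  using A.inv_unique[of x "w a" "winv a"] that c a by simp
 have "ph a a (winv a)*[A a]ph a a (w a) = ph a a (winv a*[A a]w a)"
  using a c(1) by (intro ph_mult[symmetric]) simp_all
 then show "ph a a (winv a) = winv a"
  using a c ph_hom(4)[OF a a] by (intro q) simp_all
qed

text \<open>In RT(H) the generator squares to \<open>w\<close>, so its inverse, which is the twist
  element, is w^-1 times the generator.\<close>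

lemma theta_RT:
 assumes a: "a:cr P"
 shows "theta (RT P K H) a = (\<zero>[A a], winv a)"
proof -
 interpret A: ring "A a" using a by (rule A_ring)
 note w = winv[OF a] and [simp] = a
 have z: "ph a a \<zero>[A a] = \<zero>[A a]"
  using lo_zero[OF A_module A_module ph_hom(1)[OF a a]] by simp
 have "inv\<^bsub>A2 a\<^esub> (\<zero>[A a], \<one>[A a]) = (\<zero>[A a], winv a)"
  unfolding m_inv_def
 proof (rule the_equality)
  show "(\<zero>[A a], winv a):cr (A2 a) & (\<zero>[A a], \<one>[A a])*[A2 a](\<zero>[A a], winv a) = \<one>[A2 a] & (\<zero>[A a], winv a)*[A2 a](\<zero>[A a], \<one>[A a]) = \<one>[A2 a]"
   using w(1-4) ph_hom(4)[OF a a] by (simp add: z)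
  fix y assume y: "y:cr (A2 a) & (\<zero>[A a], \<one>[A a])*[A2 a]y = \<one>[A2 a] & y*[A2 a](\<zero>[A a], \<one>[A a]) = \<one>[A2 a]"
  obtain h k where hk: "y = (h, k)" by (cases y)
  with y have c [simp]: "h:cA a" "k:cA a" by simp_all
  have "k*[A a]w a = \<one>[A a]" "h = \<zero>[A a]"
   using y ph_hom(4)[OF a a] unfolding hk by (simp_all add: z)
  then show "y = (\<zero>[A a], winv a)" using w(5)[of k] by (simp add: hk)
 qed
 then show ?thesis by (simp add: RT_def)
qed

lemma act_zero [simp]: "hm M ==> x:elts M ==> act M \<zero>[A (gr M)] x = \<zero>[sp M]"
 by (rule lo_zero[where f="%h. act M h x"]) (auto intro!: lin)

text \<open>The inverse of t as a map is the operator by which the generator of RT(H) acts. Its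
  commutation with h up to the crossing and its square \<open>w\<close>, proved next, are the
  relations of RT(H).\<close>

definition vi :: "('g, 'k, 'h, 'u) harr => 'u => 'u" where "vi t = amap (rv t)"

lemma vi:
 assumes "rib (M, t)"
 shows "lo K (sp M) (sp M) (vi t)" "x:elts M ==> vi t x:elts M"
  "x:elts M ==> vi t (amap t x) = x" "x:elts M ==> amap t (vi t x) = x"
  "x:elts M ==> h:cA (gr M) ==> vi t (act M h x) = act M (ph (gr M) (gr M) h) (vi t x)"
  "x:elts M ==> vi t (vi t x) = act M (w (gr M)) x"
proof -
 note r = ribD[OF assms] note T = twD[OF r(1)] note [simp] = r(2) T(5)
 note i = Rep_iso_amap[OF T(2) RC.inv_inv[OF T(3)], folded vi_def]
 show l: "lo K (sp M) (sp M) (vi t)" "x:elts M ==> vi t x:elts M"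
  using Rep_homD(7,8)[OF i(1)] by (simp_all add: vi_def)
 show e: "x:elts M ==> vi t (amap t x) = x" "x:elts M ==> amap t (vi t x) = x" for x
  using i by simp_all
 show "x:elts M ==> h:cA (gr M) ==> vi t (act M h x) = act M (ph (gr M) (gr M) h) (vi t x)"
  using Rep_homD(9)[OF i(1), of "gr M" "ph (gr M) (gr M) h" x] by (simp add: vi_def)
 assume x: "x:elts M"
 have v: "vi t x:elts M" "vi t (vi t x):elts M" using x Rep_homD(8)[OF i(1)] by (simp_all add: vi_def)
 have "amap t (amap t (vi t (vi t x))) = x" by (simp only: e(2)[OF v(1)] e(2)[OF x])
 with r(3)[OF v(2)] show "vi t (vi t x) = act M (w (gr M)) x" by metis
qed

text \<open>A pair (h, k) stands for h plus k times the generator and acts as h + k t^-1. The maps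
  are restricted because actions are extensional, which makes \<open>RF\<close> a bijection on
  objects and not only an equivalence.\<close>

definition RF :: "('g, 'k, 'h, 'u) hmod \<times> ('g, 'k, 'h, 'u) harr => ('g, 'k, 'h \<times> 'h, 'u) hmod" where
 "RF X = \<lparr> grade = gr (fst X), space = sp (fst X),
  act = (\<lambda>q\<in>cr (A2 (gr (fst X))). \<lambda>x\<in>elts (fst X).
   act (fst X) (fst q) x+[sp (fst X)]act (fst X) (snd q) (vi (snd X) x)) \<rparr>"

lemma RF_simps [simp]:
 "gr (RF (M, t)) = gr M" "sp (RF (M, t)) = sp M"
 "h:cA (gr M) ==> k:cA (gr M) ==> x:elts M ==>
  act (RF (M, t)) (h, k) x = act M h x+[sp M]act M k (vi t x)"
 "act (RF (M, t)):extensional (cA (gr M) \<times> cA (gr M))"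
 "q:cA (gr M) \<times> cA (gr M) ==> act (RF (M, t)) q:extensional (elts M)"
 by (auto simp: RF_def)

lemma hm2_iff:
 "hm2 N \<longleftrightarrow> gr N:cr P & fd_space K (sp N) & bo K (A2 (gr N)) (sp N) (sp N) (act N) &
  (\<forall>a\<in>cr (A2 (gr N)). \<forall>b\<in>cr (A2 (gr N)). \<forall>x\<in>elts N. act N (a*[A2 (gr N)]b) x = act N a (act N b x)) &
  (\<forall>x\<in>elts N. act N \<one>[A2 (gr N)] x = x) &
  act N:extensional (cr (A2 (gr N))) & (\<forall>a\<in>cr (A2 (gr N)). act N a:extensional (elts N))"
 unfolding is_hmod_def Let_def by (simp add: RT_def del: A2_simps)

lemma hm2_RF:
 assumes "rib X"
 shows "hm2 (RF X)"
proof -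
 obtain M t where X: "X = (M, t)" by (cases X)
 note r = ribD[OF assms[unfolded X]] note v = vi[OF assms[unfolded X]] note [simp] = r(2) v(2)
 interpret V: module K "sp M" by simp
 show ?thesis
  unfolding hm2_iff
 proof (intro conjI ballI)
  have l: "lo K (A (gr M)) (sp M) (%h. act M h x)" "lo K (sp M) (sp M) (act M h)"
   if "x:elts M" "h:cA (gr M)" for x h
   using that by (auto intro!: lin)
  show "bo K (A2 (gr (RF X))) (sp (RF X)) (sp (RF X)) (act (RF X))"
  proof (rule boI)
   fix q assume q: "q:cr (A2 (gr (RF X)))"
   show "lo K (sp (RF X)) (sp (RF X)) (%x. act (RF X) q x)"
    using q by (auto simp: X loD[OF l(2)] loD[OF v(1)] V.M.a_ac V.smult_r_distr intro!: loI)
  next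
   fix x assume x: "x:elts (RF X)"
   show "lo K (A2 (gr (RF X))) (sp (RF X)) (%q. act (RF X) q x)"
    using x by (auto simp: X loD[OF l(1)] V.M.a_ac V.smult_r_distr intro!: loI)
  qed
  show "act (RF X) (p*[A2 (gr (RF X))]q) x = act (RF X) p (act (RF X) q x)"
   if "p:cr (A2 (gr (RF X)))" "q:cr (A2 (gr (RF X)))" "x:elts (RF X)" for p q x
   using that by (cases p; cases q) (auto simp: X loD[OF l(1)] loD[OF l(2)] loD[OF v(1)] v(5,6) act_mult[OF r(2) HOL.refl] V.M.a_ac)
  show "act (RF X) \<one>[A2 (gr (RF X))] x = x" if "x:elts (RF X)" for x
   using that by (simp add: X)
 qed (simp_all add: X)
qed

text \<open>H acts through the first components, and t is the action of the inverse generator. That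
  t is linear into the conjugate and has inverse square \<open>w\<close> are the relations of
  RT(H).\<close>

lemma RF_surj:
 assumes "hm2 N"
 shows "\<exists>X. rib X & RF X = N"
proof -
 let ?g = "gr N" and ?V = "sp N"
 note N = assms[unfolded hm2_iff]
 let ?A = "A2 ?g"
 have g [simp]: "?g:cr P" "fd_space K ?V" using N by auto
 interpret V: module K ?V by simp
 interpret A: module K "A ?g" by simp
 interpret AR: ring "A ?g" by (rule A_ring) simp
 have bil: "bo K ?A ?V ?V (act N)" using N by auto
 note b1 = loD[OF boD(1)[OF bil]] and b2 = loD[OF boD(2)[OF bil]]
 have mul: "act N (a*[?A]b) x = act N a (act N b x)" if "a:cr ?A" "b:cr ?A" "x:elts N" for a b x
  using N that by auto
 have one: "act N (\<one>[A ?g], \<zero>[A ?g]) x = x" if "x:elts N" for x using N that by simp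
 have z: "ph ?g ?g \<zero>[A ?g] = \<zero>[A ?g]" "ph ?g ?g \<one>[A ?g] = \<one>[A ?g]"
  using lo_zero[OF A_module A_module ph_hom(1)[of ?g ?g]] ph_hom(4)[of ?g ?g] by simp_all
 note W = winv[OF g(1)]
 define M where "M = \<lparr> grade = ?g, space = ?V, act = (\<lambda>h\<in>cA ?g. \<lambda>x\<in>elts N. act N (h, \<zero>[A ?g]) x) \<rparr>"
 have M: "gr M = ?g" "sp M = ?V" "!!h x. h:cA ?g ==> x:elts N ==> act M h x = act N (h, \<zero>[A ?g]) x"
  by (simp_all add: M_def)
 let ?v = "act N (\<zero>[A ?g], \<one>[A ?g])" and ?t = "act N (\<zero>[A ?g], winv ?g)"
 have hM: "hm M"
 proof (rule hmodI[OF _ _ HOL.refl])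
  show "lo K (sp M) (sp M) (act M h)" if "h:cA (gr M)" for h
   using that by (intro loI) (auto simp: M b1)
  show "lo K (A (gr M)) (sp M) (%h. act M h x)" if "x:elts M" for x
   using that b2(2)[of x "(_, \<zero>[A ?g])" "(_, \<zero>[A ?g])"] b2(3)[of x _ "(_, \<zero>[A ?g])"] by (intro loI) (auto simp: M b1)
  show "act M (h*[A (gr M)]k) x = act M h (act M k x)" if "h:cA (gr M)" "k:cA (gr M)" "x:elts M" for h k x
   using that mul[of "(h, \<zero>[A ?g])" "(k, \<zero>[A ?g])" x] by (simp add: M b1 z)
 qed (auto simp: M one, auto simp: M_def)
 have v: "lo K ?V ?V ?v" "lo K ?V ?V ?t" using boD(1)[OF bil] W(1) by simp_all
 note [simp] = loD(1)[OF v(1)] loD(1)[OF v(2)]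
 have vt: "?v (?t x) = x" "?t (?v x) = x" if "x:elts N" for x
  using mul[of "(\<zero>[A ?g], \<one>[A ?g])" "(\<zero>[A ?g], winv ?g)" x] mul[of "(\<zero>[A ?g], winv ?g)" "(\<zero>[A ?g], \<one>[A ?g])" x] W(1-4) z that one by simp_all
 have vv: "?v (?v x) = act M (w ?g) x" if "x:elts N" for x
  using mul[of "(\<zero>[A ?g], \<one>[A ?g])" "(\<zero>[A ?g], \<one>[A ?g])" x] z that by (simp add: M)
 have vh: "?v (act M h x) = act M (ph ?g ?g h) (?v x)" if "x:elts N" "h:cA ?g" for h x
  using mul[of "(\<zero>[A ?g], \<one>[A ?g])" "(h, \<zero>[A ?g])" x] mul[of "(ph ?g ?g h, \<zero>[A ?g])" "(\<zero>[A ?g], \<one>[A ?g])" x] z that by (simp add: M)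
 have th: "?t (act M h x) = act M (ph (iv ?g) ?g h) (?t x)" if x: "x:elts N" and h: "h:cA ?g" for h x
 proof -
  have "act M h x = ?v (act M (ph (iv ?g) ?g h) (?t x))"
   using vh[of "?t x" "ph (iv ?g) ?g h"] vt x h by simp
  then show ?thesis using vt(2)[of "act M (ph (iv ?g) ?g h) (?t x)"] x h hmD(4)[OF hM, of ?g "ph (iv ?g) ?g h" "?t x"] by (simp add: M(1,2))
 qed
 define t where "t = Arr M (rc ?g M) (restrict ?t (elts N))"
 have t: "t:rh M (rc (gr M) M)"
  unfolding t_def Rep_hom_iff arr.sel
  using hM v(2) th hmD(4)[OF hM] by (intro conjI hmod_linearI) (auto simp: M(1,2) lo_cong[where f="restrict _ _"])
 have "bij_betw (amap t) (elts M) (elts (rc (gr M) M))"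
  by (rule bij_betwI[where g="?v"]) (auto simp: t_def M(2) vt)
 then have tw: "twisting M t" using t Rep_iso_bij[OF t] by (simp add: tw_iff)
 have "act M (w (gr M)) (amap t (amap t x)) = x" if "x:elts M" for x
  using that vv[of "?t (?t x)"] vt by (simp add: t_def M(1,2))
 then have r: "rib (M, t)" using tw by (simp add: is_rib_iff)
 have vi: "vi t x = ?v x" if "x:elts N" for x
  using vi(3)[OF r, of "?v x"] that vt by (simp add: M(2) t_def)
 have "RF (M, t) = N"
 proof -
  have "act (RF (M, t)) q x = act N q x" if "q:cr ?A" "x:elts N" for q x
  proof -
   obtain h k where q: "q = (h, k)" by (cases q)
   have c: "h:cA ?g" "k:cA ?g" using that q by simp_all
   have "act N (k, \<zero>[A ?g]) (?v x) = act N (\<zero>[A ?g], k) x"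
    using mul[of "(k, \<zero>[A ?g])" "(\<zero>[A ?g], \<one>[A ?g])" x] that c z by simp
   then show ?thesis
    using that c b2(2)[of x "(h, \<zero>[A ?g])" "(\<zero>[A ?g], k)"] by (simp add: q M vi)
  qed
  moreover have "act N:extensional (cr ?A)" "!!q. q:cr ?A ==> act N q:extensional (elts N)" using N by auto
  ultimately have "act (RF (M, t)) = act N"
   by (intro extensionalityI[where A="cr ?A"] extensionalityI[where A="elts N"]) (use RF_simps(4)[of M t] RF_simps(5)[of _ M t] in \<open>auto simp: M(1,2)\<close>)
  then show ?thesis using M by simp
 qed
 then show ?thesis using r by blast
qed

text \<open>Setting k = 0 recovers the action of H; setting h = 0 and k = 1 recovers t^-1, hence
  t.\<close>

lemma RF_inj:
 assumes "rib X" "rib Y" "RF X = RF Y"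
 shows "X = Y"
proof -
 obtain M t N s where X: "X = (M, t)" "Y = (N, s)" by (cases X; cases Y)
 note r = ribD[OF assms(1)[unfolded X]] and r' = ribD[OF assms(2)[unfolded X]] and v = vi[OF assms(1)[unfolded X]] and v' = vi[OF assms(2)[unfolded X]]
 note [simp] = r(2) r'(2) v(2) v'(2)
 interpret V: module K "sp M" by simp
 interpret W: module K "sp N" by simp
 have e: "gr M = gr N" "sp M = sp N" using arg_cong[OF assms(3),of gr] arg_cong[OF assms(3),of sp] by (simp_all add: X)
 have a: "act M h x+[sp M]act M k (vi t x) = act N h x+[sp N]act N k (vi s x)"
  if "h:cA (gr M)" "k:cA (gr M)" "x:elts M" for h k x
  using arg_cong[OF assms(3), of "%N. act N (h, k) x"] that e by (simp add: X)
 have "act M h x = act N h x" if "h:cA (gr M)" "x:elts M" for h x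
  using a[of h "\<zero>[A (gr M)]" x] that e hmD(4)[OF r(2) HOL.refl] hmD(4)[OF r'(2) HOL.refl] act_zero[OF r'(2)] act_zero[OF r(2)] v(2) v'(2) by simp
 then have MN: "M = N"
  using act_ext[OF r(2)] act_ext[OF r'(2)] e by (intro hmod_eqI[OF e HOL.refl]) auto
 have vi: "vi t x = vi s x" if "x:elts M" for x
  using a[of "\<zero>[A (gr M)]" "\<one>[A (gr M)]" x] that v(2) v'(2) by (simp flip: MN)
 have "t = s"
 proof (rule Rep_ar_eqI[OF twD(2)[OF r(1)]])
  show "s:rh M (rc (gr M) M)" using twD(2)[OF r'(1)] MN by simp
  fix x assume x: "x:elts M"
  show "amap t x = amap s x"
   using v'(4)[of "amap t x"] v(3)[OF x] vi[of "amap t x"] twD(5)[OF r(1) x] by (simp flip: MN)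
 qed
 then show ?thesis using X MN by simp
qed

text \<open>The generator acts as t^-1, and since t is invertible, a map compatible with t^-1 is
  compatible with t and conversely.\<close>

lemma RF_linear:
 assumes "rib (M, t)" "rib (N, s)"
 shows "hmod_linear K (RT P K H) (RF (M, t)) (RF (N, s)) f \<longleftrightarrow> hl M N f & (\<forall>x\<in>elts M. f (amap t x) = amap s (f x))"
proof -
 note r = ribD[OF assms(1)] and r' = ribD[OF assms(2)] and v = vi[OF assms(1)] and v' = vi[OF assms(2)]
 note [simp] = r(2) r'(2) v(2) v'(2) twD(5)[OF r(1)] twD(5)[OF r'(1)]
 interpret V: module K "sp M" by simp
 interpret W: module K "sp N" by simp
 have alg: "alg (RT P K H) = A2" by (simp add: RT_def)
 show ?thesis
 proof
  assume L: "hmod_linear K (RT P K H) (RF (M, t)) (RF (N, s)) f"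
  then have g: "gr M = gr N" and f: "f:extensional (elts M)" "lo K (sp M) (sp N) f" by (simp_all add: hmod_linear_def)
  note fc = loD(1)[OF f(2)]
  have e: "f (act M h x+[sp M]act M k (vi t x)) = act N h (f x)+[sp N]act N k (vi s (f x))"
   if "h:cA (gr M)" "k:cA (gr M)" "x:elts M" for h k x
   using L that fc g by (force simp: hmod_linear_def alg)
  have "f (act M h x) = act N h (f x)" if "h:cA (gr M)" "x:elts M" for h x
   using e[of h "\<zero>[A (gr M)]" x] that fc g act_zero[OF r'(2)] hmD(4)[OF r'(2), of "gr M" h "f x"]
    act_zero[OF r(2), of "vi t x"] hmD(4)[OF r(2), of "gr M" h x] by simp
  then have 1: "hl M N f" using g f by (intro hmod_linearI) auto
  have vf: "f (vi t x) = vi s (f x)" if "x:elts M" for x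
   using e[of "\<zero>[A (gr M)]" "\<one>[A (gr M)]" x] that fc g act_zero[OF r'(2)] hmD(3)[OF r'(2)]
    act_zero[OF r(2),of x] hmD(3)[OF r(2), of "vi t x"] by simp
  have "f (amap t x) = amap s (f x)" if "x:elts M" for x
   using vf[of "amap t x"] v(3)[OF that] v'(4)[of "f (amap t x)"] that fc by simp
  then show "hl M N f & (\<forall>x\<in>elts M. f (amap t x) = amap s (f x))" using 1 by blast
 next
  assume R: "hl M N f & (\<forall>x\<in>elts M. f (amap t x) = amap s (f x))"
  note L = hmod_linearD[OF conjunct1[OF R]]
  have vf: "f (vi t x) = vi s (f x)" if "x:elts M" for x
  proof -
   have "vi s (amap s (f (vi t x))) = vi s (f (amap t (vi t x)))" using R that by simp
   then show ?thesis using that v(4)[OF that] v'(3)[of "f (vi t x)"] L(4) by simp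
  qed
  show "hmod_linear K (RT P K H) (RF (M, t)) (RF (N, s)) f"
   unfolding hmod_linear_def alg
   using L vf by (auto simp: lo_add[OF L(3)])
 qed
qed

text \<open>The twist of M \<otimes> N is inverted by undoing the twists of the factors and then the
  two braidings in reverse order. The inverse R-matrices met on the way are those in the
  comultiplication of the generator.\<close>

lemma vi_tensor:
 assumes "rib (M, t)" "rib (N, s)"
 defines "a == gr M" and "b == gr N" and "c == cj (gr M) (gr N)"
 assumes x: "x:elts M" and y: "y:elts N"
 shows "vi (tt M t N s) (mp M N x y) = tsum (ms M N) (%p q. tsum (ms M N) (%p' q'.
  mp M N (act M (p*[A a]q') (vi t x)) (act N (q*[A b]ph (iv a) c p') (vi s y))) (Ri c a)) (Ri a b)"
proof -
 note r = ribD[OF assms(1)] and r' = ribD[OF assms(2)] and v = vi[OF assms(1)] and v' = vi[OF assms(2)]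
 note T = twD[OF r(1)] and S = twD[OF r'(1)]
 note [simp] = r(2) r'(2) v(2) v'(2) x y T(5) S(5)
 have g [simp]: "a:cr P" "b:cr P" "c:cr P" "gr M = a" "gr N = b" "cj (iv a) c = b" "cj a b = c"
  by (simp_all add: a_def b_def c_def)
 let ?N = "rc a N" and ?X = "vi t x" and ?Y = "vi s y" and ?T = "ms M N"
 note i1 = Rep_iso_amap[OF rb_hom(1)[OF r(2) r'(2)] rb_iso[OF r(2) r'(2)]]
 have hN: "hm ?N" by simp
 note i2 = Rep_iso_amap[OF rb_hom(1)[OF hN r(2)] rb_iso[OF hN r(2)]]
 have Ri: "Ri a b:cr (AA M N)" "Ri c a:cr (AA ?N M)" by (simp_all add: Ri_closed)
 \<comment> \<open>The inverse braidings are applied to the untwisted pure tensor, giving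
   \<open>z1\<close> and then \<open>E\<close>; afterwards the twist is checked to send
   \<open>E\<close> to the tensor of x and y.\<close>
 define z1 where "z1 = top ?N M (Ri c a) (flip M ?N (mp M N ?X ?Y))"
 define E where "E = top M N (Ri a b) (flip N M z1)"
 note f1 = flip_props[OF r(2) hN] and f2 = flip_props[OF r'(2) r(2)]
 have z1: "z1 = tsum (ms N M) (%p' q'. mp N M (act N (ph (iv a) c p') ?Y) (act M q' ?X)) (Ri c a)"
  using f1(2)[of ?X ?Y] top_pure[OF hN r(2) Ri(2),of ?Y ?X] unfolding z1_def
  by simp (rule tsum_cong[of K "A c" "A a"], auto simp: Ri_closed)
 have z1c [simp]: "z1:cr (ms N M)" using f1(3)[of "mp M N ?X ?Y"] top_closed[OF hN r(2) Ri(2)] by (simp add: z1_def)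
 have Ec [simp]: "E:cr ?T" using f2(3)[OF z1c] top_closed[OF r(2) r'(2) Ri(1)] by (simp add: E_def)
 have e1: "amap (rb M N) E = z1" using i1(3)[of z1] f2(3)[OF z1c] by (simp add: E_def)
 have e2: "amap (rb ?N M) z1 = mp M N ?X ?Y" using i2(3)[of "mp M N ?X ?Y"] by (simp add: z1_def)
 define t1 where "t1 = rj c t"
 define s1 where "s1 = rj a s"
 have t1: "t1:rh (rc c M) (rc c (rc a M))" "amap t1 = amap t"
  and s1: "s1:rh (rc a N) (rc a (rc b N))" "amap s1 = amap s"
  using rc_ar_hom[OF _ T(2),of c] rc_ar_hom[OF _ S(2),of a] by (simp_all add: t1_def s1_def)
 note f = Rep_tens[OF t1(1) s1(1)]
 have cc: "rb ?N M oR rb M N:rh (mt M N) (mt (rc c M) ?N)"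
  using db_eval(1)[OF r(2) r'(2)] by (simp del: Rep_simps(5))
 have "amap (tt M t N s) E = amap (rt t1 s1) (amap (rb ?N M oR rb M N) E)"
  using Rep_comp(2)[OF cc f(1),of E]
  by (simp add: braided_T_category.twist_tensor_def[OF bRC] braided_T_category.double_braid_def[OF bRC] s1_def t1_def del: Rep_simps(5,14))
 also have "... = amap (rt t1 s1) (mp M N ?X ?Y)"
  using Rep_comp(2)[OF rb_hom(1)[OF r(2) r'(2),unfolded g(4)] rb_hom(1)[OF hN r(2)], of E] e1 e2 by (simp del: Rep_simps(5))
 also have "... = mp M N x y"
  using f(2)[of ?X ?Y] v(4) v'(4) by (simp add: t1(2) s1(2))
 finally have "vi (tt M t N s) (mp M N x y) = E"
  using vi(3)[OF rib_tensor[OF assms(1,2)], of E] by simp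
 also have "E = tsum ?T (%p' q'. top M N (Ri a b) (flip N M (mp N M (act N (ph (iv a) c p') ?Y) (act M q' ?X)))) (Ri c a)"
  unfolding E_def z1
  by (rule tsum_out[of K "A c" "A a", OF _ _ _ _ lo_compose[OF f2(1) top_linear[OF r(2) r'(2) Ri(1)]]]) (auto simp: Ri_closed)
 also have "... = tsum ?T (%p' q'. tsum ?T (%p q.
   mp M N (act M (p*[A a]q') (vi t x)) (act N (q*[A b]ph (iv a) c p') (vi s y))) (Ri a b)) (Ri c a)"
  using f2(2) top_pure[OF r(2) r'(2) Ri(1)]
  by (intro tsum_cong[of K "A c" "A a"]) (auto simp: Ri_closed act_mult intro!: tsum_cong[of K "A a" "A b"])
 also have "... = tsum ?T (%p q. tsum ?T (%p' q'.
   mp M N (act M (p*[A a]q') (vi t x)) (act N (q*[A b]ph (iv a) c p') (vi s y))) (Ri c a)) (Ri a b)"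
  by (rule tsum_swap[of K "A c" "A a" "A a" "A b"]) (auto simp: Ri_closed)
 finally show ?thesis .
qed

lemma RF_eqI:
 assumes "rib (M, t)" "gr N = gr M" "sp N = sp M"
  "act N:extensional (cr (A2 (gr M)))" "!!q. q:cr (A2 (gr M)) ==> act N q:extensional (elts M)"
  "!!h k x. h:cA (gr M) ==> k:cA (gr M) ==> x:elts M ==> act N (h, k) x = act M h x+[sp M]act M k (vi t x)"
 shows "N = RF (M, t)"
proof -
 have "act N q = act (RF (M, t)) q" if q: "q:cr (A2 (gr M))" for q
  by (rule extensionalityI[OF assms(5)[OF q] RF_simps(5)]) (use q assms(6) in auto)
 then have "act N = act (RF (M, t))"
  using RF_simps(4)[of M t] assms(4) by (intro extensionalityI[where A="cr (A2 (gr M))"]) auto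
 then show ?thesis using assms(2,3) by simp
qed

abbreviation "R2 == RT P K H"

lemma RT_simps: "alg R2 = A2" "counit R2 (h, k) = ep h+[K]ep k"
 "crossing R2 b a (h, k) = (ph b a h, ph b a k)" "antipode R2 a (h, k) = (S a h, S a (ph (iv a) a k))"
 by (simp_all add: RT_def)

text \<open>Keeps the vector general, so that the parts of k can act after the generator has acted
  on M \<otimes> N as a whole.\<close>

lemma act_mt_tsum:
 assumes M [simp]: "hm M" and N [simp]: "hm N" and h: "h:cA (gr M*[P]gr N)" and z [simp]: "z:cr (ms M N)"
 shows "act (mt M N) h z = tsum (ms M N) (%p q. top M N (pure K (A (gr M)) (A (gr N)) p q) z) (De (gr M) (gr N) h)"
proof -
 let ?A = "A (gr M)" and ?B = "A (gr N)" and ?t = "De (gr M) (gr N) h"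
 have t: "?t:cr (AA M N)" using h by (simp add: De_closed)
 have "act (mt M N) h z = top M N (tsum (AA M N) (pure K ?A ?B) ?t) z"
  using h tsum_pure_id[of K ?A ?B ?t] t by (simp add: act_mt)
 also have "... = tsum (ms M N) (%p q. top M N (pure K ?A ?B p q) z) ?t"
  by (rule tsum_out[of K ?A ?B, OF _ _ _ _ linear_top_left[OF M N z] t]) (auto intro: mod_tensor)
 finally show ?thesis .
qed

lemma RF_act_bilinear:
 assumes "rib (M, t)"
 shows "bo K (A2 (gr M)) (sp M) (sp M) (act (RF (M, t)))"
 using hm2_RF[OF assms,unfolded hm2_iff] by simp

text \<open>Both modules have the same space, so only the actions are compared. The summand of the
  comultiplication without the generator gives the action of h; the one with it gives k applied to
  the inverse twist, by \<open>vi_tensor\<close>.\<close>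

lemma RF_tens:
 assumes "rib (M, t)" "rib (N, s)"
 shows "rep_tens P K VV R2 (RF (M, t)) (RF (N, s)) = RF (mt M N, tt M t N s)"
proof -
 note r = ribD[OF assms(1)] and r' = ribD[OF assms(2)] and v = vi[OF assms(1)] and v' = vi[OF assms(2)]
 note rr = rib_tensor[OF assms] note V = vi[OF rr]
 note [simp] = r(2) r'(2) v(2) v'(2)
 let ?a = "gr M" and ?b = "gr N" and ?c = "cj (gr M) (gr N)" and ?T = "ms M N"
 let ?TT = "tensor K (A2 ?a) (A2 ?b)" and ?N = "rep_tens P K VV R2 (RF (M, t)) (RF (N, s))"
 let ?B = "%x y p q. mp M N (act (RF (M, t)) p x) (act (RF (N, s)) q y)"
 note b1 = RF_act_bilinear[OF assms(1)] and b2 = RF_act_bilinear[OF assms(2)]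
 note l1 = boD[OF b1] and l2 = boD[OF b2]
 note [simp] = loD(1)[OF l1(1)] loD(1)[OF l2(1)]
 let ?m = "mt M N" and ?d = "?a*[P]?b" and ?t = "tt M t N s" and ?R = "Ri ?c ?a" and ?e = "Ri ?a ?b"
 have TT: "module K ?TT" by (simp add: mod_tensor)
 interpret T: module K ?T by simp
 interpret M: module K "sp M" by simp
 interpret N: module K "sp N" by simp
 have B1: "bo K (A2 ?a) (A2 ?b) ?T (?B x y)" if "x:elts M" "y:elts N" for x y
  using that by (intro boI linear_tp_left linear_tp_right l1 l2) simp_all
 have B2: "bo K (sp M) (sp N) ?T (%x y. tsum ?T (?B x y) D)" if "D:cr ?TT" for D
  using that by (intro boI lo_tsum[of K "A2 ?a" "A2 ?b"] linear_tp_left linear_tp_right l1 l2) simp_all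
 define D1 where "D1 h = tsum ?TT (%h' h''. pure K (A2 ?a) (A2 ?b) (h', \<zero>[A ?a]) (h'', \<zero>[A ?b])) (De ?a ?b h)" for h
 \<comment> \<open>The nested sums in the comultiplication of RT(H), named from the inside out; the
   bilinear evaluation \<open>?B\<close> is pushed through them one level at a time.\<close>
 define D4 where "D4 = (%k' k'' p q p' q'. pure K (A2 ?a) (A2 ?b) (\<zero>[A ?a], k'*[A ?a]p*[A ?a]q')
  (\<zero>[A ?b], k''*[A ?b]q*[A ?b]ph (iv ?a) ?c p'))"
 define D3 where "D3 = (%k' k'' p q. tsum ?TT (D4 k' k'' p q) ?R)"
 define D2 where "D2 = (%k' k''. tsum ?TT (D3 k' k'') ?e)"
 have com: "comult R2 ?a ?b (h, k) = D1 h+[?TT]tsum ?TT D2 (De ?a ?b k)" for h k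
  by (simp add: RT_def Let_def D1_def D2_def D3_def D4_def del: A2_simps)
 have [simp]: "?c:cr P" "cj (iv ?a) ?c = ?b" by simp_all
 have D4c: "D4 k' k'' p q p' q':cr ?TT"
  if "k':cA ?a" "k'':cA ?b" "p:cA ?a" "q:cA ?b" "p':cA ?c" "q':cA ?a" for k' k'' p q p' q'
  using that by (simp add: D4_def)
 have D3c: "D3 k' k'' p q:cr ?TT"
  if "k':cA ?a" "k'':cA ?b" "p:cA ?a" "q:cA ?b" for k' k'' p q
  unfolding D3_def using that D4c by (intro tsum_closed[of K "A ?c" "A ?a"] TT) (simp_all add: Ri_closed)
 have D2c: "D2 k' k'':cr ?TT" if "k':cA ?a" "k'':cA ?b" for k' k''
  unfolding D2_def using that D3c by (intro tsum_closed[of K "A ?a" "A ?b"] TT) (simp_all add: Ri_closed)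
 have cc: "De ?a ?b h:cr (AA M N)" if "h:cA ?d" for h using that by (simp add: De_closed)
 have D1c: "D1 h:cr ?TT" if "h:cA ?d" for h
  unfolding D1_def using that by (intro tsum_closed[of K "A ?a" "A ?b"] TT cc) simp_all
 have DDc: "tsum ?TT D2 (De ?a ?b k):cr ?TT" if "k:cA ?d" for k
  using that D2c by (intro tsum_closed[of K "A ?a" "A ?b"] TT cc) simp_all
 have comc: "comult R2 ?a ?b (h, k):cr ?TT" if "h:cA ?d" "k:cA ?d" for h k
  using abelian_monoid.a_closed[OF abelian_group.axioms(1)[OF module.axioms(2)[OF TT]] D1c[OF that(1)] DDc[OF that(2)]] by (simp add: com)
 have actN: "act ?N (h, k) = lft (sp M) (sp N) ?T (%x y. tsum ?T (?B x y) (comult R2 ?a ?b (h, k)))"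
  if "h:cA ?d" "k:cA ?d" for h k
  using that by (simp add: rep_tens_def Let_def RT_simps)
 have e: "tsum ?T (?B x y) (comult R2 ?a ?b (h, k)) = act ?m h (mp M N x y)+[?T]act ?m k (vi ?t (mp M N x y))"
  if h: "h:cA ?d" and k: "k:cA ?d" and x [simp]: "x:elts M" and y [simp]: "y:elts N" for h k x y
 proof -
  let ?L = "tsum ?T (?B x y)" and ?v = "vi ?t (mp M N x y)"
  have L: "lo K ?TT ?T ?L" by (rule lo_tsum_tensor[OF A2_module A2_module _ B1]) simp_all
  have Lp: "?L (pure K (A2 ?a) (A2 ?b) p q) = ?B x y p q" if "p:cr (A2 ?a)" "q:cr (A2 ?b)" for p q
   by (rule tsum_pure[OF A2_module A2_module _ B1]) (use that in simp_all)
  have 1: "?L (D1 h) = act ?m h (mp M N x y)"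
  proof -
   have "?L (D1 h) = tsum ?T (%h' h''. ?L (pure K (A2 ?a) (A2 ?b) (h', \<zero>[A ?a]) (h'', \<zero>[A ?b]))) (De ?a ?b h)"
    unfolding D1_def using h by (intro tsum_out[of K "A ?a" "A ?b", OF _ _ TT _ L] cc) simp_all
   also have "... = tsum ?T (%h' h''. mp M N (act M h' x) (act N h'' y)) (De ?a ?b h)"
    using h by (intro tsum_cong[of K "A ?a" "A ?b"] cc) (simp_all add: Lp)
   finally show ?thesis using h by (simp add: act_mt_pure)
  qed
  have 2: "?L (D2 k' k'') = top M N (pure K (A ?a) (A ?b) k' k'') ?v" if [simp]: "k':cA ?a" "k'':cA ?b" for k' k''
  proof -
   let ?G = "%p q p' q'. mp M N (act M (p*[A ?a]q') (vi t x)) (act N (q*[A ?b]ph (iv ?a) ?c p') (vi s y))"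
   let ?P = "pure K (A ?a) (A ?b) k' k''"
   have lt: "lo K ?T ?T (top M N ?P)" by (rule top_linear) simp_all
   have tp: "top M N ?P (mp M N x' y') = mp M N (act M k' x') (act N k'' y')" if "x':elts M" "y':elts N" for x' y'
    using that top_pure[of M N ?P x' y'] top_act_bilinear[of M N x' y'] by (simp add: tsum_pure[OF A_module A_module])
   have "?L (D2 k' k'') = tsum ?T (%p q. ?L (D3 k' k'' p q)) ?e"
    unfolding D2_def by (intro tsum_out[of K "A ?a" "A ?b", OF _ _ TT _ L]) (simp_all add: Ri_closed D3c)
   also have "... = tsum ?T (%p q. tsum ?T (%p' q'. top M N ?P (?G p q p' q')) ?R) ?e"
   proof (rule tsum_cong[of K "A ?a" "A ?b"])
    fix p q assume [simp]: "p:cA ?a" "q:cA ?b"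
    have "?L (D3 k' k'' p q) = tsum ?T (%p' q'. ?L (D4 k' k'' p q p' q')) ?R"
     unfolding D3_def by (intro tsum_out[of K "A ?c" "A ?a", OF _ _ TT _ L]) (simp_all add: Ri_closed D4c)
    also have "... = tsum ?T (%p' q'. top M N ?P (?G p q p' q')) ?R"
     by (intro tsum_cong[of K "A ?c" "A ?a"]) (simp_all add: Ri_closed D4_def Lp tp act_mult)
    finally show "?L (D3 k' k'' p q) = ..." .
   qed (simp_all add: Ri_closed)
   also have "... = tsum ?T (%p q. top M N ?P (tsum ?T (?G p q) ?R)) ?e"
    by (intro tsum_cong[of K "A ?a" "A ?b"] tsum_out[of K "A ?c" "A ?a", OF _ _ _ _ lt, symmetric]) (simp_all add: Ri_closed)
   also have "... = top M N ?P (tsum ?T (%p q. tsum ?T (?G p q) ?R) ?e)"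
    by (intro tsum_out[of K "A ?a" "A ?b", OF _ _ _ _ lt, symmetric] tsum_closed[of K "A ?c" "A ?a"]) (simp_all add: Ri_closed)
   finally show ?thesis using vi_tensor[OF assms x y] by simp
  qed
  have "?L (tsum ?TT D2 (De ?a ?b k)) = tsum ?T (%k' k''. ?L (D2 k' k'')) (De ?a ?b k)"
   using k by (intro tsum_out[of K "A ?a" "A ?b", OF _ _ TT _ L] cc D2c) simp_all
  also have "... = tsum ?T (%k' k''. top M N (pure K (A ?a) (A ?b) k' k'') ?v) (De ?a ?b k)"
   using k by (intro tsum_cong[of K "A ?a" "A ?b"] cc) (simp_all add: 2)
  also have "... = act ?m k ?v"
   using k V(2)[of "mp M N x y"] by (intro act_mt_tsum[symmetric]) simp_all
  finally show ?thesis using loD(2)[OF L D1c[OF h] DDc[OF k]] 1 by (simp add: com)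
 qed
 show ?thesis
 proof (rule RF_eqI[OF rr])
  show "act ?N:extensional (cr (A2 (gr ?m)))" by (simp add: rep_tens_def Let_def RT_simps)
  show "act ?N q:extensional (elts ?m)" if "q:cr (A2 (gr ?m))" for q
   using that B2[OF comc] by (cases q) (auto simp: actN intro!: tlift_pr(1))
  fix h k z assume h: "h:cA (gr ?m)" "k:cA (gr ?m)" and z: "z:elts ?m"
  have hk: "h:cA ?d" "k:cA ?d" using h by simp_all
  note p = tlift_pr[OF _ _ _ B2[OF comc[OF hk]]]
  have lv: "lo K ?T ?T (vi ?t)" using V(1) by simp
  have la: "lo K ?T ?T (act ?m h)" "lo K ?T ?T (act ?m k)" using linear_act[OF hm_mt,of M N] h by simp_all
  show "act ?N (h, k) z = act ?m h z+[sp ?m]act ?m k (vi ?t z)"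
   unfolding actN[OF hk] mt_simps
  proof (rule ts_ext[where V="sp M" and W="sp N" and X="?T" and z=z and g="%z. act ?m h z+[?T]act ?m k (vi ?t z)"])
   show "lo K ?T ?T (%z. act ?m h z+[?T]act ?m k (vi ?t z))"
    by (intro lo_plus la lo_compose[OF lv la(2)]) simp
  qed (use p e[OF hk] z in simp_all)
 qed (simp_all add: rep_tens_def Let_def)
qed

lemma vi_eq:
 assumes "rib (M, t)" "rib (N, s)" "sp N = sp M" "!!x. x:elts M ==> amap s x = amap t x" "x:elts M"
 shows "vi s x = vi t x"
 using vi(3)[OF assms(2), of "vi t x"] vi(2)[OF assms(1)] vi(4)[OF assms(1)] assms(3-5) by simp

lemma RF_conj:
 assumes "rib (M, t)" and b [simp]: "b:cr P"
 shows "rep_conj P R2 b (RF (M, t)) = RF (rc b M, rj b t)"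
proof (rule RF_eqI[OF rib_conj[OF assms]])
 note r = ribD[OF assms(1)] note [simp] = r(2)
 let ?g = "cj b (gr M)"
 let ?r = "rc b M"
 show "act (rep_conj P R2 b (RF (M, t))) (h, k) x = act ?r h x+[sp ?r]act ?r k (vi (rj b t) x)"
  if "h:cA (gr ?r)" "k:cA (gr ?r)" "x:elts ?r" for h k x
  using that vi(2)[OF assms(1),of x] vi_eq[OF assms(1) rib_conj[OF assms], of x]
  by (simp add: rep_conj_def Let_def RT_simps)
qed (auto simp: rep_conj_def Let_def RT_simps)

lemma RF_unit: "rep_unit P VV R2 = RF (ru, ri ru)"
proof (rule RF_eqI[OF rib_unit])
 interpret k: module K kk by simp
 have v: "vi (ri ru) x = x" if "x:cr kk" for x
  using vi(3)[OF rib_unit,of x] that by simp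
 show "act (rep_unit P VV R2) (h, k) x = act ru h x+[sp ru]act ru k (vi (ri ru) x)"
  if "h:cA (gr ru)" "k:cA (gr ru)" "x:elts ru" for h k x
  using that v[of x] by (simp add: rep_unit_def RT_simps k.smult_l_distr del: Rep_simps(4))
qed (auto simp: rep_unit_def RT_simps)

text \<open>On the summand with k the antipode and the crossing commute, and the crossing is
  absorbed by t^-1; what results is the transpose of t^-1 followed by the action of k on the
  dual.\<close>

lemma RF_dual:
 assumes "rib (M, t)"
 shows "rep_dual P VV R2 (RF (M, t)) = RF (rd M, dtw M t)"
proof (rule RF_eqI[OF rib_dual_rib[OF assms]])
 note r = ribD[OF assms] and r' = ribD[OF rib_dual_rib[OF assms]] and v = vi[OF assms] and v' = vi[OF rib_dual_rib[OF assms], unfolded rd_simps]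
 note [simp] = r(2) v(2) v'(2)
 let ?g = "gr M" and ?V = "sp M"
 interpret D: module K "ds ?V" by simp
 interpret V: module K ?V by simp
 let ?i = "iv ?g" and ?d = "dtw M t"
 have pv: "pr ?V (vi ?d f) x = pr ?V f (vi t x)" if "f:cr (ds ?V)" "x:elts M" for f x
  using dual_twist(2)[OF r(1), of "vi ?d f" "vi t x"] that v(4) v'(4) by simp
 show "act (rep_dual P VV R2 (RF (M, t))) (h, k) f = act (rd M) h f+[sp (rd M)]act (rd M) k (vi ?d f)"
  if "h:cA (gr (rd M))" "k:cA (gr (rd M))" "f:elts (rd M)" for h k f
 proof -
  have h [simp]: "h:cA ?i" "k:cA ?i" "f:cr (ds ?V)" using that by simp_all
  let ?e = "act (rd M) h f+[ds ?V]act (rd M) k (vi ?d f)"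
  have c: "act (rd M) h f:cr (ds ?V)" "act (rd M) k (vi ?d f):cr (ds ?V)" by (auto intro!: act_rd)
  have s: "antipode R2 ?i (h, k) = (S ?i h, ph ?g ?g (S ?i k))"
   using S_crossing[of "iv ?g" ?g k] by (simp add: RT_simps)
  have "pr ?V ?e x = pr ?V f (act (RF (M, t)) (antipode R2 ?i (h, k)) x)" if x: "x:elts M" for x
   using x c v(5)[of x "S ?i k"] by (simp add: s pr_lin act_rd pv)
  then have "(THE g. g:cr (ds ?V) & (\<forall>x\<in>elts M. pr ?V g x = pr ?V f (act (RF (M, t)) (antipode R2 ?i (h, k)) x))) = ?e"
   using c ds_ext[of ?V] by (intro the_equality) auto
  then show ?thesis by (simp add: rep_dual_def Let_def RT_simps(1))
 qed
qed (auto simp: rep_dual_def Let_def RT_simps)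

abbreviation "RR == ribbon_Rep P K VV R2"

section \<open>Transport of the ribbon structure to the representations of RT(H)\<close>

lemma ribbon_Rep_simps:
 "Ob RR = {N. hm2 N}" "Ar RR = {Arr M N f | M N f. hm2 M & hm2 N & hmod_linear K R2 M N f}" "Dom RR = adom" "Cod RR = acod"
 "Id RR N = Arr N N (\<lambda>x\<in>elts N. x)" "g\<bullet>[RR]f = Arr (adom f) (acod g) (compose (elts (adom f)) (amap g) (amap f))"
 "tens_ob RR = rep_tens P K VV R2" "tens_ar RR = rep_tens_ar P K VV R2" "\<I>[RR] = rep_unit P VV R2" "assoc RR = rep_assoc P K VV R2"
 "lunit RR = rep_lunit P K VV R2" "runit RR = rep_runit P K VV R2" "Deg RR = gr" "conj_ob RR = rep_conj P R2"
 "conj_ar RR b f = Arr (rep_conj P R2 b (adom f)) (rep_conj P R2 b (acod f)) (amap f)" "braid RR = rep_braid P K VV R2"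
 "twist RR N = Arr N (rep_conj P R2 (gr N) N) (\<lambda>x\<in>elts N. act N (theta R2 (gr N)) x)"
 "dual_ob RR = rep_dual P VV R2" "coev RR = rep_coev P K VV R2" "ev RR = rep_ev P K VV R2"
 by (simp_all add: ribbon_Rep_def Rep_def balanced_tcat.extend_def braided_tcat.extend_def balanced_tcat.fields_def ribbon_tcat.fields_def)

lemma RF_fields [simp]: "gr (RF X) = gr (fst X)" "sp (RF X) = sp (fst X)"
 by (simp_all add: RF_def)

lemma RF_ops:
 assumes "X:Ob RB" "Y:Ob RB"
 shows "rep_tens P K VV R2 (RF X) (RF Y) = RF (X**[RB]Y)"
  "b:cr P ==> rep_conj P R2 b (RF X) = RF (conj_ob RB b X)"
  "rep_dual P VV R2 (RF X) = RF (dual_ob RB X)"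
 using assms RF_tens[of "fst X" "snd X" "fst Y" "snd Y"] RF_conj[of "fst X" "snd X" b] RF_dual[of "fst X" "snd X"]
  Rib_tens[of "fst X" "snd X" "fst Y" "snd Y"]
 by (simp_all add: Rib_def Let_def split_beta rib_dual_eq[of "fst X" "snd X", simplified])

lemma RF_unit': "rep_unit P VV R2 = RF \<I>[RB]"
 by (simp add: RF_unit Rib_def Let_def del: Rep_simps(4))

text \<open>An arrow of Rib(H) wraps an arrow of \<open>Rep\<close>, which in turn wraps a linear
  map; that linear map is kept, between the images of source and target.\<close>

definition RG :: "(('g, 'k, 'h, 'u) hmod \<times> ('g, 'k, 'h, 'u) harr, ('g, 'k, 'h, 'u) harr) arr => ('g, 'k, 'h \<times> 'h, 'u) harr" where
 "RG h = Arr (RF (adom h)) (RF (acod h)) (amap (amap h))"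

lemma rib_arrow_iff:
 assumes "rib X" "rib Y" "f:rh (fst X) (fst Y)"
 shows "snd Y oR f = rj (gr (fst X)) f oR snd X \<longleftrightarrow> (\<forall>x\<in>elts (fst X). amap f (amap (snd X) x) = amap (snd Y) (amap f x))"
proof -
 obtain M t N s where X: "X = (M, t)" "Y = (N, s)" by (cases X; cases Y)
 note r = ribD[OF assms(1)[unfolded X]] and r' = ribD[OF assms(2)[unfolded X]]
 note f = assms(3)[unfolded X fst_conv] note F = Rep_homD[OF f]
 note t = twD[OF r(1)] and s = twD[OF r'(1)]
 note a = Rep_comp[OF f s(2)] and b = Rep_comp[OF t(2) rc_ar_hom[OF hmD(1)[OF r(2)] f]]
 show ?thesis
  unfolding X fst_conv snd_conv
 proof
  assume "s oR f = rj (gr M) f oR t"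
  then show "\<forall>x\<in>elts M. amap f (amap t x) = amap s (amap f x)" using a(2) b(2) by (simp del: Rep_simps(5))
 next
  assume e: "\<forall>x\<in>elts M. amap f (amap t x) = amap s (amap f x)"
  show "s oR f = rj (gr M) f oR t"
   by (rule Rep_ar_eqI[OF a(1)]) (use b a(2) b(2) e F(6) in \<open>simp_all del: Rep_simps(5)\<close>)
 qed
qed

lemma RG_bij: "bij_betw RG (Ar RB) (Ar RR)"
proof -
 interpret RB: twisted_category P RC RB by (rule tcat_Rib)
 have Ar: "Arr X Y f:Ar RB \<longleftrightarrow> rib X & rib Y & adom f = fst X & acod f = fst Y & hmod_linear K R2 (RF X) (RF Y) (amap f)" for X Y f
 proof -
  have "Arr X Y f:Ar RB \<longleftrightarrow> rib X & rib Y & f:rh (fst X) (fst Y) & snd Y oR f = rj (gr (fst X)) f oR snd X"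
   by (simp add: RB.D_Ar Rib_Ob del: split_paired_Ex Rep_simps(4,5,14))
  also have "... \<longleftrightarrow> rib X & rib Y & adom f = fst X & acod f = fst Y & hmod_linear K R2 (RF X) (RF Y) (amap f)"
   using rib_arrow_iff[of X Y f] RF_linear[of "fst X" "snd X" "fst Y" "snd Y" "amap f"] ribD(2)[of "fst X" "snd X"] ribD(2)[of "fst Y" "snd Y"]
   by (auto simp: Rep_hom_iff simp del: Rep_simps(4,5,14))
  finally show ?thesis .
 qed
 show ?thesis
 proof (rule bij_betw_imageI)
  show "inj_on RG (Ar RB)"
  proof (rule inj_onI)
   fix h k assume hk: "h:Ar RB" "k:Ar RB" "RG h = RG k"
   obtain X Y f X' Y' f' where h: "h = Arr X Y f" "k = Arr X' Y' f'" by (cases h; cases k)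
   have "X = X'" "Y = Y'" "f = f'"
    using hk RF_inj[of X X'] RF_inj[of Y Y'] by (auto simp: h Ar RG_def intro: arr.expand)
   then show "h = k" by (simp add: h)
  qed
  show "RG ` Ar RB = Ar RR"
  proof (intro equalityI subsetI)
   fix q assume "q:RG ` Ar RB"
   then obtain h where h: "h:Ar RB" "q = RG h" by blast
   then show "q:Ar RR" by (cases h) (simp add: Ar ribbon_Rep_simps RG_def hm2_RF)
  next
   fix q assume "q:Ar RR"
   then obtain M N f where q: "q = Arr M N f" "hm2 M" "hm2 N" "hmod_linear K R2 M N f" by (auto simp: ribbon_Rep_simps)
   obtain X Y where X: "rib X" "RF X = M" "rib Y" "RF Y = N" using RF_surj[OF q(2)] RF_surj[OF q(3)] by blast
   then have "Arr X Y (Arr (fst X) (fst Y) f):Ar RB" "RG (Arr X Y (Arr (fst X) (fst Y) f)) = q"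
    using q by (simp_all add: Ar RG_def)
   then show "q:RG ` Ar RB" by blast
  qed
 qed
qed

text \<open>The R-matrix of RT(H) is that of H placed in the first components, so t^-1 does not
  occur in the braiding.\<close>

lemma RG_braid:
 assumes "X:Ob RB" "Y:Ob RB"
 shows "rep_braid P K VV R2 (RF X) (RF Y) = RG (braid RB X Y)"
proof -
 interpret RB: twisted_category P RC RB by (rule tcat_Rib)
 obtain M t N s where X: "X = (M, t)" "Y = (N, s)" by (cases X; cases Y)
 have rb: "rib (M, t)" "rib (N, s)" using assms by (simp_all add: X Rib_Ob)
 note r = ribD(2)[OF rb(1)] ribD(2)[OF rb(2)] note [simp] = r
 let ?a = "gr M" and ?b = "gr N" and ?T = "ms N M"
 interpret M: module K "sp M" by simp
 interpret N: module K "sp N" by simp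
 let ?TT = "tensor K (A2 ?a) (A2 ?b)"
 note l1 = boD[OF RF_act_bilinear[OF rb(1)]] and l2 = boD[OF RF_act_bilinear[OF rb(2)]]
 note [simp] = loD(1)[OF l1(1)] loD(1)[OF l2(1)] vi(2)[OF rb(1)] vi(2)[OF rb(2)]
 have TT: "module K ?TT" by (simp add: mod_tensor)
 have e: "tsum ?T (%p q. mp N M (act (RF (N, s)) q y) (act (RF (M, t)) p x)) (Rmat R2 ?a ?b) = tsum ?T (%g h. mp N M (act N h y) (act M g x)) (R ?a ?b)"
  if [simp]: "x:elts M" "y:elts N" for x y
 proof -
  let ?B = "%p q. mp N M (act (RF (N, s)) q y) (act (RF (M, t)) p x)"
  have B: "bo K (A2 ?a) (A2 ?b) ?T ?B"
   by (intro boI linear_tp_left linear_tp_right l1 l2) simp_all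
  have L: "lo K ?TT ?T (tsum ?T ?B)" by (rule lo_tsum_tensor[OF A2_module A2_module _ B]) simp_all
  have Lp: "tsum ?T ?B (pure K (A2 ?a) (A2 ?b) p q) = ?B p q" if "p:cr (A2 ?a)" "q:cr (A2 ?b)" for p q
   by (rule tsum_pure[OF A2_module A2_module _ B]) (use that in simp_all)
  have "Rmat R2 ?a ?b = tsum ?TT (%g h. pure K (A2 ?a) (A2 ?b) (g, \<zero>[A ?a]) (h, \<zero>[A ?b])) (R ?a ?b)"
   by (simp add: RT_def Let_def del: A2_simps)
  then have "tsum ?T ?B (Rmat R2 ?a ?b) = tsum ?T (%g h. tsum ?T ?B (pure K (A2 ?a) (A2 ?b) (g, \<zero>[A ?a]) (h, \<zero>[A ?b]))) (R ?a ?b)"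
   by (simp only:) (rule tsum_out[of K "A ?a" "A ?b", OF _ _ TT _ L], simp_all add: R_closed)
  also have "... = tsum ?T (%g h. mp N M (act N h y) (act M g x)) (R ?a ?b)"
   by (intro tsum_cong[of K "A ?a" "A ?b"]) (simp_all add: R_closed Lp)
  finally show ?thesis .
 qed
 have "lft (sp M) (sp N) ?T (%x y. tsum ?T (%p q. mp N M (act (RF (N, s)) q y) (act (RF (M, t)) p x)) (Rmat R2 ?a ?b)) = amap (rb M N)"
  unfolding rep_braid_def Let_def arr.sel mt_simps rc_simps by (intro tlift_cong e)
 moreover have "sp (fst (conj_ob RB ?a Y**[RB]X)) = ?T"
  using RB.D_fs(1)[OF RB.D_closed(3)[OF _ assms(2)] assms(1), of ?a] by (simp add: X RB.D_fs)
 ultimately show ?thesis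
  using RF_ops[OF assms] RF_ops(1)[OF RB.D_closed(3)[OF _ assms(2)] assms(1), of ?a] RF_ops(2)[OF assms(2,1),of ?a]
  unfolding RG_def RB.D_fld arr.sel
  by (simp add: rep_braid_def[of P K VV R2] Let_def X RB.D_fs del: Rep_simps(14))
qed

text \<open>The twist element acts as w^-1 t^-1, which is t because t^-2 = w.\<close>

lemma RG_twist:
 assumes "X:Ob RB"
 shows "(\<lambda>x\<in>elts (fst X). act (RF X) (theta R2 (gr (fst X))) x) = amap (snd X)"
proof -
 obtain M t where X: "X = (M, t)" by (cases X)
 have rb: "rib (M, t)" using assms by (simp add: X Rib_Ob)
 note r = ribD[OF rb] and v = vi[OF rb] note [simp] = r(2) v(2) twD(5)[OF r(1)]
 interpret M: module K "sp M" by simp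
 note W = winv[OF hmD(1)[OF r(2)]]
 have "act (RF (M, t)) (theta R2 (gr M)) x = amap t x" if [simp]: "x:elts M" for x
 proof -
  have "vi t x = act M (w (gr M)) (amap t x)" using v(6)[of "amap t x"] v(3)[of x] by simp
  then have "act M (winv (gr M)) (vi t x) = amap t x"
   using W(1,2) act_mult[OF r(2) HOL.refl, of "winv (gr M)" "w (gr M)" "amap t x"] by simp
  then show ?thesis using W(1) by (simp add: theta_RT)
 qed
 moreover have "amap t:extensional (elts M)" using hmod_linearD(2)[OF Rep_homD(5)[OF twD(2)[OF r(1)]]] .
 ultimately show ?thesis
  unfolding X fst_conv snd_conv by (intro extensionalityI[where A="elts M"]) auto
qed

text \<open>Both sides use the same chosen spaces, lifts and canonical elements, so once
  \<open>RF\<close> is compatible with the operations on objects, constraints, units and counits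
  agree literally.\<close>

lemma RF_ribbon_isomorphism: "strict_ribbon_isomorphism P RB RR RF RG"
proof -
 interpret RB: twisted_category P RC RB by (rule tcat_Rib)
 interpret RX: ribbon_T_category P RB by (rule ribbon_Rib)
 have c: "coev RB X = Arr \<I>[RB] (X**[RB]dual_ob RB X) (rco (fst X))"
  "ev RB X = Arr (dual_ob RB X**[RB]X) \<I>[RB] (re (fst X))" "sp (fst (dual_ob RB X)) = ds (sp (fst X))" for X
  by (simp_all add: Rib_def Let_def rib_dual_def split_beta)
 have dO: "dual_ob RB X:Ob RB" if "X:Ob RB" for X using RX.dual[OF that] by (simp add: left_dual_def)
 have f: "fst (X**[RB]Y) = mt (fst X) (fst Y)" if "X:Ob RB" "Y:Ob RB" for X Y
  using that by (simp add: RB.D_fs)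
 have u: "fst \<I>[RB] = ru" by (simp add: RB.D_fs)
 have g: "gr (fst X):cr P" if "X:Ob RB" for X using that RB.D_Ob'(1)[OF that] by simp
 have cj: "rep_conj P R2 b (RF X) = RF (conj_ob RB b X)" if "b:cr P" "X:Ob RB" for b X
  using RF_ops(2) that by blast
 have hd: "adom (amap h) = fst (adom h)" "acod (amap h) = fst (acod h)" "adom h:Ob RB" "acod h:Ob RB" if "h:Ar RB" for h
  using RB.D_ArD[OF that] by simp_all
 show ?thesis
 proof (intro strict_ribbon_isomorphism.intro strict_isomorphism.intro strict_isomorphism_axioms.intro strict_ribbon_isomorphism_axioms.intro
   RB.balanced_T_category_D ribbon_Rib RG_bij, goal_cases)
  case 1
  show ?case
   using RF_inj RF_surj hm2_RF by (fastforce simp: bij_betw_def inj_on_def Rib_Ob ribbon_Rep_simps)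
 qed (simp_all add: RG_def RG_braid RG_twist RB.D_fld ribbon_Rep_simps RF_ops RF_unit' RB.D_closed dO hd c f u g cj
  rep_tens_ar_def rep_assoc_def rep_lunit_def rep_runit_def rep_coev_def rep_ev_def Let_def)
qed

end

theorem mainTheorem5:
  fixes P :: "('g, 'm) monoid_scheme"
    and K :: "('k, 'c) ring_scheme"
    and H :: "('g, 'k, 'h, 'z) qt_tcoalg_scheme"
    and VV :: "('k, 'u) vect_choice"
  assumes "group P" and "field K"
    and "quasitriangular_T_coalgebra P K H"
    and "vect_universe K VV"
  shows "ribbon_T_category P (Rib P K VV H)
    \<and> isomorphic_ribbon_T_categories P (Rib P K VV H) (ribbon_Rep P K VV (RT P K H))
    \<and> isomorphic_balanced_T_categories P (Rib P K VV H) (good_subcat P (twist_ext (Rep P K VV H)))"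
proof -
 interpret Q: qt_rep P K H VV by (intro qt_rep.intro assms)
 show ?thesis
  unfolding isomorphic_ribbon_T_categories_def isomorphic_balanced_T_categories_def
  using Q.ribbon_Rib strict_ribbon_isomorphism.ribbon_isomorphism[OF Q.RF_ribbon_isomorphism]
   strict_isomorphism.balanced_isomorphism[OF Q.Rib_good_subcat] by blast
qed

end
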